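(* For every integer $k\ge 0$ and every angle $\theta\in(0,\pi/2)$ there exists a model knot solution of charge $k$ to the $\theta$-deformed Kapustin–Witten equations on $\mathbb R\times\mathbb R^2\times\mathbb R^+$ with gauge group $SU(2)$ (in the sense defined in the context).
   Context: Let $M=\mathbb R_{x_1}\times\mathbb C_z\times\mathbb R^+_y$, $z=x_2+ix_3$, $r=|z|$, $y>0$, $\sigma=y/r$, with the Euclidean metric and orientation $dx_1\wedge dx_2\wedge dx_3\wedge dy$. On the trivial rank-2 Hermitian bundle, let $\hat A$ be an $\mathfrak{su}(2)$-connection form and $\Phi$ an $\mathfrak{su}(2)$-valued 1-form. Put $\mathcal A=\hat A+i\Phi$, with curvature $F_{\mathcal A}=F_{\hat A}-\Phi\wedge\Phi+i\,d_{\hat A}\Phi$. The $\theta$-deformed Kapustin–Witten equations are $e^{i\theta}F_{\mathcal A}=\overline{\star\, e^{i\theta}F_{\mathcal A}}$ together with $d_{\hat A}\star\Phi=0$. Here the bar is the conjugation of $\mathfrak{sl}(2,\mathbb C)=\mathfrak{su}(2)\oplus i\,\mathfrak{su}(2)$ fixing $\mathfrak{su}(2)$ (and complex conjugation on scalars), i.e. $\overline{P+iQ}=P-iQ$ for $\mathfrak{su}(2)$-valued forms $P,Q$. Given $\theta\in(0,\pi/2)$ define $\beta\in(-\pi/6,\pi/6)$ by $\theta=\pi/4+3\beta/2$. A model knot solution of charge $k$ is a smooth solution $(\hat A,\Phi)$ of these equations on $\{y>0\}$, independent of $x_1$, of the form $$\hat A=A_z\,dz+A_{\bar z}\,d\bar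 z+A_y\,dy+A_1\,dx_1,\qquad \Phi=\phi_z\,dz+\phi_{\bar z}\,d\bar z+\phi_1\,dx_1,\qquad A_1=\tan\beta\,\phi_1,$$ with $A_{\bar z}=-A_z^\dagger$, $\phi_{\bar z}=-\phi_z^\dagger$ (conjugate transposes) and $$A_z=\frac{\sin^2\beta}{2}\begin{pmatrix} Y^{-1}\partial_zY & 2Y^{-1}\partial_z\Sigma \\ 0 & -Y^{-1}\partial_zY \end{pmatrix}-\sin\beta\begin{pmatrix} 0 & Y^{-1}z^k \\ 0 & 0 \end{pmatrix}-\frac{\cos^2\beta}{2}\begin{pmatrix} Y^{-1}\partial_zY & 0 \\ 2Y^{-1}\partial_z\bar\Sigma & -Y^{-1}\partial_zY \end{pmatrix},$$ $$\phi_z=\sin\beta\cos\beta\begin{pmatrix} Y^{-1}\partial_zY & Y^{-1}\partial_z\Sigma \\ {} Y^{-1}\partial_z\bar\Sigma & -Y^{-1}\partial_zY \end{pmatrix}-\cos\beta\begin{pmatrix} 0 & Y^{-1}z^k \\ 0 & 0 \end{pmatrix},$$ $$A_y=\frac12\begin{pmatrix} 0 & Y^{-1}\partial_y\Sigma \\ -Y^{-1}\partial_y\bar\Sigma & 0 \end{pmatrix},\qquad \phi_1=\frac{i\cos\beta}{2}\begin{pmatrix} Y^{-1}\partial_yY & Y^{-1}\partial_y\Sigma \\ {} Y^{-1}\partial_y\bar\Sigma & -Y^{-1}\partial_yY \end{pmatrix},$$ where, away from $z=0$, $$Y=r^{k+1}e^{u(\sigma)},\qquad \Sigma=\sin\beta\,z^{k+1}v(\sigma)$$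 for real-valued functions $u,v$ on $(0,\infty)$ satisfying: $u(\sigma)/\log\sigma\to1$ as $\sigma\to0^+$; $u(\sigma)/\log\sigma\to k+1$ as $\sigma\to\infty$; $v(\sigma)/\sigma^2\to 2k$ as $\sigma\to0^+$; and there are $C>0$, $\epsilon\in(0,1)$ with $|v(\sigma)|\le C\sigma^{(k+1)(1-\epsilon)}$ for $\sigma\ge1$. *)

theory Defs
  imports "HOL-Analysis.Analysis"
begin

text \<open>
  Points of \<open>\<real> \<times> \<complex> \<times> \<real>\<^sup>+\<close> are vectors \<open>x :: real^4\<close> with coordinates
  \<open>x$1 = x\<^sub>1\<close>, \<open>x$2 = x\<^sub>2\<close>, \<open>x$3 = x\<^sub>3\<close>, \<open>x$4 = y\<close>, so \<open>z = x$2 + i x$3\<close>.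
  A matrix-valued \<open>p\<close>-form is given by its \<open>p\<close>-index array of component functions
  with respect to \<open>dx\<^sub>1, dx\<^sub>2, dx\<^sub>3, dy\<close> (antisymmetric in the indices for \<open>p \<ge> 2\<close>).
  Fields are total functions on \<open>real^4\<close>; only their values on the open half space matter.
\<close>

type_synonym point = "real^4"
type_synonym mat2 = "complex^2^2"
type_synonym form1 = "4 \<Rightarrow> point \<Rightarrow> mat2"
type_synonym form2 = "4 \<Rightarrow> 4 \<Rightarrow> point \<Rightarrow> mat2"
type_synonym form3 = "4 \<Rightarrow> 4 \<Rightarrow> 4 \<Rightarrow> point \<Rightarrow> mat2"
type_synonym form4 = "4 \<Rightarrow> 4 \<Rightarrow> 4 \<Rightarrow> 4 \<Rightarrow> point \<Rightarrow> mat2"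

definition half_space :: "point set" where
  "half_space = {x. x$4 > 0}"

definition zcoord :: "point \<Rightarrow> complex" where
  "zcoord x = Complex (x$2) (x$3)"

definition ycoord :: "point \<Rightarrow> real" where
  "ycoord x = x$4"


subsection \<open>Smoothness and partial derivatives\<close>

primrec times_differentiable_on ::
    "nat \<Rightarrow> 'a::real_normed_vector set \<Rightarrow> ('a \<Rightarrow> 'b::real_normed_vector) \<Rightarrow> bool" where
  "times_differentiable_on 0 S f \<longleftrightarrow> continuous_on S f"
| "times_differentiable_on (Suc n) S f \<longleftrightarrow>
     (\<forall>x\<in>S. f differentiable (at x)) \<and>
     (\<forall>w. times_differentiable_on n S (\<lambda>x. frechet_derivative f (at x) w))"

text \<open>Meant for open \<open>S\<close>, since the derivatives are taken at \<open>x\<close> without restriction to \<open>S\<close>.\<close>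

definition smooth_on ::
    "'a::real_normed_vector set \<Rightarrow> ('a \<Rightarrow> 'b::real_normed_vector) \<Rightarrow> bool" where
  "smooth_on S f \<longleftrightarrow> (\<forall>n. times_differentiable_on n S f)"

definition pd :: "4 \<Rightarrow> (point \<Rightarrow> 'b::real_normed_vector) \<Rightarrow> point \<Rightarrow> 'b" where
  "pd i f x = frechet_derivative f (at x) (axis i 1)"

definition dz :: "(point \<Rightarrow> complex) \<Rightarrow> point \<Rightarrow> complex" where
  "dz f x = (pd 2 f x - \<i> * pd 3 f x) / 2"


subsection \<open>Matrices\<close>

definition m22 :: "complex \<Rightarrow> complex \<Rightarrow> complex \<Rightarrow> complex \<Rightarrow> mat2" where
  "m22 a b c d = vector [vector [a, b], vector [c, d]]"

definition cscale :: "complex \<Rightarrow> mat2 \<Rightarrow> mat2" (infixr "*\<^sub>C" 75) where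
  "c *\<^sub>C M = (\<chi> i j. c * M$i$j)"

definition dagger :: "mat2 \<Rightarrow> mat2" where
  "dagger M = (\<chi> i j. cnj (M$j$i))"

definition commutator :: "mat2 \<Rightarrow> mat2 \<Rightarrow> mat2" where
  "commutator M N = M ** N - N ** M"

definition su2 :: "mat2 set" where
  "su2 = {M. dagger M = - M \<and> trace M = 0}"

definition conj_sl2 :: "mat2 \<Rightarrow> mat2" where
  "conj_sl2 M = - dagger M"

text \<open>
  The next two facts show that this is the conjugation of \<open>sl(2,\<complex>) = su(2) \<oplus> i su(2)\<close>
  fixing \<open>su(2)\<close>, extended antilinearly.
\<close>

lemma conj_sl2_su2:
  assumes "P \<in> su2" and "Q \<in> su2"
  shows "conj_sl2 (P + \<i> *\<^sub>C Q) = P - \<i> *\<^sub>C Q"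
proof -
  have P: "cnj (P$j$i) = - (P$i$j)" for i j
    using assms(1) by (auto simp: su2_def dagger_def vec_eq_iff)
  have Q: "cnj (Q$j$i) = - (Q$i$j)" for i j
    using assms(2) by (auto simp: su2_def dagger_def vec_eq_iff)
  show ?thesis
    by (simp add: vec_eq_iff conj_sl2_def dagger_def cscale_def P Q)
qed

lemma conj_sl2_cscale: "conj_sl2 (c *\<^sub>C M) = cnj c *\<^sub>C conj_sl2 M"
  by (simp add: vec_eq_iff conj_sl2_def dagger_def cscale_def)


subsection \<open>Differential forms\<close>

text \<open>
  The value of \<open>dx\<^sub>1 \<and> dx\<^sub>2 \<and> dx\<^sub>3 \<and> dy\<close> on four coordinate vectors.
\<close>

definition eps :: "4 \<Rightarrow> 4 \<Rightarrow> 4 \<Rightarrow> 4 \<Rightarrow> real" where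
  "eps i j k l = det (vector [axis i 1, axis j 1, axis k 1, axis l 1] :: real^4^4)"

definition hodge1 :: "form1 \<Rightarrow> form3" where
  "hodge1 \<phi> j k l x = (\<Sum>i\<in>UNIV. eps i j k l *\<^sub>R \<phi> i x)"

definition hodge2 :: "form2 \<Rightarrow> form2" where
  "hodge2 \<omega> i j x = (1/2) *\<^sub>R (\<Sum>k\<in>UNIV. \<Sum>l\<in>UNIV. eps k l i j *\<^sub>R \<omega> k l x)"

text \<open>The components of \<open>\<phi> \<and> \<phi>\<close> (matrix product of the coefficients).\<close>

definition wedge_self :: "form1 \<Rightarrow> form2" where
  "wedge_self \<phi> i j x = \<phi> i x ** \<phi> j x - \<phi> j x ** \<phi> i x"

definition curvature :: "form1 \<Rightarrow> form2" where
  "curvature A i j x = pd i (A j) x - pd j (A i) x + wedge_self A i j x"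

definition covd :: "form1 \<Rightarrow> 4 \<Rightarrow> (point \<Rightarrow> mat2) \<Rightarrow> point \<Rightarrow> mat2" where
  "covd A i f x = pd i f x + commutator (A i x) (f x)"

definition dA1 :: "form1 \<Rightarrow> form1 \<Rightarrow> form2" where
  "dA1 A \<phi> i j x = covd A i (\<phi> j) x - covd A j (\<phi> i) x"

definition dA3 :: "form1 \<Rightarrow> form3 \<Rightarrow> form4" where
  "dA3 A \<omega> i j k l x =
     covd A i (\<omega> j k l) x - covd A j (\<omega> i k l) x
     + covd A k (\<omega> i j l) x - covd A l (\<omega> i j k) x"


subsection \<open>The deformed Kapustin--Witten equations\<close>

text \<open>The curvature \<open>F\<^sub>A - \<Phi> \<and> \<Phi> + i d\<^sub>A \<Phi>\<close> of the complex connection \<open>A + i \<Phi>\<close>.\<close>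

definition complex_curvature :: "form1 \<Rightarrow> form1 \<Rightarrow> form2" where
  "complex_curvature A \<Phi> i j x =
     curvature A i j x - wedge_self \<Phi> i j x + \<i> *\<^sub>C dA1 A \<Phi> i j x"

definition KW_equations :: "real \<Rightarrow> form1 \<Rightarrow> form1 \<Rightarrow> bool" where
  "KW_equations \<theta> A \<Phi> \<longleftrightarrow>
     (let F = (\<lambda>i j x. cis \<theta> *\<^sub>C complex_curvature A \<Phi> i j x) in
      \<forall>x\<in>half_space. \<forall>i j. F i j x = conj_sl2 (hodge2 F i j x)) \<and>
     (\<forall>x\<in>half_space. \<forall>i j k l. dA3 A (hodge1 \<Phi>) i j k l x = 0)"


subsection \<open>Model knot solutions\<close>

text \<open>The solution of \<open>\<theta> = \<pi>/4 + 3\<beta>/2\<close>.\<close>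

definition beta_of :: "real \<Rightarrow> real" where
  "beta_of \<theta> = (2/3) * (\<theta> - pi/4)"

definition ansatz_Az ::
    "real \<Rightarrow> nat \<Rightarrow> (point \<Rightarrow> real) \<Rightarrow> (point \<Rightarrow> complex) \<Rightarrow> point \<Rightarrow> mat2" where
  "ansatz_Az \<beta> k Y \<Sigma> x =
     (let Yi = inverse (complex_of_real (Y x));
          Yz = dz (\<lambda>p. complex_of_real (Y p)) x;
          Sz = dz \<Sigma> x;
          Sbz = dz (\<lambda>p. cnj (\<Sigma> p)) x
      in ((sin \<beta>)\<^sup>2 / 2) *\<^sub>R m22 (Yi * Yz) (2 * Yi * Sz) 0 (- (Yi * Yz))
         - sin \<beta> *\<^sub>R m22 0 (Yi * zcoord x ^ k) 0 0
         - ((cos \<beta>)\<^sup>2 / 2) *\<^sub>R m22 (Yi * Yz) 0 (2 * Yi * Sbz) (- (Yi * Yz)))"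

definition ansatz_\<phi>z ::
    "real \<Rightarrow> nat \<Rightarrow> (point \<Rightarrow> real) \<Rightarrow> (point \<Rightarrow> complex) \<Rightarrow> point \<Rightarrow> mat2" where
  "ansatz_\<phi>z \<beta> k Y \<Sigma> x =
     (let Yi = inverse (complex_of_real (Y x));
          Yz = dz (\<lambda>p. complex_of_real (Y p)) x;
          Sz = dz \<Sigma> x;
          Sbz = dz (\<lambda>p. cnj (\<Sigma> p)) x
      in (sin \<beta> * cos \<beta>) *\<^sub>R m22 (Yi * Yz) (Yi * Sz) (Yi * Sbz) (- (Yi * Yz))
         - cos \<beta> *\<^sub>R m22 0 (Yi * zcoord x ^ k) 0 0)"

definition ansatz_Ay :: "(point \<Rightarrow> real) \<Rightarrow> (point \<Rightarrow> complex) \<Rightarrow> point \<Rightarrow> mat2" where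
  "ansatz_Ay Y \<Sigma> x =
     (let Yi = inverse (complex_of_real (Y x));
          Sy = pd 4 \<Sigma> x;
          Sby = pd 4 (\<lambda>p. cnj (\<Sigma> p)) x
      in (1/2) *\<^sub>R m22 0 (Yi * Sy) (- (Yi * Sby)) 0)"

definition ansatz_\<phi>1 ::
    "real \<Rightarrow> (point \<Rightarrow> real) \<Rightarrow> (point \<Rightarrow> complex) \<Rightarrow> point \<Rightarrow> mat2" where
  "ansatz_\<phi>1 \<beta> Y \<Sigma> x =
     (let Yi = inverse (complex_of_real (Y x));
          Yy = pd 4 (\<lambda>p. complex_of_real (Y p)) x;
          Sy = pd 4 \<Sigma> x;
          Sby = pd 4 (\<lambda>p. cnj (\<Sigma> p)) x
      in (\<i> * complex_of_real (cos \<beta>) / 2) *\<^sub>C m22 (Yi * Yy) (Yi * Sy) (Yi * Sby) (- (Yi * Yy)))"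

text \<open>
  With \<open>dz = dx\<^sub>2 + i dx\<^sub>3\<close>, the form \<open>a dz + b d\<zbar>\<close> has components \<open>a + b\<close> and \<open>i (a - b)\<close>
  along \<open>dx\<^sub>2\<close> and \<open>dx\<^sub>3\<close>; here \<open>b\<close> is minus the conjugate transpose of \<open>a\<close>.
\<close>

definition has_ansatz_form ::
    "real \<Rightarrow> nat \<Rightarrow> (point \<Rightarrow> real) \<Rightarrow> (point \<Rightarrow> complex) \<Rightarrow> form1 \<Rightarrow> form1 \<Rightarrow> bool" where
  "has_ansatz_form \<beta> k Y \<Sigma> A \<Phi> \<longleftrightarrow>
     (\<forall>x\<in>half_space.
        let Az = ansatz_Az \<beta> k Y \<Sigma> x; Azb = - dagger Az;
            \<phi>z = ansatz_\<phi>z \<beta> k Y \<Sigma> x; \<phi>zb = - dagger \<phi>z;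
            \<phi>1 = ansatz_\<phi>1 \<beta> Y \<Sigma> x
        in A 1 x = tan \<beta> *\<^sub>R \<phi>1 \<and>
           A 2 x = Az + Azb \<and>
           A 3 x = \<i> *\<^sub>C (Az - Azb) \<and>
           A 4 x = ansatz_Ay Y \<Sigma> x \<and>
           \<Phi> 1 x = \<phi>1 \<and>
           \<Phi> 2 x = \<phi>z + \<phi>zb \<and>
           \<Phi> 3 x = \<i> *\<^sub>C (\<phi>z - \<phi>zb) \<and>
           \<Phi> 4 x = 0)"

definition profile_asymptotics :: "nat \<Rightarrow> (real \<Rightarrow> real) \<Rightarrow> (real \<Rightarrow> real) \<Rightarrow> bool" where
  "profile_asymptotics k u v \<longleftrightarrow>
     ((\<lambda>\<sigma>. u \<sigma> / ln \<sigma>) \<longlongrightarrow> 1) (at_right 0) \<and>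
     ((\<lambda>\<sigma>. u \<sigma> / ln \<sigma>) \<longlongrightarrow> real k + 1) at_top \<and>
     ((\<lambda>\<sigma>. v \<sigma> / \<sigma>\<^sup>2) \<longlongrightarrow> 2 * real k) (at_right 0) \<and>
     (\<exists>C>0. \<exists>\<epsilon>. 0 < \<epsilon> \<and> \<epsilon> < 1 \<and>
        (\<forall>\<sigma>\<ge>1. \<bar>v \<sigma>\<bar> \<le> C * \<sigma> powr ((real k + 1) * (1 - \<epsilon>))))"

text \<open>
  The formulas for \<open>Y\<close> and \<open>\<Sigma>\<close> in terms of \<open>u\<close> and \<open>v\<close> make sense only for \<open>z \<noteq> 0\<close>.
  Across \<open>z = 0\<close> both are required to extend smoothly, with \<open>Y\<close> positive, so that the
  expressions for the fields are meaningful on the whole half space.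
\<close>

definition model_knot_solution :: "nat \<Rightarrow> real \<Rightarrow> form1 \<Rightarrow> form1 \<Rightarrow> bool" where
  "model_knot_solution k \<theta> A \<Phi> \<longleftrightarrow>
     (\<forall>i. \<forall>x\<in>half_space. A i x \<in> su2 \<and> \<Phi> i x \<in> su2) \<and>
     (\<forall>i. smooth_on half_space (A i) \<and> smooth_on half_space (\<Phi> i)) \<and>
     (\<forall>i. \<forall>x\<in>half_space. \<forall>t. A i (x + axis 1 t) = A i x \<and> \<Phi> i (x + axis 1 t) = \<Phi> i x) \<and>
     KW_equations \<theta> A \<Phi> \<and>
     (\<exists>Y \<Sigma> u v.
        smooth_on half_space Y \<and> smooth_on half_space \<Sigma> \<and> (\<forall>x\<in>half_space. Y x > 0) \<and>
        has_ansatz_form (beta_of \<theta>) k Y \<Sigma> A \<Phi> \<and>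
        profile_asymptotics k u v \<and>
        (\<forall>x\<in>half_space. zcoord x \<noteq> 0 \<longrightarrow>
           (let r = cmod (zcoord x); \<sigma> = ycoord x / r in
              Y x = r ^ (k+1) * exp (u \<sigma>) \<and>
              \<Sigma> x = complex_of_real (sin (beta_of \<theta>)) * zcoord x ^ (k+1) * complex_of_real (v \<sigma>))))"

end

theory Submission
  imports Defs "HOL-Analysis.Analysis" "HOL-Probability.Discrete_Topology" "HOL-Real_Asymp.Real_Asymp"
begin

text \<open>
  Write \<open>n = k + 1\<close>, \<open>s = sin \<beta>\<close>, \<open>c = cos \<beta>\<close>. For fields of the given form the equations hold
  identically except for a moment map equation, that is, two scalar equations of second order for
  \<open>Y\<close> and \<open>\<Sigma>\<close>. With \<open>sinh t = y / r\<close>, \<open>w = e\<^sup>-\<^sup>2\<^sup>t\<close>, \<open>Y = 2 (y + \<rho>)\<^sup>n e\<^bsup>h(w)\<^esup>\<close> and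
  \<open>\<Sigma> = z\<^sup>n (1 / (n s) - 2 G(w))\<close> they become a system of ordinary differential equations for \<open>h\<close>
  and \<open>G\<close> on \<open>[0, 1)\<close>, singular at \<open>w = 0\<close>; its solutions regular there are smooth in \<open>w\<close>, so that
  \<open>Y\<close> and \<open>\<Sigma>\<close> are smooth across \<open>z = 0\<close>. They form a family depending on \<open>h(0)\<close>, which only
  scales, and \<open>G(0)\<close>.

  The pair \<open>(Y, \<Sigma>)\<close> is a Hermitian metric, and its trace distance to the explicit reference
  \<open>Y = r\<^sup>n sinh (n t) / n\<close> (up to a factor), \<open>G = 1 / (2 n s)\<close> satisfies a Kato inequality: up to a bounded
  correction its logarithm is a convex bounded function of \<open>t\<close>, so the distance is controlled by its
  value near the boundary \<open>t = 0\<close>. Shooting produces solutions that agree with the reference at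
  \<open>w = V\<close>; a limit \<open>V \<longrightarrow> 1\<close> has distance tending to \<open>2\<close>, the minimum, at the boundary, which
  gives the asymptotics there. For \<open>k = 0\<close> and for \<open>s = 0\<close> the solution is explicit.
\<close>

subsection \<open>Volterra integral equations\<close>

text \<open>Both ends of the radial interval are singular. At \<open>w = 0\<close> the averaged
  integral form keeps only the regular solutions, but it is a contraction only after all unknowns
  are truncated, so every later estimate also has to show that the truncation is inactive. The
  distance controls \<open>G\<close> only through \<open>G^2 w^n\<close>, which says nothing at the
  center: a solution might concentrate there, with \<open>G 0\<close> huge and \<open>h\<close>
  dropping on a tiny interval. This is excluded because \<open>w p\<close>, the slope of
  \<open>h\<close> in \<open>ln w\<close>, is monotone: a drop by \<open>1/4\<close> makes the slope
  at least a fixed constant, and a lower bound on \<open>h\<close> at a later point then bounds the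
  length of the interval from below. At the boundary the reference solves the equation for
  \<open>h\<close> exactly but misses the one for \<open>G\<close>; its defect enters the convexity
  inequality with size \<open>1/t\<close>, dominated by the second derivative of a multiple of
  \<open>- sqrt t\<close>. As that correction vanishes at \<open>t = 0\<close>, the distance tends
  to exactly \<open>2\<close> instead of being merely bounded. The range of \<open>\<beta>\<close>
  enters as \<open>|s| \<le> 1/2\<close>, in the positivity of the quadratic form driving
  \<open>h\<close> and in the size of the defect.\<close>

lemma continuous_on_discrete_times:
  fixes f :: "'i discrete \<times> 'a::topological_space \<Rightarrow> 'b::topological_space"
  assumes "\<And>i. continuous_on UNIV (\<lambda>w. f (i, w))"
  shows "continuous_on UNIV f"
proof -
  have "continuous_on ({i} \<times> UNIV) f" for i
  proof -
    have "continuous_on ({i} \<times> UNIV) (\<lambda>p. f (i, snd p))"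
      by (rule continuous_on_compose2[OF assms[of i]]) (auto intro: continuous_intros)
    then show ?thesis
      by (rule continuous_on_cong[THEN iffD1, rotated -1]) auto
  qed
  moreover have "open ({i::'i discrete} \<times> (UNIV::'a set))" for i
    by (intro open_Times) (auto simp: Discrete_Topology.open_discrete)
  ultimately have "continuous_on (\<Union>i. {i} \<times> UNIV) f"
    by (intro continuous_on_open_UN) auto
  moreover have "(\<Union>i. {i} \<times> UNIV) = (UNIV :: ('i discrete \<times> 'a) set)" by auto
  ultimately show ?thesis by simp
qed

text \<open>The factor \<open>w\<close> in front of the average is what an exponential weight turns
  into the small constant \<open>1 / \<Lambda>\<close>.\<close>

lemma weighted_average_bound:
  fixes w \<Lambda> :: real
  assumes "\<Lambda> > 0"
  shows "\<bar>w\<bar> * integral {0..1} (\<lambda>l. exp (\<Lambda> * \<bar>l * w\<bar>)) \<le> exp (\<Lambda> * \<bar>w\<bar>) / \<Lambda>"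
proof -
  let ?F = "\<lambda>l. exp (\<Lambda> * l * \<bar>w\<bar>) / \<Lambda>"
  have "((\<lambda>l. \<bar>w\<bar> * exp (\<Lambda> * \<bar>l * w\<bar>)) has_integral (?F 1 - ?F 0)) {0..1}"
  proof (rule fundamental_theorem_of_calculus)
    fix l :: real assume "l \<in> {0..1}"
    then have l: "\<bar>l * w\<bar> = l * \<bar>w\<bar>" by (simp add: abs_mult)
    have "(?F has_real_derivative \<bar>w\<bar> * exp (\<Lambda> * \<bar>l * w\<bar>)) (at l within {0..1})"
      unfolding l using assms by (auto intro!: derivative_eq_intros simp: field_simps)
    then show "(?F has_vector_derivative \<bar>w\<bar> * exp (\<Lambda> * \<bar>l * w\<bar>)) (at l within {0..1})"
      by (simp add: has_real_derivative_iff_has_vector_derivative)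
  qed simp
  then have "integral {0..1} (\<lambda>l. \<bar>w\<bar> * exp (\<Lambda> * \<bar>l * w\<bar>)) = ?F 1 - ?F 0"
    by (rule integral_unique)
  then show ?thesis using assms by simp
qed

text \<open>Two kinds of terms: \<open>f\<close> will carry a factor \<open>w\<close> and may have
  any Lipschitz constant, since an exponential weight absorbs it; \<open>g\<close> has no such
  factor, so its constant has to be small. The separate argument \<open>l\<close> admits the weights
  \<open>l ^ n\<close> that come from the singular equation for \<open>q\<close>.\<close>

locale volterra =
  fixes f g :: "nat \<Rightarrow> real \<Rightarrow> real \<Rightarrow> (nat \<Rightarrow> real) \<Rightarrow> real" and C :: real
  assumes f_cont: "\<And>x i. (\<And>j. continuous_on UNIV (x j)) \<Longrightarrow>
            continuous_on (UNIV \<times> {0..1}) (\<lambda>(w, l). f i l (l * w) (\<lambda>j. x j (l * w)))"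
    and g_cont: "\<And>x i. (\<And>j. continuous_on UNIV (x j)) \<Longrightarrow>
            continuous_on (UNIV \<times> {0..1}) (\<lambda>(w, l). g i l (l * w) (\<lambda>j. x j (l * w)))"
    and f_bound: "\<And>i l v x. l \<in> {0..1} \<Longrightarrow> \<bar>f i l v x\<bar> \<le> C"
    and g_bound: "\<And>i l v x. l \<in> {0..1} \<Longrightarrow> \<bar>g i l v x\<bar> \<le> C"
    and f_lip: "\<And>i l v x y d. l \<in> {0..1} \<Longrightarrow> (\<And>j. \<bar>x j - y j\<bar> \<le> d) \<Longrightarrow> \<bar>f i l v x - f i l v y\<bar> \<le> C * d"
    and g_lip: "\<And>i l v x y d. l \<in> {0..1} \<Longrightarrow> (\<And>j. \<bar>x j - y j\<bar> \<le> d) \<Longrightarrow> \<bar>g i l v x - g i l v y\<bar> \<le> d / 4"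
    and C_pos: "C > 0"
begin

definition rhs :: "(nat \<Rightarrow> real \<Rightarrow> real) \<Rightarrow> nat \<Rightarrow> real \<Rightarrow> real" where
  "rhs x i w = integral {0..1} (\<lambda>l. w * f i l (l * w) (\<lambda>j. x j (l * w)) + g i l (l * w) (\<lambda>j. x j (l * w)))"

lemma integrand_cont:
  assumes "\<And>j. continuous_on UNIV (x j)"
  shows "continuous_on (UNIV \<times> {0..1})
    (\<lambda>(w, l). w * f i l (l * w) (\<lambda>j. x j (l * w)) + g i l (l * w) (\<lambda>j. x j (l * w)))"
proof -
  have "continuous_on (UNIV \<times> {0..1}) (\<lambda>z. fst z * (\<lambda>(w, l). f i l (l * w) (\<lambda>j. x j (l * w))) z
      + (\<lambda>(w, l). g i l (l * w) (\<lambda>j. x j (l * w))) z)"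
    by (intro continuous_intros f_cont g_cont assms)
  then show ?thesis by (simp add: case_prod_beta')
qed

lemma rhs_cont:
  assumes "\<And>j. continuous_on UNIV (x j)"
  shows "continuous_on UNIV (rhs x i)"
proof -
  have "continuous_on UNIV (\<lambda>w. integral (cbox 0 1)
     (\<lambda>l. w * f i l (l * w) (\<lambda>j. x j (l * w)) + g i l (l * w) (\<lambda>j. x j (l * w))))"
    by (rule integral_continuous_on_param) (use integrand_cont[OF assms, of i] in auto)
  then show ?thesis unfolding rhs_def[abs_def] by simp
qed

lemma integrand_integrable:
  assumes "\<And>j. continuous_on UNIV (x j)"
  shows "(\<lambda>l. w * f i l (l * w) (\<lambda>j. x j (l * w)) + g i l (l * w) (\<lambda>j. x j (l * w))) integrable_on {0..1}"
proof (rule integrable_continuous_real)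
  have "continuous_on {0..1} (\<lambda>l. (\<lambda>(w, l). w * f i l (l * w) (\<lambda>j. x j (l * w)) + g i l (l * w) (\<lambda>j. x j (l * w))) (w, l))"
    by (rule continuous_on_compose2[OF integrand_cont[OF assms, of i]]) (auto intro: continuous_intros)
  then show "continuous_on {0..1} (\<lambda>l. w * f i l (l * w) (\<lambda>j. x j (l * w)) + g i l (l * w) (\<lambda>j. x j (l * w)))"
    by simp
qed

lemma rhs_bound:
  assumes "\<And>j. continuous_on UNIV (x j)"
  shows "\<bar>rhs x i w\<bar> \<le> C * (\<bar>w\<bar> + 1)"
proof -
  have "norm (rhs x i w) \<le> integral {0..1} (\<lambda>l::real. C * (\<bar>w\<bar> + 1))"
    unfolding rhs_def
  proof (rule integral_norm_bound_integral[OF integrand_integrable[OF assms]])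
    fix l :: real assume l: "l \<in> {0..1}"
    let ?f = "f i l (l * w) (\<lambda>j. x j (l * w))" and ?g = "g i l (l * w) (\<lambda>j. x j (l * w))"
    have "\<bar>w * ?f\<bar> \<le> \<bar>w\<bar> * C" unfolding abs_mult by (intro mult_left_mono f_bound l) auto
    moreover have "\<bar>?g\<bar> \<le> C" by (intro g_bound l)
    ultimately show "norm (w * ?f + ?g) \<le> C * (\<bar>w\<bar> + 1)" by (simp add: algebra_simps)
  qed auto
  then show ?thesis by simp
qed

text \<open>In the norm with weight \<open>exp (4 C |w|)\<close> the \<open>f\<close> part
  contributes \<open>C / (4 C) = 1/4\<close> and the \<open>g\<close> part another
  \<open>1/4\<close>, hence the contraction factor \<open>1/2\<close>.\<close>

lemma rhs_lip:
  assumes x: "\<And>j. continuous_on UNIV (x j)" and y: "\<And>j. continuous_on UNIV (y j)"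
    and d: "\<And>j w. \<bar>x j w - y j w\<bar> \<le> exp (4 * C * \<bar>w\<bar>) * d" and "d \<ge> 0"
  shows "\<bar>rhs x i w - rhs y i w\<bar> \<le> exp (4 * C * \<bar>w\<bar>) * (d / 2)"
proof -
  let ?e = "\<lambda>l. exp (4 * C * \<bar>l * w\<bar>)"
  let ?h = "\<lambda>x l. w * f i l (l * w) (\<lambda>j. x j (l * w)) + g i l (l * w) (\<lambda>j. x j (l * w))"
  have eint: "?e integrable_on {0..1}"
    by (intro integrable_continuous_real continuous_intros)
  have eq: "rhs x i w - rhs y i w = integral {0..1} (\<lambda>l. ?h x l - ?h y l)"
    unfolding rhs_def by (rule integral_diff[symmetric]; rule integrand_integrable; fact)
  have bound: "norm (integral {0..1} (\<lambda>l. ?h x l - ?h y l)) \<le> integral {0..1} (\<lambda>l. C * d * (\<bar>w\<bar> * ?e l) + d / 4 * exp (4 * C * \<bar>w\<bar>))"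
  proof (rule integral_norm_bound_integral)
    show "(\<lambda>l. ?h x l - ?h y l) integrable_on {0..1}"
      by (intro integrable_diff integrand_integrable x y)
    show "(\<lambda>l. C * d * (\<bar>w\<bar> * ?e l) + d / 4 * exp (4 * C * \<bar>w\<bar>)) integrable_on {0..1}"
      by (intro integrable_continuous_real continuous_intros)
    fix l :: real assume l: "l \<in> {0..1}"
    let ?x = "\<lambda>j. x j (l * w)" and ?y = "\<lambda>j. y j (l * w)"
    have "\<bar>w * (f i l (l * w) ?x - f i l (l * w) ?y)\<bar> \<le> \<bar>w\<bar> * (C * (?e l * d))"
      unfolding abs_mult[of w] by (intro mult_left_mono f_lip l d) auto
    moreover have "\<bar>g i l (l * w) ?x - g i l (l * w) ?y\<bar> \<le> ?e l * d / 4"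
      by (intro g_lip l d)
    moreover have "?e l * d / 4 \<le> d / 4 * exp (4 * C * \<bar>w\<bar>)"
    proof -
      have "\<bar>l * w\<bar> \<le> \<bar>w\<bar>" using l by (simp add: abs_mult mult_left_le_one_le)
      then have "?e l \<le> exp (4 * C * \<bar>w\<bar>)" using C_pos by simp
      then show ?thesis using \<open>d \<ge> 0\<close> by (simp add: mult_mono mult.commute mult_right_mono)
    qed
    moreover have "?h x l - ?h y l = w * (f i l (l * w) ?x - f i l (l * w) ?y) + (g i l (l * w) ?x - g i l (l * w) ?y)"
      by (simp add: algebra_simps)
    moreover have "\<bar>w\<bar> * (C * (?e l * d)) = C * d * (\<bar>w\<bar> * ?e l)" by (simp only: mult_ac)
    ultimately show "norm (?h x l - ?h y l) \<le> C * d * (\<bar>w\<bar> * ?e l) + d / 4 * exp (4 * C * \<bar>w\<bar>)"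
      unfolding real_norm_def by linarith
  qed
  have "\<bar>rhs x i w - rhs y i w\<bar> \<le> integral {0..1} (\<lambda>l. C * d * (\<bar>w\<bar> * ?e l) + d / 4 * exp (4 * C * \<bar>w\<bar>))"
    using bound unfolding eq real_norm_def .
  also have "\<dots> = C * d * (\<bar>w\<bar> * integral {0..1} ?e) + d / 4 * exp (4 * C * \<bar>w\<bar>)"
  proof (rule integral_unique)
    have "((\<lambda>l::real. d / 4 * exp (4 * C * \<bar>w\<bar>)) has_integral d / 4 * exp (4 * C * \<bar>w\<bar>)) {0..1}"
      using has_integral_const_real[of "d / 4 * exp (4 * C * \<bar>w\<bar>)" 0 1] by simp
    then show "((\<lambda>l. C * d * (\<bar>w\<bar> * ?e l) + d / 4 * exp (4 * C * \<bar>w\<bar>)) has_integral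
        C * d * (\<bar>w\<bar> * integral {0..1} ?e) + d / 4 * exp (4 * C * \<bar>w\<bar>)) {0..1}"
      by (rule has_integral_add[OF has_integral_mult_right[OF has_integral_mult_right[OF integrable_integral[OF eint]]]])
  qed
  also have "\<dots> \<le> C * d * (exp (4 * C * \<bar>w\<bar>) / (4 * C)) + d / 4 * exp (4 * C * \<bar>w\<bar>)"
    using weighted_average_bound[of "4 * C" w] C_pos \<open>d \<ge> 0\<close> by (intro add_right_mono mult_left_mono) auto
  also have "\<dots> = exp (4 * C * \<bar>w\<bar>) * (d / 2)"
    using C_pos by (simp add: field_simps)
  finally show ?thesis .
qed

text \<open>The integrand at \<open>w\<close> only sees arguments \<open>l * w\<close> between
  \<open>0\<close> and \<open>w\<close>, so both solutions may be frozen outside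
  \<open>[0, R]\<close> by clamping the argument. The contraction estimate on the whole line is then
  iterated.\<close>

lemma solution_unique_on:
  assumes x: "\<And>j. continuous_on {0..R} (x j)" and y: "\<And>j. continuous_on {0..R} (y j)"
    and x_eq: "\<And>i w. w \<in> {0..R} \<Longrightarrow> x i w = c i + rhs x i w"
    and y_eq: "\<And>i w. w \<in> {0..R} \<Longrightarrow> y i w = c i + rhs y i w"
    and d0: "\<And>j w. w \<in> {0..R} \<Longrightarrow> \<bar>x j w - y j w\<bar> \<le> d" and w: "w \<in> {0..R}"
  shows "x i w = y i w"
proof -
  define cl where "cl v = max 0 (min R v)" for v :: real
  have R: "0 \<le> R" using w by simp
  have cl: "cl v \<in> {0..R}" "\<bar>cl v\<bar> \<le> \<bar>v\<bar>" for v using R unfolding cl_def by auto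
  have cl_id: "cl v = v" if "v \<in> {0..R}" for v using that unfolding cl_def by auto
  have cl_cont: "continuous_on UNIV cl" unfolding cl_def by (intro continuous_intros)
  have cont: "continuous_on UNIV (\<lambda>v. z j (cl v))" if "\<And>j. continuous_on {0..R} (z j)"
    for z :: "nat \<Rightarrow> real \<Rightarrow> real" and j
    by (rule continuous_on_compose2[OF that cl_cont]) (use cl in auto)
  have rhs_cl: "rhs (\<lambda>j v. z j (cl v)) i v = rhs z i v" if v: "v \<in> {0..R}" for z i v
    unfolding rhs_def
  proof (rule Henstock_Kurzweil_Integration.integral_cong)
    fix l :: real assume l: "l \<in> {0..1}"
    have "l * v \<in> {0..R}" using l v mult_mono[of l 1 v v] by auto
    then show "v * f i l (l * v) (\<lambda>j. z j (cl (l * v))) + g i l (l * v) (\<lambda>j. z j (cl (l * v))) =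
      v * f i l (l * v) (\<lambda>j. z j (l * v)) + g i l (l * v) (\<lambda>j. z j (l * v))" by (simp add: cl_id)
  qed
  have d: "0 \<le> d" using d0[OF w, of 0] by linarith
  have bound: "\<bar>x j (cl v) - y j (cl v)\<bar> \<le> exp (4 * C * \<bar>v\<bar>) * (d / 2 ^ k)" for j v k
  proof (induction k arbitrary: j v)
    case 0
    have "d \<le> exp (4 * C * \<bar>v\<bar>) * d" using C_pos d by (simp add: mult_le_cancel_right1)
    then show ?case using d0[OF cl(1), of j v] by simp
  next
    case (Suc k)
    have "\<bar>x j (cl v) - y j (cl v)\<bar> = \<bar>rhs (\<lambda>j v. x j (cl v)) j (cl v) - rhs (\<lambda>j v. y j (cl v)) j (cl v)\<bar>"
      using x_eq[OF cl(1), of j v] y_eq[OF cl(1), of j v] rhs_cl[OF cl(1), of x j v] rhs_cl[OF cl(1), of y j v] by simp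
    also have "\<dots> \<le> exp (4 * C * \<bar>cl v\<bar>) * (d / 2 ^ k / 2)"
      by (rule rhs_lip) (use Suc d in \<open>auto intro: cont[OF x] cont[OF y]\<close>)
    also have "\<dots> \<le> exp (4 * C * \<bar>v\<bar>) * (d / 2 ^ k / 2)"
      using cl(2)[of v] C_pos d by (intro mult_right_mono) auto
    finally show ?case by simp
  qed
  have lim: "(\<lambda>k. exp (4 * C * \<bar>w\<bar>) * (d / 2 ^ k)) \<longlonglongrightarrow> exp (4 * C * \<bar>w\<bar>) * 0"
    by (intro tendsto_mult tendsto_const LIMSEQ_divide_realpow_zero) simp
  have "\<bar>x i w - y i w\<bar> \<le> exp (4 * C * \<bar>w\<bar>) * 0"
    by (rule LIMSEQ_le_const[OF lim]) (use bound[of i w] cl_id[OF w] in auto)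
  then show ?thesis by simp
qed

text \<open>Banach's fixed point theorem for the unknown multiplied by
  \<open>exp (- 4 C |w|)\<close>, which is bounded because \<open>rhs\<close> grows at most
  linearly. The data \<open>m * c i\<close> are linear in the shooting parameter \<open>m\<close>,
  so the fixed points are Lipschitz in \<open>m\<close>.\<close>

lemma exists_solution_family:
  fixes c :: "nat \<Rightarrow> real"
  assumes c: "\<And>i. \<bar>c i\<bar> \<le> 1"
  obtains X \<Lambda> where
    "\<And>m j. continuous_on UNIV (X m j)"
    "\<And>m i w. X m i w = m * c i + rhs (X m) i w"
    "\<And>m m' i w. \<bar>X m i w - X m' i w\<bar> \<le> \<bar>m - m'\<bar> * (2 * exp (\<Lambda> * \<bar>w\<bar>))"
    "\<And>i w. (\<And>i w. rhs (\<lambda>_ _. 0) i w = 0) \<Longrightarrow> X 0 i w = 0"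
proof -
  let ?e = "\<lambda>w::real. exp (4 * C * \<bar>w\<bar>)"
  \<comment> \<open>The component index becomes a point of a discrete space. The whole countable
    system then lives in one complete space of bounded continuous functions, with the supremum over
    components and \<open>w\<close> as its norm; \<open>un\<close> undoes the weight.\<close>
  define un :: "((nat discrete \<times> real) \<Rightarrow>\<^sub>C real) \<Rightarrow> nat \<Rightarrow> real \<Rightarrow> real"
    where "un y = (\<lambda>j w. ?e w * apply_bcontfun y (discrete j, w))" for y
  have un_cont: "continuous_on UNIV (un y j)" for y j
  proof -
    have "continuous_on UNIV (\<lambda>w. apply_bcontfun y (discrete j, w))"
      by (rule continuous_on_compose2[OF continuous_on_apply_bcontfun[of UNIV]])
        (auto intro: continuous_intros)
    then show ?thesis unfolding un_def by (intro continuous_intros)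
  qed
  define T0 where "T0 m y = (\<lambda>(i, w). exp (- (4 * C * \<bar>w\<bar>)) * (m * c (of_discrete i) + rhs (un y) (of_discrete i) w))" for m y
  have T0_in: "T0 m y \<in> bcontfun" for m y
    unfolding bcontfun_def
  proof safe
    show "continuous_on UNIV (T0 m y)"
      unfolding T0_def by (rule continuous_on_discrete_times) (auto intro!: continuous_intros rhs_cont un_cont)
    have "norm (T0 m y z) \<le> \<bar>m\<bar> + (1 + C)" for z
    proof (cases z)
      case (Pair i' w)
      define i where "i = of_discrete i'"
      have "\<bar>m * c i\<bar> \<le> \<bar>m\<bar> * 1" unfolding abs_mult by (intro mult_left_mono c) auto
      moreover have "C * (\<bar>w\<bar> + 1) \<le> ?e w * (1 + C)"
      proof -
        have "4 * C * \<bar>w\<bar> + 1 \<le> ?e w" using exp_ge_add_one_self[of "4 * C * \<bar>w\<bar>"] by linarith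
        moreover have "0 \<le> C * \<bar>w\<bar>" "0 \<le> C * (C * \<bar>w\<bar>)" using C_pos by auto
        moreover have "(4 * C * \<bar>w\<bar> + 1) * (1 + C) \<le> ?e w * (1 + C)"
          using calculation C_pos by (intro mult_right_mono) auto
        ultimately show ?thesis by (simp add: algebra_simps)
      qed
      moreover have "\<bar>m\<bar> \<le> ?e w * \<bar>m\<bar>" using C_pos by (simp add: mult_le_cancel_right1)
      ultimately have "\<bar>m * c i\<bar> + \<bar>rhs (un y) i w\<bar> \<le> ?e w * \<bar>m\<bar> + ?e w * (1 + C)"
        using rhs_bound[of "un y" i w, OF un_cont] by linarith
      then have "\<bar>m * c i + rhs (un y) i w\<bar> \<le> ?e w * (\<bar>m\<bar> + (1 + C))"
        using abs_triangle_ineq[of "m * c i" "rhs (un y) i w"] by (simp only: distrib_left)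
      then show ?thesis unfolding Pair T0_def by (simp add: i_def abs_mult exp_minus field_simps)
    qed
    then show "bounded (range (T0 m y))" by (auto simp: bounded_iff)
  qed
  define T where "T m y = Bcontfun (T0 m y)" for m y
  have T_app: "apply_bcontfun (T m y) (discrete i, w) = exp (- (4 * C * \<bar>w\<bar>)) * (m * c i + rhs (un y) i w)" for m y i w
    unfolding T_def by (subst Bcontfun_inverse[OF T0_in]) (simp add: T0_def discrete_inverse)
  have contr: "dist (T m y) (T m y') \<le> 1/2 * dist y y'" for m y y'
  proof (rule dist_bound)
    fix z :: "nat discrete \<times> real"
    obtain i w where z: "z = (discrete i, w)" by (metis of_discrete_inverse prod.exhaust)
    have "\<bar>un y j v - un y' j v\<bar> \<le> ?e v * dist y y'" for j v
    proof -
      have "\<bar>apply_bcontfun y (discrete j, v) - apply_bcontfun y' (discrete j, v)\<bar> \<le> dist y y'"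
        using dist_bounded[of y "(discrete j, v)" y'] by (simp add: dist_real_def)
      then show ?thesis unfolding un_def by (simp add: right_diff_distrib[symmetric] abs_mult)
    qed
    then have "\<bar>rhs (un y) i w - rhs (un y') i w\<bar> \<le> ?e w * (dist y y' / 2)"
      by (intro rhs_lip un_cont) auto
    then have le: "exp (- (4 * C * \<bar>w\<bar>)) * \<bar>rhs (un y) i w - rhs (un y') i w\<bar> \<le> exp (- (4 * C * \<bar>w\<bar>)) * (?e w * (dist y y' / 2))"
      by (intro mult_left_mono) auto
    have "apply_bcontfun (T m y) z - apply_bcontfun (T m y') z = exp (- (4 * C * \<bar>w\<bar>)) * (rhs (un y) i w - rhs (un y') i w)"
      unfolding z T_app by (simp only: distrib_left right_diff_distrib add_diff_add diff_self add_0)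
    then have "dist (apply_bcontfun (T m y) z) (apply_bcontfun (T m y') z) = exp (- (4 * C * \<bar>w\<bar>)) * \<bar>rhs (un y) i w - rhs (un y') i w\<bar>"
      by (simp add: dist_real_def abs_mult)
    also note le
    also have "exp (- (4 * C * \<bar>w\<bar>)) * (?e w * (dist y y' / 2)) = 1/2 * dist y y'"
      by (simp add: exp_minus)
    finally show "dist (apply_bcontfun (T m y) z) (apply_bcontfun (T m y') z) \<le> 1/2 * dist y y'" .
  qed
  have "\<exists>y. T m y = y" for m
    using banach_fix_type[of "1/2" "T m"] contr by auto
  then obtain Y where Y: "\<And>m. T m (Y m) = Y m" by metis
  \<comment> \<open>\<open>2 = 1 / (1 - 1/2)\<close>: changing the map by at most
    \<open>|m - m'|\<close> moves its fixed point by at most twice as much.\<close>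
  have lip: "dist (Y m) (Y m') \<le> 2 * \<bar>m - m'\<bar>" for m m'
  proof -
    have "dist (T m (Y m')) (T m' (Y m')) \<le> \<bar>m - m'\<bar>"
    proof (rule dist_bound)
      fix z :: "nat discrete \<times> real"
      obtain i w where z: "z = (discrete i, w)" by (metis of_discrete_inverse prod.exhaust)
      have "\<bar>m - m'\<bar> * \<bar>c i\<bar> \<le> \<bar>m - m'\<bar> * 1" by (intro mult_left_mono c) auto
      moreover have "exp (- (4 * C * \<bar>w\<bar>)) \<le> 1" using C_pos by simp
      ultimately have "exp (- (4 * C * \<bar>w\<bar>)) * (\<bar>m - m'\<bar> * \<bar>c i\<bar>) \<le> 1 * \<bar>m - m'\<bar>"
        by (intro mult_mono) auto
      then show "dist (apply_bcontfun (T m (Y m')) z) (apply_bcontfun (T m' (Y m')) z) \<le> \<bar>m - m'\<bar>"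
        unfolding z T_app dist_real_def
        by (simp add: right_diff_distrib[symmetric] left_diff_distrib[symmetric] abs_mult)
    qed
    moreover have "dist (T m (Y m)) (T m' (Y m')) \<le> dist (T m (Y m)) (T m (Y m')) + dist (T m (Y m')) (T m' (Y m'))"
      by (rule dist_triangle)
    moreover have "x \<le> 2 * v" if "u \<le> v" "x \<le> y + u" "y \<le> 1/2 * x" for u v x y :: real
      using that by linarith
    ultimately show ?thesis using contr[of m "Y m" "Y m'"] unfolding Y by blast
  qed
  show ?thesis
  proof (rule that[of "\<lambda>m. un (Y m)" "4 * C"])
    show "un (Y m) i w = m * c i + rhs (un (Y m)) i w" for m i w
    proof -
      have "un (Y m) i w = ?e w * apply_bcontfun (T m (Y m)) (discrete i, w)"
        unfolding Y un_def ..
      also have "\<dots> = m * c i + rhs (un (Y m)) i w"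
        unfolding T_app by (simp add: exp_minus)
      finally show ?thesis .
    qed
    show "\<bar>un (Y m) i w - un (Y m') i w\<bar> \<le> \<bar>m - m'\<bar> * (2 * exp (4 * C * \<bar>w\<bar>))" for m m' i w
    proof -
      have "\<bar>apply_bcontfun (Y m) (discrete i, w) - apply_bcontfun (Y m') (discrete i, w)\<bar> \<le> 2 * \<bar>m - m'\<bar>"
        using dist_bounded[of "Y m" "(discrete i, w)" "Y m'"] lip[of m m'] by (simp add: dist_real_def)
      then show ?thesis unfolding un_def by (simp add: right_diff_distrib[symmetric] abs_mult)
    qed
    show "un (Y 0) i w = 0" if "\<And>i w. rhs (\<lambda>_ _. 0) i w = 0" for i w
    proof -
      let ?z = "const_bcontfun 0 :: (nat discrete \<times> real) \<Rightarrow>\<^sub>C real"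
      have unz: "un ?z = (\<lambda>_ _. 0)" by (simp add: un_def const_bcontfun.rep_eq)
      have "T 0 ?z = ?z"
      proof (intro bcontfun_eqI)
        fix z :: "nat discrete \<times> real"
        obtain i w where z: "z = (discrete i, w)" by (metis of_discrete_inverse prod.exhaust)
        show "apply_bcontfun (T 0 ?z) z = apply_bcontfun ?z z"
          unfolding z T_app unz that by (simp add: const_bcontfun.rep_eq)
      qed
      then have "dist (Y 0) ?z \<le> 1/2 * dist (Y 0) ?z" using contr[of 0 "Y 0" ?z] Y[of 0] by simp
      then have "Y 0 = ?z" by simp
      then show ?thesis by (simp add: un_def const_bcontfun.rep_eq)
    qed
  qed (rule un_cont)
qed

end

subsection \<open>The radial equations\<close>

lemma scale_mem:
  fixes a b l v :: real
  assumes "l \<in> {0..1}" "v \<in> {a<..<b}" "a < 0" "0 < b"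
  shows "l * v \<in> {a<..<b}"
proof -
  have "l * v \<le> max 0 v" "min 0 v \<le> l * v" using assms(1)
    by (auto simp: max_def min_def mult_le_0_iff mult_left_le_one_le mult_nonneg_nonpos
        mult_le_cancel_right1 zero_le_mult_iff)
  then show ?thesis using assms by auto
qed

text \<open>Substituting \<open>v = l w\<close> turns the left side into the integral of
  \<open>v ^ j * F v\<close> from \<open>0\<close> to \<open>w\<close>. The averaged form is kept
  because it makes sense at \<open>w = 0\<close> and on both sides of it.\<close>

lemma average_has_derivative:
  fixes F :: "real \<Rightarrow> real"
  assumes "continuous_on {a<..<b} F" and w: "w \<in> {a<..<b}" and ab: "a < 0" "0 < b"
  shows "((\<lambda>w. w ^ Suc j * integral {0..1} (\<lambda>l. l ^ j * F (l * w))) has_real_derivative w ^ j * F w) (at w)"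
proof -
  define a' b' where "a' = (a + min 0 w) / 2" and "b' = (b + max 0 w) / 2"
  have ab': "a < a'" "a' < 0" "0 < b'" "b' < b" and w': "w \<in> {a'<..<b'}"
    using w ab unfolding a'_def b'_def by auto
  have "continuous_on {a'..b'} (\<lambda>v. v ^ j * F v)"
    by (intro continuous_intros continuous_on_subset[OF assms(1)]) (use ab' in auto)
  then obtain g where g: "\<And>v. v \<in> {a'..b'} \<Longrightarrow> (g has_vector_derivative v ^ j * F v) (at v within {a'..b'})"
    using antiderivative_continuous by blast
  have gd: "(g has_real_derivative v ^ j * F v) (at v)" if "v \<in> {a'<..<b'}" for v
    using g[of v] that at_within_interior[of v "{a'..b'}"]
    by (simp add: has_real_derivative_iff_has_vector_derivative)
  have eq: "v ^ Suc j * integral {0..1} (\<lambda>l. l ^ j * F (l * v)) = g v - g 0" if v: "v \<in> {a'<..<b'}" for v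
  proof -
    have "((\<lambda>l. v ^ Suc j * (l ^ j * F (l * v))) has_integral (g (1 * v) - g (0 * v))) {0..1}"
    proof (rule fundamental_theorem_of_calculus)
      fix l :: real assume l: "l \<in> {0..1}"
      have "((\<lambda>l. g (l * v)) has_real_derivative ((l * v) ^ j * F (l * v)) * v) (at l)"
        by (rule DERIV_chain2[where f = g and g = "\<lambda>l. l * v", OF gd[OF scale_mem[OF l v ab'(2,3)]]]) (auto intro!: derivative_eq_intros)
      then have "((\<lambda>l. g (l * v)) has_real_derivative v ^ Suc j * (l ^ j * F (l * v))) (at l)"
        by (simp add: power_mult_distrib mult_ac)
      then show "((\<lambda>l. g (l * v)) has_vector_derivative v ^ Suc j * (l ^ j * F (l * v))) (at l within {0..1})"
        by (simp add: has_real_derivative_iff_has_vector_derivative has_vector_derivative_at_within)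
    qed simp
    from integral_unique[OF this] show ?thesis by simp
  qed
  have "((\<lambda>v. g v - g 0) has_real_derivative w ^ j * F w) (at w)"
    using gd[OF w'] by (auto intro!: derivative_eq_intros)
  then show ?thesis
    by (rule has_field_derivative_transform_within_open[of _ _ _ "{a'<..<b'}"]) (use w' eq in auto)
qed

text \<open>This is \<open>tanh t\<close> in the variable \<open>w = exp (- 2 t)\<close>.\<close>

definition tt :: "real \<Rightarrow> real" where "tt w = (1 - w) / (1 + w)"

definition src_p :: "nat \<Rightarrow> real \<Rightarrow> (real \<Rightarrow> real) \<Rightarrow> (real \<Rightarrow> real) \<Rightarrow> (real \<Rightarrow> real) \<Rightarrow> real \<Rightarrow> real" where
  "src_p n s h G q v = - (v ^ (n - 1) * exp (- 2 * h v) *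
      ((v * q v)\<^sup>2 + 2 * s\<^sup>2 * n * tt v * G v * (v * q v) + (n * s * G v)\<^sup>2))"

definition src_q :: "nat \<Rightarrow> real \<Rightarrow> (real \<Rightarrow> real) \<Rightarrow> (real \<Rightarrow> real) \<Rightarrow> (real \<Rightarrow> real) \<Rightarrow> real \<Rightarrow> real" where
  "src_q n s p G q v = 2 * v * q v * p v + s\<^sup>2 * n * G v * (2 * n / (1 + v) + 2 * tt v * p v)"

text \<open>The last two conditions are the integrated form of \<open>w p' + p = src_p\<close> and
  \<open>w q' + (n + 1) q = src_q\<close>, which selects the solutions that are regular at \<open>w = 0\<close>.\<close>

definition profile :: "nat \<Rightarrow> real \<Rightarrow> real \<Rightarrow> real \<Rightarrow> (real \<Rightarrow> real) \<Rightarrow> (real \<Rightarrow> real) \<Rightarrow> (real \<Rightarrow> real) \<Rightarrow> (real \<Rightarrow> real) \<Rightarrow> bool" where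
  "profile n s a b h p G q \<longleftrightarrow> -1 \<le> a \<and> a < 0 \<and> 0 < b \<and> b \<le> 1 \<and>
     (\<forall>w\<in>{a<..<b}. isCont p w \<and> isCont q w \<and>
        (h has_real_derivative p w) (at w) \<and> (G has_real_derivative q w) (at w) \<and>
        p w = integral {0..1} (\<lambda>l. src_p n s h G q (l * w)) \<and>
        q w = integral {0..1} (\<lambda>l. l ^ n * src_q n s p G q (l * w)))"

section \<open>Truncation and bounded Lipschitz nonlinearities\<close>

definition clampr :: "real \<Rightarrow> real \<Rightarrow> real" where "clampr N x = max (- N) (min N x)"

lemma clampr_cont [continuous_intros]: "continuous_on S f \<Longrightarrow> continuous_on S (\<lambda>x. clampr N (f x))"
  unfolding clampr_def by (intro continuous_intros)

lemma clampr_id: "\<bar>x\<bar> \<le> N \<Longrightarrow> clampr N x = x"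
  unfolding clampr_def by auto

lemma clampr_abs: "\<bar>clampr N x\<bar> \<le> \<bar>N\<bar>"
  unfolding clampr_def by linarith

lemma clampr_lip: "\<bar>clampr N x - clampr N y\<bar> \<le> \<bar>x - y\<bar>"
  unfolding clampr_def by linarith

text \<open>One constant serves both as bound and as Lipschitz constant in the supremum distance,
  which makes the class closed under sums, products, powers and \<open>exp\<close>.\<close>

definition bounded_lipschitz :: "(real \<Rightarrow> real \<Rightarrow> (nat \<Rightarrow> real) \<Rightarrow> real) \<Rightarrow> bool" where
  "bounded_lipschitz F \<longleftrightarrow> (\<exists>C\<ge>0. \<forall>l\<in>{0..1}. \<forall>v x y d. (\<forall>j. \<bar>x j - y j\<bar> \<le> d) \<longrightarrow>
      \<bar>F l v x\<bar> \<le> C \<and> \<bar>F l v x - F l v y\<bar> \<le> C * d)"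

lemma bounded_lipschitz_I: "C \<ge> 0 \<Longrightarrow> (\<And>l v x y d. l \<in> {0..1} \<Longrightarrow> (\<And>j. \<bar>x j - y j\<bar> \<le> d) \<Longrightarrow>
      \<bar>F l v x\<bar> \<le> C \<and> \<bar>F l v x - F l v y\<bar> \<le> C * d) \<Longrightarrow> bounded_lipschitz F"
  unfolding bounded_lipschitz_def by blast

lemma bounded_lipschitz_E:
  assumes "bounded_lipschitz F"
  obtains C where "C \<ge> 0" "\<And>l v x. l \<in> {0..1} \<Longrightarrow> \<bar>F l v x\<bar> \<le> C"
    "\<And>l v x y d. l \<in> {0..1} \<Longrightarrow> (\<And>j. \<bar>x j - y j\<bar> \<le> d) \<Longrightarrow> \<bar>F l v x - F l v y\<bar> \<le> C * d"
proof -
  obtain C where C: "C \<ge> 0" "\<forall>l\<in>{0..1}. \<forall>v x y d. (\<forall>j. \<bar>x j - y j\<bar> \<le> d) \<longrightarrow>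
      \<bar>F l v x\<bar> \<le> C \<and> \<bar>F l v x - F l v y\<bar> \<le> C * d"
    using assms unfolding bounded_lipschitz_def by blast
  show ?thesis
  proof (rule that[OF C(1)])
    show "\<bar>F l v x\<bar> \<le> C" if "l \<in> {0..1}" for l v x
      using C(2)[rule_format, OF that, of x x 0 v] by simp
  qed (use C(2) in blast)
qed

lemma bounded_lipschitz_coeff:
  assumes "\<And>l v. l \<in> {0..1} \<Longrightarrow> \<bar>k l v\<bar> \<le> B"
  shows "bounded_lipschitz (\<lambda>l v x. k l v)"
proof (rule bounded_lipschitz_I[of "\<bar>B\<bar>"])
  fix l :: real and v d and x y :: "nat \<Rightarrow> real" assume l: "l \<in> {0..1}" and d: "\<And>j. \<bar>x j - y j\<bar> \<le> d"
  have "\<bar>k l v\<bar> \<le> B" "0 \<le> d" using assms[OF l, of v] d[of 0] by linarith+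
  then show "\<bar>k l v\<bar> \<le> \<bar>B\<bar> \<and> \<bar>k l v - k l v\<bar> \<le> \<bar>B\<bar> * d" by simp
qed simp

lemma bounded_lipschitz_const: "bounded_lipschitz (\<lambda>l v x. c)"
  by (rule bounded_lipschitz_coeff[of _ "\<bar>c\<bar>"]) simp

lemma bounded_lipschitz_clamp: "bounded_lipschitz (\<lambda>l v x. clampr N (x j))"
proof (rule bounded_lipschitz_I[of "\<bar>N\<bar> + 1"])
  fix l :: real and v d and x y :: "nat \<Rightarrow> real" assume "l \<in> {0..1}" and d: "\<And>j. \<bar>x j - y j\<bar> \<le> d"
  have "0 \<le> d" using d[of 0] by linarith
  then have "0 \<le> \<bar>N\<bar> * d" by simp
  then show "\<bar>clampr N (x j)\<bar> \<le> \<bar>N\<bar> + 1 \<and> \<bar>clampr N (x j) - clampr N (y j)\<bar> \<le> (\<bar>N\<bar> + 1) * d"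
    using d[of j] clampr_lip[of N "x j" "y j"] clampr_abs[of N "x j"]
    unfolding distrib_right by linarith
qed simp

lemma bounded_lipschitz_mult:
  assumes "bounded_lipschitz F" "bounded_lipschitz G"
  shows "bounded_lipschitz (\<lambda>l v x. F l v x * G l v x)"
proof -
  obtain C where C: "C \<ge> 0" "\<And>l v x. l \<in> {0..1} \<Longrightarrow> \<bar>F l v x\<bar> \<le> C"
    "\<And>l v x y d. l \<in> {0..1} \<Longrightarrow> (\<And>j. \<bar>x j - y j\<bar> \<le> d) \<Longrightarrow> \<bar>F l v x - F l v y\<bar> \<le> C * d"
    using bounded_lipschitz_E[OF assms(1)] by metis
  obtain D where D: "D \<ge> 0" "\<And>l v x. l \<in> {0..1} \<Longrightarrow> \<bar>G l v x\<bar> \<le> D"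
    "\<And>l v x y d. l \<in> {0..1} \<Longrightarrow> (\<And>j. \<bar>x j - y j\<bar> \<le> d) \<Longrightarrow> \<bar>G l v x - G l v y\<bar> \<le> D * d"
    using bounded_lipschitz_E[OF assms(2)] by metis
  show ?thesis
  proof (rule bounded_lipschitz_I[of "2 * C * D"])
    fix l :: real and v d and x y :: "nat \<Rightarrow> real" assume l: "l \<in> {0..1}" and d: "\<And>j. \<bar>x j - y j\<bar> \<le> d"
    have "\<bar>F l v x * G l v x\<bar> \<le> C * D"
      unfolding abs_mult using C D l by (intro mult_mono) auto
    moreover have "F l v x * G l v x - F l v y * G l v y
        = F l v x * (G l v x - G l v y) + (F l v x - F l v y) * G l v y" by (simp add: algebra_simps)
    moreover have "\<bar>F l v x * (G l v x - G l v y)\<bar> \<le> C * (D * d)"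
      unfolding abs_mult using C(1,2) D(3)[OF l d] l by (intro mult_mono) auto
    moreover have "\<bar>(F l v x - F l v y) * G l v y\<bar> \<le> (C * d) * D"
      unfolding abs_mult using C(1) C(3)[OF l d] D(1,2) l d[of 0] by (intro mult_mono) auto
    ultimately show "\<bar>F l v x * G l v x\<bar> \<le> 2 * C * D \<and> \<bar>F l v x * G l v x - F l v y * G l v y\<bar> \<le> 2 * C * D * d"
      using mult_nonneg_nonneg[OF C(1) D(1)] by (simp add: algebra_simps abs_le_iff)
  qed (use C D in auto)
qed

lemma bounded_lipschitz_add:
  assumes "bounded_lipschitz F" "bounded_lipschitz G"
  shows "bounded_lipschitz (\<lambda>l v x. F l v x + G l v x)"
proof -
  obtain C where C: "C \<ge> 0" "\<And>l v x. l \<in> {0..1} \<Longrightarrow> \<bar>F l v x\<bar> \<le> C"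
    "\<And>l v x y d. l \<in> {0..1} \<Longrightarrow> (\<And>j. \<bar>x j - y j\<bar> \<le> d) \<Longrightarrow> \<bar>F l v x - F l v y\<bar> \<le> C * d"
    using bounded_lipschitz_E[OF assms(1)] by metis
  obtain D where D: "D \<ge> 0" "\<And>l v x. l \<in> {0..1} \<Longrightarrow> \<bar>G l v x\<bar> \<le> D"
    "\<And>l v x y d. l \<in> {0..1} \<Longrightarrow> (\<And>j. \<bar>x j - y j\<bar> \<le> d) \<Longrightarrow> \<bar>G l v x - G l v y\<bar> \<le> D * d"
    using bounded_lipschitz_E[OF assms(2)] by metis
  show ?thesis
  proof (rule bounded_lipschitz_I[of "C + D"])
    fix l :: real and v d and x y :: "nat \<Rightarrow> real" assume l: "l \<in> {0..1}" and d: "\<And>j. \<bar>x j - y j\<bar> \<le> d"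
    show "\<bar>F l v x + G l v x\<bar> \<le> C + D \<and> \<bar>F l v x + G l v x - (F l v y + G l v y)\<bar> \<le> (C + D) * d"
      using C(2)[OF l, of v x] D(2)[OF l, of v x] C(3)[OF l, of x y d v, OF d] D(3)[OF l, of x y d v, OF d]
      unfolding distrib_right by linarith
  qed (use C D in auto)
qed

lemma bounded_lipschitz_exp:
  assumes "bounded_lipschitz F"
  shows "bounded_lipschitz (\<lambda>l v x. exp (F l v x))"
proof -
  obtain C where C: "C \<ge> 0" "\<And>l v x. l \<in> {0..1} \<Longrightarrow> \<bar>F l v x\<bar> \<le> C"
    "\<And>l v x y d. l \<in> {0..1} \<Longrightarrow> (\<And>j. \<bar>x j - y j\<bar> \<le> d) \<Longrightarrow> \<bar>F l v x - F l v y\<bar> \<le> C * d"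
    using bounded_lipschitz_E[OF assms(1)] by metis
  have exp_lip: "exp a - exp b \<le> exp C * \<bar>a - b\<bar>" if "a \<le> C" for a b :: real
  proof -
    have "exp a * (a - b) \<ge> exp a * (1 - exp (b - a))"
    proof (rule mult_left_mono)
      show "1 - exp (b - a) \<le> a - b" using exp_ge_add_one_self[of "b - a"] by linarith
    qed simp
    moreover have "exp a * (1 - exp (b - a)) = exp a - exp b" by (simp add: exp_diff field_simps)
    moreover have "exp a * (a - b) \<le> exp a * \<bar>a - b\<bar>" by (intro mult_left_mono) auto
    moreover have "exp a * \<bar>a - b\<bar> \<le> exp C * \<bar>a - b\<bar>"
      using that by (intro mult_right_mono) auto
    ultimately show ?thesis by (simp add: algebra_simps)
  qed
  show ?thesis
  proof (rule bounded_lipschitz_I[of "exp C * (C + 1)"])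
    fix l :: real and v d and x y :: "nat \<Rightarrow> real" assume l: "l \<in> {0..1}" and d: "\<And>j. \<bar>x j - y j\<bar> \<le> d"
    have "0 \<le> d" using d[of 0] by linarith
    have "exp (F l v x) \<le> exp C" "F l v x \<le> C" "F l v y \<le> C" using C(2)[OF l, of v] by (auto simp: abs_le_iff)
    moreover have "\<bar>exp (F l v x) - exp (F l v y)\<bar> \<le> exp C * \<bar>F l v x - F l v y\<bar>"
      using exp_lip[of "F l v x" "F l v y"] exp_lip[of "F l v y" "F l v x"] calculation
      by (auto simp: abs_minus_commute abs_le_iff)
    moreover have "exp C * \<bar>F l v x - F l v y\<bar> \<le> exp C * (C * d)"
      by (intro mult_left_mono C(3) l d) auto
    moreover have "0 \<le> exp C * d" "0 \<le> exp C * C" using \<open>0 \<le> d\<close> C by auto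
    moreover have "exp C * (C + 1) = exp C * C + exp C" "exp C * (C + 1) * d = exp C * (C * d) + exp C * d"
      by (simp_all add: algebra_simps)
    ultimately show "\<bar>exp (F l v x)\<bar> \<le> exp C * (C + 1) \<and> \<bar>exp (F l v x) - exp (F l v y)\<bar> \<le> exp C * (C + 1) * d"
      unfolding abs_exp_cancel by linarith
  qed (use C in auto)
qed

lemma bounded_lipschitz_power: "bounded_lipschitz F \<Longrightarrow> bounded_lipschitz (\<lambda>l v x. F l v x ^ k)"
  by (induction k) (auto intro: bounded_lipschitz_const bounded_lipschitz_mult)

lemmas bounded_lipschitz_intros = bounded_lipschitz_const bounded_lipschitz_clamp bounded_lipschitz_add bounded_lipschitz_mult bounded_lipschitz_exp bounded_lipschitz_power

lemma tt_bound:
  assumes "0 \<le> W" "W < 1" "\<bar>v\<bar> \<le> W"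
  shows "\<bar>tt v\<bar> \<le> 2 / (1 - W)" and "\<bar>1 / (1 + v)\<bar> \<le> 1 / (1 - W)"
proof -
  have p: "1 + v > 0" "1 - v \<ge> 0" "1 - v \<le> 2" "1 - W > 0" "1 + v \<ge> 1 - W" using assms by auto
  show "\<bar>1 / (1 + v)\<bar> \<le> 1 / (1 - W)" using p by (simp add: frac_le)
  have "(1 - v) / (1 + v) \<le> 2 / (1 - W)" using p by (intro frac_le) auto
  then show "\<bar>tt v\<bar> \<le> 2 / (1 - W)" unfolding tt_def using p by simp
qed

text \<open>The components \<open>X m 0, \<dots>, X m 3\<close> are \<open>h, p, G, \<eta> q\<close> for the equations with all unknowns clamped to
  \<open>[-N, N]\<close>; a small \<open>\<eta>\<close> makes the integral operator a contraction.\<close>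

theorem cutoff_family:
  fixes n :: nat and s W N :: real
  assumes n: "n \<ge> 2" and W: "0 < W" "W < 1" and N: "N > 0"
  obtains X :: "real \<Rightarrow> nat \<Rightarrow> real \<Rightarrow> real" and \<Lambda> \<eta> :: real where "\<eta> > 0" "\<eta> \<le> 1"
    "\<And>m j. continuous_on UNIV (X m j)"
    "\<And>m m' i w. \<bar>X m i w - X m' i w\<bar> \<le> \<bar>m - m'\<bar> * (2 * exp (\<Lambda> * \<bar>w\<bar>))"
    "\<And>m. X m 0 0 = 0" "\<And>m. X m 2 0 = m" "\<And>j w. X 0 j w = 0" "\<And>m j w. j \<ge> 4 \<Longrightarrow> X m j w = 0"
    "\<And>m a b. -W \<le> a \<Longrightarrow> a < 0 \<Longrightarrow> 0 < b \<Longrightarrow> b \<le> W \<Longrightarrow>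
        (\<And>j w. w \<in> {a<..<b} \<Longrightarrow> \<bar>X m j w\<bar> \<le> N) \<Longrightarrow>
        profile n s a b (X m 0) (X m 1) (X m 2) (\<lambda>w. X m 3 w / \<eta>)"
    "\<And>a b h p G q R w. profile n s a b h p G q \<Longrightarrow> R < b \<Longrightarrow> R \<le> W \<Longrightarrow> h 0 = 0 \<Longrightarrow>
        (\<And>v. v \<in> {0..R} \<Longrightarrow> \<bar>h v\<bar> \<le> N \<and> \<bar>p v\<bar> \<le> N \<and> \<bar>G v\<bar> \<le> N \<and> \<bar>q v\<bar> \<le> N) \<Longrightarrow> w \<in> {0..R} \<Longrightarrow>
        h w = X (G 0) 0 w \<and> p w = X (G 0) 1 w \<and> G w = X (G 0) 2 w \<and> q w = X (G 0) 3 w / \<eta>"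
proof -
  \<comment> \<open>The argument is clamped as well; this keeps \<open>1 + v\<close> away from
    \<open>0\<close>, where \<open>tt\<close> and the source of \<open>q\<close> are
    singular.\<close>
  let ?c = "clampr W" and ?N = "clampr N"
  have cW: "\<bar>?c v\<bar> \<le> W" for v using clampr_abs[of W v] W by simp
  have c1: "1 + ?c v > 0" for v using cW[of v] W by linarith
  \<comment> \<open>The part of \<open>src_q\<close> without a factor \<open>w\<close>. It involves
    \<open>p\<close> and \<open>G\<close> but not \<open>q\<close>, so working with
    \<open>\<eta> q\<close> instead of \<open>q\<close> multiplies its Lipschitz constant by
    \<open>\<eta>\<close>; the factors \<open>1 / \<eta>\<close> caused elsewhere sit in terms that
    do carry \<open>w\<close>.\<close>
  define gg where "gg = (\<lambda>(l::real) v (x::nat \<Rightarrow> real).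
      l ^ n * (s\<^sup>2 * n * ?N (x 2) * (2 * n * (1 / (1 + ?c v)) + 2 * tt (?c v) * ?N (x 1))))"
  have bounded_lipschitz_l: "bounded_lipschitz (\<lambda>l v x. l ^ j)" for j
    by (rule bounded_lipschitz_coeff[of _ 1]) (auto simp: power_le_one abs_le_iff intro: order_trans[of _ 0])
  have bounded_lipschitz_1: "bounded_lipschitz (\<lambda>l v x. l)"
    by (rule bounded_lipschitz_coeff[of _ 1]) auto
  have bounded_lipschitz_c: "bounded_lipschitz (\<lambda>l v x. ?c v)"
    by (rule bounded_lipschitz_coeff[of _ W]) (rule cW)
  have bounded_lipschitz_t: "bounded_lipschitz (\<lambda>l v x. tt (?c v))"
    by (rule bounded_lipschitz_coeff[of _ "2 / (1 - W)"]) (use tt_bound[of W] W cW in auto)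
  have bounded_lipschitz_i: "bounded_lipschitz (\<lambda>l v x. 1 / (1 + ?c v))"
    by (rule bounded_lipschitz_coeff, rule tt_bound(2)[of W]) (use W cW in auto)
  have "bounded_lipschitz gg"
    unfolding gg_def by (intro bounded_lipschitz_intros bounded_lipschitz_l bounded_lipschitz_1 bounded_lipschitz_c bounded_lipschitz_t bounded_lipschitz_i)
  then obtain K where K: "K \<ge> 0" "\<And>l v x. l \<in> {0..1} \<Longrightarrow> \<bar>gg l v x\<bar> \<le> K"
    "\<And>l v x y d. l \<in> {0..1} \<Longrightarrow> (\<And>j. \<bar>x j - y j\<bar> \<le> d) \<Longrightarrow> \<bar>gg l v x - gg l v y\<bar> \<le> K * d"
    using bounded_lipschitz_E by metis
  define \<eta> where "\<eta> = 1 / (4 * (K + 1))"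
  have \<eta>1: "\<eta> \<le> 1" using K(1) unfolding \<eta>_def by (auto simp: field_simps)
  have \<eta>: "\<eta> > 0" "\<eta> * K \<le> 1 / 4" using K(1) unfolding \<eta>_def by (auto simp: field_simps)
  define f0 where "f0 = (\<lambda>(l::real) (v::real) (x::nat \<Rightarrow> real). ?N (x 1))"
  \<comment> \<open>As \<open>n \<ge> 2\<close>, one factor \<open>l * w\<close> can be split off
    \<open>(l * w) ^ (n - 1)\<close>; it supplies the \<open>w\<close> expected of an
    \<open>f\<close> term.\<close>
  define f1 where "f1 = (\<lambda>(l::real) v (x::nat \<Rightarrow> real). (-1) * l * (?c v ^ (n - 2) * exp ((- 2) * ?N (x 0)) *
      ((?c v * (?N (x 3) * (1 / \<eta>))) ^ 2 + 2 * s\<^sup>2 * n * tt (?c v) * ?N (x 2) * (?c v * (?N (x 3) * (1 / \<eta>))) + (n * s * ?N (x 2)) ^ 2)))"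
  define f2 where "f2 = (\<lambda>(l::real) (v::real) (x::nat \<Rightarrow> real). ?N (x 3) * (1 / \<eta>))"
  define f3 where "f3 = (\<lambda>(l::real) (v::real) (x::nat \<Rightarrow> real). l ^ (n + 1) * (2 * ?N (x 3) * ?N (x 1)))"
  have bl0: "bounded_lipschitz f0" and bl1: "bounded_lipschitz f1"
    and bl2: "bounded_lipschitz f2" and bl3: "bounded_lipschitz f3"
    unfolding f0_def f1_def f2_def f3_def by (intro bounded_lipschitz_intros bounded_lipschitz_l bounded_lipschitz_1 bounded_lipschitz_c bounded_lipschitz_t bounded_lipschitz_i)+
  define f where "f i = (if i = 0 then f0 else if i = 1 then f1 else if i = 2 then f2 else if i = 3 then f3
      else (\<lambda>l v x. 0))" for i :: nat
  define g where "g i = (if i = 3 then (\<lambda>l v x. \<eta> * gg l v x) else (\<lambda>l v x. 0))" for i :: nat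
  obtain C0 where C0: "C0 \<ge> 0" "\<And>l v x. l \<in> {0..1} \<Longrightarrow> \<bar>f0 l v x\<bar> \<le> C0"
    "\<And>l v x y d. l \<in> {0..1} \<Longrightarrow> (\<And>j. \<bar>x j - y j\<bar> \<le> d) \<Longrightarrow> \<bar>f0 l v x - f0 l v y\<bar> \<le> C0 * d"
    using bounded_lipschitz_E[OF bl0] by metis
  obtain C1 where C1: "C1 \<ge> 0" "\<And>l v x. l \<in> {0..1} \<Longrightarrow> \<bar>f1 l v x\<bar> \<le> C1"
    "\<And>l v x y d. l \<in> {0..1} \<Longrightarrow> (\<And>j. \<bar>x j - y j\<bar> \<le> d) \<Longrightarrow> \<bar>f1 l v x - f1 l v y\<bar> \<le> C1 * d"
    using bounded_lipschitz_E[OF bl1] by metis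
  obtain C2 where C2: "C2 \<ge> 0" "\<And>l v x. l \<in> {0..1} \<Longrightarrow> \<bar>f2 l v x\<bar> \<le> C2"
    "\<And>l v x y d. l \<in> {0..1} \<Longrightarrow> (\<And>j. \<bar>x j - y j\<bar> \<le> d) \<Longrightarrow> \<bar>f2 l v x - f2 l v y\<bar> \<le> C2 * d"
    using bounded_lipschitz_E[OF bl2] by metis
  obtain C3 where C3: "C3 \<ge> 0" "\<And>l v x. l \<in> {0..1} \<Longrightarrow> \<bar>f3 l v x\<bar> \<le> C3"
    "\<And>l v x y d. l \<in> {0..1} \<Longrightarrow> (\<And>j. \<bar>x j - y j\<bar> \<le> d) \<Longrightarrow> \<bar>f3 l v x - f3 l v y\<bar> \<le> C3 * d"
    using bounded_lipschitz_E[OF bl3] by metis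
  define C where "C = C0 + C1 + C2 + C3 + 1"
  have Cle: "C0 \<le> C" "C1 \<le> C" "C2 \<le> C" "C3 \<le> C" "1 \<le> C" "C > 0"
    unfolding C_def using C0(1) C1(1) C2(1) C3(1) by auto
  have f_cont: "continuous_on (UNIV \<times> {0..1}) (\<lambda>(w, l). f i l (l * w) (\<lambda>j. x j (l * w)))"
    and g_cont: "continuous_on (UNIV \<times> {0..1}) (\<lambda>(w, l). g i l (l * w) (\<lambda>j. x j (l * w)))"
    if x: "\<And>j. continuous_on UNIV (x j)" for x :: "nat \<Rightarrow> real \<Rightarrow> real" and i
  proof -
    have x': "continuous_on S (\<lambda>z. x j (snd z * fst z))" for j and S :: "(real \<times> real) set"
      by (rule continuous_on_compose2[OF x]) (auto intro!: continuous_intros)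
    show "continuous_on (UNIV \<times> {0..1}) (\<lambda>(w, l). f i l (l * w) (\<lambda>j. x j (l * w)))"
      unfolding f_def f0_def f1_def f2_def f3_def tt_def case_prod_beta'
      using c1 \<eta>(1) by (auto intro!: continuous_intros x' simp: less_imp_neq[symmetric] simp del: mult_minus_left)
    show "continuous_on (UNIV \<times> {0..1}) (\<lambda>(w, l). g i l (l * w) (\<lambda>j. x j (l * w)))"
      unfolding g_def gg_def tt_def case_prod_beta'
      using c1 \<eta>(1) by (auto intro!: continuous_intros x' simp: less_imp_neq[symmetric])
  qed
  interpret volterra f g C
  proof
    fix i :: nat and l v :: real and x y :: "nat \<Rightarrow> real" and d :: real assume l: "l \<in> {0..1}"
    show "\<bar>f i l v x\<bar> \<le> C"
      unfolding f_def using C0(2)[OF l, of v x] C1(2)[OF l, of v x] C2(2)[OF l, of v x] C3(2)[OF l, of v x] Cle by auto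
    have "\<bar>\<eta> * gg l v x\<bar> \<le> \<eta> * K" unfolding abs_mult using K(2)[OF l, of v x] \<eta>(1) by simp
    then show "\<bar>g i l v x\<bar> \<le> C" unfolding g_def using \<eta> Cle by auto
    assume d: "\<And>j. \<bar>x j - y j\<bar> \<le> d"
    then have d0: "0 \<le> d" using abs_ge_zero[of "x 0 - y 0"] order_trans by blast
    have "B * d \<le> C * d" if "B \<le> C" for B using that d0 by (rule mult_right_mono)
    note Cd = this[OF Cle(1)] this[OF Cle(2)] this[OF Cle(3)] this[OF Cle(4)]
    show "\<bar>f i l v x - f i l v y\<bar> \<le> C * d"
      unfolding f_def using C0(3)[OF l, of x y d v, OF d] C1(3)[OF l, of x y d v, OF d]
        C2(3)[OF l, of x y d v, OF d] C3(3)[OF l, of x y d v, OF d] Cd d0 Cle(6) by auto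
    have "\<bar>\<eta> * gg l v x - \<eta> * gg l v y\<bar> = \<eta> * \<bar>gg l v x - gg l v y\<bar>"
      using \<eta>(1) by (simp add: abs_mult flip: right_diff_distrib)
    also have "\<dots> \<le> \<eta> * (K * d)" using K(3)[OF l, of x y d v, OF d] \<eta>(1) by (intro mult_left_mono) auto
    also have "\<dots> \<le> 1 / 4 * d" unfolding mult.assoc[symmetric] by (rule mult_right_mono[OF \<eta>(2) d0])
    finally show "\<bar>g i l v x - g i l v y\<bar> \<le> d / 4" unfolding g_def using d0 by auto
  qed (use f_cont g_cont Cle in auto)
  obtain X \<Lambda> where X: "\<And>m j. continuous_on UNIV (X m j)"
    "\<And>m i w. X m i w = m * (if i = 2 then 1 else 0) + rhs (X m) i w"
    "\<And>m m' i w. \<bar>X m i w - X m' i w\<bar> \<le> \<bar>m - m'\<bar> * (2 * exp (\<Lambda> * \<bar>w\<bar>))"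
    "\<And>i w. (\<And>i w. rhs (\<lambda>_ _. 0) i w = 0) \<Longrightarrow> X 0 i w = 0"
    by (rule exists_solution_family[of "\<lambda>i. if i = 2 then 1 else 0"]) auto
  have N0: "?N 0 = 0" using N by (simp add: clampr_def)
  have X0: "X 0 j w = 0" for j w
    by (rule X(4)) (simp add: rhs_def f_def g_def f0_def f1_def f2_def f3_def gg_def N0)
  have isc: "isCont (X m j) w" for m j w
    using X(1)[of m j] by (simp add: continuous_on_eq_continuous_at)
  have prof: "profile n s a b (X m 0) (X m 1) (X m 2) (\<lambda>w. X m 3 w / \<eta>)"
    if ab: "-W \<le> a" "a < 0" "0 < b" "b \<le> W" and box: "\<And>j w. w \<in> {a<..<b} \<Longrightarrow> \<bar>X m j w\<bar> \<le> N" for m a b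
    unfolding profile_def
  proof (intro conjI ballI)
    show "- 1 \<le> a" "a < 0" "0 < b" "b \<le> 1" using ab W by auto
    fix w assume w: "w \<in> {a<..<b}"
    have lw: "l * w \<in> {a<..<b}" if "l \<in> {0..1}" for l
      using scale_mem[OF that w ab(2,3)] .
    have cid: "?c v = v" "?N (X m j v) = X m j v" if "v \<in> {a<..<b}" for v j
      using that ab box[OF that] by (auto intro!: clampr_id)
    show "isCont (X m 1) w" by (rule isc)
    show "isCont (\<lambda>w. X m 3 w / \<eta>) w" using isc \<eta>(1) by (intro continuous_intros) auto
    have "X m 0 = (\<lambda>w. w ^ Suc 0 * integral {0..1} (\<lambda>l. l ^ 0 * ?N (X m 1 (l * w))))"
      by (rule ext, subst X(2)) (simp add: rhs_def f_def g_def f0_def)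
    moreover have "((\<lambda>w. w ^ Suc 0 * integral {0..1} (\<lambda>l. l ^ 0 * ?N (X m 1 (l * w)))) has_real_derivative w ^ 0 * ?N (X m 1 w)) (at w)"
      by (rule average_has_derivative[OF _ w ab(2,3)]) (intro continuous_intros continuous_on_subset[OF X(1)], auto)
    ultimately show "(X m 0 has_real_derivative X m 1 w) (at w)" using cid[OF w] by simp
    have "X m 2 = (\<lambda>w. m + w ^ Suc 0 * integral {0..1} (\<lambda>l. l ^ 0 * (?N (X m 3 (l * w)) / \<eta>)))"
      by (rule ext, subst X(2)) (simp add: rhs_def f_def g_def f2_def)
    moreover have "((\<lambda>w. m + w ^ Suc 0 * integral {0..1} (\<lambda>l. l ^ 0 * (?N (X m 3 (l * w)) / \<eta>))) has_real_derivative 0 + w ^ 0 * (?N (X m 3 w) / \<eta>)) (at w)"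
      by (intro DERIV_add DERIV_const average_has_derivative[OF _ w ab(2,3)])
        (use \<eta>(1) in \<open>auto intro!: continuous_intros continuous_on_subset[OF X(1)]\<close>)
    ultimately show "(X m 2 has_real_derivative X m 3 w / \<eta>) (at w)" using cid[OF w] by simp
    have n1: "n - Suc 0 = Suc (n - 2)" using n by simp
    have "X m 1 w = integral {0..1} (\<lambda>l. w * f1 l (l * w) (\<lambda>j. X m j (l * w)))"
      by (subst X(2)) (simp add: rhs_def f_def g_def)
    also have "\<dots> = integral {0..1} (\<lambda>l. src_p n s (X m 0) (X m 2) (\<lambda>w. X m 3 w / \<eta>) (l * w))"
      by (rule Henstock_Kurzweil_Integration.integral_cong)
        (simp add: f1_def src_p_def cid[OF lw] n1 algebra_simps)
    finally show "X m 1 w = integral {0..1} (\<lambda>l. src_p n s (X m 0) (X m 2) (\<lambda>w. X m 3 w / \<eta>) (l * w))" .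
    have "X m 3 w / \<eta> = integral {0..1} (\<lambda>l. (w * f3 l (l * w) (\<lambda>j. X m j (l * w)) + \<eta> * gg l (l * w) (\<lambda>j. X m j (l * w)))) * (1 / \<eta>)"
      by (subst X(2)) (simp add: rhs_def f_def g_def)
    also have "\<dots> = integral {0..1} (\<lambda>l. (w * f3 l (l * w) (\<lambda>j. X m j (l * w)) + \<eta> * gg l (l * w) (\<lambda>j. X m j (l * w))) * (1 / \<eta>))"
      by (rule integral_mult_left[symmetric])
    also have "\<dots> = integral {0..1} (\<lambda>l. l ^ n * src_q n s (X m 1) (X m 2) (\<lambda>w. X m 3 w / \<eta>) (l * w))"
      by (rule Henstock_Kurzweil_Integration.integral_cong)
        (use \<eta>(1) in \<open>simp add: f3_def gg_def src_q_def cid[OF lw] field_simps\<close>)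
    finally show "X m 3 w / \<eta> = integral {0..1} (\<lambda>l. l ^ n * src_q n s (X m 1) (X m 2) (\<lambda>w. X m 3 w / \<eta>) (l * w))" .
  qed
  have n1: "n - Suc 0 = Suc (n - 2)" using n by simp
  have uniq: "h w = X (G 0) 0 w \<and> p w = X (G 0) 1 w \<and> G w = X (G 0) 2 w \<and> q w = X (G 0) 3 w / \<eta>"
    if prof: "profile n s a b h p G q" and R: "R < b" "R \<le> W" and h0: "h 0 = 0"
      and box: "\<And>v. v \<in> {0..R} \<Longrightarrow> \<bar>h v\<bar> \<le> N \<and> \<bar>p v\<bar> \<le> N \<and> \<bar>G v\<bar> \<le> N \<and> \<bar>q v\<bar> \<le> N"
      and w: "w \<in> {0..R}" for a b h p G q R w
  proof -
    \<comment> \<open>The given profile, with \<open>q\<close> rescaled by \<open>\<eta>\<close> and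
      padded by zeros, solves the truncated system on \<open>[0, R]\<close>, where all truncations
      act trivially.\<close>
    define Y where "Y j = (if j = 0 then h else if j = 1 then p else if j = 2 then G else if j = 3 then (\<lambda>v. \<eta> * q v) else (\<lambda>v. 0))"
      for j :: nat
    have R0: "0 \<le> R" using w by simp
    have ab: "a < 0" "0 < b" using prof unfolding profile_def by auto
    have inab: "v \<in> {a<..<b}" if "v \<in> {0..R}" for v using that R ab by auto
    have pr: "isCont p v" "isCont q v" "(h has_real_derivative p v) (at v)" "(G has_real_derivative q v) (at v)"
      "p v = integral {0..1} (\<lambda>l. src_p n s h G q (l * v))"
      "q v = integral {0..1} (\<lambda>l. l ^ n * src_q n s p G q (l * v))" if "v \<in> {0..R}" for v
      using prof inab[OF that] unfolding profile_def by blast+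
    have Ybox: "\<bar>Y j v\<bar> \<le> N" if v: "v \<in> {0..R}" for j v
    proof -
      have "\<bar>\<eta> * q v\<bar> \<le> 1 * N" unfolding abs_mult using \<eta> \<eta>1 box[OF v] by (intro mult_mono) auto
      then show ?thesis unfolding Y_def using box[OF v] N by auto
    qed
    have lv: "l * v \<in> {0..R}" if "l \<in> {0..1}" "v \<in> {0..R}" for l v
      using that mult_mono[of l 1 v v] by auto
    have Ycont: "continuous_on {0..R} (Y j)" for j
    proof -
      have "continuous_on {0..R} h" "continuous_on {0..R} p" "continuous_on {0..R} G" "continuous_on {0..R} q"
        using pr DERIV_isCont by (blast intro: continuous_at_imp_continuous_on)+
      then show ?thesis unfolding Y_def by (auto intro!: continuous_intros)
    qed
    have cid: "?c v = v" "?N (Y j v) = Y j v" if "v \<in> {0..R}" for v j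
      using that R W Ybox[OF that] by (auto intro!: clampr_id)
    have ftc: "v * integral {0..1} (\<lambda>l. F' (l * v)) = F v - F 0"
      if F: "\<And>u. u \<in> {0..R} \<Longrightarrow> (F has_real_derivative F' u) (at u)" and v: "v \<in> {0..R}" for F F' v
    proof -
      have "((\<lambda>l. v * F' (l * v)) has_integral F (1 * v) - F (0 * v)) {0..1}"
      proof (rule fundamental_theorem_of_calculus)
        fix l :: real assume l: "l \<in> {0..1}"
        have "((\<lambda>l. F (l * v)) has_real_derivative F' (l * v) * v) (at l)"
          by (rule DERIV_chain2[where f = F and g = "\<lambda>l. l * v", OF F[OF lv[OF l v]]]) (auto intro!: derivative_eq_intros)
        then show "((\<lambda>l. F (l * v)) has_vector_derivative v * F' (l * v)) (at l within {0..1})"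
          by (simp add: has_real_derivative_iff_has_vector_derivative has_vector_derivative_at_within mult.commute)
      qed simp
      from integral_unique[OF this] show ?thesis by simp
    qed
    have Yeq: "Y i v = (G 0 * (if i = 2 then 1 else 0)) + rhs Y i v" if v: "v \<in> {0..R}" for i v
    proof -
      consider "i = 0" | "i = 1" | "i = 2" | "i = 3" | "i \<ge> 4" by linarith
      then show ?thesis
      proof cases
        case 1
        have "rhs Y 0 v = integral {0..1} (\<lambda>l. v * p (l * v))"
          unfolding rhs_def by (rule Henstock_Kurzweil_Integration.integral_cong)
            (use v in \<open>simp add: f_def g_def f0_def cid[OF lv], simp add: Y_def\<close>)
        then show ?thesis using ftc[OF pr(3) v] h0 1 by (simp add: Y_def)
      next
        case 2
        have "rhs Y 1 v = integral {0..1} (\<lambda>l. src_p n s h G q (l * v))"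
          unfolding rhs_def by (rule Henstock_Kurzweil_Integration.integral_cong)
            (use v \<eta>(1) in \<open>simp add: f_def g_def f1_def src_p_def cid[OF lv] n1, simp add: Y_def algebra_simps\<close>)
        then show ?thesis using pr(5)[OF v] 2 by (simp add: Y_def)
      next
        case 3
        have "rhs Y 2 v = integral {0..1} (\<lambda>l. v * q (l * v))"
          unfolding rhs_def by (rule Henstock_Kurzweil_Integration.integral_cong)
            (use v \<eta>(1) in \<open>simp add: f_def g_def f2_def cid[OF lv], simp add: Y_def\<close>)
        then show ?thesis using ftc[OF pr(4) v] 3 by (simp add: Y_def)
      next
        case 4
        have "rhs Y 3 v = integral {0..1} (\<lambda>l. \<eta> * (l ^ n * src_q n s p G q (l * v)))"
          unfolding rhs_def by (rule Henstock_Kurzweil_Integration.integral_cong)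
            (use v \<eta>(1) in \<open>simp add: f_def g_def f3_def gg_def src_q_def cid[OF lv], simp add: Y_def algebra_simps\<close>)
        then show ?thesis using pr(6)[OF v] 4 by (simp add: Y_def)
      next
        case 5
        then show ?thesis by (simp add: Y_def rhs_def f_def g_def)
      qed
    qed
    \<comment> \<open>\<open>solution_unique_on\<close> asks for one bound on all components; those
      of index at least \<open>4\<close> vanish, so a sum of four suffices.\<close>
    define S where "S v = \<bar>X (G 0) 0 v\<bar> + \<bar>X (G 0) 1 v\<bar> + \<bar>X (G 0) 2 v\<bar> + \<bar>X (G 0) 3 v\<bar>" for v
    have "continuous_on {0..R} S" unfolding S_def
      by (intro continuous_intros continuous_on_subset[OF X(1)]) auto
    then have "\<exists>v'\<in>{0..R}. \<forall>v\<in>{0..R}. S v \<le> S v'"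
      using continuous_attains_sup[of "{0..R}" S] R0 by auto
    then obtain v' where v': "\<And>v. v \<in> {0..R} \<Longrightarrow> S v \<le> S v'" by blast
    have Xz: "X m j v = 0" if "j \<ge> 4" for m j v
      using that by (subst X(2)) (simp add: rhs_def f_def g_def)
    have XB: "\<bar>X (G 0) j v\<bar> \<le> S v'" if v: "v \<in> {0..R}" for j v
    proof -
      have "j = 0 \<or> j = 1 \<or> j = 2 \<or> j = 3 \<or> j \<ge> 4" by linarith
      moreover have "0 \<le> S v" unfolding S_def by simp
      ultimately have "\<bar>X (G 0) j v\<bar> \<le> S v" using Xz[of j "G 0" v] unfolding S_def by auto
      then show ?thesis using v'[OF v] by linarith
    qed
    have eq: "Y i w = X (G 0) i w" for i
    proof (rule solution_unique_on[where R = R and x = Y and y = "X (G 0)" and c = "\<lambda>i. G 0 * (if i = 2 then 1 else 0)" and d = "N + S v'"])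
      show "continuous_on {0..R} (X (G 0) j)" for j
        by (rule continuous_on_subset[OF X(1)]) simp
      show "\<bar>Y j v - X (G 0) j v\<bar> \<le> N + S v'" if "v \<in> {0..R}" for j v
        by (rule order_trans[OF abs_triangle_ineq4]) (intro add_mono Ybox XB that)
      show "X (G 0) i v = G 0 * (if i = 2 then 1 else 0) + rhs (X (G 0)) i v" for i v by (rule X(2))
    qed (use Ycont Yeq w in auto)
    show ?thesis using eq[of 0] eq[of 1] eq[of 2] eq[of 3] \<eta>(1)
      by (simp add: Y_def eq_divide_eq mult.commute)
  qed
  show ?thesis
  proof (rule that[of \<eta> X \<Lambda>])
    show "X m j w = 0" if "j \<ge> 4" for m j w
      using that by (subst X(2)) (simp add: rhs_def f_def g_def)
    show "X m 0 0 = 0" for m by (subst X(2)) (simp add: rhs_def f_def g_def)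
    show "X m 2 0 = m" for m by (subst X(2)) (simp add: rhs_def f_def g_def)
  qed (use \<eta> \<eta>1 X X0 prof uniq in auto)
qed

subsection \<open>A priori bounds\<close>

lemma abs_diff_le_of_deriv:
  fixes f g :: "real \<Rightarrow> real"
  assumes "u \<le> v" and f: "continuous_on {u..v} f" and g: "continuous_on {u..v} g"
    and f': "\<And>x. u < x \<Longrightarrow> x < v \<Longrightarrow> (f has_real_derivative f' x) (at x)"
    and g': "\<And>x. u < x \<Longrightarrow> x < v \<Longrightarrow> (g has_real_derivative g' x) (at x)"
    and le: "\<And>x. u < x \<Longrightarrow> x < v \<Longrightarrow> \<bar>f' x\<bar> \<le> g' x"
  shows "\<bar>f v - f u\<bar> \<le> g v - g u"
proof -
  have "(\<lambda>x. g x - f x) u \<le> (\<lambda>x. g x - f x) v"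
  proof (rule DERIV_nonneg_imp_increasing_open[OF \<open>u \<le> v\<close>])
    show "\<exists>y. ((\<lambda>x. g x - f x) has_real_derivative y) (at x) \<and> 0 \<le> y" if "u < x" "x < v" for x
      using f'[OF that] g'[OF that] le[OF that] by (intro exI[of _ "g' x - f' x"]) (auto intro!: derivative_eq_intros)
  qed (intro continuous_intros f g)
  moreover have "(\<lambda>x. g x + f x) u \<le> (\<lambda>x. g x + f x) v"
  proof (rule DERIV_nonneg_imp_increasing_open[OF \<open>u \<le> v\<close>])
    show "\<exists>y. ((\<lambda>x. g x + f x) has_real_derivative y) (at x) \<and> 0 \<le> y" if "u < x" "x < v" for x
      using f'[OF that] g'[OF that] le[OF that] by (intro exI[of _ "g' x + f' x"]) (auto intro!: derivative_eq_intros)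
  qed (intro continuous_intros f g)
  ultimately show ?thesis by auto
qed

lemma diff_le_of_deriv:
  fixes f g :: "real \<Rightarrow> real"
  assumes "u \<le> v" and f: "continuous_on {u..v} f" and g: "continuous_on {u..v} g"
    and f': "\<And>x. u < x \<Longrightarrow> x < v \<Longrightarrow> (f has_real_derivative f' x) (at x)"
    and g': "\<And>x. u < x \<Longrightarrow> x < v \<Longrightarrow> (g has_real_derivative g' x) (at x)"
    and le: "\<And>x. u < x \<Longrightarrow> x < v \<Longrightarrow> f' x \<le> g' x"
  shows "f v - f u \<le> g v - g u"
proof -
  have "(\<lambda>x. g x - f x) u \<le> (\<lambda>x. g x - f x) v"
  proof (rule DERIV_nonneg_imp_increasing_open[OF \<open>u \<le> v\<close>])
    show "\<exists>y. ((\<lambda>x. g x - f x) has_real_derivative y) (at x) \<and> 0 \<le> y" if "u < x" "x < v" for x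
      using f'[OF that] g'[OF that] le[OF that] by (intro exI[of _ "g' x - f' x"]) (auto intro!: derivative_eq_intros)
  qed (intro continuous_intros f g)
  then show ?thesis by simp
qed

text \<open>The quadratic form driving \<open>h\<close>: with \<open>g = G\<close> and
  \<open>Q = w q\<close> it is \<open>src_p\<close> divided by
  \<open>- w ^ (n - 1) * exp (- 2 h)\<close>.\<close>

definition pot :: "nat \<Rightarrow> real \<Rightarrow> real \<Rightarrow> real \<Rightarrow> real \<Rightarrow> real" where
  "pot n s T g Q = Q\<^sup>2 + 2 * s\<^sup>2 * n * T * g * Q + (n * s * g)\<^sup>2"

text \<open>With \<open>A = n s g\<close> the form is
  \<open>(Q + s T A)^2 + (1 - s^2 T^2) A^2\<close>, and \<open>|s T| \<le> 1/2\<close>.\<close>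

lemma pot_bounds:
  assumes "0 < s" "s \<le> 1/2" "0 \<le> T" "T \<le> 1"
  shows "pot n s T g Q \<ge> 3/4 * (n * s * g)\<^sup>2" and "pot n s T g Q \<ge> 0"
    and "pot n s T g Q \<le> 2 * (Q\<^sup>2 + (n * s * g)\<^sup>2)"
proof -
  have sT: "0 \<le> s * T" "s * T \<le> 1/2" using assms mult_mono[of s "1/2" T 1] by auto
  define A where "A = n * s * g"
  have eq: "pot n s T g Q = Q\<^sup>2 + 2 * (s * T) * A * Q + A\<^sup>2"
    unfolding pot_def A_def by (simp add: power2_eq_square algebra_simps)
  have "(s * T)\<^sup>2 \<le> (1/2)\<^sup>2" by (intro power_mono sT)
  then have "(s * T)\<^sup>2 * A\<^sup>2 \<le> 1/4 * A\<^sup>2" by (intro mult_right_mono) (auto simp: power2_eq_square)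
  moreover have "pot n s T g Q = (Q + s * T * A)\<^sup>2 + A\<^sup>2 - (s * T)\<^sup>2 * A\<^sup>2"
    unfolding eq by (simp add: power2_eq_square algebra_simps)
  ultimately show 1: "pot n s T g Q \<ge> 3/4 * (n * s * g)\<^sup>2" unfolding A_def[symmetric] 
    using zero_le_power2[of "Q + s * T * A"] by linarith
  then show "pot n s T g Q \<ge> 0" using zero_le_power2[of "n * s * g"] by linarith
  have "2 * A * Q \<le> A\<^sup>2 + Q\<^sup>2" using zero_le_power2[of "A - Q"] by (simp add: power2_eq_square algebra_simps)
  then have "(s * T) * (2 * A * Q) \<le> (s * T) * (A\<^sup>2 + Q\<^sup>2)" by (intro mult_left_mono sT)
  also have "\<dots> \<le> 1/2 * (A\<^sup>2 + Q\<^sup>2)" using sT by (intro mult_right_mono) auto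
  finally show "pot n s T g Q \<le> 2 * (Q\<^sup>2 + (n * s * g)\<^sup>2)"
    unfolding eq A_def[symmetric] using zero_le_power2[of A] zero_le_power2[of Q]
    by (simp only: distrib_left mult_ac)
qed

section \<open>Monotone quantities and estimates near the center\<close>

locale knot_profile =
  fixes n :: nat and s a b :: real and h p G q :: "real \<Rightarrow> real"
  assumes prof: "profile n s a b h p G q" and n2: "n \<ge> 2" and s: "0 < s" "s \<le> 1/2"
begin

lemma ab: "-1 \<le> a" "a < 0" "0 < b" "b \<le> 1"
  using prof unfolding profile_def by auto

lemma s2: "s\<^sup>2 \<le> 1/4"
  using s power_mono[of s "1/2" 2] by (simp add: power2_eq_square)

lemma deriv_h: "w \<in> {a<..<b} \<Longrightarrow> (h has_real_derivative p w) (at w)"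
  and deriv_G: "w \<in> {a<..<b} \<Longrightarrow> (G has_real_derivative q w) (at w)"
  and cont_p: "w \<in> {a<..<b} \<Longrightarrow> isCont p w"
  and cont_q: "w \<in> {a<..<b} \<Longrightarrow> isCont q w"
  and p_eq: "w \<in> {a<..<b} \<Longrightarrow> p w = integral {0..1} (\<lambda>l. src_p n s h G q (l * w))"
  and q_eq: "w \<in> {a<..<b} \<Longrightarrow> q w = integral {0..1} (\<lambda>l. l ^ n * src_q n s p G q (l * w))"
  using prof unfolding profile_def by blast+

lemma cont_on: "S \<subseteq> {a<..<b} \<Longrightarrow> continuous_on S h" "S \<subseteq> {a<..<b} \<Longrightarrow> continuous_on S G"
  "S \<subseteq> {a<..<b} \<Longrightarrow> continuous_on S p" "S \<subseteq> {a<..<b} \<Longrightarrow> continuous_on S q"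
  by (rule continuous_at_imp_continuous_on; use deriv_h deriv_G cont_p cont_q DERIV_isCont in blast)+

lemma cont_tt: "S \<subseteq> {a<..<b} \<Longrightarrow> continuous_on S tt"
  unfolding tt_def[abs_def] using ab by (intro continuous_intros) auto

lemma cont_src: "continuous_on {a<..<b} (src_p n s h G q)" "continuous_on {a<..<b} (src_q n s p G q)"
  unfolding src_p_def[abs_def] src_q_def[abs_def]
  by (intro continuous_intros cont_on cont_tt order_refl; use ab in force)+

lemma deriv_P: "w \<in> {a<..<b} \<Longrightarrow> ((\<lambda>w. w * p w) has_real_derivative src_p n s h G q w) (at w)"
proof -
  assume w: "w \<in> {a<..<b}"
  have "((\<lambda>w. w ^ Suc 0 * integral {0..1} (\<lambda>l. l ^ 0 * src_p n s h G q (l * w))) has_real_derivative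
      w ^ 0 * src_p n s h G q w) (at w)"
    by (rule average_has_derivative[OF cont_src(1) w ab(2,3)])
  then have "((\<lambda>w. w * integral {0..1} (\<lambda>l. src_p n s h G q (l * w))) has_real_derivative src_p n s h G q w) (at w)"
    by simp
  then show ?thesis
    by (rule has_field_derivative_transform_within_open[of _ _ _ "{a<..<b}"]) (use w p_eq in auto)
qed

lemma deriv_Q: "w \<in> {a<..<b} \<Longrightarrow> ((\<lambda>w. w ^ Suc n * q w) has_real_derivative w ^ n * src_q n s p G q w) (at w)"
proof -
  assume w: "w \<in> {a<..<b}"
  have "((\<lambda>w. w ^ Suc n * integral {0..1} (\<lambda>l. l ^ n * src_q n s p G q (l * w))) has_real_derivative
      w ^ n * src_q n s p G q w) (at w)"
    by (rule average_has_derivative[OF cont_src(2) w ab(2,3)])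
  then show ?thesis
    by (rule has_field_derivative_transform_within_open[of _ _ _ "{a<..<b}"]) (use w q_eq in auto)
qed

lemma src_p_pot: "src_p n s h G q w = - (w ^ (n - 1) * exp (- 2 * h w) * pot n s (tt w) (G w) (w * q w))"
  unfolding src_p_def pot_def by simp

lemma tt_range: "0 \<le> w \<Longrightarrow> w < b \<Longrightarrow> 0 \<le> tt w \<and> tt w \<le> 1"
  unfolding tt_def using ab by auto

lemma in_ab: "0 \<le> w \<Longrightarrow> w < b \<Longrightarrow> w \<in> {a<..<b}"
  using ab by auto

lemma src_p_nonpos: "0 \<le> w \<Longrightarrow> w < b \<Longrightarrow> src_p n s h G q w \<le> 0"
  unfolding src_p_pot using pot_bounds(2)[OF s] tt_range by simp

text \<open>The derivative of \<open>w p\<close> is \<open>src_p\<close>, which is minus a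
  nonnegative form.\<close>

lemma P_antimono: "0 \<le> u \<Longrightarrow> u \<le> v \<Longrightarrow> v < b \<Longrightarrow> v * p v \<le> u * p u"
  using DERIV_nonpos_imp_nonincreasing[of u v "\<lambda>w. w * p w"] deriv_P[OF in_ab] src_p_nonpos
  by (meson order_trans order_le_less_trans)

lemma P_nonpos: "0 \<le> w \<Longrightarrow> w < b \<Longrightarrow> w * p w \<le> 0"
  using P_antimono[of 0 w] by simp

lemma p0: "p 0 = 0"
  using p_eq[of 0] ab n2 by (simp add: src_p_def)

lemma p_nonpos: "0 \<le> w \<Longrightarrow> w < b \<Longrightarrow> p w \<le> 0"
  using P_nonpos[of w] p0 by (cases "w = 0") (auto simp: mult_le_0_iff)

lemma h_antimono: "0 \<le> u \<Longrightarrow> u \<le> v \<Longrightarrow> v < b \<Longrightarrow> h v \<le> h u"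
  using DERIV_nonpos_imp_nonincreasing[of u v h] deriv_h[OF in_ab] p_nonpos
  by (meson order_trans order_le_less_trans)

text \<open>\<open>exp (- 2 h)\<close> is the integrating factor that removes the quadratic term
  \<open>2 w q p\<close> of \<open>src_q\<close>; the right-hand side no longer contains
  \<open>q\<close>.\<close>

lemma deriv_Phi:
  assumes "w \<in> {a<..<b}"
  shows "((\<lambda>v. v ^ Suc n * q v * exp (- 2 * h v)) has_real_derivative
     w ^ n * exp (- 2 * h w) * (s\<^sup>2 * n * G w * (2 * n / (1 + w) + 2 * tt w * p w))) (at w)"
proof -
  have "((\<lambda>v. exp (- 2 * h v)) has_real_derivative exp (- 2 * h w) * (- 2 * p w)) (at w)"
    by (auto intro!: derivative_eq_intros deriv_h[OF assms])
  from DERIV_mult[OF deriv_Q[OF assms] this] show ?thesis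
    by (rule DERIV_cong) (simp add: src_q_def algebra_simps)
qed

lemma Phi_rhs_bound:
  fixes w :: real
  assumes w: "0 \<le> w" "w < b" and M: "\<bar>G w\<bar> \<le> M"
  shows "\<bar>s\<^sup>2 * n * G w * (2 * n / (1 + w) + 2 * tt w * p w)\<bar> \<le> s\<^sup>2 * n * M * (2 * n - 2 * p w)"
proof -
  have "\<bar>tt w * p w\<bar> \<le> 1 * (- p w)"
    unfolding abs_mult using tt_range[OF w] p_nonpos[OF w] by (intro mult_mono) auto
  moreover have "2 * real n / (1 + w) \<le> 2 * n" "0 \<le> 2 * real n / (1 + w)"
    using w by (auto simp: divide_le_eq algebra_simps)
  ultimately have "\<bar>2 * n / (1 + w) + 2 * tt w * p w\<bar> \<le> 2 * n - 2 * p w" by (auto simp: abs_le_iff)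
  then have "s\<^sup>2 * n * \<bar>G w\<bar> * \<bar>2 * n / (1 + w) + 2 * tt w * p w\<bar> \<le> s\<^sup>2 * n * M * (2 * n - 2 * p w)"
    using M by (intro mult_mono mult_left_mono) auto
  then show ?thesis by (simp add: abs_mult)
qed

text \<open>Integrate \<open>deriv_Phi\<close> from \<open>0\<close>. Since \<open>h\<close>
  decreases, the weight \<open>exp (- 2 h)\<close> at \<open>x\<close> is at most its value at
  \<open>w\<close>, where it cancels; and \<open>- x p x \<le> - w p w\<close> allows a polynomial
  in \<open>v\<close> as comparison function.\<close>

lemma Q_bound:
  fixes w :: real
  assumes w: "0 \<le> w" "w < b" and M: "\<And>v. 0 \<le> v \<Longrightarrow> v \<le> w \<Longrightarrow> \<bar>G v\<bar> \<le> M"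
  shows "\<bar>w * q w\<bar> \<le> 2 * s\<^sup>2 * M * (n * w - w * p w)"
proof (cases "w = 0")
  case False
  then have w0: "0 < w" using w by simp
  define e where "e = exp (- 2 * h w)"
  define R where "R = - (w * p w)"
  have M0: "0 \<le> M" using M[of 0] w by force
  have R0: "0 \<le> R" unfolding R_def using P_nonpos[OF w] by simp
  have "\<bar>(\<lambda>v. v ^ Suc n * q v * exp (- 2 * h v)) w - (\<lambda>v. v ^ Suc n * q v * exp (- 2 * h v)) 0\<bar>
      \<le> (\<lambda>v. e * s\<^sup>2 * M * (2 * n * v ^ Suc n + 2 * v ^ n * R)) w - (\<lambda>v. e * s\<^sup>2 * M * (2 * n * v ^ Suc n + 2 * v ^ n * R)) (0::real)"
  proof (rule abs_diff_le_of_deriv[OF w(1)])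
    show "continuous_on {0..w} (\<lambda>v. v ^ Suc n * q v * exp (- 2 * h v))"
      using w ab by (intro continuous_intros cont_on) auto
    fix x assume x: "0 < x" "x < w"
    then have xb: "x < b" "x \<in> {a<..<b}" using w ab by auto
    show "((\<lambda>v. v ^ Suc n * q v * exp (- 2 * h v)) has_real_derivative
     x ^ n * exp (- 2 * h x) * (s\<^sup>2 * n * G x * (2 * n / (1 + x) + 2 * tt x * p x))) (at x)"
      by (rule deriv_Phi[OF xb(2)])
    show "((\<lambda>v. e * s\<^sup>2 * M * (2 * n * v ^ Suc n + 2 * v ^ n * R)) has_real_derivative
       e * s\<^sup>2 * M * (2 * n * (Suc n * x ^ n) + 2 * (n * x ^ (n - 1)) * R)) (at x)"
      by (rule derivative_eq_intros refl)+ simp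
    have xp: "- (x * p x) \<le> R" unfolding R_def using P_antimono[of x w] x w by auto
    have "x ^ n * (- p x) = x ^ (n - 1) * (- (x * p x))"
      using n2 by (cases n) auto
    also have "\<dots> \<le> x ^ (n - 1) * R" using xp x by (intro mult_left_mono) auto
    finally have A: "x ^ n * (2 * n - 2 * p x) \<le> 2 * (n + 1) * x ^ n + 2 * x ^ (n - 1) * R"
      using x by (simp add: algebra_simps)
    have B: "\<bar>s\<^sup>2 * n * G x * (2 * n / (1 + x) + 2 * tt x * p x)\<bar> \<le> s\<^sup>2 * n * M * (2 * n - 2 * p x)"
      using x w M by (intro Phi_rhs_bound) auto
    have he: "exp (- 2 * h x) \<le> e" unfolding e_def using h_antimono[of x w] x w by simp
    have "\<bar>x ^ n * exp (- 2 * h x) * (s\<^sup>2 * n * G x * (2 * n / (1 + x) + 2 * tt x * p x))\<bar>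
        \<le> x ^ n * e * (s\<^sup>2 * n * M * (2 * n - 2 * p x))"
      unfolding abs_mult[of "x ^ n * exp (- 2 * h x)"] using x he by (intro mult_mono B) (auto simp: e_def)
    also have "\<dots> = e * (s\<^sup>2 * n * M) * (x ^ n * (2 * n - 2 * p x))" by (simp add: mult_ac)
    also have "\<dots> \<le> e * (s\<^sup>2 * n * M) * (2 * (n + 1) * x ^ n + 2 * x ^ (n - 1) * R)"
      using M0 by (intro mult_left_mono A) (auto simp: e_def)
    also have "\<dots> = e * s\<^sup>2 * M * (2 * n * (Suc n * x ^ n) + 2 * (n * x ^ (n - 1)) * R)"
      by (simp add: algebra_simps)
    finally show "\<bar>x ^ n * exp (- 2 * h x) * (s\<^sup>2 * n * G x * (2 * n / (1 + x) + 2 * tt x * p x))\<bar>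
        \<le> e * s\<^sup>2 * M * (2 * n * (Suc n * x ^ n) + 2 * (n * x ^ (n - 1)) * R)" .
  qed (intro continuous_intros)
  then have "\<bar>w ^ Suc n * q w * e\<bar> \<le> e * s\<^sup>2 * M * (2 * n * w ^ Suc n + 2 * w ^ n * R)"
    using n2 by (simp add: e_def power_0_left)
  moreover have "\<bar>w ^ Suc n * q w * e\<bar> = (w ^ n * e) * \<bar>w * q w\<bar>"
    using w0 by (simp add: abs_mult e_def)
  moreover have "e * s\<^sup>2 * M * (2 * n * w ^ Suc n + 2 * w ^ n * R) = (w ^ n * e) * (2 * s\<^sup>2 * M * (n * w + R))"
    by (simp add: algebra_simps)
  ultimately have "(w ^ n * e) * \<bar>w * q w\<bar> \<le> (w ^ n * e) * (2 * s\<^sup>2 * M * (n * w + R))" by linarith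
  then have "\<bar>w * q w\<bar> \<le> 2 * s\<^sup>2 * M * (n * w + R)"
    using w0 by (subst (asm) mult_le_cancel_left_pos) (auto simp: e_def)
  then show ?thesis unfolding R_def by simp
qed (use w in auto)

text \<open>In the variable \<open>ln w\<close> the slope of \<open>h\<close> is \<open>w p\<close>,
  which only decreases. So between \<open>w\<close> and \<open>W\<close> the function
  \<open>h\<close> falls at least at the rate it has at \<open>w\<close>.\<close>

lemma P_log_bound:
  fixes w :: real
  assumes w: "0 < w" "w \<le> W" "W < b"
  shows "- (w * p w) * ln (W / w) \<le> h w - h W"
proof -
  have "h W - h w \<le> (\<lambda>v. w * p w * ln v) W - (\<lambda>v. w * p w * ln v) w"
  proof (rule diff_le_of_deriv[OF w(2)])
    show "continuous_on {w..W} h" using w ab by (intro cont_on) auto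
    fix x assume x: "w < x" "x < W"
    show "(h has_real_derivative p x) (at x)" using x w ab by (intro deriv_h) auto
    show "((\<lambda>v. w * p w * ln v) has_real_derivative w * p w / x) (at x)"
      using x w by (auto intro!: derivative_eq_intros)
    have "x * p x \<le> w * p w" using x w by (intro P_antimono) auto
    then show "p x \<le> w * p w / x" using x w by (simp add: field_simps)
  qed (use w in \<open>auto intro!: continuous_intros\<close>)
  then show ?thesis using w by (simp add: ln_div algebra_simps)
qed


text \<open>With \<open>M\<close> the maximum of \<open>|G|\<close> on \<open>[0, W]\<close>,
  \<open>Q_bound\<close> and \<open>s^2 \<le> 1/4\<close> give
  \<open>|q| \<le> M / 2 * (n - p)\<close>, which integrates to at most \<open>M / 4\<close> because
  \<open>n w\<close> and \<open>- h\<close> are both at most \<open>1/4\<close>. Hence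
  \<open>M \<le> 4/3 * |G 0|\<close>.\<close>

lemma G_near_center:
  fixes W w :: real
  assumes W: "0 < W" "W < b" and small: "n * W \<le> 1/4" and h0: "h 0 = 0" and hW: "h W \<ge> - 1/4" and w: "0 \<le> w" "w \<le> W"
  shows "\<bar>G w - G 0\<bar> \<le> \<bar>G 0\<bar> / 3"
proof -
  have "continuous_on {0..W} (\<lambda>w. \<bar>G w\<bar>)" using W ab by (intro continuous_intros cont_on) auto
  then obtain w' where w': "w' \<in> {0..W}" "\<And>v. v \<in> {0..W} \<Longrightarrow> \<bar>G v\<bar> \<le> \<bar>G w'\<bar>"
    using continuous_attains_sup[of "{0..W}" "\<lambda>w. \<bar>G w\<bar>"] W by auto
  define M where "M = \<bar>G w'\<bar>"
  have key: "\<bar>G v - G 0\<bar> \<le> M / 4" if v: "0 \<le> v" "v \<le> W" for v :: real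
  proof -
    have "\<bar>G v - G 0\<bar> \<le> (\<lambda>v. M / 2 * (n * v - h v)) v - (\<lambda>v. M / 2 * (n * v - h v)) (0::real)"
    proof (rule abs_diff_le_of_deriv[OF v(1)])
      show "continuous_on {0..v} G" using W v ab by (intro cont_on) auto
      show "continuous_on {0..v} (\<lambda>v. M / 2 * (n * v - h v))" using W v ab by (intro continuous_intros cont_on) auto
      fix x assume x: "0 < x" "x < v"
      then have xb: "x < b" "x \<in> {a<..<b}" using v W ab by auto
      show "(G has_real_derivative q x) (at x)" using deriv_G xb by simp
      show "((\<lambda>v. M / 2 * (n * v - h v)) has_real_derivative M / 2 * (n - p x)) (at x)"
        using deriv_h[OF xb(2)] by (auto intro!: derivative_eq_intros)
      have "\<bar>x * q x\<bar> \<le> 2 * s\<^sup>2 * M * (n * x - x * p x)"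
        using x v W w'(2) unfolding M_def by (intro Q_bound) auto
      also have "\<dots> \<le> 2 * (1/4) * M * (n * x - x * p x)"
        using s2 p_nonpos[of x] x xb by (intro mult_right_mono) (auto simp: M_def intro: order_trans[of _ 0])
      also have "\<dots> = x * (M / 2 * (n - p x))" by (simp add: algebra_simps)
      finally show "\<bar>q x\<bar> \<le> M / 2 * (n - p x)" using x by (simp add: abs_mult)
    qed
    also have "\<dots> = M / 2 * (n * v - h v)" using h0 by simp
    also have "\<dots> \<le> M / 2 * (1/2)"
    proof (rule mult_left_mono)
      have "n * v \<le> n * W" using v by (intro mult_left_mono) auto
      moreover have "h W \<le> h v" using v W by (intro h_antimono) auto
      ultimately show "n * v - h v \<le> 1/2" using small hW by linarith
    qed (simp add: M_def)
    finally show ?thesis by simp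
  qed
  have "0 \<le> w'" "w' \<le> W" using w'(1) by auto
  from key[OF this] have "M \<le> \<bar>G 0\<bar> + M / 4" unfolding M_def by linarith
  then show ?thesis using key[OF w] by linarith
qed

text \<open>This rules out concentration at the center. If \<open>|G|\<close> has size
  \<open>M\<close>, a drop of \<open>h\<close> by \<open>1/4\<close> on \<open>[0, W]\<close> forces
  \<open>M^2 W^n \<ge> 1/32\<close>, and the same product bounds the slope \<open>- W p W\<close>
  from below. The uncontrolled quantities \<open>M\<close> and \<open>W\<close> enter only through
  this product.\<close>

lemma radius_lower_bound:
  fixes W :: real
  assumes W: "0 < W" "W < b" and small: "n * W \<le> 1/4" and h0: "h 0 = 0" and hW: "h W = - 1/4"
  shows "W * p W \<le> - min 1 (3 * n * s\<^sup>2 / 1000)"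
proof (cases "W * p W \<le> -1")
  \<comment> \<open>Here \<open>- x p x \<le> 1\<close> up to \<open>W\<close>, so that
    \<open>Q_bound\<close> turns into \<open>|x q x| \<le> M\<close>.\<close>
  case False
  define M where "M = 4/3 * \<bar>G 0\<bar>"
  have near: "\<bar>G v - G 0\<bar> \<le> M / 4" if "0 \<le> v" "v \<le> W" for v
    using G_near_center[OF W small h0 _ that] hW unfolding M_def by simp
  have GM: "\<bar>G v\<bar> \<le> M" "\<bar>G v\<bar> \<ge> M / 2" if "0 \<le> v" "v \<le> W" for v
    using near[OF that] unfolding M_def by linarith+
  have M0: "M \<ge> 0" unfolding M_def by simp
  have s1: "s\<^sup>2 \<le> 1" using s2 by simp
  have Pup: "- (v * p v) \<le> 4 * M\<^sup>2 * (1 + n\<^sup>2) / n * v ^ n" if v: "0 \<le> v" "v \<le> W" for v :: real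
  proof -
    have "\<bar>(\<lambda>v. v * p v) v - (\<lambda>v. v * p v) 0\<bar> \<le> (\<lambda>v. 4 * M\<^sup>2 * (1 + n\<^sup>2) / n * v ^ n) v - (\<lambda>v. 4 * M\<^sup>2 * (1 + n\<^sup>2) / n * v ^ n) (0::real)"
    proof (rule abs_diff_le_of_deriv[OF v(1)])
      show "continuous_on {0..v} (\<lambda>v. v * p v)" using W v ab by (intro continuous_intros cont_on) auto
      fix x assume x: "0 < x" "x < v"
      then have xb: "x < b" "x \<in> {a<..<b}" "0 \<le> x" "x \<le> W" using v W ab by auto
      show "((\<lambda>v. v * p v) has_real_derivative src_p n s h G q x) (at x)" by (rule deriv_P[OF xb(2)])
      show "((\<lambda>v. 4 * M\<^sup>2 * (1 + n\<^sup>2) / n * v ^ n) has_real_derivative 4 * M\<^sup>2 * (1 + n\<^sup>2) * x ^ (n - 1)) (at x)"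
        using n2 by (auto intro!: derivative_eq_intros)
      have "n * x \<le> n * W" using xb by (intro mult_left_mono) auto
      then have nx: "n * x \<le> 1/4" using small by linarith
      have Px: "- (x * p x) \<le> 1" using P_antimono[of x W] xb W False by simp
      have "\<bar>x * q x\<bar> \<le> 2 * s\<^sup>2 * M * (n * x - x * p x)"
        using xb GM(1) by (intro Q_bound) auto
      also have "\<dots> \<le> 2 * (1/4) * M * 2"
      proof (intro mult_mono)
        show "0 \<le> n * x - x * p x" using P_nonpos[of x] xb by (simp add: order_trans[of _ 0])
      qed (use s2 nx Px xb M0 in auto)
      finally have Q: "\<bar>x * q x\<bar> \<le> M" by simp
      then have Q2: "(x * q x)\<^sup>2 \<le> M\<^sup>2" by (metis abs_ge_zero power2_abs power_mono)
      have "(G x)\<^sup>2 \<le> M\<^sup>2" using GM(1)[of x] xb by (metis abs_ge_zero power2_abs power_mono)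
      then have "n\<^sup>2 * (s\<^sup>2 * (G x)\<^sup>2) \<le> n\<^sup>2 * (1 * M\<^sup>2)"
        using s1 by (intro mult_left_mono mult_mono) auto
      then have g2: "(n * s * G x)\<^sup>2 \<le> n\<^sup>2 * M\<^sup>2" by (simp add: power_mult_distrib mult_ac)
      have "pot n s (tt x) (G x) (x * q x) \<le> 2 * ((x * q x)\<^sup>2 + (n * s * G x)\<^sup>2)"
        using tt_range[of x] xb by (intro pot_bounds s) auto
      also have "\<dots> \<le> 2 * M\<^sup>2 * (1 + n\<^sup>2)" using Q2 g2 by (simp add: algebra_simps)
      finally have pot: "pot n s (tt x) (G x) (x * q x) \<le> 2 * M\<^sup>2 * (1 + n\<^sup>2)" .
      have "h W \<le> h x" using xb W by (intro h_antimono) auto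
      then have "exp (- 2 * h x) \<le> exp (1/2)" using hW by simp
      also have "exp (1/2 :: real) \<le> 2"
      proof (rule power2_le_imp_le)
        show "(exp (1/2 :: real))\<^sup>2 \<le> 2\<^sup>2" using exp_double[of "1/2 :: real"] exp_le by simp
      qed simp
      finally have e: "exp (- 2 * h x) \<le> 2" .
      have "x ^ (n - 1) * exp (- 2 * h x) * pot n s (tt x) (G x) (x * q x) \<le> x ^ (n - 1) * 2 * (2 * M\<^sup>2 * (1 + n\<^sup>2))"
        using xb e pot pot_bounds(2)[OF s] tt_range[of x] by (intro mult_mono) auto
      then show "\<bar>src_p n s h G q x\<bar> \<le> 4 * M\<^sup>2 * (1 + n\<^sup>2) * x ^ (n - 1)"
        using src_p_nonpos[of x] xb unfolding src_p_pot by (simp add: mult_ac)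
    qed (intro continuous_intros)
    then show ?thesis using n2 by (simp add: power_0_left)
  qed
  have hlow: "1/4 \<le> 4 * M\<^sup>2 * (1 + n\<^sup>2) / n\<^sup>2 * W ^ n"
  proof -
    have "\<bar>h W - h 0\<bar> \<le> (\<lambda>v. 4 * M\<^sup>2 * (1 + n\<^sup>2) / n\<^sup>2 * v ^ n) W - (\<lambda>v. 4 * M\<^sup>2 * (1 + n\<^sup>2) / n\<^sup>2 * v ^ n) (0::real)"
    proof (rule abs_diff_le_of_deriv)
      show "0 \<le> W" using W by simp
      show "continuous_on {0..W} h" using W ab by (intro continuous_intros cont_on) auto
      fix x assume x: "0 < x" "x < W"
      then have xb: "x < b" "x \<in> {a<..<b}" "0 \<le> x" "x \<le> W" using W ab by auto
      show "(h has_real_derivative p x) (at x)" by (rule deriv_h[OF xb(2)])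
      show "((\<lambda>v. 4 * M\<^sup>2 * (1 + n\<^sup>2) / n\<^sup>2 * v ^ n) has_real_derivative 4 * M\<^sup>2 * (1 + n\<^sup>2) / n * x ^ (n - 1)) (at x)"
        using n2 by (auto intro!: derivative_eq_intros simp: power2_eq_square)
      have "x * (- p x) \<le> x * (4 * M\<^sup>2 * (1 + n\<^sup>2) / n * x ^ (n - 1))"
        using Pup[of x] xb n2 by (cases n) (auto simp: mult_ac)
      then have "- p x \<le> 4 * M\<^sup>2 * (1 + n\<^sup>2) / n * x ^ (n - 1)"
        using x by (subst (asm) mult_le_cancel_left_pos) auto
      then show "\<bar>p x\<bar> \<le> 4 * M\<^sup>2 * (1 + n\<^sup>2) / n * x ^ (n - 1)"
        using p_nonpos[of x] xb by simp
    qed (intro continuous_intros)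
    then show ?thesis using hW h0 n2 by (simp add: power_0_left)
  qed
  have "4 * M\<^sup>2 * (1 + n\<^sup>2) / n\<^sup>2 * W ^ n \<le> 4 * M\<^sup>2 * 2 * W ^ n"
  proof -
    have "1 \<le> (real n)\<^sup>2" using n2 by (simp add: one_le_power)
    then have "(1 + (real n)\<^sup>2) / (real n)\<^sup>2 \<le> 2" by (simp add: divide_le_eq)
    then have "4 * M\<^sup>2 * ((1 + (real n)\<^sup>2) / (real n)\<^sup>2) * W ^ n \<le> 4 * M\<^sup>2 * 2 * W ^ n"
      using W by (intro mult_right_mono mult_left_mono) auto
    then show ?thesis by simp
  qed
  with hlow have MW: "M\<^sup>2 * W ^ n \<ge> 1/32" by simp
  have "(\<lambda>v. v * p v) W - (\<lambda>v. v * p v) 0 \<le> (\<lambda>v. - (3/16) * n * s\<^sup>2 * M\<^sup>2 * v ^ n) W - (\<lambda>v. - (3/16) * n * s\<^sup>2 * M\<^sup>2 * v ^ n) (0::real)"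
  proof (rule diff_le_of_deriv)
    show "0 \<le> W" using W by simp
    show "continuous_on {0..W} (\<lambda>v. v * p v)" using W ab by (intro continuous_intros cont_on) auto
    fix x assume x: "0 < x" "x < W"
    then have xb: "x < b" "x \<in> {a<..<b}" "0 \<le> x" "x \<le> W" using W ab by auto
    show "((\<lambda>v. v * p v) has_real_derivative src_p n s h G q x) (at x)" by (rule deriv_P[OF xb(2)])
    show "((\<lambda>v. - (3/16) * n * s\<^sup>2 * M\<^sup>2 * v ^ n) has_real_derivative - (3/16) * n * s\<^sup>2 * M\<^sup>2 * (n * x ^ (n - 1))) (at x)"
      by (auto intro!: derivative_eq_intros)
    have "(M / 2)\<^sup>2 \<le> \<bar>G x\<bar>\<^sup>2" using GM(2)[of x] xb M0 by (intro power_mono) auto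
    then have "(n * s)\<^sup>2 * (M / 2)\<^sup>2 \<le> (n * s)\<^sup>2 * (G x)\<^sup>2" by (intro mult_left_mono) auto
    then have "3/4 * ((n * s)\<^sup>2 * (M / 2)\<^sup>2) \<le> 3/4 * (n * s * G x)\<^sup>2" by (simp add: power_mult_distrib mult_ac)
    also have "\<dots> \<le> pot n s (tt x) (G x) (x * q x)"
      using tt_range[of x] xb by (intro pot_bounds s) auto
    finally have pot: "3/16 * n\<^sup>2 * s\<^sup>2 * M\<^sup>2 \<le> pot n s (tt x) (G x) (x * q x)"
      by (simp add: power_mult_distrib power_divide mult_ac)
    have "h x \<le> 0" using h_antimono[of 0 x] xb h0 by simp
    then have e: "1 \<le> exp (- 2 * h x)" by simp
    have "x ^ (n - 1) * 1 * (3/16 * n\<^sup>2 * s\<^sup>2 * M\<^sup>2) \<le> x ^ (n - 1) * exp (- 2 * h x) * pot n s (tt x) (G x) (x * q x)"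
      using xb by (intro mult_mono e pot) auto
    then show "src_p n s h G q x \<le> - (3/16) * n * s\<^sup>2 * M\<^sup>2 * (n * x ^ (n - 1))"
      unfolding src_p_pot by (simp add: power2_eq_square mult_ac)
  qed (intro continuous_intros)
  then have "W * p W \<le> - (3/16) * n * s\<^sup>2 * (M\<^sup>2 * W ^ n)" using n2 by (simp add: power_0_left mult_ac)
  also have "\<dots> \<le> - (3/16) * n * s\<^sup>2 * (1/32)"
  proof -
    have "(3/16) * n * s\<^sup>2 * (1/32) \<le> (3/16) * n * s\<^sup>2 * (M\<^sup>2 * W ^ n)" by (intro mult_left_mono MW) auto
    then show ?thesis by linarith
  qed
  \<comment> \<open>\<open>3/16 * 1/32 = 3/512\<close>, rounded down to
    \<open>3/1000\<close>.\<close>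
  also have "\<dots> \<le> - (3 * n * s\<^sup>2 / 1000)"
  proof -
    have "0 \<le> n * s\<^sup>2" by simp
    then show ?thesis by linarith
  qed
  finally show ?thesis by linarith
qed simp

end

text \<open>The hypothesis on \<open>G\<close> degenerates at \<open>w = 0\<close>, so the point is
  to control \<open>G\<close> near the center. There is a \<open>w1\<close>, bounded below by a
  constant, such that \<open>G\<close> stays close to \<open>G 0\<close> on \<open>[0, w1]\<close>;
  from \<open>w1\<close> on the hypothesis itself bounds \<open>G\<close>, and at \<open>w1\<close>
  it bounds \<open>G 0\<close>.\<close>

theorem a_priori_bound:
  fixes n :: nat and s W K :: real
  assumes n: "n \<ge> 2" and s: "0 < s" "s \<le> 1/2" and W: "0 < W" "W < 1" and K: "K \<ge> 0"
  obtains N where "N > 0" "\<And>a b h p G q w. profile n s a b h p G q \<Longrightarrow> W < b \<Longrightarrow> h 0 = 0 \<Longrightarrow> h W \<ge> - K \<Longrightarrow>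
      (\<And>w. 0 \<le> w \<Longrightarrow> w \<le> W \<Longrightarrow> (G w)\<^sup>2 * w ^ n \<le> K\<^sup>2) \<Longrightarrow> 0 \<le> w \<Longrightarrow> w \<le> W \<Longrightarrow>
      \<bar>h w\<bar> \<le> N \<and> \<bar>p w\<bar> \<le> N \<and> \<bar>G w\<bar> \<le> N \<and> \<bar>q w\<bar> \<le> N"
proof -
  define c where "c = min 1 (3 * n * s\<^sup>2 / 1000)"
  define w0 where "w0 = min W (1 / (4 * n))"
  \<comment> \<open>\<open>W * exp (- K / c)\<close> is a lower bound for a radius at which
    \<open>h\<close> has dropped by \<open>1/4\<close>: from there on \<open>h\<close> falls at rate
    at least \<open>c\<close> in \<open>ln w\<close>, yet by at most \<open>K\<close> up to
    \<open>W\<close>.\<close>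
  define w2 where "w2 = min w0 (W * exp (- K / c))"
  \<comment> \<open>\<open>4 = 16/9 * 9/4\<close>: the squared factors lost in passing from
    \<open>G\<close> on \<open>[0, w1]\<close> to \<open>G 0\<close>, and from \<open>G 0\<close> to
    \<open>G w1\<close>.\<close>
  define Mb where "Mb = sqrt (4 * K\<^sup>2 / w2 ^ n)"
  define C3 where "C3 = exp (2 * K) * (Mb / 4) * n * (2 * n + 2 * K)"
  define C4 where "C4 = C3 / (W / 2) ^ n"
  define D1 where "D1 = exp (2 * K) * (2 * (C4\<^sup>2 + n\<^sup>2 * Mb\<^sup>2))"
  define Pb where "Pb = K / ln 2 + D1"
  define Qb where "Qb = Mb / 2 * (n + Pb)"
  define C5 where "C5 = exp (2 * K) * (2 * (Qb\<^sup>2 + n\<^sup>2 * Mb\<^sup>2))"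
  define N where "N = 1 + K + C5 + Mb + Mb / 2 * (n + C5)"
  have c0: "c > 0" unfolding c_def using n s by auto
  have w0: "0 < w0" "w0 \<le> W" "n * w0 \<le> 1/4"
    unfolding w0_def using n W by (auto simp: min_def field_simps)
  have w2: "0 < w2" "w2 \<le> w0" "w2 \<le> W * exp (- K / c)" unfolding w2_def using w0 W by auto
  have Mb: "Mb \<ge> 0" "Mb\<^sup>2 * w2 ^ n = 4 * K\<^sup>2" unfolding Mb_def using w2 by auto
  have pos: "C3 \<ge> 0" "C4 \<ge> 0" "D1 \<ge> 0" "Pb \<ge> 0" "Qb \<ge> 0" "C5 \<ge> 0"
    unfolding C3_def C4_def D1_def Pb_def Qb_def C5_def using Mb W K by auto
  show ?thesis
  proof (rule that)
    show "N > 0" unfolding N_def using pos K Mb by (auto intro: add_pos_nonneg)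
    fix a b h p G q w
    assume prof: "profile n s a b h p G q" and Wb: "W < b" and h0: "h 0 = 0" and hW: "h W \<ge> - K"
      and GK: "\<And>w. 0 \<le> w \<Longrightarrow> w \<le> W \<Longrightarrow> (G w)\<^sup>2 * w ^ n \<le> K\<^sup>2" and w: "0 \<le> w" "w \<le> W"
    interpret knot_profile n s a b h p G q by (unfold_locales; fact)
    have hb: "- K \<le> h v" "h v \<le> 0" if "0 \<le> v" "v \<le> W" for v
      using h_antimono[of v W] h_antimono[of 0 v] that Wb hW h0 by auto
    have eb: "1 \<le> exp (- 2 * h v)" "exp (- 2 * h v) \<le> exp (2 * K)" if "0 \<le> v" "v \<le> W" for v
      using hb[OF that] by auto
    obtain w1 where w1: "0 < w1" "w2 \<le> w1" "w1 \<le> W" "\<And>v. 0 \<le> v \<Longrightarrow> v \<le> w1 \<Longrightarrow> \<bar>G v - G 0\<bar> \<le> \<bar>G 0\<bar> / 3"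
    proof (cases "h w0 \<ge> - 1/4")
      case True
      show ?thesis
        by (rule that[of w0]) (use w0 w2 Wb G_near_center[OF w0(1) _ w0(3) h0 True] in auto)
    next
      case False
      \<comment> \<open>Stop where \<open>h\<close> has dropped by exactly \<open>1/4\<close>: there
        both \<open>radius_lower_bound\<close> and \<open>G_near_center\<close> apply.\<close>
      have "\<exists>x\<ge>0. x \<le> w0 \<and> h x = - 1/4"
        by (rule IVT2') (use False h0 w0 Wb ab in \<open>auto intro!: cont_on\<close>)
      then obtain w1 where w1: "0 \<le> w1" "w1 \<le> w0" "h w1 = - 1/4" by auto
      have w1p: "0 < w1" using w1 h0 by (cases "w1 = 0") auto
      have nw1: "n * w1 \<le> 1/4" using w0(3) mult_left_mono[OF w1(2), of n] by linarith
      have w1b: "w1 < b" "w1 \<le> W" using w1 w0 Wb by auto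
      have Pl: "w1 * p w1 \<le> - c" unfolding c_def by (rule radius_lower_bound[OF w1p w1b(1) nw1 h0 w1(3)])
      have l0: "ln (W / w1) \<ge> 0" using w1p w1b by simp
      have "c * ln (W / w1) \<le> - (w1 * p w1) * ln (W / w1)" using Pl l0 by (intro mult_right_mono) auto
      also have "\<dots> \<le> h w1 - h W" by (rule P_log_bound) (use w1p w1b Wb in auto)
      also have "\<dots> \<le> K" using w1(3) hW by simp
      finally have "ln (W / w1) \<le> K / c" using c0 by (simp add: field_simps)
      then have "exp (ln (W / w1)) \<le> exp (K / c)" by simp
      then have "W / w1 \<le> exp (K / c)" using W w1p by simp
      then have "W * exp (- K / c) \<le> w1" using w1p by (simp add: exp_minus field_simps)
      then show ?thesis
        by (intro that[of w1]) (use w1p w1b w2 w1(3) G_near_center[OF w1p w1b(1) nw1 h0] in auto)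
    qed
    have sq: "x\<^sup>2 \<le> k\<^sup>2 * y\<^sup>2" if "\<bar>x\<bar> \<le> k * \<bar>y\<bar>" for x y k :: real
      using power_mono[OF that, of 2] by (simp add: power_mult_distrib)
    have Gpow: "(G v)\<^sup>2 * w2 ^ n \<le> K\<^sup>2" if "w1 \<le> v" "v \<le> W" for v
    proof -
      have "(G v)\<^sup>2 * w2 ^ n \<le> (G v)\<^sup>2 * v ^ n"
        using that w1 w2 by (intro mult_left_mono power_mono) auto
      then show ?thesis using GK[of v] that w1 by auto
    qed
    have "\<bar>G 0\<bar> \<le> 3/2 * \<bar>G w1\<bar>" using w1(4)[of w1] w1(1) by linarith
    then have "(G 0)\<^sup>2 \<le> 9/4 * (G w1)\<^sup>2" using sq[of "G 0" "3/2" "G w1"] by (simp add: power2_eq_square)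
    then have "(G 0)\<^sup>2 * w2 ^ n \<le> 9/4 * (G w1)\<^sup>2 * w2 ^ n" using w2 by (intro mult_right_mono) auto
    then have G0: "(G 0)\<^sup>2 * w2 ^ n \<le> 9/4 * K\<^sup>2" using Gpow[of w1] w1 by simp
    have GM: "\<bar>G v\<bar> \<le> Mb" if v: "0 \<le> v" "v \<le> W" for v :: real
    proof -
      have "(G v)\<^sup>2 * w2 ^ n \<le> 4 * K\<^sup>2"
      proof (cases "v \<le> w1")
        case True
        have "\<bar>G v\<bar> \<le> 4/3 * \<bar>G 0\<bar>" using w1(4)[of v] v True by linarith
        then have "(G v)\<^sup>2 \<le> 16/9 * (G 0)\<^sup>2" using sq[of "G v" "4/3" "G 0"] by (simp add: power2_eq_square)
        then have "(G v)\<^sup>2 * w2 ^ n \<le> 16/9 * (G 0)\<^sup>2 * w2 ^ n" using w2 by (intro mult_right_mono) auto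
        then show ?thesis using G0 by simp
      next
        case False
        then have "w1 \<le> v" by simp
        from Gpow[OF this v(2)] show ?thesis using zero_le_power2[of K] by linarith
      qed
      then have "(G v)\<^sup>2 * w2 ^ n \<le> Mb\<^sup>2 * w2 ^ n" using Mb by simp
      then have "\<bar>G v\<bar>\<^sup>2 \<le> Mb\<^sup>2" using w2 by simp
      then show ?thesis using Mb(1) by (rule power2_le_imp_le)
    qed
    have s1: "s\<^sup>2 \<le> 1" using s2 by simp
    have gM: "(n * s * G v)\<^sup>2 \<le> n\<^sup>2 * Mb\<^sup>2" if v: "0 \<le> v" "v \<le> W" for v :: real
    proof -
      have "(G v)\<^sup>2 \<le> Mb\<^sup>2" using GM[OF v] by (metis abs_ge_zero power2_abs power_mono)
      then have "n\<^sup>2 * (s\<^sup>2 * (G v)\<^sup>2) \<le> n\<^sup>2 * (1 * Mb\<^sup>2)"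
        using s1 by (intro mult_left_mono mult_mono) auto
      then show ?thesis by (simp add: power_mult_distrib mult_ac)
    qed
    have srcb: "\<bar>src_p n s h G q v\<bar> \<le> exp (2 * K) * (2 * (B\<^sup>2 + n\<^sup>2 * Mb\<^sup>2))"
      if v: "0 \<le> v" "v \<le> W" and B: "\<bar>v * q v\<bar> \<le> B" for v B
    proof -
      have vb: "v < b" using v Wb by simp
      have "(v * q v)\<^sup>2 \<le> B\<^sup>2" using B by (metis abs_ge_zero power2_abs power_mono)
      then have "2 * ((v * q v)\<^sup>2 + (n * s * G v)\<^sup>2) \<le> 2 * (B\<^sup>2 + n\<^sup>2 * Mb\<^sup>2)" using gM[OF v] by simp
      then have pt: "pot n s (tt v) (G v) (v * q v) \<le> 2 * (B\<^sup>2 + n\<^sup>2 * Mb\<^sup>2)"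
        using pot_bounds(3)[OF s, of "tt v" n "G v" "v * q v"] tt_range[OF v(1) vb] by linarith
      have v1: "v ^ (n - 1) \<le> 1" using v W by (intro power_le_one) auto
      have "v ^ (n - 1) * exp (- 2 * h v) * pot n s (tt v) (G v) (v * q v) \<le> 1 * exp (2 * K) * (2 * (B\<^sup>2 + n\<^sup>2 * Mb\<^sup>2))"
        using v v1 eb[OF v] pt pot_bounds(2)[OF s] tt_range[OF v(1) vb] by (intro mult_mono) auto
      then show ?thesis using src_p_nonpos[OF v(1) vb] unfolding src_p_pot by simp
    qed
    \<comment> \<open>\<open>Q_bound\<close> does not help yet: it estimates \<open>w q\<close> by
      \<open>w p\<close>, whose derivative is quadratic in \<open>w q\<close>, and such a Riccati
      inequality gives no a priori bound. The weighted quantity is controlled by the total drop of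
      \<open>h\<close>, which is at most \<open>K\<close>.\<close>
    have Phi: "\<bar>v ^ Suc n * q v * exp (- 2 * h v)\<bar> \<le> C3" if v: "0 \<le> v" "v \<le> W" for v :: real
    proof -
      let ?B = "\<lambda>v::real. exp (2 * K) * (Mb / 4) * n * (2 * n * v - 2 * h v)"
      have "\<bar>v ^ Suc n * q v * exp (- 2 * h v) - 0 ^ Suc n * q 0 * exp (- 2 * h 0)\<bar> \<le> ?B v - ?B (0::real)"
      proof (rule abs_diff_le_of_deriv[OF v(1), of "\<lambda>v. v ^ Suc n * q v * exp (- 2 * h v)" ?B])
        show "continuous_on {0..v} (\<lambda>v. v ^ Suc n * q v * exp (- 2 * h v))" "continuous_on {0..v} ?B"
          using v Wb ab by (intro continuous_intros cont_on; force)+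
        fix x assume x: "0 < x" "x < v"
        then have xb: "x < b" "x \<in> {a<..<b}" "0 \<le> x" "x \<le> W" using v Wb ab by auto
        show "((\<lambda>v. v ^ Suc n * q v * exp (- 2 * h v)) has_real_derivative
          x ^ n * exp (- 2 * h x) * (s\<^sup>2 * n * G x * (2 * n / (1 + x) + 2 * tt x * p x))) (at x)"
          by (rule deriv_Phi[OF xb(2)])
        show "(?B has_real_derivative exp (2 * K) * (Mb / 4) * n * (2 * n - 2 * p x)) (at x)"
          using deriv_h[OF xb(2)] by (auto intro!: derivative_eq_intros)
        have pn: "0 \<le> 2 * n - 2 * p x" using p_nonpos[of x] xb by simp
        have x1: "x ^ n \<le> 1" using xb W by (intro power_le_one) auto
        have "s\<^sup>2 * n * Mb * (2 * n - 2 * p x) \<le> 1/4 * n * Mb * (2 * n - 2 * p x)"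
          using s2 pn Mb by (intro mult_right_mono) auto
        then have "\<bar>s\<^sup>2 * n * G x * (2 * n / (1 + x) + 2 * tt x * p x)\<bar> \<le> 1/4 * n * Mb * (2 * n - 2 * p x)"
          using Phi_rhs_bound[OF xb(3,1) GM[OF xb(3,4)]] by linarith
        then have "\<bar>x ^ n * exp (- 2 * h x) * (s\<^sup>2 * n * G x * (2 * n / (1 + x) + 2 * tt x * p x))\<bar>
           \<le> (1 * exp (2 * K)) * (1/4 * n * Mb * (2 * n - 2 * p x))"
          unfolding abs_mult[of "x ^ n * exp (- 2 * h x)"] abs_mult[of "x ^ n"]
          using xb x1 eb[OF xb(3,4)] by (intro mult_mono) auto
        then show "\<bar>x ^ n * exp (- 2 * h x) * (s\<^sup>2 * n * G x * (2 * n / (1 + x) + 2 * tt x * p x))\<bar>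
           \<le> exp (2 * K) * (Mb / 4) * n * (2 * n - 2 * p x)" by (simp add: mult_ac)
      qed
      also have "?B v - ?B (0::real) = exp (2 * K) * (Mb / 4) * n * (2 * n * v - 2 * h v)" using h0 by simp
      also have "\<dots> \<le> C3" unfolding C3_def
      proof (intro mult_left_mono)
        have "real n * v \<le> real n * 1" using v W by (intro mult_left_mono) auto
        then show "2 * n * v - 2 * h v \<le> 2 * n + 2 * K" using hb[OF v] by simp
      qed (use Mb in auto)
      finally show ?thesis by simp
    qed
    have Q4: "\<bar>v * q v\<bar> \<le> C4" if v: "W / 2 \<le> v" "v \<le> W" for v
    proof -
      have v0: "0 \<le> v" using v W by simp
      have "(W / 2) ^ n * 1 * \<bar>v * q v\<bar> \<le> v ^ n * exp (- 2 * h v) * \<bar>v * q v\<bar>"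
        using v W v0 eb[OF v0 v(2)] by (intro mult_right_mono mult_mono power_mono) auto
      also have "\<dots> = \<bar>v ^ Suc n * q v * exp (- 2 * h v)\<bar>" using v0 by (simp add: abs_mult)
      also have "\<dots> \<le> C3" by (rule Phi[OF v0 v(2)])
      finally show ?thesis unfolding C4_def using W by (simp add: field_simps)
    qed
    \<comment> \<open>The logarithmic bound controls \<open>w p\<close> at \<open>W / 2\<close>, the
      bound \<open>C4\<close> for \<open>w q\<close> on \<open>[W / 2, W]\<close> carries it to
      \<open>W\<close>, and by monotonicity \<open>- w p\<close> is then bounded on all of
      \<open>[0, W]\<close>.\<close>
    have PW: "- (W * p W) \<le> Pb"
    proof -
      have "\<bar>W * p W - W / 2 * p (W / 2)\<bar> \<le> D1 * W - D1 * (W / 2)"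
      proof (rule abs_diff_le_of_deriv[of "W / 2" W "\<lambda>v. v * p v" "\<lambda>v. D1 * v"])
        show "continuous_on {W / 2..W} (\<lambda>v. v * p v)" using W Wb ab by (intro continuous_intros cont_on) auto
        fix x assume x: "W / 2 < x" "x < W"
        then show "((\<lambda>v. v * p v) has_real_derivative src_p n s h G q x) (at x)" using W Wb ab by (intro deriv_P) auto
        show "((\<lambda>v. D1 * v) has_real_derivative D1) (at x)" by (auto intro!: derivative_eq_intros)
        show "\<bar>src_p n s h G q x\<bar> \<le> D1" unfolding D1_def using x W Q4[of x] by (intro srcb) auto
      qed (use W in \<open>auto intro!: continuous_intros\<close>)
      moreover have "D1 * W - D1 * (W / 2) \<le> D1" using pos(3) W mult_left_mono[of W 1 D1] mult_nonneg_nonneg[OF pos(3), of W] by simp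
      moreover have "- (W / 2 * p (W / 2)) * ln 2 \<le> K"
        using P_log_bound[of "W / 2" W] W Wb hb[of "W / 2"] hW by simp
      then have "- (W / 2 * p (W / 2)) \<le> K / ln 2" by (simp add: field_simps)
      ultimately show ?thesis unfolding Pb_def by linarith
    qed
    have Q5: "\<bar>v * q v\<bar> \<le> Mb / 2 * (n * v - v * p v)" if v: "0 \<le> v" "v \<le> W" for v :: real
    proof -
      have vb: "v < b" using v Wb by simp
      have "0 \<le> n * v - v * p v" using P_nonpos[OF v(1) vb] v by (simp add: order_trans[of _ 0])
      then have "2 * s\<^sup>2 * Mb * (n * v - v * p v) \<le> 2 * (1/4) * Mb * (n * v - v * p v)"
        using s2 Mb by (intro mult_right_mono) auto
      moreover have "\<bar>v * q v\<bar> \<le> 2 * s\<^sup>2 * Mb * (n * v - v * p v)"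
        using v vb GM by (intro Q_bound) auto
      ultimately show ?thesis by simp
    qed
    have pC: "\<bar>p v\<bar> \<le> C5" if v: "0 \<le> v" "v \<le> W" for v :: real
    proof (cases "v = 0")
      case False
      then have v0: "0 < v" using v by simp
      have "\<bar>v * p v - 0 * p 0\<bar> \<le> C5 * v - C5 * 0"
      proof (rule abs_diff_le_of_deriv[OF v(1), of "\<lambda>v. v * p v" "\<lambda>v. C5 * v"])
        show "continuous_on {0..v} (\<lambda>v. v * p v)" using v Wb ab by (intro continuous_intros cont_on) auto
        fix x assume x: "0 < x" "x < v"
        then have xb: "x < b" "x \<in> {a<..<b}" "0 \<le> x" "x \<le> W" using v Wb ab by auto
        show "((\<lambda>v. v * p v) has_real_derivative src_p n s h G q x) (at x)" by (rule deriv_P[OF xb(2)])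
        show "((\<lambda>v. C5 * v) has_real_derivative C5) (at x)" by (auto intro!: derivative_eq_intros)
        have "- (x * p x) \<le> Pb" using P_antimono[of x W] xb Wb PW by auto
        moreover have "real n * x \<le> real n * 1" using xb W by (intro mult_left_mono) auto
        ultimately have "Mb / 2 * (n * x - x * p x) \<le> Qb" unfolding Qb_def using Mb by (intro mult_left_mono) auto
        then have "\<bar>x * q x\<bar> \<le> Qb" using Q5[OF xb(3,4)] by linarith
        then show "\<bar>src_p n s h G q x\<bar> \<le> C5" unfolding C5_def using xb by (intro srcb) auto
      qed (auto intro!: continuous_intros)
      then show ?thesis using v0 by (simp add: abs_mult)
    qed (use p0 pos in simp)
    have qC: "\<bar>q v\<bar> \<le> Mb / 2 * (n + C5)" if v: "0 < v" "v \<le> W" for v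
    proof -
      have "- p v \<le> C5" using pC[of v] v by simp
      then have "Mb / 2 * (n * v - v * p v) \<le> Mb / 2 * (v * (n + C5))"
        using v Mb mult_left_mono[of "- p v" C5 v] by (intro mult_left_mono) (auto simp: algebra_simps)
      moreover have "\<bar>v * q v\<bar> = v * \<bar>q v\<bar>" using v by (simp add: abs_mult)
      moreover have "Mb / 2 * (v * (n + C5)) = v * (Mb / 2 * (n + C5))" by simp
      ultimately have "v * \<bar>q v\<bar> \<le> v * (Mb / 2 * (n + C5))" using Q5[of v] v by linarith
      then show ?thesis using v by simp
    qed
    \<comment> \<open>The estimate of \<open>q\<close> divides by \<open>v\<close>, so the center is
      reached by continuity.\<close>
    have q0: "\<bar>q 0\<bar> \<le> Mb / 2 * (n + C5)"
    proof (rule tendsto_upperbound[of "\<lambda>x. \<bar>q x\<bar>" _ "at_right 0"])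
      have "isCont q 0" using cont_q ab by simp
      then have "(q \<longlongrightarrow> q 0) (at_right 0)"
        by (simp add: isCont_def filterlim_at_split)
      then show "((\<lambda>x. \<bar>q x\<bar>) \<longlongrightarrow> \<bar>q 0\<bar>) (at_right 0)" by (rule tendsto_rabs)
      show "\<forall>\<^sub>F x in at_right 0. \<bar>q x\<bar> \<le> Mb / 2 * (n + C5)"
        unfolding eventually_at_right_field using qC W by (intro exI[of _ W]) auto
    qed simp
    have "\<bar>q w\<bar> \<le> Mb / 2 * (n + C5)" using q0 qC[of w] w by (cases "w = 0") auto
    moreover have "0 \<le> Mb / 2 * (n + C5)" using Mb pos by auto
    ultimately show "\<bar>h w\<bar> \<le> N \<and> \<bar>p w\<bar> \<le> N \<and> \<bar>G w\<bar> \<le> N \<and> \<bar>q w\<bar> \<le> N"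
      using hb[OF w] pC[OF w] GM[OF w] Mb pos K unfolding N_def by auto
  qed
qed

subsection \<open>Comparison with the reference\<close>

text \<open>A positive slope somewhere would force linear growth from there on, against the upper
  bound.\<close>

lemma convex_bounded_antimono:
  fixes F :: "real \<Rightarrow> real"
  assumes F: "\<And>t. t \<ge> t0 \<Longrightarrow> (F has_real_derivative F1 t) (at t)"
    and F1: "\<And>t. t \<ge> t0 \<Longrightarrow> (F1 has_real_derivative F2 t) (at t)"
    and F2: "\<And>t. t \<ge> t0 \<Longrightarrow> F2 t \<ge> 0" and B: "\<And>t. t \<ge> t0 \<Longrightarrow> F t \<le> B" and t: "t \<ge> t0"
  shows "F t \<le> F t0"
proof -
  have mono: "F1 u \<le> F1 v" if "t0 \<le> u" "u \<le> v" for u v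
  proof (rule DERIV_nonneg_imp_nondecreasing[OF that(2)])
    show "\<exists>y. (F1 has_real_derivative y) (at x) \<and> 0 \<le> y" if "u \<le> x" "x \<le> v" for x
      using F1[of x] F2[of x] that \<open>t0 \<le> u\<close> by (intro exI[of _ "F2 x"]) auto
  qed
  have neg: "F1 u \<le> 0" if u: "t0 \<le> u" for u
  proof (rule ccontr)
    assume "\<not> F1 u \<le> 0"
    then have pos: "F1 u > 0" by simp
    define v where "v = u + (\<bar>B - F u\<bar> + 1) / F1 u"
    have v: "u \<le> v" unfolding v_def using pos by simp
    have "(\<lambda>x. F x - F1 u * x) u \<le> (\<lambda>x. F x - F1 u * x) v"
    proof (rule DERIV_nonneg_imp_nondecreasing[OF v])
      fix x assume x: "u \<le> x" "x \<le> v"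
      then show "\<exists>y. ((\<lambda>x. F x - F1 u * x) has_real_derivative y) (at x) \<and> 0 \<le> y"
        using F[of x] mono[of u x] u by (intro exI[of _ "F1 x - F1 u"]) (auto intro!: derivative_eq_intros)
    qed
    moreover have "F1 u * (v - u) = \<bar>B - F u\<bar> + 1" unfolding v_def using pos by simp
    ultimately have "F v \<ge> F u + \<bar>B - F u\<bar> + 1" by (simp add: right_diff_distrib)
    moreover have "F v \<le> B" using B v u by simp
    ultimately show False by linarith
  qed
  show ?thesis
    by (rule DERIV_nonpos_imp_nonincreasing[OF t]) (use F neg in blast)
qed

text \<open>The algebra behind the Kato inequality. For \<open>m = exp ((U - u0) / 2)\<close>,
  \<open>i = 1 / m\<close> and \<open>e = exp (- (U + u0) / 2)\<close> the distance is the squared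
  norm of the triangular matrix with entries \<open>m\<close>, \<open>W e\<close>, \<open>i\<close>.
  Each of the three brackets on the right is the squared norm of a matrix playing the role of its
  covariant derivative in one direction; the last term is the defect of the reference.\<close>

lemma dist_second_derivative:
  fixes m i e W G0 P U k T s n :: real
  assumes mi: "m * i = 1"
  defines "X \<equiv> U - k" and "R \<equiv> U + k" and "S \<equiv> (2 * n - T * (U + k)) / 2"
    and "x \<equiv> n * (W + G0) - T * P / 2" and "y \<equiv> - (T * P / 2)"
    and "Q \<equiv> P\<^sup>2 - 4 * s\<^sup>2 * n * T * (W + G0) * P + 4 * n\<^sup>2 * s\<^sup>2 * (W + G0)\<^sup>2"
    and "Q0 \<equiv> 4 * n\<^sup>2 * s\<^sup>2 * G0\<^sup>2"
    and "P2 \<equiv> 2 * P * U + 4 * s\<^sup>2 * n * (W + G0) * (n - T * U)"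
  shows "(m\<^sup>2 + i\<^sup>2) * X\<^sup>2 + (m\<^sup>2 - i\<^sup>2) * (e\<^sup>2 * m\<^sup>2 * Q0 - e\<^sup>2 * i\<^sup>2 * Q)
     + e\<^sup>2 * (2 * P\<^sup>2 + 2 * W * P2 - 4 * W * P * R + W\<^sup>2 * R\<^sup>2 + W\<^sup>2 * (e\<^sup>2 * m\<^sup>2 * Q0 + e\<^sup>2 * i\<^sup>2 * Q))
   = (1 - T\<^sup>2) * ((m * X + W * e * (e * i * P))\<^sup>2 + (m * (e * i * P) - W * e * R)\<^sup>2 + (e * i * P * i)\<^sup>2 + (X * i)\<^sup>2)
     + 4 * (1 - s\<^sup>2) * ((m * (- (T * X / 2)) + W * e * (e * i * y))\<^sup>2 + (m * (e * i * x) - W * e * S - e * m * n * G0 * i)\<^sup>2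
         + (e * i * y * i)\<^sup>2 + (T * X / 2 * i)\<^sup>2)
     + 4 * s\<^sup>2 * ((m * (- (T * X / 2)) + W * e * (e * i * x))\<^sup>2 + (m * (e * i * y) - W * e * S)\<^sup>2
         + (e * i * x * i - e * m * n * G0 * m)\<^sup>2 + (T * X / 2 * i - e * m * n * G0 * (W * e))\<^sup>2)
     + 2 * W * e\<^sup>2 * (4 * s\<^sup>2 * n * G0 * (n - T * k))" (is "?L = ?R")
proof -
  \<comment> \<open>Each square is expanded with \<open>m i = 1\<close>. Sorting by the powers of
    \<open>e\<close>, \<open>m\<close> and \<open>i\<close> reduces the claim to \<open>q\<close>,
    \<open>q0\<close> and \<open>mid\<close>, in which \<open>m\<close>, \<open>i\<close> and
    \<open>e\<close> no longer occur.\<close>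
  have a: "(m * z + W * e * (e * i * t))\<^sup>2 = m\<^sup>2 * z\<^sup>2 + e\<^sup>2 * (2 * W * z * t) + e^4 * i\<^sup>2 * (W\<^sup>2 * t\<^sup>2)" for z t
    using mi by algebra
  have b: "(m * (e * i * t) - W * e * z)\<^sup>2 = e\<^sup>2 * (t - W * z)\<^sup>2" for t z using mi by algebra
  have c: "(m * (e * i * t) - W * e * z - e * m * n * G0 * i)\<^sup>2 = e\<^sup>2 * (t - W * z - n * G0)\<^sup>2" for t z
    using mi by algebra
  have d: "(e * i * t * i)\<^sup>2 = e\<^sup>2 * i^4 * t\<^sup>2" for t by algebra
  have f: "(e * i * t * i - e * m * n * G0 * m)\<^sup>2 = e\<^sup>2 * i^4 * t\<^sup>2 - e\<^sup>2 * (2 * t * n * G0) + e\<^sup>2 * m^4 * (n * G0)\<^sup>2" for t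
    using mi by algebra
  have g: "(t * i - e * m * n * G0 * (W * e))\<^sup>2 = i\<^sup>2 * t\<^sup>2 - e\<^sup>2 * (2 * t * W * n * G0) + e^4 * m\<^sup>2 * (W * n * G0)\<^sup>2" for t
    using mi by algebra
  have h: "(z * i)\<^sup>2 = i\<^sup>2 * z\<^sup>2" for z by algebra
  have mi2: "m\<^sup>2 * i\<^sup>2 = 1" using mi by algebra
  have L: "?L = m\<^sup>2 * X\<^sup>2 + i\<^sup>2 * X\<^sup>2 + e\<^sup>2 * m^4 * Q0 + e\<^sup>2 * i^4 * Q
     + e^4 * m\<^sup>2 * (W\<^sup>2 * Q0) + e^4 * i\<^sup>2 * (W\<^sup>2 * Q)
     + e\<^sup>2 * (2 * P\<^sup>2 + 2 * W * P2 - 4 * W * P * R + W\<^sup>2 * R\<^sup>2 - Q - Q0)"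
    using mi2 by algebra
  have q: "(1 - T\<^sup>2) * P\<^sup>2 + 4 * (1 - s\<^sup>2) * y\<^sup>2 + 4 * s\<^sup>2 * x\<^sup>2 = Q"
    unfolding x_def y_def Q_def by (simp add: power2_eq_square field_simps)
  have q0: "4 * s\<^sup>2 * (n * G0)\<^sup>2 = Q0" unfolding Q0_def by (simp add: power2_eq_square)
  have mid: "(1 - T\<^sup>2) * (2 * W * X * P + (P - W * R)\<^sup>2)
      + 4 * (1 - s\<^sup>2) * (2 * W * (- (T * X / 2)) * y + (x - W * S - n * G0)\<^sup>2)
      + 4 * s\<^sup>2 * (2 * W * (- (T * X / 2)) * x + (y - W * S)\<^sup>2 - 2 * x * n * G0 - 2 * (T * X / 2) * W * n * G0)
      + 2 * W * (4 * s\<^sup>2 * n * G0 * (n - T * k)) = 2 * P\<^sup>2 + 2 * W * P2 - 4 * W * P * R + W\<^sup>2 * R\<^sup>2 - Q - Q0"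
    unfolding x_def y_def Q_def Q0_def S_def R_def X_def P2_def by (simp add: power2_eq_square field_simps)
  have R: "?R = m\<^sup>2 * X\<^sup>2 + i\<^sup>2 * X\<^sup>2 + e\<^sup>2 * m^4 * (4 * s\<^sup>2 * (n * G0)\<^sup>2)
     + e\<^sup>2 * i^4 * ((1 - T\<^sup>2) * P\<^sup>2 + 4 * (1 - s\<^sup>2) * y\<^sup>2 + 4 * s\<^sup>2 * x\<^sup>2)
     + e^4 * m\<^sup>2 * (W\<^sup>2 * (4 * s\<^sup>2 * (n * G0)\<^sup>2))
     + e^4 * i\<^sup>2 * (W\<^sup>2 * ((1 - T\<^sup>2) * P\<^sup>2 + 4 * (1 - s\<^sup>2) * y\<^sup>2 + 4 * s\<^sup>2 * x\<^sup>2))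
     + e\<^sup>2 * ((1 - T\<^sup>2) * (2 * W * X * P + (P - W * R)\<^sup>2)
      + 4 * (1 - s\<^sup>2) * (2 * W * (- (T * X / 2)) * y + (x - W * S - n * G0)\<^sup>2)
      + 4 * s\<^sup>2 * (2 * W * (- (T * X / 2)) * x + (y - W * S)\<^sup>2 - 2 * x * n * G0 - 2 * (T * X / 2) * W * n * G0)
      + 2 * W * (4 * s\<^sup>2 * n * G0 * (n - T * k)))"
    unfolding a b c d f g h by (simp add: power_mult_distrib power_divide field_simps)
  show ?thesis unfolding L R q q0 mid by simp
qed

text \<open>For Cauchy-Schwarz: the triangular matrix is paired with each of the three derivative
  matrices of \<open>dist_second_derivative\<close>, and every pairing turns out to be a multiple of
  \<open>E1\<close>.\<close>

lemma dist_first_derivative: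
  fixes m i e W G0 P U k T n :: real
  assumes mi: "m * i = 1"
  defines "X \<equiv> U - k" and "R \<equiv> U + k" and "S \<equiv> (2 * n - T * (U + k)) / 2"
    and "x \<equiv> n * (W + G0) - T * P / 2" and "y \<equiv> - (T * P / 2)"
    and "E1 \<equiv> (m\<^sup>2 - i\<^sup>2) * (U - k) + e\<^sup>2 * (2 * W * P - W\<^sup>2 * (U + k))"
  shows "m * (m * X + W * e * (e * i * P)) + W * e * (m * (e * i * P) - W * e * R) - i * (X * i) = E1" (is ?A)
    and "m * (m * (- (T * X / 2)) + W * e * (e * i * y)) + W * e * (m * (e * i * x) - W * e * S - e * m * n * G0 * i)
        + i * (T * X / 2 * i) = - (T * E1 / 2)" (is ?B)
    and "m * (m * (- (T * X / 2)) + W * e * (e * i * x)) + W * e * (m * (e * i * y) - W * e * S)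
        + i * (T * X / 2 * i - e * m * n * G0 * (W * e)) = - (T * E1 / 2)" (is ?C)
proof -
  have a: "m * (m * z + W * e * (e * i * t)) = m\<^sup>2 * z + W * e\<^sup>2 * t" for z t using mi by algebra
  have b: "W * e * (m * (e * i * t) - W * e * z) = e\<^sup>2 * W * (t - W * z)" for z t using mi by algebra
  have c: "W * e * (m * (e * i * t) - W * e * z - e * m * n * G0 * i) = e\<^sup>2 * W * (t - W * z - n * G0)" for z t
    using mi by algebra
  have d: "i * (t * i - e * m * n * G0 * (W * e)) = i\<^sup>2 * t - e\<^sup>2 * n * G0 * W" for t using mi by algebra
  show ?A unfolding a b E1_def X_def R_def by (simp add: power2_eq_square field_simps)
  show ?B unfolding a c E1_def X_def S_def x_def y_def by (simp add: power2_eq_square field_simps)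
  show ?C unfolding a b d E1_def X_def S_def x_def y_def by (simp add: power2_eq_square field_simps)
qed

text \<open>\<open>z\<close> stands for the lower left entry, which is paired with the zero of the
  triangular matrix.\<close>

lemma cauchy_schwarz3:
  fixes a b c x y z w :: real
  shows "(a * x + b * y + c * w)\<^sup>2 \<le> (a\<^sup>2 + b\<^sup>2 + c\<^sup>2) * (x\<^sup>2 + y\<^sup>2 + z\<^sup>2 + w\<^sup>2)"
proof -
  have "(a\<^sup>2 + b\<^sup>2 + c\<^sup>2) * (x\<^sup>2 + y\<^sup>2 + z\<^sup>2 + w\<^sup>2) - (a * x + b * y + c * w)\<^sup>2
    = (a * y - b * x)\<^sup>2 + (a * w - c * x)\<^sup>2 + (b * w - c * y)\<^sup>2 + (a\<^sup>2 + b\<^sup>2 + c\<^sup>2) * z\<^sup>2"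
    by (simp add: power2_eq_square algebra_simps)
  moreover have "\<dots> \<ge> 0" by (intro add_nonneg_nonneg mult_nonneg_nonneg) auto
  ultimately show ?thesis by linarith
qed

text \<open>Here \<open>E\<close> is the trace distance to the reference, \<open>E1\<close> and \<open>E2\<close> are its derivatives along a
  solution. Without the right-hand side, which is the defect of the reference as a solution of the
  equations for \<open>s \<noteq> 0\<close>, the inequality says that \<open>ln E\<close> is convex.\<close>

lemma kato:
  fixes m i e W G0 P U k T s n :: real
  assumes mi: "m * i = 1" and m: "m > 0" and e: "e > 0" and T: "T\<^sup>2 \<le> 1" and s: "0 \<le> s" "s\<^sup>2 \<le> 1" and G0: "2 * n * s * G0 = 1"
  defines "Q \<equiv> P\<^sup>2 - 4 * s\<^sup>2 * n * T * (W + G0) * P + 4 * n\<^sup>2 * s\<^sup>2 * (W + G0)\<^sup>2"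
    and "P2 \<equiv> 2 * P * U + 4 * s\<^sup>2 * n * (W + G0) * (n - T * U)"
    and "E \<equiv> m\<^sup>2 + i\<^sup>2 + W\<^sup>2 * e\<^sup>2"
    and "E1 \<equiv> (m\<^sup>2 - i\<^sup>2) * (U - k) + e\<^sup>2 * (2 * W * P - W\<^sup>2 * (U + k))"
  defines "E2 \<equiv> (m\<^sup>2 + i\<^sup>2) * (U - k)\<^sup>2 + (m\<^sup>2 - i\<^sup>2) * (e\<^sup>2 * m\<^sup>2 - e\<^sup>2 * i\<^sup>2 * Q)
     + e\<^sup>2 * (2 * P\<^sup>2 + 2 * W * P2 - 4 * W * P * (U + k) + W\<^sup>2 * (U + k)\<^sup>2 + W\<^sup>2 * (e\<^sup>2 * m\<^sup>2 + e\<^sup>2 * i\<^sup>2 * Q))"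
  shows "E * E2 - E1\<^sup>2 \<ge> - (2 * s * (e * m) * \<bar>n - T * k\<bar>) * E\<^sup>2"
proof -
  define X where "X = U - k" define R where "R = U + k" define S where "S = (2 * n - T * (U + k)) / 2"
  define x where "x = n * (W + G0) - T * P / 2" define y where "y = - (T * P / 2)"
  define Ny where "Ny = (m * X + W * e * (e * i * P))\<^sup>2 + (m * (e * i * P) - W * e * R)\<^sup>2 + (e * i * P * i)\<^sup>2 + (X * i)\<^sup>2"
  define Nz where "Nz = (m * (- (T * X / 2)) + W * e * (e * i * y))\<^sup>2 + (m * (e * i * x) - W * e * S - e * m * n * G0 * i)\<^sup>2
         + (e * i * y * i)\<^sup>2 + (T * X / 2 * i)\<^sup>2"
  define Nb where "Nb = (m * (- (T * X / 2)) + W * e * (e * i * x))\<^sup>2 + (m * (e * i * y) - W * e * S)\<^sup>2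
         + (e * i * x * i - e * m * n * G0 * m)\<^sup>2 + (T * X / 2 * i - e * m * n * G0 * (W * e))\<^sup>2"
  define err where "err = 2 * W * e\<^sup>2 * (4 * s\<^sup>2 * n * G0 * (n - T * k))"
  have i: "i > 0" using mi m by (metis zero_less_mult_pos zero_less_one)
  have Q0: "4 * n\<^sup>2 * s\<^sup>2 * G0\<^sup>2 = 1"
    using arg_cong[OF G0, of "\<lambda>x. x\<^sup>2"] by (simp add: power_mult_distrib mult_ac)
  have E2_eq: "E2 = (1 - T\<^sup>2) * Ny + 4 * (1 - s\<^sup>2) * Nz + 4 * s\<^sup>2 * Nb + err"
    using dist_second_derivative[OF mi, where U = U and k = k and e = e and W = W and ?G0.0 = G0 and n = n and s = s and T = T and P = P]
    unfolding Q0 E2_def Q_def P2_def X_def R_def S_def x_def y_def Ny_def Nz_def Nb_def err_def by (simp only: mult_1_right)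
  have E_eq: "E = m\<^sup>2 + (W * e)\<^sup>2 + i\<^sup>2" unfolding E_def by (simp add: power_mult_distrib)
  have E0: "E > 0" unfolding E_def using m by (simp add: add_pos_nonneg)
  have y1: "E1\<^sup>2 \<le> E * Ny"
  proof -
    have "m * (m * X + W * e * (e * i * P)) + W * e * (m * (e * i * P) - W * e * R) + i * (- (X * i)) = E1"
      using dist_first_derivative(1)[OF mi, where U = U and k = k and W = W and e = e and P = P] unfolding E1_def X_def R_def by simp
    then show ?thesis
      using cauchy_schwarz3[of m "m * X + W * e * (e * i * P)" "W * e" "m * (e * i * P) - W * e * R" i "- (X * i)" "e * i * P * i"]
      unfolding E_eq Ny_def by simp
  qed
  have z1: "(T * E1 / 2)\<^sup>2 \<le> E * Nz"
  proof -
    have "m * (m * (- (T * X / 2)) + W * e * (e * i * y)) + W * e * (m * (e * i * x) - W * e * S - e * m * n * G0 * i)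
        + i * (T * X / 2 * i) = - (T * E1 / 2)"
      using dist_first_derivative(2)[OF mi, where U = U and k = k and W = W and e = e and P = P and T = T and n = n and ?G0.0 = G0] unfolding E1_def X_def S_def x_def y_def by simp
    then show ?thesis
      using cauchy_schwarz3[of m "m * (- (T * X / 2)) + W * e * (e * i * y)" "W * e" "m * (e * i * x) - W * e * S - e * m * n * G0 * i"
          i "T * X / 2 * i" "e * i * y * i"]
      unfolding E_eq Nz_def by simp
  qed
  have b1: "(T * E1 / 2)\<^sup>2 \<le> E * Nb"
  proof -
    have "m * (m * (- (T * X / 2)) + W * e * (e * i * x)) + W * e * (m * (e * i * y) - W * e * S)
        + i * (T * X / 2 * i - e * m * n * G0 * (W * e)) = - (T * E1 / 2)"
      using dist_first_derivative(3)[OF mi, where U = U and k = k and W = W and e = e and P = P and T = T and n = n and ?G0.0 = G0] unfolding E1_def X_def S_def x_def y_def by simp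
    then show ?thesis
      using cauchy_schwarz3[of m "m * (- (T * X / 2)) + W * e * (e * i * x)" "W * e" "m * (e * i * y) - W * e * S"
          i "T * X / 2 * i - e * m * n * G0 * (W * e)" "e * i * x * i - e * m * n * G0 * m"]
      unfolding E_eq Nb_def by simp
  qed
  \<comment> \<open>The weights match:
    \<open>(1 - T^2) + (1 - s^2) T^2 + s^2 T^2 = 1\<close>.\<close>
  have "E1\<^sup>2 = (1 - T\<^sup>2) * E1\<^sup>2 + 4 * (1 - s\<^sup>2) * (T * E1 / 2)\<^sup>2 + 4 * s\<^sup>2 * (T * E1 / 2)\<^sup>2"
    by (simp add: power2_eq_square field_simps)
  also have "\<dots> \<le> (1 - T\<^sup>2) * (E * Ny) + 4 * (1 - s\<^sup>2) * (E * Nz) + 4 * s\<^sup>2 * (E * Nb)"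
    using T s by (intro add_mono mult_left_mono y1 z1 b1) auto
  also have "\<dots> = E * (E2 - err)" unfolding E2_eq by (simp add: algebra_simps)
  finally have 1: "E1\<^sup>2 \<le> E * E2 - E * err" by (simp add: algebra_simps)
  \<comment> \<open>\<open>err\<close> is linear in \<open>W\<close>. This inequality makes it at
    most a multiple of \<open>E\<close>, so that the defect enters the second derivative of
    \<open>ln E\<close> additively.\<close>
  have We: "2 * \<bar>W * e\<bar> * i \<le> E"
  proof -
    have "0 \<le> (\<bar>W * e\<bar> - i)\<^sup>2" by simp
    then have "2 * \<bar>W * e\<bar> * i \<le> (W * e)\<^sup>2 + i\<^sup>2"
      unfolding power2_diff power2_abs by (simp add: mult_ac)
    then show ?thesis unfolding E_eq using zero_le_power2[of m] by linarith
  qed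
  have "err = 4 * s * (W * e) * e * (2 * n * s * G0) * (n - T * k)"
    unfolding err_def by (simp add: power2_eq_square)
  also have "\<dots> = 2 * s * (e * m) * (2 * (W * e) * i) * (n - T * k)"
  proof -
    have "2 * s * (e * m) * (2 * (W * e) * i) * (n - T * k) = 4 * s * (W * e) * e * (n - T * k) * (m * i)" by algebra
    then show ?thesis by (simp only: mi G0 mult_1_right)
  qed
  finally have "\<bar>err\<bar> = 2 * s * (e * m) * \<bar>n - T * k\<bar> * (2 * \<bar>W * e\<bar> * i)"
    using s e m i by (simp add: abs_mult)
  also have "\<dots> \<le> 2 * s * (e * m) * \<bar>n - T * k\<bar> * E"
    using s e m by (intro mult_left_mono We) auto
  finally have "\<bar>err\<bar> \<le> 2 * s * (e * m) * \<bar>n - T * k\<bar> * E" .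
  then have "err \<ge> - (2 * s * (e * m) * \<bar>n - T * k\<bar> * E)" by linarith
  then have "E * err \<ge> E * - (2 * s * (e * m) * \<bar>n - T * k\<bar> * E)" using E0 by (intro mult_left_mono) auto
  moreover have "E * - (2 * s * (e * m) * \<bar>n - T * k\<bar> * E) = - (2 * s * (e * m) * \<bar>n - T * k\<bar>) * E\<^sup>2"
    by (simp add: power2_eq_square)
  ultimately show ?thesis using 1 by linarith
qed

text \<open>\<open>ln E\<close> plus a bounded correction is convex and bounded on \<open>[t0, \<infinity>)\<close>, hence nonincreasing.\<close>

lemma comparison:
  fixes U \<Gamma> U1 \<Gamma>1 :: "real \<Rightarrow> real" and n :: nat and s t0 B :: real
  defines "u0 \<equiv> \<lambda>t::real. ln (sinh (n * t) / n)"
  defines "E \<equiv> \<lambda>t::real. exp (U t - u0 t) + exp (u0 t - U t) + (\<Gamma> t - 1 / (2 * n * s))\<^sup>2 * exp (- U t - u0 t)"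
  assumes n: "n \<ge> 1" and s: "0 < s" "s \<le> 1/2" and t0: "t0 > 0"
    and dU: "\<And>t. t \<ge> t0 \<Longrightarrow> (U has_real_derivative U1 t) (at t)"
    and dU1: "\<And>t. t \<ge> t0 \<Longrightarrow> (U1 has_real_derivative - (exp (- 2 * U t) *
        ((\<Gamma>1 t)\<^sup>2 - 4 * s\<^sup>2 * n * tanh t * \<Gamma> t * \<Gamma>1 t + 4 * n\<^sup>2 * s\<^sup>2 * (\<Gamma> t)\<^sup>2))) (at t)"
    and dG: "\<And>t. t \<ge> t0 \<Longrightarrow> (\<Gamma> has_real_derivative \<Gamma>1 t) (at t)"
    and dG1: "\<And>t. t \<ge> t0 \<Longrightarrow> (\<Gamma>1 has_real_derivative
        2 * \<Gamma>1 t * U1 t + 4 * s\<^sup>2 * n * \<Gamma> t * (n - tanh t * U1 t)) (at t)"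
    and B: "\<And>t. t \<ge> t0 \<Longrightarrow> E t \<le> B" and t: "t \<ge> t0"
  shows "E t \<le> E t0 * exp (8 * n\<^sup>2 * sqrt (1 - exp (- t)))"
proof -
  define G0 where "G0 = 1 / (2 * n * s)"
  define k where "k t = n * cosh (n * t) / sinh (n * t)" for t :: real
  define Q where "Q t = (\<Gamma>1 t)\<^sup>2 - 4 * s\<^sup>2 * n * tanh t * \<Gamma> t * \<Gamma>1 t + 4 * n\<^sup>2 * s\<^sup>2 * (\<Gamma> t)\<^sup>2" for t
  define P2 where "P2 t = 2 * \<Gamma>1 t * U1 t + 4 * s\<^sup>2 * n * \<Gamma> t * (n - tanh t * U1 t)" for t
  define W where "W t = \<Gamma> t - G0" for t
  define E1 where "E1 t = (exp (U t - u0 t) - exp (u0 t - U t)) * (U1 t - k t)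
      + exp (- U t - u0 t) * (2 * W t * \<Gamma>1 t - (W t)\<^sup>2 * (U1 t + k t))" for t
  define E2 where "E2 t = (exp (U t - u0 t) + exp (u0 t - U t)) * (U1 t - k t)\<^sup>2
      + (exp (U t - u0 t) - exp (u0 t - U t)) * (exp (- 2 * u0 t) - exp (- 2 * U t) * Q t)
      + exp (- U t - u0 t) * (2 * (\<Gamma>1 t)\<^sup>2 + 2 * W t * P2 t - 4 * W t * \<Gamma>1 t * (U1 t + k t)
        + (W t)\<^sup>2 * (U1 t + k t)\<^sup>2 + (W t)\<^sup>2 * (exp (- 2 * u0 t) + exp (- 2 * U t) * Q t))" for t
  \<comment> \<open>\<open>\<psi>\<close> compensates the defect: its second derivative dominates
    \<open>n^2 / sinh t\<close>, which is of order \<open>1/t\<close> at \<open>0\<close>, while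
    \<open>\<psi>\<close> itself is bounded and tends to \<open>0\<close> there.\<close>
  define \<psi> where "\<psi> t = - (8 * n\<^sup>2 * sqrt (1 - exp (- t)))" for t :: real
  define \<psi>1 where "\<psi>1 t = - (4 * n\<^sup>2 * exp (- t) / sqrt (1 - exp (- t)))" for t :: real
  define \<psi>2 where "\<psi>2 t = 4 * n\<^sup>2 * exp (- t) / sqrt (1 - exp (- t))
      + 2 * n\<^sup>2 * exp (- t) * exp (- t) / ((1 - exp (- t)) * sqrt (1 - exp (- t)))" for t :: real
  have E_eq: "E t = exp (U t - u0 t) + exp (u0 t - U t) + (W t)\<^sup>2 * exp (- U t - u0 t)" for t
    unfolding E_def W_def G0_def ..
  have tp: "t > 0" if "t \<ge> t0" for t using that t0 by simp
  have sh: "sinh (n * t) > 0" if "t > 0" for t :: real using that n by simp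
  have du0: "(u0 has_real_derivative k t) (at t)" if "t > 0" for t :: real
    unfolding u0_def k_def using sh[OF that] n that
    by (auto intro!: derivative_eq_intros simp: field_simps)
  have eu0: "exp (- 2 * u0 t) = n\<^sup>2 / (sinh (n * t))\<^sup>2" "exp (- u0 t) = n / sinh (n * t)" if "t > 0" for t :: real
  proof -
    show 1: "exp (- u0 t) = n / sinh (n * t)"
      unfolding u0_def exp_minus using sh[OF that] n by simp
    have "exp (- 2 * u0 t) = (exp (- u0 t))\<^sup>2" by (simp flip: exp_double)
    then show "exp (- 2 * u0 t) = n\<^sup>2 / (sinh (n * t))\<^sup>2" unfolding 1 by (simp add: power_divide)
  qed
  have dk: "(k has_real_derivative - exp (- 2 * u0 t)) (at t)" if "t > 0" for t :: real
  proof -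
    have "(k has_real_derivative (n * (sinh (n * t) * n) * sinh (n * t) - n * cosh (n * t) * (cosh (n * t) * n)) / (sinh (n * t) * sinh (n * t))) (at t)"
      unfolding k_def using sh[OF that] by (auto intro!: derivative_eq_intros)
    moreover have "n * (sinh (n * t) * n) * sinh (n * t) - n * cosh (n * t) * (cosh (n * t) * n) = - (real n)\<^sup>2"
      using cosh_square_eq[of "n * t"] by (simp add: power2_eq_square algebra_simps)
    ultimately show ?thesis unfolding eu0(1)[OF that] by (simp add: power2_eq_square)
  qed
  have dE: "(E has_real_derivative E1 t) (at t)" if "t \<ge> t0" for t
    unfolding E_eq[abs_def] E1_def W_def
    by (rule derivative_eq_intros dU[OF that] dG[OF that] du0[OF tp[OF that]] refl)+ (simp add: algebra_simps power2_eq_square)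
  have dE1: "(E1 has_real_derivative E2 t) (at t)" if "t \<ge> t0" for t
    unfolding E1_def[abs_def] E2_def W_def
    by (rule derivative_eq_intros dU[OF that] dG[OF that] dU1[OF that, folded Q_def] dG1[OF that, folded P2_def] du0[OF tp[OF that]] dk[OF tp[OF that]] refl)+
      (simp add: algebra_simps power2_eq_square)
  have Epos: "E t > 0" for t unfolding E_eq by (intro add_pos_nonneg) (auto intro: add_pos_pos)
  have x: "0 < 1 - exp (- t)" if "t > 0" for t :: real using that by simp
  have d\<psi>: "(\<psi> has_real_derivative \<psi>1 t) (at t)" if "t > 0" for t :: real
    unfolding \<psi>_def[abs_def] \<psi>1_def using x[OF that] by (auto intro!: derivative_eq_intros simp: field_simps)
  have d\<psi>1: "(\<psi>1 has_real_derivative \<psi>2 t) (at t)" if "t > 0" for t :: real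
  proof -
    have "(\<psi>1 has_real_derivative - ((4 * n\<^sup>2 * - exp (- t) * sqrt (1 - exp (- t)) - 4 * n\<^sup>2 * exp (- t) * (exp (- t) * (inverse (sqrt (1 - exp (- t))) / 2)))
        / (sqrt (1 - exp (- t)) * sqrt (1 - exp (- t))))) (at t)"
      unfolding \<psi>1_def[abs_def] using x[OF that]
      by (auto intro!: derivative_eq_intros)
    moreover have "- ((4 * n\<^sup>2 * - z * r - 4 * n\<^sup>2 * z * (z * (inverse r / 2))) / (r * r))
       = 4 * n\<^sup>2 * z / r + 2 * n\<^sup>2 * z * z / (r * r * r)" if "r > 0" for z r :: real
      using that by (simp add: field_simps)
    moreover have "0 < sqrt (1 - exp (- t))" using x[OF that] by simp
    moreover have "4 * n\<^sup>2 * exp (- t) / sqrt (1 - exp (- t)) + 2 * n\<^sup>2 * exp (- t) * exp (- t) /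
       (sqrt (1 - exp (- t)) * sqrt (1 - exp (- t)) * sqrt (1 - exp (- t))) = \<psi>2 t"
      unfolding \<psi>2_def using x[OF that] by simp
    ultimately show ?thesis by metis
  qed
  have lower: "E t * E2 t - (E1 t)\<^sup>2 \<ge> - \<psi>2 t * (E t)\<^sup>2" if t: "t \<ge> t0" for t
  proof -
    define m i e where "m = exp ((U t - u0 t) / 2)" and "i = exp ((u0 t - U t) / 2)" and "e = exp (- (U t + u0 t) / 2)"
    have sq: "m\<^sup>2 = exp (U t - u0 t)" "i\<^sup>2 = exp (u0 t - U t)" "e\<^sup>2 = exp (- U t - u0 t)"
      "m * i = 1" "e * m = exp (- u0 t)" "m > 0" "e > 0"
      unfolding m_def i_def e_def by (simp_all flip: exp_double exp_add add: field_simps)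
    have sq2: "exp (- U t - u0 t) * exp (U t - u0 t) = exp (- 2 * u0 t)" "exp (- U t - u0 t) * exp (u0 t - U t) = exp (- 2 * U t)"
      by (simp_all flip: exp_add)
    have T: "(tanh t)\<^sup>2 \<le> 1" using tanh_real_bounds[of t] by (simp add: abs_square_le_1 abs_le_iff)
    have s1: "s\<^sup>2 \<le> 1" using s power_mono[of s 1 2] by simp
    have G0: "2 * real n * s * G0 = 1" unfolding G0_def using n s by simp
    have K: "E t * E2 t - (E1 t)\<^sup>2 \<ge> - (2 * s * (e * m) * \<bar>n - tanh t * k t\<bar>) * (E t)\<^sup>2"
      using kato[OF sq(4,6,7) T _ s1 G0, where W = "W t" and P = "\<Gamma>1 t" and U = "U1 t" and k = "k t"] s(1)
      unfolding sq(1-3) sq2 E_eq E1_def E2_def Q_def P2_def W_def by simp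
    have t': "t > 0" using tp[OF t] .
    have "0 \<le> n - tanh t * k t \<and> n - tanh t * k t \<le> n"
    proof -
      have "t \<le> n * t" using t' n by simp
      then have "tanh t \<le> tanh (n * t)" by simp
      moreover have "tanh (n * t) > 0" "tanh t > 0" using t' n by simp_all
      ultimately have r: "0 \<le> tanh t / tanh (n * t)" "tanh t / tanh (n * t) \<le> 1" by auto
      have "tanh t * k t = n * (tanh t / tanh (n * t))" unfolding k_def tanh_def by simp
      moreover have "0 \<le> n * (tanh t / tanh (n * t))" "n * (tanh t / tanh (n * t)) \<le> real n * 1"
        using r by (intro mult_nonneg_nonneg mult_left_mono; simp)+
      ultimately show ?thesis by linarith
    qed
    then have N: "\<bar>n - tanh t * k t\<bar> \<le> n" by simp
    define z where "z = exp (- t)"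
    have z: "0 < z" "z < 1" unfolding z_def using t' by auto
    define r where "r = sqrt (1 - z)"
    have r: "0 < r" "r \<le> 1" "r * r = 1 - z" unfolding r_def using z by auto
    have "2 * s * (e * m) * \<bar>n - tanh t * k t\<bar> \<le> 1 * (e * m) * n"
      using s sq(6,7) N by (intro mult_mono) auto
    also have "\<dots> = n\<^sup>2 / sinh (n * t)" unfolding sq(5) eu0(2)[OF t'] by (simp add: power2_eq_square)
    also have "\<dots> \<le> n\<^sup>2 / sinh t"
    proof (rule divide_left_mono)
      show "sinh t \<le> sinh (n * t)" using t' n by simp
    qed (use t' sh[OF t'] in auto)
    also have "\<dots> = n\<^sup>2 * (2 * z / ((1 - z) * (1 + z)))"
    proof -
      have "sinh t = (1 - z * z) / (2 * z)"
        unfolding sinh_field_def z_def using exp_minus_inverse[of t] by (simp add: field_simps)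
      then show ?thesis using z by (simp add: algebra_simps)
    qed
    also have "\<dots> \<le> n\<^sup>2 * (4 * z / r + 2 * z * z / ((1 - z) * r))"
    proof (rule mult_left_mono)
      \<comment> \<open>After clearing denominators this is
        \<open>1 \<le> (2 - z) * (1 + z)\<close>.\<close>
      have "2 * z / ((1 - z) * (1 + z)) \<le> 4 * z + 2 * z * z / (1 - z)"
      proof -
        have zz: "(1 - z) * (1 + z) > 0" "1 - z > 0" using z by auto
        have eq: "4 * z + 2 * z * z / (1 - z) = 2 * z * (2 - z) * (1 + z) / ((1 - z) * (1 + z))"
          using zz z by (simp add: field_simps)
        have "2 * z \<le> 2 * z * (2 - z) * (1 + z)"
        proof -
          have "z * z \<le> 1 * 1" using z by (intro mult_mono) auto
          then have "1 \<le> (2 - z) * (1 + z)" using z by (simp add: algebra_simps)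
          then have "2 * z * 1 \<le> 2 * z * ((2 - z) * (1 + z))" using z by (intro mult_left_mono) auto
          then show ?thesis by (simp add: mult.assoc)
        qed
        then show ?thesis unfolding eq by (rule divide_right_mono) (use zz in simp)
      qed
      also have "\<dots> \<le> 4 * z / r + 2 * z * z / ((1 - z) * r)"
      proof (rule add_mono)
        show "4 * z \<le> 4 * z / r" using r z by (simp add: le_divide_eq)
        have "(1 - z) * r \<le> (1 - z) * 1" using r z by (intro mult_left_mono) auto
        then show "2 * z * z / (1 - z) \<le> 2 * z * z / ((1 - z) * r)"
          using r z by (intro divide_left_mono) auto
      qed
      finally show "2 * z / ((1 - z) * (1 + z)) \<le> 4 * z / r + 2 * z * z / ((1 - z) * r)" .
    qed simp
    also have "\<dots> = \<psi>2 t" unfolding \<psi>2_def r_def z_def by (simp add: distrib_left mult_ac)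
    finally have "2 * s * (e * m) * \<bar>n - tanh t * k t\<bar> * (E t)\<^sup>2 \<le> \<psi>2 t * (E t)\<^sup>2" by (rule mult_right_mono) simp
    then show ?thesis using K unfolding mult_minus_left by linarith
  qed
  have "(\<lambda>t. ln (E t) + \<psi> t) t \<le> (\<lambda>t. ln (E t) + \<psi> t) t0"
  proof (rule convex_bounded_antimono[OF _ _ _ _ t])
    fix u assume u: "u \<ge> t0"
    show "((\<lambda>t. ln (E t) + \<psi> t) has_real_derivative E1 u / E u + \<psi>1 u) (at u)"
      using dE[OF u] d\<psi>[OF tp[OF u]] Epos[of u] by (auto intro!: derivative_eq_intros)
    show "((\<lambda>t. E1 t / E t + \<psi>1 t) has_real_derivative (E2 u * E u - E1 u * E1 u) / (E u * E u) + \<psi>2 u) (at u)"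
      using dE[OF u] dE1[OF u] d\<psi>1[OF tp[OF u]] Epos[of u] by (auto intro!: derivative_eq_intros)
    have "(E2 u * E u - E1 u * E1 u) / (E u * E u) \<ge> - \<psi>2 u"
      using lower[OF u] Epos[of u] by (simp add: le_divide_eq power2_eq_square mult_ac)
    then show "0 \<le> (E2 u * E u - E1 u * E1 u) / (E u * E u) + \<psi>2 u" by linarith
    have "ln (E u) \<le> ln B" using B[OF u] Epos[of u] by simp
    moreover have "\<psi> u \<le> 0" unfolding \<psi>_def using tp[OF u] by simp
    ultimately show "ln (E u) + \<psi> u \<le> ln B" by linarith
  qed
  moreover have "\<psi> t0 \<le> 0" unfolding \<psi>_def using t0 by simp
  ultimately have "ln (E t) \<le> ln (E t0) - \<psi> t" by linarith
  then have "exp (ln (E t)) \<le> exp (ln (E t0) - \<psi> t)" by simp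
  then show ?thesis using Epos by (simp add: exp_diff exp_minus \<psi>_def field_simps exp_add)
qed

text \<open>The distance of the solution, moved along the scaling symmetry \<open>(h, G) \<mapsto> (h + \<alpha>, e\<^sup>\<alpha> G)\<close>, to the
  reference \<open>e\<^sup>h = (1 - w\<^sup>n) / 2n\<close>, \<open>G = 1 / 2ns\<close>: it is \<open>tr (H\<^sub>0\<^sup>-\<^sup>1 H)\<close> for the associated Hermitian
  metrics, so it is at least \<open>2\<close>.\<close>

definition trace_dist :: "nat \<Rightarrow> real \<Rightarrow> real \<Rightarrow> (real \<Rightarrow> real) \<Rightarrow> (real \<Rightarrow> real) \<Rightarrow> real \<Rightarrow> real" where
  "trace_dist n s \<alpha> h G w = exp (h w + \<alpha>) * (2 * n / (1 - w ^ n)) + (1 - w ^ n) / (2 * n) * exp (- h w - \<alpha>)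
     + (exp \<alpha> * G w - 1 / (2 * n * s))\<^sup>2 * (w ^ n * (2 * n / (1 - w ^ n)) * exp (- h w - \<alpha>))"

section \<open>Decay of the trace distance along a profile\<close>

lemma exp_power_eq:
  fixes t :: real
  shows "exp (- 2 * t) ^ n = exp (- 2 * (n * t))"
  by (simp flip: exp_of_nat_mult)

lemma sinh_eq_power:
  fixes t :: real
  assumes "n \<ge> 1" "t > 0"
  shows "sinh (n * t) / n = exp (n * t) * ((1 - exp (- 2 * t) ^ n) / (2 * n))"
proof -
  have "exp (n * t) * exp (- 2 * t) ^ n = exp (- (n * t))"
    using exp_power_eq[of t n] by (simp flip: exp_add)
  then show ?thesis using assms unfolding sinh_field_def by (simp add: field_simps)
qed

context knot_profile
begin

lemma deriv_wq:
  assumes w: "0 < w" "w < b"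
  shows "((\<lambda>w. w * q w) has_real_derivative src_q n s p G q w - n * q w) (at w)"
proof -
  obtain m where m: "n = Suc m" using n2 by (cases n) auto
  have w': "w \<in> {a<..<b}" using w ab by auto
  have d: "((\<lambda>w. w ^ n) has_real_derivative n * w ^ m) (at w)"
    using DERIV_pow[of n w] m by simp
  have "((\<lambda>w. w ^ Suc n * q w / w ^ n) has_real_derivative
     (w ^ n * src_q n s p G q w * w ^ n - w ^ Suc n * q w * (n * w ^ m)) / (w ^ n * w ^ n)) (at w)"
    by (rule DERIV_divide[OF deriv_Q[OF w'] d]) (use w in simp)
  moreover have "(w ^ n * src_q n s p G q w * w ^ n - w ^ Suc n * q w * (n * w ^ m)) / (w ^ n * w ^ n) = src_q n s p G q w - n * q w"
    using w unfolding m by (simp add: field_simps)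
  ultimately have "((\<lambda>w. w ^ Suc n * q w / w ^ n) has_real_derivative src_q n s p G q w - n * q w) (at w)" by simp
  then show ?thesis
    by (rule has_field_derivative_transform_within_open[of _ _ _ "{0<..}"]) (use w in auto)
qed

text \<open>This is \<open>comparison\<close> in the variable \<open>w = exp (- 2 t)\<close>, where
  \<open>exp (- t) = sqrt w\<close>. The upper bound it requires as \<open>t\<close> tends to
  infinity comes from continuity of the profile up to \<open>w = 0\<close>; here regularity at the
  center enters.\<close>

lemma trace_dist_decay:
  assumes W: "0 < W" "W < b" "W < 1" and w: "0 < w" "w \<le> W"
  shows "trace_dist n s \<alpha> h G w \<le> trace_dist n s \<alpha> h G W * exp (8 * n\<^sup>2 * sqrt (1 - sqrt w))"
proof -
  define U where "U t = n * t + h (exp (- 2 * t)) + \<alpha>" for t :: real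
  define U1 where "U1 t = n - 2 * (exp (- 2 * t) * p (exp (- 2 * t)))" for t
  define \<Gamma> where "\<Gamma> t = exp \<alpha> * G (exp (- 2 * t))" for t
  define \<Gamma>1 where "\<Gamma>1 t = - 2 * exp \<alpha> * (exp (- 2 * t) * q (exp (- 2 * t)))" for t
  define u0 where "u0 t = ln (sinh (n * t) / n)" for t :: real
  define E where "E t = exp (U t - u0 t) + exp (u0 t - U t) + (\<Gamma> t - 1 / (2 * n * s))\<^sup>2 * exp (- U t - u0 t)" for t :: real
  have ew: "exp (- 2 * (- ln v / 2)) = v" if "v > 0" for v :: real using that by simp
  define t0 where "t0 = - ln W / 2"
  define t where "t = - ln w / 2"
  have t0: "t0 > 0" unfolding t0_def using W by simp
  have t: "t0 \<le> t" unfolding t0_def t_def using w W by simp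
  have wr: "0 < exp (- 2 * u)" "exp (- 2 * u) \<le> W" "exp (- 2 * u) < b" "exp (- 2 * u) \<in> {a<..<b}" "exp (- 2 * u) < 1" if "u \<ge> t0" for u
  proof -
    have "exp (- 2 * u) \<le> exp (- 2 * t0)" using that by simp
    then show "exp (- 2 * u) \<le> W" unfolding t0_def ew[OF W(1)] .
    then show "exp (- 2 * u) < b" "exp (- 2 * u) < 1" using W by linarith+
    then show "exp (- 2 * u) \<in> {a<..<b}" using ab by (auto intro: less_trans[of _ 0])
  qed simp
  have dw: "((\<lambda>t. exp (- 2 * t)) has_real_derivative - 2 * exp (- 2 * u)) (at u)" for u :: real
    by (auto intro!: derivative_eq_intros)
  have tanh: "tanh u = tt (exp (- 2 * u))" for u :: real
    unfolding tanh_real_altdef tt_def by simp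
  have E_eq: "E u = trace_dist n s \<alpha> h G (exp (- 2 * u))" if u: "u > 0" for u :: real
  proof -
    define v where "v = exp (- 2 * u)"
    have v: "0 < v" "v < 1" unfolding v_def using u by auto
    have vn: "v ^ n < 1" using v n2 by (simp add: power_less_one_iff)
    have eu0: "exp (u0 u) = exp (n * u) * ((1 - v ^ n) / (2 * n))"
    proof -
      have "0 < sinh (n * u) / n" using u n2 by simp
      then have "exp (u0 u) = sinh (n * u) / n" unfolding u0_def by (rule exp_ln)
      then show ?thesis using sinh_eq_power[of n u] n2 u unfolding v_def by simp
    qed
    have U: "U u = n * u + h v + \<alpha>" unfolding U_def v_def ..
    have en: "exp (n * u) * exp (n * u) * v ^ n = 1"
      unfolding v_def exp_power_eq by (simp flip: exp_add)
    define x z zi y where "x = exp (n * u)" and "z = exp (h v + \<alpha>)" and "zi = exp (- h v - \<alpha>)" and "y = 1 - v ^ n"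
    have pos: "x > 0" "z > 0" "y > 0" "real n > 0" "z * zi = 1" "x * x * v ^ n = 1"
      using vn n2 en by (simp_all add: x_def z_def zi_def y_def flip: exp_add)
    have eU: "exp (U u) = x * z" unfolding U x_def z_def by (simp add: add.assoc flip: exp_add)
    have zi: "zi = 1 / z" using pos by (simp add: field_simps)
    have vx: "v ^ n = 1 / (x * x)" using pos by (simp add: field_simps)
    have 1: "exp (U u - u0 u) = exp (h v + \<alpha>) * (2 * n / (1 - v ^ n))"
      unfolding exp_diff eu0 eU x_def[symmetric] y_def[symmetric] z_def[symmetric] using pos by (simp add: field_simps)
    have 2: "exp (u0 u - U u) = (1 - v ^ n) / (2 * n) * exp (- h v - \<alpha>)"
      unfolding exp_diff[of "u0 u"] eu0 eU x_def[symmetric] y_def[symmetric] zi_def[symmetric] zi using pos by (simp add: field_simps)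
    have "exp (- U u - u0 u) = 1 / (exp (U u) * exp (u0 u))" by (simp add: exp_diff exp_minus field_simps)
    also have "\<dots> = 1 / (x * z * (x * (y / (2 * n))))"
      unfolding eu0 eU x_def y_def by simp
    also have "\<dots> = 1 / (x * x) * (2 * n / y) * (1 / z)" using pos by (simp add: field_simps)
    also have "\<dots> = v ^ n * (2 * n / y) * zi" unfolding zi vx ..
    finally have 3: "exp (- U u - u0 u) = v ^ n * (2 * n / (1 - v ^ n)) * exp (- h v - \<alpha>)"
      unfolding y_def zi_def .
    show ?thesis unfolding E_def trace_dist_def v_def[symmetric] 1 2 3 \<Gamma>_def by (simp add: v_def)
  qed
  have cont: "continuous_on {0..W} (trace_dist n s \<alpha> h G)"
  proof -
    have "1 - v ^ n \<noteq> 0" if "v \<in> {0..W}" for v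
    proof -
      have "v ^ n < 1" using that W n2 by (simp add: power_less_one_iff)
      then show ?thesis by simp
    qed
    then show ?thesis unfolding trace_dist_def[abs_def] using W ab n2
      by (intro continuous_intros cont_on) auto
  qed
  have "bounded (trace_dist n s \<alpha> h G ` {0..W})"
    by (intro compact_imp_bounded compact_continuous_image cont) simp
  then have "\<exists>B. \<forall>v\<in>{0..W}. trace_dist n s \<alpha> h G v \<le> B"
    unfolding bounded_iff by (auto simp: abs_le_iff)
  then obtain B where B: "\<And>v. v \<in> {0..W} \<Longrightarrow> trace_dist n s \<alpha> h G v \<le> B" by blast
  have main: "E t \<le> E t0 * exp (8 * n\<^sup>2 * sqrt (1 - exp (- t)))"
    unfolding E_def u0_def
  proof (rule comparison[where ?U1.0 = U1 and ?\<Gamma>1.0 = \<Gamma>1 and B = B])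
    show "1 \<le> n" "0 < s" "s \<le> 1/2" using n2 s by auto
    show "0 < t0" "t0 \<le> t" by fact+
    fix u assume u: "u \<ge> t0"
    define v where "v = exp (- 2 * u)"
    have v: "0 < v" "v < b" "v \<in> {a<..<b}" using wr[OF u] unfolding v_def by auto
    have dv: "((\<lambda>t. exp (- 2 * t)) has_real_derivative - 2 * v) (at u)" using dw unfolding v_def .
    have dh: "((\<lambda>t. h (exp (- 2 * t))) has_real_derivative p v * (- 2 * v)) (at u)"
      by (rule DERIV_chain2[where f = h and g = "\<lambda>t. exp (- 2 * t)", OF _ dv])
        (use deriv_h[OF v(3)] in \<open>simp add: v_def\<close>)
    then show "(U has_real_derivative U1 u) (at u)"
      unfolding U_def[abs_def] U1_def v_def[symmetric] by (auto intro!: derivative_eq_intros)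
    have dG: "((\<lambda>t. G (exp (- 2 * t))) has_real_derivative q v * (- 2 * v)) (at u)"
      by (rule DERIV_chain2[where f = G and g = "\<lambda>t. exp (- 2 * t)", OF _ dv])
        (use deriv_G[OF v(3)] in \<open>simp add: v_def\<close>)
    then show "(\<Gamma> has_real_derivative \<Gamma>1 u) (at u)"
      unfolding \<Gamma>_def[abs_def] \<Gamma>1_def v_def[symmetric] by (auto intro!: derivative_eq_intros)
    have dp: "((\<lambda>t. exp (- 2 * t) * p (exp (- 2 * t))) has_real_derivative src_p n s h G q v * (- 2 * v)) (at u)"
      by (rule DERIV_chain2[where f = "\<lambda>w. w * p w" and g = "\<lambda>t. exp (- 2 * t)", OF _ dv])
        (use deriv_P[OF v(3)] in \<open>simp add: v_def\<close>)
    have dU1: "(U1 has_real_derivative 4 * v * src_p n s h G q v) (at u)"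
      unfolding U1_def[abs_def] by (rule DERIV_cong[OF DERIV_diff[OF DERIV_const DERIV_cmult[OF dp]]]) simp
    have e2U: "exp (- 2 * U u) * (exp \<alpha>)\<^sup>2 = v ^ n * exp (- 2 * h v)"
    proof -
      have "v ^ n = exp (- 2 * (n * u))" unfolding v_def by (rule exp_power_eq)
      then show ?thesis unfolding U_def v_def[symmetric]
        by (simp add: algebra_simps flip: exp_double exp_add)
    qed
    have pot_eq: "(\<Gamma>1 u)\<^sup>2 - 4 * s\<^sup>2 * n * tanh u * \<Gamma> u * \<Gamma>1 u + 4 * n\<^sup>2 * s\<^sup>2 * (\<Gamma> u)\<^sup>2 = 4 * (exp \<alpha>)\<^sup>2 * pot n s (tt v) (G v) (v * q v)"
      unfolding tanh \<Gamma>1_def \<Gamma>_def v_def[symmetric] pot_def by (simp add: power2_eq_square algebra_simps)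
    have vn: "v * v ^ (n - 1) = v ^ n" using n2 by (simp flip: power_Suc)
    have src_U: "4 * v * src_p n s h G q v = - (exp (- 2 * U u) * (4 * (exp \<alpha>)\<^sup>2 * pot n s (tt v) (G v) (v * q v)))"
    proof -
      have "4 * v * src_p n s h G q v = - (4 * ((v * v ^ (n - 1)) * exp (- 2 * h v)) * pot n s (tt v) (G v) (v * q v))"
        unfolding src_p_pot by simp
      also have "\<dots> = - (4 * (exp (- 2 * U u) * (exp \<alpha>)\<^sup>2) * pot n s (tt v) (G v) (v * q v))"
        unfolding vn e2U ..
      finally show ?thesis by (simp add: mult_ac)
    qed
    show "(U1 has_real_derivative - (exp (- 2 * U u) *
        ((\<Gamma>1 u)\<^sup>2 - 4 * s\<^sup>2 * n * tanh u * \<Gamma> u * \<Gamma>1 u + 4 * n\<^sup>2 * s\<^sup>2 * (\<Gamma> u)\<^sup>2))) (at u)"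
      using dU1 unfolding pot_eq src_U .
    have dq: "((\<lambda>t. exp (- 2 * t) * q (exp (- 2 * t))) has_real_derivative (src_q n s p G q v - n * q v) * (- 2 * v)) (at u)"
      by (rule DERIV_chain2[where f = "\<lambda>w. w * q w" and g = "\<lambda>t. exp (- 2 * t)", OF _ dv])
        (use deriv_wq[OF v(1,2)] in \<open>simp add: v_def\<close>)
    have "(\<Gamma>1 has_real_derivative - 2 * exp \<alpha> * ((src_q n s p G q v - n * q v) * (- 2 * v))) (at u)"
      unfolding \<Gamma>1_def[abs_def] by (rule DERIV_cmult[OF dq])
    moreover have "- 2 * exp \<alpha> * ((src_q n s p G q v - n * q v) * (- 2 * v)) = 2 * \<Gamma>1 u * U1 u + 4 * s\<^sup>2 * n * \<Gamma> u * (n - tanh u * U1 u)"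
    proof -
      have tv: "tt v * (1 + v) = 1 - v" unfolding tt_def using v by simp
      have eq: "2 * n * v / (1 + v) = n - n * tt v" unfolding tt_def using v by (simp add: field_simps)
      have "v * src_q n s p G q v = 2 * (v * q v) * (v * p v) + s\<^sup>2 * n * G v * (2 * n * v / (1 + v) + 2 * tt v * (v * p v))"
        unfolding src_q_def by (simp add: algebra_simps)
      then have "4 * exp \<alpha> * v * src_q n s p G q v = 4 * exp \<alpha> * (2 * (v * q v) * (v * p v) + s\<^sup>2 * n * G v * ((n - n * tt v) + 2 * tt v * (v * p v)))"
        unfolding eq by (simp only: mult.assoc)
      then show ?thesis
        unfolding tanh \<Gamma>1_def \<Gamma>_def U1_def v_def[symmetric] by (simp add: algebra_simps)
    qed
    ultimately show "(\<Gamma>1 has_real_derivative 2 * \<Gamma>1 u * U1 u + 4 * s\<^sup>2 * n * \<Gamma> u * (n - tanh u * U1 u)) (at u)" by simp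
    have "E u \<le> B" using E_eq[of u] u t0 B[of v] wr[OF u] unfolding v_def by simp
    then show "exp (U u - ln (sinh (n * u) / n)) + exp (ln (sinh (n * u) / n) - U u) + (\<Gamma> u - 1 / (2 * n * s))\<^sup>2 * exp (- U u - ln (sinh (n * u) / n)) \<le> B"
      unfolding E_def u0_def .
  qed
  have Et: "E t = trace_dist n s \<alpha> h G w" using E_eq[of t] t t0 ew[OF w(1)] unfolding t_def by simp
  have Et0: "E t0 = trace_dist n s \<alpha> h G W" using E_eq[of t0] t0 ew[OF W(1)] unfolding t0_def by simp
  have "(exp (- t))\<^sup>2 = w" using w unfolding t_def by (simp flip: exp_double)
  then have "exp (- t) = sqrt w" by (intro real_sqrt_unique[symmetric]) auto
  then show ?thesis using main unfolding Et Et0 by simp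
qed

end

subsection \<open>Profiles up to the boundary\<close>

text \<open>\<open>src_p\<close> is even and \<open>src_q\<close> is odd in the pair
  \<open>(G, q)\<close>.\<close>

lemma profile_neg:
  assumes "profile n s a b h p G q"
  shows "profile n s a b h p (\<lambda>w. - G w) (\<lambda>w. - q w)"
proof -
  have p: "src_p n s h (\<lambda>w. - G w) (\<lambda>w. - q w) = src_p n s h G q"
    by (rule ext) (simp add: src_p_def)
  have q: "src_q n s p (\<lambda>w. - G w) (\<lambda>w. - q w) = (\<lambda>w. - src_q n s p G q w)"
    by (rule ext) (simp add: src_q_def)
  show ?thesis
    using assms unfolding profile_def p q by (auto intro!: derivative_eq_intros continuous_intros)
qed

lemma power_lt_one: "0 \<le> w \<Longrightarrow> w < 1 \<Longrightarrow> n \<ge> 2 \<Longrightarrow> w ^ n < (1::real)"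
  by (simp add: power_less_one_iff)

lemma trace_dist_cont:
  assumes "profile n s a b h p G q" "n \<ge> 2" "W < b" "S \<subseteq> {0..W}"
  shows "continuous_on S (trace_dist n s \<alpha> h G)"
proof -
  have ab: "a < 0" "b \<le> 1" using assms(1) unfolding profile_def by auto
  have c: "continuous_on S h" "continuous_on S G"
    by (rule continuous_at_imp_continuous_on; use assms ab in \<open>force simp: profile_def intro: DERIV_isCont\<close>)+
  have "1 - v ^ n \<noteq> 0" if "v \<in> S" for v
    using power_lt_one[of v n] that assms ab by force
  then show ?thesis unfolding trace_dist_def[abs_def] using c assms(2)
    by (intro continuous_intros) auto
qed

text \<open>The three summands of the distance are nonnegative, so each is at most \<open>B\<close>.
  At \<open>w = 0\<close>, where \<open>h = 0\<close>, the first two confine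
  \<open>\<alpha>\<close>; then the second one at \<open>W\<close> bounds \<open>h W\<close> from
  below, and the third one bounds \<open>G^2 w^n\<close>.\<close>

lemma bounds_of_trace_dist:
  fixes n :: nat and s W B \<alpha> :: real
  assumes prof: "profile n s a b h p G q" and n: "n \<ge> 2" and s: "0 < s" "s \<le> 1/2" and W: "0 < W" "W < b"
    and h0: "h 0 = 0" and B: "B \<ge> 1" and td: "\<And>w. 0 < w \<Longrightarrow> w \<le> W \<Longrightarrow> trace_dist n s \<alpha> h G w \<le> B"
  shows "h W \<ge> - (ln (B\<^sup>2 / (1 - W ^ n)) + sqrt (4 * real n * B\<^sup>2 + 2 * B\<^sup>2 / s\<^sup>2))"
    and "0 \<le> w \<Longrightarrow> w \<le> W \<Longrightarrow> (G w)\<^sup>2 * w ^ n \<le> (ln (B\<^sup>2 / (1 - W ^ n)) + sqrt (4 * real n * B\<^sup>2 + 2 * B\<^sup>2 / s\<^sup>2))\<^sup>2"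
    and "\<bar>\<alpha>\<bar> \<le> ln (2 * real n * B)"
proof -
  interpret knot_profile n s a b h p G q by (unfold_locales; fact)
  have W1: "W < 1" using W ab by simp
  have td0: "trace_dist n s \<alpha> h G 0 \<le> B"
  proof (rule tendsto_upperbound[of "trace_dist n s \<alpha> h G" _ "at 0 within {0..W}"])
    have "continuous_on {0..W} (trace_dist n s \<alpha> h G)"
      by (rule trace_dist_cont[OF prof n W(2)]) simp
    then show "(trace_dist n s \<alpha> h G \<longlongrightarrow> trace_dist n s \<alpha> h G 0) (at 0 within {0..W})"
      using W by (simp add: continuous_on_def)
    show "\<forall>\<^sub>F x in at 0 within {0..W}. trace_dist n s \<alpha> h G x \<le> B"
      unfolding eventually_at_filter using td by (intro always_eventually) auto
    show "at 0 within {0..W} \<noteq> bot" using W by (simp add: trivial_limit_within islimpt_Icc)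
  qed
  have n1: "1 \<le> real n" using n by simp
  have wn: "0 < 1 - w ^ n" "1 - w ^ n \<le> 1" if "0 \<le> w" "w \<le> W" for w
    using power_lt_one[of w n] that W1 n by auto
  have parts: "exp (h w + \<alpha>) * (2 * real n / (1 - w ^ n)) \<le> B" "(1 - w ^ n) / (2 * real n) * exp (- h w - \<alpha>) \<le> B"
    "(exp \<alpha> * G w - 1 / (2 * real n * s))\<^sup>2 * (w ^ n * (2 * real n / (1 - w ^ n)) * exp (- h w - \<alpha>)) \<le> B"
    if w: "0 \<le> w" "w \<le> W" for w
  proof -
    have t: "trace_dist n s \<alpha> h G w \<le> B" using td[of w] td0 w by (cases "w = 0") auto
    have "0 \<le> exp (h w + \<alpha>) * (2 * real n / (1 - w ^ n))" "0 \<le> (1 - w ^ n) / (2 * real n) * exp (- h w - \<alpha>)"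
      "0 \<le> (exp \<alpha> * G w - 1 / (2 * real n * s))\<^sup>2 * (w ^ n * (2 * real n / (1 - w ^ n)) * exp (- h w - \<alpha>))"
      using wn[OF w] w by auto
    then show "exp (h w + \<alpha>) * (2 * real n / (1 - w ^ n)) \<le> B" "(1 - w ^ n) / (2 * real n) * exp (- h w - \<alpha>) \<le> B"
      "(exp \<alpha> * G w - 1 / (2 * real n * s))\<^sup>2 * (w ^ n * (2 * real n / (1 - w ^ n)) * exp (- h w - \<alpha>)) \<le> B"
      using t unfolding trace_dist_def by linarith+
  qed
  have e1: "2 * real n * exp \<alpha> \<le> B" using parts(1)[of 0] h0 W n by (simp add: power_0_left mult_ac)
  have e2: "exp (- \<alpha>) \<le> 2 * real n * B"
    using parts(2)[of 0] h0 W n by (simp add: power_0_left field_simps)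
  have "\<alpha> \<le> ln (2 * real n * B)"
  proof -
    have "exp \<alpha> \<le> 2 * real n * exp \<alpha>" using n1 by simp
    moreover have "B \<le> 2 * real n * B" using n1 B by simp
    ultimately have "exp \<alpha> \<le> 2 * real n * B" using e1 by linarith
    then show ?thesis using B n by (subst ln_ge_iff) auto
  qed
  moreover have "- \<alpha> \<le> ln (2 * real n * B)" using e2 B n by (subst ln_ge_iff) auto
  ultimately show "\<bar>\<alpha>\<bar> \<le> ln (2 * real n * B)" by linarith
  define K1 where "K1 = ln (B\<^sup>2 / (1 - W ^ n))"
  define K2 where "K2 = sqrt (4 * real n * B\<^sup>2 + 2 * B\<^sup>2 / s\<^sup>2)"
  have WW: "0 < 1 - W ^ n" "1 - W ^ n \<le> 1" using wn[of W] W by auto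
  have "1 - W ^ n \<le> B\<^sup>2" using WW B one_le_power[of B 2] by linarith
  then have K1: "0 \<le> K1" unfolding K1_def using WW by (simp add: le_divide_eq)
  have K2: "0 \<le> K2" "K2\<^sup>2 = 4 * real n * B\<^sup>2 + 2 * B\<^sup>2 / s\<^sup>2" unfolding K2_def by auto
  have "exp (- h W) \<le> B\<^sup>2 / (1 - W ^ n)"
  proof -
    have "(1 - W ^ n) * exp (- h W) = ((1 - W ^ n) / (2 * real n) * exp (- h W - \<alpha>)) * (2 * real n * exp \<alpha>)"
      using n by (simp add: exp_diff exp_minus field_simps)
    also have "\<dots> \<le> B * B" using parts(2)[of W] W e1 B WW by (intro mult_mono) auto
    finally show ?thesis using WW by (simp add: field_simps power2_eq_square)
  qed
  then have "- h W \<le> K1" unfolding K1_def using WW B by (subst ln_ge_iff) auto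
  then show "h W \<ge> - (ln (B\<^sup>2 / (1 - W ^ n)) + sqrt (4 * real n * B\<^sup>2 + 2 * B\<^sup>2 / s\<^sup>2))"
    using K2(1) unfolding K1_def[symmetric] K2_def[symmetric] by linarith
  assume w: "0 \<le> w" "w \<le> W"
  define D where "D = (exp \<alpha> * G w - 1 / (2 * real n * s))\<^sup>2 * w ^ n"
  have D0: "0 \<le> D" unfolding D_def using w by simp
  have "D * (2 * real n * exp (- \<alpha>)) \<le> B"
  proof -
    have "h w \<le> 0" using h_antimono[of 0 w] w W h0 by simp
    then have "exp (- \<alpha>) \<le> exp (- h w - \<alpha>)" by simp
    moreover have "2 * real n \<le> 2 * real n / (1 - w ^ n)" using wn[OF w] n by (simp add: le_divide_eq)
    ultimately have "D * (2 * real n * exp (- \<alpha>)) \<le> D * (2 * real n / (1 - w ^ n) * exp (- h w - \<alpha>))"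
      using D0 wn[OF w] by (intro mult_left_mono mult_mono) auto
    also have "\<dots> \<le> B" using parts(3)[OF w] unfolding D_def by (simp add: mult_ac)
    finally show ?thesis .
  qed
  moreover have "D \<le> D * (2 * real n)" using D0 n1 by (simp add: mult_le_cancel_left1)
  then have "D * exp (- \<alpha>) \<le> D * (2 * real n) * exp (- \<alpha>)" by (intro mult_right_mono) auto
  ultimately have D1: "D * exp (- \<alpha>) \<le> B" by (simp add: mult.assoc)
  have "(G w)\<^sup>2 * w ^ n = (exp (- \<alpha>))\<^sup>2 * (exp \<alpha> * G w)\<^sup>2 * w ^ n"
    by (simp add: power_mult_distrib flip: exp_double exp_add)
  also have "\<dots> \<le> (exp (- \<alpha>))\<^sup>2 * (2 * (exp \<alpha> * G w - 1 / (2 * real n * s))\<^sup>2 + 2 * (1 / (2 * real n * s))\<^sup>2) * w ^ n"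
  proof -
    have "x\<^sup>2 \<le> 2 * (x - y)\<^sup>2 + 2 * y\<^sup>2" for x y :: real
      using zero_le_power2[of "x - 2 * y"] by (simp add: power2_eq_square algebra_simps)
    then show ?thesis using w by (intro mult_right_mono mult_left_mono) auto
  qed
  also have "\<dots> = 2 * (exp (- \<alpha>) * (D * exp (- \<alpha>))) + 2 * ((exp (- \<alpha>) * (1 / (2 * real n * s)))\<^sup>2 * w ^ n)"
    unfolding D_def by (simp add: power2_eq_square algebra_simps)
  also have "\<dots> \<le> 2 * (exp (- \<alpha>) * B) + 2 * ((2 * real n * B * (1 / (2 * real n * s)))\<^sup>2 * 1)"
    using D1 e2 w W1 s B power_le_one[of w n]
    by (intro add_mono mult_left_mono mult_mono power_mono) auto
  also have "2 * real n * B * (1 / (2 * real n * s)) = B / s" using n s by simp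
  finally have G1: "(G w)\<^sup>2 * w ^ n \<le> 2 * (exp (- \<alpha>) * B) + 2 * B\<^sup>2 / s\<^sup>2" by (simp add: power_divide)
  have "exp (- \<alpha>) * B \<le> 2 * real n * B * B" using e2 B by (intro mult_right_mono) auto
  then have "(G w)\<^sup>2 * w ^ n \<le> K2\<^sup>2" using G1 unfolding K2(2) by (simp add: power2_eq_square)
  also have "\<dots> \<le> (K1 + K2)\<^sup>2" using K1 K2(1) by (intro power_mono) auto
  finally show "(G w)\<^sup>2 * w ^ n \<le> (ln (B\<^sup>2 / (1 - W ^ n)) + sqrt (4 * real n * B\<^sup>2 + 2 * B\<^sup>2 / s\<^sup>2))\<^sup>2"
    unfolding K1_def K2_def .
qed

theorem uniform_bound:
  fixes n :: nat and s W B :: real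
  assumes n: "n \<ge> 2" and s: "0 < s" "s \<le> 1/2" and W: "0 < W" "W < 1" and B: "B \<ge> 1"
  obtains N where "N > 0" "\<And>a b h p G q \<alpha> w. profile n s a b h p G q \<Longrightarrow> W < b \<Longrightarrow> h 0 = 0 \<Longrightarrow>
      (\<And>w. 0 < w \<Longrightarrow> w \<le> W \<Longrightarrow> trace_dist n s \<alpha> h G w \<le> B) \<Longrightarrow> 0 \<le> w \<Longrightarrow> w \<le> W \<Longrightarrow>
      \<bar>h w\<bar> \<le> N \<and> \<bar>p w\<bar> \<le> N \<and> \<bar>G w\<bar> \<le> N \<and> \<bar>q w\<bar> \<le> N"
proof -
  define K where "K = ln (B\<^sup>2 / (1 - W ^ n)) + sqrt (4 * real n * B\<^sup>2 + 2 * B\<^sup>2 / s\<^sup>2)"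
  have W1: "0 < 1 - W ^ n" "1 - W ^ n \<le> 1" using power_lt_one[of W n] W n by auto
  have "1 - W ^ n \<le> B\<^sup>2" using W1 B one_le_power[of B 2] by linarith
  then have "0 \<le> ln (B\<^sup>2 / (1 - W ^ n))" using W1 by (simp add: le_divide_eq)
  then have K: "K \<ge> 0" unfolding K_def by simp
  obtain N where N: "N > 0" "\<And>a b h p G q w. profile n s a b h p G q \<Longrightarrow> W < b \<Longrightarrow> h 0 = 0 \<Longrightarrow> h W \<ge> - K \<Longrightarrow>
      (\<And>w. 0 \<le> w \<Longrightarrow> w \<le> W \<Longrightarrow> (G w)\<^sup>2 * w ^ n \<le> K\<^sup>2) \<Longrightarrow> 0 \<le> w \<Longrightarrow> w \<le> W \<Longrightarrow>
      \<bar>h w\<bar> \<le> N \<and> \<bar>p w\<bar> \<le> N \<and> \<bar>G w\<bar> \<le> N \<and> \<bar>q w\<bar> \<le> N"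
    by (rule a_priori_bound[OF n s W K]) blast
  show ?thesis
  proof (rule that[OF N(1)])
    fix a b h p G q \<alpha> w
    assume A: "profile n s a b h p G q" "W < b" "h 0 = 0" "\<And>w. 0 < w \<Longrightarrow> w \<le> W \<Longrightarrow> trace_dist n s \<alpha> h G w \<le> B"
      and w: "0 \<le> w" "w \<le> W"
    note bd = bounds_of_trace_dist[OF A(1) n s W(1) A(2,3) B A(4), folded K_def]
    show "\<bar>h w\<bar> \<le> N \<and> \<bar>p w\<bar> \<le> N \<and> \<bar>G w\<bar> \<le> N \<and> \<bar>q w\<bar> \<le> N"
      by (rule N(2)[OF A(1-3) bd(1) bd(2) w])
  qed
qed

text \<open>This \<open>\<alpha>\<close> makes the first two summands equal to \<open>1\<close>,
  which leaves only the third. The quantity \<open>G * exp (- h)\<close> is invariant under the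
  scaling symmetry, so it is the one to compare with the reference.\<close>

lemma trace_dist_matched:
  assumes n: "n \<ge> 2" and s: "0 < s" and W: "0 < W" "W < 1"
    and \<alpha>: "\<alpha> = ln ((1 - W ^ n) / (2 * real n)) - h W" and \<rho>: "\<bar>G W * exp (- h W)\<bar> \<le> 1 / (s * (1 - W ^ n))"
  shows "trace_dist n s \<alpha> h G W \<le> 2 + (1 / (real n * s))\<^sup>2 * (W ^ n * (2 * real n / (1 - W ^ n))\<^sup>2)"
    and "G W * exp (- h W) = 1 / (s * (1 - W ^ n)) \<Longrightarrow> trace_dist n s \<alpha> h G W = 2"
proof -
  have W1: "0 < 1 - W ^ n" using power_lt_one[of W n] W n by auto
  have e: "exp \<alpha> = (1 - W ^ n) / (2 * real n) * exp (- h W)"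
    unfolding \<alpha> using W1 n by (simp add: exp_diff exp_minus field_simps)
  have e1: "exp (h W + \<alpha>) = (1 - W ^ n) / (2 * real n)" unfolding \<alpha> using W1 n by simp
  have e2: "exp (- h W - \<alpha>) = 2 * real n / (1 - W ^ n)"
    using arg_cong[OF e1, of inverse] by (simp add: exp_minus[symmetric])
  have td: "trace_dist n s \<alpha> h G W = 2 + ((1 - W ^ n) / (2 * real n) * (G W * exp (- h W)) - 1 / (2 * real n * s))\<^sup>2 * (W ^ n * (2 * real n / (1 - W ^ n))\<^sup>2)"
    unfolding trace_dist_def e1 e2 e using W1 n by (simp add: power2_eq_square mult_ac)
  show "trace_dist n s \<alpha> h G W = 2" if "G W * exp (- h W) = 1 / (s * (1 - W ^ n))"
    unfolding td that using W1 n s by simp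
  have "\<bar>(1 - W ^ n) / (2 * real n) * (G W * exp (- h W))\<bar> \<le> (1 - W ^ n) / (2 * real n) * (1 / (s * (1 - W ^ n)))"
    unfolding abs_mult[of "(1 - W ^ n) / (2 * real n)"] using W1 by (intro mult_mono \<rho>) auto
  also have "\<dots> = 1 / (2 * real n * s)" using W1 n s by simp
  finally have c: "\<bar>(1 - W ^ n) / (2 * real n) * (G W * exp (- h W))\<bar> \<le> 1 / (2 * real n * s)" .
  have "\<bar>x - y\<bar> \<le> 2 * y" if "\<bar>x\<bar> \<le> y" for x y :: real using that by linarith
  from this[OF c] have "\<bar>(1 - W ^ n) / (2 * real n) * (G W * exp (- h W)) - 1 / (2 * real n * s)\<bar> \<le> 1 / (real n * s)"
    by simp
  then have "\<bar>(1 - W ^ n) / (2 * real n) * (G W * exp (- h W)) - 1 / (2 * real n * s)\<bar>\<^sup>2 \<le> (1 / (real n * s))\<^sup>2"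
    by (intro power_mono) auto
  then show "trace_dist n s \<alpha> h G W \<le> 2 + (1 / (real n * s))\<^sup>2 * (W ^ n * (2 * real n / (1 - W ^ n))\<^sup>2)"
    unfolding td power2_abs using W by (intro add_left_mono mult_right_mono) auto
qed

text \<open>Shooting in \<open>m = G 0\<close>: as long as \<open>\<bar>G e\<^sup>-\<^sup>h\<bar>\<close> at \<open>W\<close> stays below the value of the reference, the a priori
  bound keeps \<open>m\<close> below \<open>N\<close>, and a clopen argument on \<open>{0..N + 1}\<close> shows that it cannot stay below.\<close>

theorem exists_matched:
  fixes n :: nat and s W :: real
  assumes n: "n \<ge> 2" and s: "0 < s" "s \<le> 1/2" and W: "0 < W" "W < 1"
  obtains a b h p G q \<alpha> where "profile n s a b h p G q" "W < b" "h 0 = 0" "trace_dist n s \<alpha> h G W = 2"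
proof -
  \<comment> \<open>\<open>B0\<close> bounds the distance at \<open>W\<close> while
    \<open>|\<rho>| \<le> \<rho>0\<close>, and \<open>exp (8 n^2)\<close> is the largest loss in
    \<open>trace_dist_decay\<close>.\<close>
  define B0 where "B0 = 2 + (1 / (real n * s))\<^sup>2 * (W ^ n * (2 * real n / (1 - W ^ n))\<^sup>2)"
  define B where "B = B0 * exp (8 * n\<^sup>2)"
  define \<rho>0 where "\<rho>0 = 1 / (s * (1 - W ^ n))"
  have W1: "0 < 1 - W ^ n" using power_lt_one[of W n] W n by auto
  have \<rho>0: "\<rho>0 > 0" unfolding \<rho>0_def using s W1 by simp
  have B0: "B0 \<ge> 2" unfolding B0_def using W by simp
  have "2 * 1 \<le> B0 * exp (8 * n\<^sup>2)" using B0 by (intro mult_mono) auto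
  then have B: "B \<ge> 1" unfolding B_def by simp
  obtain N where N: "N > 0" "\<And>a b h p G q \<alpha> w. profile n s a b h p G q \<Longrightarrow> W < b \<Longrightarrow> h 0 = 0 \<Longrightarrow>
      (\<And>w. 0 < w \<Longrightarrow> w \<le> W \<Longrightarrow> trace_dist n s \<alpha> h G w \<le> B) \<Longrightarrow> 0 \<le> w \<Longrightarrow> w \<le> W \<Longrightarrow>
      \<bar>h w\<bar> \<le> N \<and> \<bar>p w\<bar> \<le> N \<and> \<bar>G w\<bar> \<le> N \<and> \<bar>q w\<bar> \<le> N"
    by (rule uniform_bound[OF n s W B]) blast
  have W': "0 < (1 + W) / 2" "(1 + W) / 2 < 1" "W < (1 + W) / 2" using W by auto
  have N2: "N + 2 > 0" using N(1) by simp
  obtain X :: "real \<Rightarrow> nat \<Rightarrow> real \<Rightarrow> real" and \<Lambda> \<eta> :: real where X: "\<eta> > 0" "\<eta> \<le> 1" "\<And>m j. continuous_on UNIV (X m j)"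
    "\<And>m m' i w. \<bar>X m i w - X m' i w\<bar> \<le> \<bar>m - m'\<bar> * (2 * exp (\<Lambda> * \<bar>w\<bar>))"
    "\<And>m. X m 0 0 = 0" "\<And>m. X m 2 0 = m" "\<And>j w. X 0 j w = 0" "\<And>m j w. j \<ge> 4 \<Longrightarrow> X m j w = 0"
    "\<And>m a b. -((1 + W) / 2) \<le> a \<Longrightarrow> a < 0 \<Longrightarrow> 0 < b \<Longrightarrow> b \<le> (1 + W) / 2 \<Longrightarrow>
        (\<And>j w. w \<in> {a<..<b} \<Longrightarrow> \<bar>X m j w\<bar> \<le> N + 2) \<Longrightarrow>
        profile n s a b (X m 0) (X m 1) (X m 2) (\<lambda>w. X m 3 w / \<eta>)"
    by (rule cutoff_family[OF n W'(1,2) N2, of s]) blast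
  \<comment> \<open>Three nested levels: the a priori bound yields \<open>N\<close>, small changes
    of \<open>m\<close> stay within \<open>N + 1\<close>, and the truncation acts only beyond
    \<open>N + 2\<close>. So a truncated solution within \<open>N + 1\<close> is a true one slightly
    beyond \<open>[0, W]\<close>, and the a priori bound then puts it within
    \<open>N\<close>.\<close>
  define bx where "bx m c \<longleftrightarrow> (\<forall>j. \<forall>w\<in>{0..W}. \<bar>X m j w\<bar> \<le> c)" for m c
  define \<rho> where "\<rho> m = X m 2 W * exp (- X m 0 W)" for m
  have prof: "\<exists>a b. W < b \<and> profile n s a b (X m 0) (X m 1) (X m 2) (\<lambda>w. X m 3 w / \<eta>)" if m: "bx m (N + 1)" for m
  proof -
    \<comment> \<open>Only four components are nontrivial, so finitely many strict inequalities
      describe an open set that contains \<open>[0, W]\<close> and hence a little more on both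
      sides.\<close>
    define S where "S = {w. \<bar>X m 0 w\<bar> < N + 2} \<inter> {w. \<bar>X m 1 w\<bar> < N + 2} \<inter> {w. \<bar>X m 2 w\<bar> < N + 2} \<inter> {w. \<bar>X m 3 w\<bar> < N + 2}"
    have "open S" unfolding S_def by (intro open_Int open_Collect_less continuous_intros X(3))
    moreover have sub: "{0..W} \<subseteq> S"
    proof
      fix w assume w: "w \<in> {0..W}"
      have "\<bar>X m j w\<bar> \<le> N + 1" for j using m w unfolding bx_def by blast
      then have "\<bar>X m j w\<bar> < N + 2" for j by (rule le_less_trans) simp
      then show "w \<in> S" unfolding S_def by simp
    qed
    ultimately obtain e1 e2 where e: "e1 > 0" "ball 0 e1 \<subseteq> S" "e2 > 0" "ball W e2 \<subseteq> S"
      using W by (metis atLeastAtMost_iff less_imp_le open_contains_ball order_refl subsetD)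
    have SX: "\<bar>X m j w\<bar> \<le> N + 2" if "w \<in> S" for j w
    proof -
      have "j = 0 \<or> j = 1 \<or> j = 2 \<or> j = 3 \<or> j \<ge> 4" by linarith
      then show ?thesis using that N(1) X(8)[of j m w] unfolding S_def by auto
    qed
    define a where "a = - min (e1 / 2) ((1 + W) / 2)"
    define b where "b = min (W + e2 / 2) ((1 + W) / 2)"
    have ab: "- ((1 + W) / 2) \<le> a" "a < 0" "W < b" "b \<le> (1 + W) / 2" "0 < b"
      unfolding a_def b_def using e W by (auto simp: min_def)
    have inS: "w \<in> S" if "w \<in> {a<..<b}" for w
    proof -
      consider "w < 0" | "w \<in> {0..W}" | "w > W" by force
      then show ?thesis
      proof cases
        case 1
        then have "w \<in> ball 0 e1" using that unfolding a_def by (auto simp: dist_real_def)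
        then show ?thesis using e by auto
      next
        case 3
        then have "w \<in> ball W e2" using that unfolding b_def by (auto simp: dist_real_def)
        then show ?thesis using e by auto
      qed (use sub in auto)
    qed
    show ?thesis using X(9)[OF ab(1,2,5,4)] inS SX ab(3) by blast
  qed
  have apriori: "bx m N" if m: "bx m (N + 1)" and \<rho>m: "\<bar>\<rho> m\<bar> \<le> \<rho>0" for m
  proof -
    obtain a b where pab: "W < b" "profile n s a b (X m 0) (X m 1) (X m 2) (\<lambda>w. X m 3 w / \<eta>)" using prof[OF m] by blast
    interpret knot_profile n s a b "X m 0" "X m 1" "X m 2" "\<lambda>w. X m 3 w / \<eta>" by (unfold_locales; fact)
    define \<alpha> where "\<alpha> = ln ((1 - W ^ n) / (2 * real n)) - X m 0 W"
    have tW: "trace_dist n s \<alpha> (X m 0) (X m 2) W \<le> B0"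
      unfolding B0_def by (rule trace_dist_matched(1)[where h = "X m 0" and G = "X m 2", OF n s(1) W \<alpha>_def]) (use \<rho>m in \<open>simp add: \<rho>_def \<rho>0_def\<close>)
    have td: "trace_dist n s \<alpha> (X m 0) (X m 2) w \<le> B" if w: "0 < w" "w \<le> W" for w
    proof -
      have "trace_dist n s \<alpha> (X m 0) (X m 2) w \<le> trace_dist n s \<alpha> (X m 0) (X m 2) W * exp (8 * n\<^sup>2 * sqrt (1 - sqrt w))"
        by (rule trace_dist_decay[OF W(1) pab(1) W(2) w])
      also have "\<dots> \<le> B0 * exp (8 * n\<^sup>2 * sqrt (1 - sqrt w))" by (intro mult_right_mono tW) auto
      also have "\<dots> \<le> B0 * exp (8 * n\<^sup>2)"
      proof -
        have "sqrt (1 - sqrt w) \<le> 1" using w by simp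
        then have "8 * (real n)\<^sup>2 * sqrt (1 - sqrt w) \<le> 8 * (real n)\<^sup>2 * 1" by (intro mult_left_mono) auto
        then show ?thesis using B0 by (intro mult_left_mono) auto
      qed
      finally show ?thesis unfolding B_def .
    qed
    have bd: "\<bar>X m 0 w\<bar> \<le> N \<and> \<bar>X m 1 w\<bar> \<le> N \<and> \<bar>X m 2 w\<bar> \<le> N \<and> \<bar>X m 3 w / \<eta>\<bar> \<le> N" if "w \<in> {0..W}" for w
      using N(2)[OF pab(2,1) X(5) td, of w] that by auto
    have "\<bar>X m j w\<bar> \<le> N" if w: "w \<in> {0..W}" for j w
    proof -
      have "\<bar>X m 3 w\<bar> = \<eta> * \<bar>X m 3 w / \<eta>\<bar>" using X(1) by (simp add: abs_mult)
      also have "\<dots> \<le> 1 * N" using X(1,2) bd[OF w] by (intro mult_mono) auto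
      finally have "\<bar>X m 3 w\<bar> \<le> N" by simp
      moreover have "j = 0 \<or> j = 1 \<or> j = 2 \<or> j = 3 \<or> j \<ge> 4" by linarith
      ultimately show ?thesis using bd[OF w] N(1) X(8)[of j m w] by auto
    qed
    then show ?thesis unfolding bx_def by blast
  qed
  define L where "L = 2 * exp \<bar>\<Lambda>\<bar>"
  have L: "L > 0" unfolding L_def by simp
  have lip: "\<bar>X m j w - X m' j w\<bar> \<le> \<bar>m - m'\<bar> * L" if w: "w \<in> {0..W}" for m m' j w
  proof -
    have "\<Lambda> * \<bar>w\<bar> \<le> \<bar>\<Lambda>\<bar> * \<bar>w\<bar>" by (intro mult_right_mono) auto
    also have "\<dots> \<le> \<bar>\<Lambda>\<bar> * 1" using w W by (intro mult_left_mono) auto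
    finally have "2 * exp (\<Lambda> * \<bar>w\<bar>) \<le> L" unfolding L_def by simp
    then have "\<bar>m - m'\<bar> * (2 * exp (\<Lambda> * \<bar>w\<bar>)) \<le> \<bar>m - m'\<bar> * L" by (intro mult_left_mono) auto
    then show ?thesis using X(4)[of m j w m'] by linarith
  qed
  have Xm_cont: "continuous_on UNIV (\<lambda>m. X m j W)" for j
  proof (rule lipschitz_on_continuous_on)
    show "L-lipschitz_on UNIV (\<lambda>m. X m j W)"
      unfolding lipschitz_on_def using lip[of W] L W by (auto simp: dist_real_def mult.commute)
  qed
  have \<rho>_cont: "continuous_on UNIV (\<lambda>m. \<bar>\<rho> m\<bar>)" unfolding \<rho>_def by (intro continuous_intros Xm_cont)
  have "\<exists>m. bx m (N + 1) \<and> \<bar>\<rho> m\<bar> = \<rho>0"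
  proof (rule ccontr)
    assume no: "\<nexists>m. bx m (N + 1) \<and> \<bar>\<rho> m\<bar> = \<rho>0"
    \<comment> \<open>Open, because \<open>apriori\<close> improves \<open>N + 1\<close> to
      \<open>N\<close>; closed, because the limit case \<open>|\<rho>| = \<rho>0\<close> is excluded
      by assumption; nonempty, because \<open>m = 0\<close> gives the zero solution.\<close>
    define Z where "Z = {m \<in> {0..N + 1}. bx m N \<and> \<bar>\<rho> m\<bar> < \<rho>0}"
    have mono: "bx m (N + 1)" if "bx m N" for m
      unfolding bx_def
    proof (intro allI ballI)
      fix j w assume "w \<in> {0..W}"
      then have "\<bar>X m j w\<bar> \<le> N" using that unfolding bx_def by blast
      then show "\<bar>X m j w\<bar> \<le> N + 1" by simp
    qed
    have op: "openin (top_of_set {0..N + 1}) Z"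
      unfolding openin_euclidean_subtopology_iff
    proof (intro conjI ballI)
      show "Z \<subseteq> {0..N + 1}" unfolding Z_def by auto
      fix m assume m: "m \<in> Z"
      have "open {m. \<bar>\<rho> m\<bar> < \<rho>0}" by (intro open_Collect_less \<rho>_cont continuous_intros)
      moreover have "m \<in> {m. \<bar>\<rho> m\<bar> < \<rho>0}" using m unfolding Z_def by simp
      ultimately obtain e where e: "e > 0" "ball m e \<subseteq> {m. \<bar>\<rho> m\<bar> < \<rho>0}" using open_contains_ball by blast
      show "\<exists>e>0. \<forall>x'\<in>{0..N + 1}. dist x' m < e \<longrightarrow> x' \<in> Z"
      proof (intro exI[of _ "min e (1 / L)"] conjI ballI impI)
        show "0 < min e (1 / L)" using e L by simp
        fix m' assume m': "m' \<in> {0..N + 1}" "dist m' m < min e (1 / L)"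
        have "m' \<in> ball m e" using m' by (simp add: dist_commute)
        then have \<rho>': "\<bar>\<rho> m'\<bar> < \<rho>0" using e(2) by blast
        have "\<bar>X m' j w\<bar> \<le> N + 1" if w: "w \<in> {0..W}" for j w
        proof -
          have "\<bar>m' - m\<bar> * L \<le> (1 / L) * L" using m'(2) L by (intro mult_right_mono) (auto simp: dist_real_def)
          then have "\<bar>X m' j w - X m j w\<bar> \<le> 1" using lip[OF w, of m' j m] L by simp
          moreover have "\<bar>X m j w\<bar> \<le> N" using m w unfolding Z_def bx_def by blast
          ultimately show ?thesis by linarith
        qed
        then have "bx m' (N + 1)" unfolding bx_def by blast
        then show "m' \<in> Z" using apriori[of m'] \<rho>' m' unfolding Z_def by simp
      qed
    qed
    have cl: "closedin (top_of_set {0..N + 1}) Z"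
      unfolding closedin_limpt
    proof (intro conjI allI impI)
      show "Z \<subseteq> {0..N + 1}" unfolding Z_def by auto
      fix m assume m: "m islimpt Z \<and> m \<in> {0..N + 1}"
      have near: "\<exists>m'\<in>Z. \<bar>m' - m\<bar> < e" if "e > 0" for e
        using m that unfolding islimpt_approachable dist_real_def by blast
      have "bx m N" unfolding bx_def
      proof (intro allI ballI)
        fix j w assume w: "w \<in> {0..W}"
        show "\<bar>X m j w\<bar> \<le> N"
        proof (rule field_le_epsilon)
          fix e :: real assume e: "e > 0"
          then obtain m' where m': "m' \<in> Z" "\<bar>m' - m\<bar> < e / L" using near[of "e / L"] L by auto
          have "\<bar>m - m'\<bar> * L \<le> (e / L) * L" using m'(2) L by (intro mult_right_mono) auto
          then have "\<bar>X m j w - X m' j w\<bar> \<le> e" using lip[OF w, of m j m'] L by simp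
          moreover have "\<bar>X m' j w\<bar> \<le> N" using m'(1) w unfolding Z_def bx_def by blast
          ultimately show "\<bar>X m j w\<bar> \<le> N + e" by linarith
        qed
      qed
      moreover have "\<bar>\<rho> m\<bar> \<le> \<rho>0"
      proof (rule ccontr)
        assume "\<not> \<bar>\<rho> m\<bar> \<le> \<rho>0"
        then have "m \<in> {m. \<rho>0 < \<bar>\<rho> m\<bar>}" by simp
        moreover have "open {m. \<rho>0 < \<bar>\<rho> m\<bar>}" by (intro open_Collect_less \<rho>_cont continuous_intros)
        ultimately obtain e where e: "e > 0" "ball m e \<subseteq> {m. \<rho>0 < \<bar>\<rho> m\<bar>}" using open_contains_ball by blast
        obtain m' where m': "m' \<in> Z" "\<bar>m' - m\<bar> < e" using near[OF e(1)] by blast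
        then have "m' \<in> ball m e" by (simp add: dist_real_def abs_minus_commute)
        then have "\<rho>0 < \<bar>\<rho> m'\<bar>" using e(2) by blast
        then show False using m'(1) unfolding Z_def by simp
      qed
      ultimately show "m \<in> Z" using no mono[of m] m unfolding Z_def by force
    qed
    have Z0: "0 \<in> Z" unfolding Z_def bx_def \<rho>_def using X(7) N(1) \<rho>0 by simp
    have con: "T = {} \<or> T = {0..N + 1}" if "openin (top_of_set {0..N + 1}) T" "closedin (top_of_set {0..N + 1}) T" for T
      using connected_Icc[of 0 "N + 1"] that unfolding connected_clopen by simp
    have "Z = {0..N + 1}" using con[OF op cl] Z0 by auto
    then have "N + 1 \<in> Z" using N(1) by simp
    then have "bx (N + 1) N" unfolding Z_def by simp
    \<comment> \<open>The contradiction comes from the center, where the component \<open>G\<close>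
      equals the parameter.\<close>
    then have "\<bar>X (N + 1) 2 0\<bar> \<le> N" unfolding bx_def using W by simp
    then show False unfolding X(6) using N(1) by simp
  qed
  then obtain m where m: "bx m (N + 1)" "\<bar>\<rho> m\<bar> = \<rho>0" by blast
  obtain a b where ab: "W < b" "profile n s a b (X m 0) (X m 1) (X m 2) (\<lambda>w. X m 3 w / \<eta>)" using prof[OF m(1)] by blast
  define \<alpha> where "\<alpha> = ln ((1 - W ^ n) / (2 * real n)) - X m 0 W"
  show ?thesis
  proof (cases "\<rho> m = \<rho>0")
    case True
    have "trace_dist n s \<alpha> (X m 0) (X m 2) W = 2"
      by (rule trace_dist_matched(2)[where h = "X m 0" and G = "X m 2", OF n s(1) W \<alpha>_def]) (use True \<rho>0 in \<open>simp_all add: \<rho>_def \<rho>0_def\<close>)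
    then show ?thesis using that[OF ab(2,1) X(5)] by blast
  next
    \<comment> \<open>The solution matches the mirror image of the reference, so the sign of
      \<open>G\<close> is reversed.\<close>
    case False
    then have \<rho>m: "- \<rho> m = \<rho>0" using m(2) by linarith
    have "trace_dist n s \<alpha> (X m 0) (\<lambda>w. - X m 2 w) W = 2"
      by (rule trace_dist_matched(2)[where h = "X m 0" and G = "\<lambda>w. - X m 2 w", OF n s(1) W \<alpha>_def]) (use \<rho>m \<rho>0 in \<open>simp_all add: \<rho>_def \<rho>0_def\<close>)
    then show ?thesis using that[OF profile_neg[OF ab(2)] ab(1) X(5)] by blast
  qed
qed

section \<open>Uniqueness, patching and the limit of matched profiles\<close>

lemma profile_unique:
  fixes n :: nat and s R :: real
  assumes n: "n \<ge> 2" and p1: "profile n s a b h p G q" "R < b" "h 0 = 0"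
    and p2: "profile n s a' b' h' p' G' q'" "R < b'" "h' 0 = 0" and G: "G 0 = G' 0" and R: "0 < R" "R < 1" and w: "w \<in> {0..R}"
  shows "h w = h' w \<and> p w = p' w \<and> G w = G' w \<and> q w = q' w"
proof -
  have bdd: "\<exists>N>0. \<forall>v\<in>{0..R}. \<bar>h v\<bar> \<le> N \<and> \<bar>p v\<bar> \<le> N \<and> \<bar>G v\<bar> \<le> N \<and> \<bar>q v\<bar> \<le> N"
    if pr: "profile n s a b h p G q" and Rb: "R < b" for a b h p G q
  proof -
    have "a < 0" using pr unfolding profile_def by simp
    then have "\<forall>v\<in>{0..R}. isCont h v \<and> isCont p v \<and> isCont G v \<and> isCont q v"
      using pr Rb unfolding profile_def by (auto dest: DERIV_isCont)
    then have "continuous_on {0..R} (\<lambda>v. \<bar>h v\<bar> + \<bar>p v\<bar> + \<bar>G v\<bar> + \<bar>q v\<bar>)"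
      by (intro continuous_intros continuous_at_imp_continuous_on) auto
    then have "bounded ((\<lambda>v. \<bar>h v\<bar> + \<bar>p v\<bar> + \<bar>G v\<bar> + \<bar>q v\<bar>) ` {0..R})"
      by (intro compact_imp_bounded compact_continuous_image) auto
    then obtain N where "\<forall>v\<in>{0..R}. \<bar>\<bar>h v\<bar> + \<bar>p v\<bar> + \<bar>G v\<bar> + \<bar>q v\<bar>\<bar> \<le> N" unfolding bounded_iff by auto
    then show ?thesis by (intro exI[of _ "\<bar>N\<bar> + 1"]) force
  qed
  obtain N1 where N1: "N1 > 0" "\<forall>v\<in>{0..R}. \<bar>h v\<bar> \<le> N1 \<and> \<bar>p v\<bar> \<le> N1 \<and> \<bar>G v\<bar> \<le> N1 \<and> \<bar>q v\<bar> \<le> N1"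
    using bdd[OF p1(1,2)] by blast
  obtain N2 where N2: "N2 > 0" "\<forall>v\<in>{0..R}. \<bar>h' v\<bar> \<le> N2 \<and> \<bar>p' v\<bar> \<le> N2 \<and> \<bar>G' v\<bar> \<le> N2 \<and> \<bar>q' v\<bar> \<le> N2"
    using bdd[OF p2(1,2)] by blast
  \<comment> \<open>A truncation level above both profiles: each of them then coincides on
    \<open>[0, R]\<close> with the member of one cutoff family selected by the common value
    \<open>G 0\<close>.\<close>
  have N: "N1 + N2 > 0" using N1(1) N2(1) by simp
  obtain X :: "real \<Rightarrow> nat \<Rightarrow> real \<Rightarrow> real" and \<eta> :: real where X:
    "\<And>a b h p G q R' w. profile n s a b h p G q \<Longrightarrow> R' < b \<Longrightarrow> R' \<le> R \<Longrightarrow> h 0 = 0 \<Longrightarrow>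
        (\<And>v. v \<in> {0..R'} \<Longrightarrow> \<bar>h v\<bar> \<le> N1 + N2 \<and> \<bar>p v\<bar> \<le> N1 + N2 \<and> \<bar>G v\<bar> \<le> N1 + N2 \<and> \<bar>q v\<bar> \<le> N1 + N2) \<Longrightarrow> w \<in> {0..R'} \<Longrightarrow>
        h w = X (G 0) 0 w \<and> p w = X (G 0) 1 w \<and> G w = X (G 0) 2 w \<and> q w = X (G 0) 3 w / \<eta>"
    by (rule cutoff_family[OF n R N, of s]) blast
  have "h w = X (G 0) 0 w \<and> p w = X (G 0) 1 w \<and> G w = X (G 0) 2 w \<and> q w = X (G 0) 3 w / \<eta>"
  proof (rule X[OF p1(1,2) order_refl p1(3) _ w])
    fix v assume "v \<in> {0..R}"
    from bspec[OF N1(2) this] show "\<bar>h v\<bar> \<le> N1 + N2 \<and> \<bar>p v\<bar> \<le> N1 + N2 \<and> \<bar>G v\<bar> \<le> N1 + N2 \<and> \<bar>q v\<bar> \<le> N1 + N2"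
      using N2(1) by simp
  qed
  moreover have "h' w = X (G' 0) 0 w \<and> p' w = X (G' 0) 1 w \<and> G' w = X (G' 0) 2 w \<and> q' w = X (G' 0) 3 w / \<eta>"
  proof (rule X[OF p2(1,2) order_refl p2(3) _ w])
    fix v assume "v \<in> {0..R}"
    from bspec[OF N2(2) this] show "\<bar>h' v\<bar> \<le> N1 + N2 \<and> \<bar>p' v\<bar> \<le> N1 + N2 \<and> \<bar>G' v\<bar> \<le> N1 + N2 \<and> \<bar>q' v\<bar> \<le> N1 + N2"
      using N1(1) by simp
  qed
  ultimately show ?thesis using G by simp
qed

lemma profile_patch:
  fixes a b :: "nat \<Rightarrow> real" and h p G q :: "nat \<Rightarrow> real \<Rightarrow> real" and W :: "nat \<Rightarrow> real"
  assumes n: "n \<ge> 2" and prof: "\<And>i. profile n s (a i) (b i) (h i) (p i) (G i) (q i)"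
    and W: "\<And>i. 0 < W i" "\<And>i. W i < b i" "\<And>i. W i < 1" "\<And>w. w < 1 \<Longrightarrow> \<exists>i. w < W i"
    and h0: "\<And>i. h i 0 = 0" and G0: "\<And>i. G i 0 = m"
  obtains a' h' p' G' q' where "profile n s a' 1 h' p' G' q'"
    "\<And>i w. 0 \<le> w \<Longrightarrow> w < W i \<Longrightarrow> h' w = h i w \<and> G' w = G i w"
proof -
  \<comment> \<open>For \<open>w \<le> 0\<close> always the first profile is taken, since uniqueness
    is established on \<open>[0, R]\<close> only; a neighborhood of \<open>0\<close> is then covered
    by that single profile.\<close>
  define k where "k w = (if w \<le> 0 then 0 else LEAST i. w < W i)" for w
  define h' where "h' w = h (k w) w" for w
  define p' where "p' w = p (k w) w" for w
  define G' where "G' w = G (k w) w" for w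
  define q' where "q' w = q (k w) w" for w
  have kW: "w < W (k w)" if "w < 1" for w
  proof (cases "w \<le> 0")
    case True
    then show ?thesis using W(1)[of 0] unfolding k_def by simp
  next
    case False
    then show ?thesis unfolding k_def using W(4)[OF that] by (auto intro: LeastI_ex)
  qed
  have agree: "h' w = h i w \<and> p' w = p i w \<and> G' w = G i w \<and> q' w = q i w" if w: "0 \<le> w" "w < W i" for i w
  proof -
    have w1: "w < 1" using w W(3)[of i] by simp
    define R where "R = (w + min (W i) (W (k w))) / 2"
    have R: "0 < R" "R < 1" "w \<le> R" "R < b i" "R < b (k w)"
      unfolding R_def using w kW[OF w1] W(2)[of i] W(2)[of "k w"] W(3)[of i] W(1)[of i] by (auto simp: min_def)
    show ?thesis unfolding h'_def p'_def G'_def q'_def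
      by (rule profile_unique[OF n prof R(5) h0 prof R(4) h0 _ R(1,2)]) (use G0 w R in auto)
  qed
  have neg: "h' w = h 0 w \<and> p' w = p 0 w \<and> G' w = G 0 w \<and> q' w = q 0 w" if "w \<le> 0" for w
    using that unfolding h'_def p'_def G'_def q'_def k_def by simp
  have a0: "a i < 0" "- 1 \<le> a i" for i using prof[of i] unfolding profile_def by auto
  have "profile n s (a 0) 1 h' p' G' q'"
    unfolding profile_def
  proof (intro conjI ballI)
    show "- 1 \<le> a 0" "a 0 < 0" "(0::real) < 1" "(1::real) \<le> 1" using a0 by auto
    fix w assume w: "w \<in> {a 0<..<1}"
    obtain i l u where J: "w \<in> {l<..<u}" "{l<..<u} \<subseteq> {a i<..<b i}"
      and ag: "\<And>v. v \<in> {l<..<u} \<Longrightarrow> h' v = h i v \<and> p' v = p i v \<and> G' v = G i v \<and> q' v = q i v"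
      and ag2: "\<And>t. t \<in> {0..1} \<Longrightarrow> h' (t * w) = h i (t * w) \<and> p' (t * w) = p i (t * w) \<and> G' (t * w) = G i (t * w) \<and> q' (t * w) = q i (t * w)"
    proof (cases "w < W 0")
      case True
      have ag: "h' v = h 0 v \<and> p' v = p 0 v \<and> G' v = G 0 v \<and> q' v = q 0 v" if "v \<in> {a 0<..<W 0}" for v
        using agree[of v 0] neg[of v] that by (cases "v \<le> 0") auto
      show ?thesis
      proof (rule that[of "a 0" "W 0" 0])
        show "h' (t * w) = h 0 (t * w) \<and> p' (t * w) = p 0 (t * w) \<and> G' (t * w) = G 0 (t * w) \<and> q' (t * w) = q 0 (t * w)"
          if "t \<in> {0..1}" for t
          by (rule ag, rule scale_mem[OF that]) (use w True a0 W(1) in auto)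
      qed (use w True ag W(2)[of 0] in auto)
    next
      case False
      then have w0: "0 < w" using W(1)[of 0] by simp
      obtain i where i: "w < W i" using W(4)[of w] w by auto
      show ?thesis
      proof (rule that[of 0 "W i" i])
        show "h' (t * w) = h i (t * w) \<and> p' (t * w) = p i (t * w) \<and> G' (t * w) = G i (t * w) \<and> q' (t * w) = q i (t * w)"
          if t: "t \<in> {0..1}" for t
        proof (rule agree)
          have "t * w \<le> 1 * w" using t w0 by (intro mult_right_mono) auto
          then show "t * w < W i" using i by linarith
          show "0 \<le> t * w" using t w0 by simp
        qed
        show "{0<..<W i} \<subseteq> {a i<..<b i}" using a0(1)[of i] W(2)[of i] by auto
      qed (use w0 i agree in auto)
    qed
    have wi: "w \<in> {a i<..<b i}" using J by auto
    have pr: "isCont (p i) w" "isCont (q i) w" "(h i has_real_derivative p i w) (at w)" "(G i has_real_derivative q i w) (at w)"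
      "p i w = integral {0..1} (\<lambda>l. src_p n s (h i) (G i) (q i) (l * w))"
      "q i w = integral {0..1} (\<lambda>l. l ^ n * src_q n s (p i) (G i) (q i) (l * w))"
      using prof[of i] wi unfolding profile_def by blast+
    have ev: "\<forall>\<^sub>F v in nhds w. v \<in> {l<..<u}" using J(1) by (intro eventually_nhds_in_open) auto
    have "\<forall>\<^sub>F v in nhds w. p' v = p i v" "\<forall>\<^sub>F v in nhds w. q' v = q i v"
      using ev by (eventually_elim, use ag in blast)+
    then show "isCont p' w" "isCont q' w" using pr(1,2) by (simp_all add: isCont_cong)
    show "(h' has_real_derivative p' w) (at w)"
      using has_field_derivative_transform_within_open[OF pr(3) _ J(1), of h'] ag J(1) by auto
    show "(G' has_real_derivative q' w) (at w)"
      using has_field_derivative_transform_within_open[OF pr(4) _ J(1), of G'] ag J(1) by auto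
    have "p' w = integral {0..1} (\<lambda>l. src_p n s (h i) (G i) (q i) (l * w))" using pr(5) ag J(1) by auto
    also have "\<dots> = integral {0..1} (\<lambda>l. src_p n s h' G' q' (l * w))"
      by (rule Henstock_Kurzweil_Integration.integral_cong) (simp add: src_p_def ag2)
    finally show "p' w = integral {0..1} (\<lambda>l. src_p n s h' G' q' (l * w))" .
    have "q' w = integral {0..1} (\<lambda>l. l ^ n * src_q n s (p i) (G i) (q i) (l * w))" using pr(6) ag J(1) by auto
    also have "\<dots> = integral {0..1} (\<lambda>l. l ^ n * src_q n s p' G' q' (l * w))"
      by (rule Henstock_Kurzweil_Integration.integral_cong) (simp add: src_q_def ag2)
    finally show "q' w = integral {0..1} (\<lambda>l. l ^ n * src_q n s p' G' q' (l * w))" .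
  qed
  then show ?thesis using agree that by blast
qed

text \<open>Compactness is needed only for the two numbers \<open>G 0\<close> and
  \<open>\<alpha>\<close>, both of which are bounded: given convergence of these, the profiles
  converge because the cutoff family depends continuously on \<open>m\<close>.\<close>

theorem profile_exists:
  fixes n :: nat and s :: real
  assumes n: "n \<ge> 2" and s: "0 < s" "s \<le> 1/2"
  obtains a h p G q \<alpha> where "profile n s a 1 h p G q"
    "\<And>w. 0 < w \<Longrightarrow> w < 1 \<Longrightarrow> trace_dist n s \<alpha> h G w \<le> 2 * exp (8 * n\<^sup>2 * sqrt (1 - sqrt w))"
proof -
  define bound where "bound w = 2 * exp (8 * n\<^sup>2 * sqrt (1 - sqrt w))" for w
  define B where "B = 2 * exp (8 * (real n)\<^sup>2)"
  define V where "V j = 1 - 1 / (real j + 2)" for j :: nat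
  have V: "0 < V j" "V j < 1" "1/2 \<le> V j" for j unfolding V_def by (auto simp: field_simps)
  have V_lim: "V \<longlonglongrightarrow> 1"
  proof -
    have "(\<lambda>j. 1 - 1 / (real j + 2)) \<longlonglongrightarrow> 1" by real_asymp
    then show ?thesis unfolding V_def[abs_def] .
  qed
  have V_ev: "\<forall>\<^sub>F j in sequentially. w < V j" if "w < 1" for w using order_tendstoD(1)[OF V_lim that] .
  have "1 \<le> exp (8 * (real n)\<^sup>2)" by simp
  then have B1: "B \<ge> 1" unfolding B_def by linarith
  have bound_B: "bound w \<le> B" if "0 < w" "w < 1" for w
  proof -
    have "sqrt (1 - sqrt w) \<le> 1" using that by simp
    then have "8 * (real n)\<^sup>2 * sqrt (1 - sqrt w) \<le> 8 * (real n)\<^sup>2 * 1" by (intro mult_left_mono) auto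
    then show ?thesis unfolding bound_def B_def by simp
  qed
  have "\<exists>a b h p G q \<alpha>. profile n s a b h p G q \<and> V j < b \<and> h 0 = 0 \<and> trace_dist n s \<alpha> h G (V j) = 2" for j
    using exists_matched[OF n s V(1,2)] by metis
  then obtain a b h p G q \<alpha> where prof: "\<And>j. profile n s (a j) (b j) (h j) (p j) (G j) (q j)" and Vb: "\<And>j. V j < b j"
    and h0: "\<And>j. h j 0 = 0" and match: "\<And>j. trace_dist n s (\<alpha> j) (h j) (G j) (V j) = 2" by metis
  have td: "trace_dist n s (\<alpha> j) (h j) (G j) w \<le> bound w" if w: "0 < w" "w \<le> V j" for j w
  proof -
    interpret knot_profile n s "a j" "b j" "h j" "p j" "G j" "q j" by (unfold_locales; fact)
    show ?thesis unfolding bound_def using trace_dist_decay[OF V(1) Vb V(2) w, of "\<alpha> j"] match by simp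
  qed
  have tdB: "trace_dist n s (\<alpha> j) (h j) (G j) w \<le> B" if w: "0 < w" "w \<le> V j" for j w
    using td[OF w] bound_B[of w] w V(2)[of j] by auto
  have half: "0 < (1/2::real)" "(1/2::real) < 1" by auto
  \<comment> \<open>All \<open>V j\<close> are at least \<open>1/2\<close>, so a bound on
    \<open>[0, 1/2]\<close> already controls every \<open>G j 0\<close>.\<close>
  obtain N0 where N0: "\<And>a b h p G q \<alpha> w. profile n s a b h p G q \<Longrightarrow> 1/2 < b \<Longrightarrow> h 0 = 0 \<Longrightarrow>
      (\<And>w. 0 < w \<Longrightarrow> w \<le> 1/2 \<Longrightarrow> trace_dist n s \<alpha> h G w \<le> B) \<Longrightarrow> 0 \<le> w \<Longrightarrow> w \<le> 1/2 \<Longrightarrow>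
      \<bar>h w\<bar> \<le> N0 \<and> \<bar>p w\<bar> \<le> N0 \<and> \<bar>G w\<bar> \<le> N0 \<and> \<bar>q w\<bar> \<le> N0"
    by (rule uniform_bound[OF n s half B1]) blast
  have mb: "\<bar>G j 0\<bar> \<le> N0" for j
    using N0[OF prof[of j] _ h0[of j], of "\<alpha> j" 0] tdB[of _ j] V(3)[of j] Vb[of j] by force
  have \<alpha>b: "\<bar>\<alpha> j\<bar> \<le> ln (2 * real n * B)" for j
    by (rule bounds_of_trace_dist(3)[OF prof n s V(1) Vb h0 B1 tdB])
  have "bounded (range (\<lambda>j. (G j 0, \<alpha> j)))"
    unfolding bounded_iff
  proof (intro exI ballI)
    fix z assume "z \<in> range (\<lambda>j. (G j 0, \<alpha> j))"
    then obtain j where z: "z = (G j 0, \<alpha> j)" by auto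
    show "norm z \<le> N0 + ln (2 * real n * B)" unfolding z
      using norm_Pair_le[of "G j 0" "\<alpha> j"] mb[of j] \<alpha>b[of j] by simp
  qed
  then obtain l r where r: "strict_mono r" and lim: "((\<lambda>j. (G j 0, \<alpha> j)) \<circ> r) \<longlonglongrightarrow> l"
    using bounded_imp_convergent_subsequence by blast
  define m where "m = fst l"
  define \<alpha>' where "\<alpha>' = snd l"
  have m_lim: "(\<lambda>j. G (r j) 0) \<longlonglongrightarrow> m" and \<alpha>_lim: "(\<lambda>j. \<alpha> (r j)) \<longlonglongrightarrow> \<alpha>'"
    using tendsto_fst[OF lim] tendsto_snd[OF lim] unfolding m_def \<alpha>'_def by (auto simp: o_def)
  \<comment> \<open>Fix \<open>W\<close> below a slightly larger \<open>W2\<close>. All late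
    profiles coincide on \<open>[0, W2]\<close> with members of one truncated family; their limit
    inherits the bound \<open>N\<close>, which is below the truncation level, so it is a profile
    itself.\<close>
  have local: "\<exists>a b h p G q. profile n s a b h p G q \<and> W < b \<and> h 0 = 0 \<and> G 0 = m \<and>
     (\<forall>w. 0 < w \<longrightarrow> w \<le> W \<longrightarrow> trace_dist n s \<alpha>' h G w \<le> bound w)" if W: "0 < W" "W < 1" for W
  proof -
    obtain W2 where W2: "W < W2" "W2 < 1" using dense[OF W(2)] by blast
    have W2p: "0 < W2" using W W2 by simp
    obtain N where N: "N > 0" "\<And>a b h p G q \<alpha> w. profile n s a b h p G q \<Longrightarrow> W2 < b \<Longrightarrow> h 0 = 0 \<Longrightarrow>
      (\<And>w. 0 < w \<Longrightarrow> w \<le> W2 \<Longrightarrow> trace_dist n s \<alpha> h G w \<le> B) \<Longrightarrow> 0 \<le> w \<Longrightarrow> w \<le> W2 \<Longrightarrow>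
      \<bar>h w\<bar> \<le> N \<and> \<bar>p w\<bar> \<le> N \<and> \<bar>G w\<bar> \<le> N \<and> \<bar>q w\<bar> \<le> N"
      by (rule uniform_bound[OF n s W2p W2(2) B1]) blast
    have N1: "N + 1 > 0" using N(1) by simp
    obtain X :: "real \<Rightarrow> nat \<Rightarrow> real \<Rightarrow> real" and \<Lambda> \<eta> :: real where X: "\<eta> > 0" "\<eta> \<le> 1" "\<And>m j. continuous_on UNIV (X m j)"
      "\<And>m m' i w. \<bar>X m i w - X m' i w\<bar> \<le> \<bar>m - m'\<bar> * (2 * exp (\<Lambda> * \<bar>w\<bar>))"
      "\<And>m. X m 0 0 = 0" "\<And>m. X m 2 0 = m" "\<And>m j w. j \<ge> 4 \<Longrightarrow> X m j w = 0"
      "\<And>m a b. -W2 \<le> a \<Longrightarrow> a < 0 \<Longrightarrow> 0 < b \<Longrightarrow> b \<le> W2 \<Longrightarrow>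
        (\<And>j w. w \<in> {a<..<b} \<Longrightarrow> \<bar>X m j w\<bar> \<le> N + 1) \<Longrightarrow>
        profile n s a b (X m 0) (X m 1) (X m 2) (\<lambda>w. X m 3 w / \<eta>)"
      "\<And>a b h p G q R w. profile n s a b h p G q \<Longrightarrow> R < b \<Longrightarrow> R \<le> W2 \<Longrightarrow> h 0 = 0 \<Longrightarrow>
        (\<And>v. v \<in> {0..R} \<Longrightarrow> \<bar>h v\<bar> \<le> N + 1 \<and> \<bar>p v\<bar> \<le> N + 1 \<and> \<bar>G v\<bar> \<le> N + 1 \<and> \<bar>q v\<bar> \<le> N + 1) \<Longrightarrow> w \<in> {0..R} \<Longrightarrow>
        h w = X (G 0) 0 w \<and> p w = X (G 0) 1 w \<and> G w = X (G 0) 2 w \<and> q w = X (G 0) 3 w / \<eta>"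
      by (rule cutoff_family[OF n W2p W2(2) N1, of s]) blast
    have ev: "\<forall>\<^sub>F j in sequentially. W2 < V (r j)"
      using V_ev[OF W2(2)] eventually_subseq[OF r] by blast
    have bd: "\<bar>h (r j) w\<bar> \<le> N \<and> \<bar>p (r j) w\<bar> \<le> N \<and> \<bar>G (r j) w\<bar> \<le> N \<and> \<bar>q (r j) w\<bar> \<le> N"
      if "W2 < V (r j)" "w \<in> {0..W2}" for j w
      by (rule N(2)[OF prof _ h0 tdB]) (use that Vb[of "r j"] in auto)
    have eqX: "h (r j) w = X (G (r j) 0) 0 w \<and> p (r j) w = X (G (r j) 0) 1 w \<and> G (r j) w = X (G (r j) 0) 2 w \<and> q (r j) w = X (G (r j) 0) 3 w / \<eta>"
      if j: "W2 < V (r j)" and w: "w \<in> {0..W2}" for j w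
    proof (rule X(9)[OF prof _ order_refl h0 _ w])
      show "W2 < b (r j)" using j Vb[of "r j"] by simp
      show "\<bar>h (r j) v\<bar> \<le> N + 1 \<and> \<bar>p (r j) v\<bar> \<le> N + 1 \<and> \<bar>G (r j) v\<bar> \<le> N + 1 \<and> \<bar>q (r j) v\<bar> \<le> N + 1"
        if "v \<in> {0..W2}" for v using bd[OF j that] by auto
    qed
    have X_lim: "(\<lambda>j. X (G (r j) 0) i w) \<longlonglongrightarrow> X m i w" for i w
    proof (rule LIM_zero_cancel, rule tendsto_rabs_zero_cancel, rule tendsto_sandwich[OF _ _ tendsto_const])
      show "\<forall>\<^sub>F j in sequentially. \<bar>X (G (r j) 0) i w - X m i w\<bar> \<le> \<bar>G (r j) 0 - m\<bar> * (2 * exp (\<Lambda> * \<bar>w\<bar>))"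
        using X(4) by simp
      have "(\<lambda>j. \<bar>G (r j) 0 - m\<bar> * (2 * exp (\<Lambda> * \<bar>w\<bar>))) \<longlonglongrightarrow> \<bar>m - m\<bar> * (2 * exp (\<Lambda> * \<bar>w\<bar>))"
        by (intro tendsto_intros m_lim)
      then show "(\<lambda>j. \<bar>G (r j) 0 - m\<bar> * (2 * exp (\<Lambda> * \<bar>w\<bar>))) \<longlonglongrightarrow> 0" by simp
    qed simp
    have XN: "\<bar>X m i w\<bar> \<le> N" if w: "w \<in> {0..W2}" for i w
    proof (rule tendsto_upperbound[OF tendsto_rabs[OF X_lim[of i w]]])
      show "\<forall>\<^sub>F j in sequentially. \<bar>X (G (r j) 0) i w\<bar> \<le> N"
        using ev
      proof eventually_elim
        case (elim j)
        note e = eqX[OF elim w] note d = bd[OF elim w]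
        have "\<bar>X (G (r j) 0) 3 w\<bar> = \<eta> * \<bar>q (r j) w\<bar>" using e X(1) by (simp add: abs_mult)
        also have "\<dots> \<le> 1 * N" using X(1,2) d by (intro mult_mono) auto
        finally have "\<bar>X (G (r j) 0) 3 w\<bar> \<le> N" by simp
        moreover have "i = 0 \<or> i = 1 \<or> i = 2 \<or> i = 3 \<or> i \<ge> 4" by linarith
        ultimately show ?case using e d N(1) X(7)[of i "G (r j) 0" w] by auto
      qed
    qed simp
    define S where "S = {w. \<bar>X m 0 w\<bar> < N + 1} \<inter> {w. \<bar>X m 1 w\<bar> < N + 1} \<inter> {w. \<bar>X m 2 w\<bar> < N + 1} \<inter> {w. \<bar>X m 3 w\<bar> < N + 1}"
    have "open S" unfolding S_def by (intro open_Int open_Collect_less continuous_intros X(3))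
    moreover have sub: "{0..W2} \<subseteq> S"
    proof
      fix w assume w: "w \<in> {0..W2}"
      have "\<bar>X m j w\<bar> < N + 1" for j using XN[OF w, of j] by linarith
      then show "w \<in> S" unfolding S_def by simp
    qed
    ultimately obtain e where e: "e > 0" "ball 0 e \<subseteq> S"
      using W2p by (metis atLeastAtMost_iff less_imp_le open_contains_ball order_refl subsetD)
    have SX: "\<bar>X m j w\<bar> \<le> N + 1" if "w \<in> S" for j w
    proof -
      have "j = 0 \<or> j = 1 \<or> j = 2 \<or> j = 3 \<or> j \<ge> 4" by linarith
      then show ?thesis using that N(1) X(7)[of j m w] unfolding S_def by auto
    qed
    define a' where "a' = - min (e / 2) W2"
    have a': "- W2 \<le> a'" "a' < 0" unfolding a'_def using e W2p by (auto simp: min_def)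
    have inS: "w \<in> S" if w: "w \<in> {a'<..<W2}" for w
    proof (cases "w < 0")
      case True
      then have "w \<in> ball 0 e" using w unfolding a'_def by (auto simp: dist_real_def)
      then show ?thesis using e by auto
    qed (use sub w in auto)
    have "profile n s a' W2 (X m 0) (X m 1) (X m 2) (\<lambda>w. X m 3 w / \<eta>)"
      by (rule X(8)[OF a' W2p order_refl]) (use inS SX in blast)
    moreover have "trace_dist n s \<alpha>' (X m 0) (X m 2) w \<le> bound w" if w: "0 < w" "w \<le> W" for w
    proof (rule tendsto_upperbound)
      have wW2: "w \<in> {0..W2}" using w W2 by auto
      have "1 - w ^ n \<noteq> 0" using power_lt_one[of w n] w W n by auto
      then show "(\<lambda>j. trace_dist n s (\<alpha> (r j)) (X (G (r j) 0) 0) (X (G (r j) 0) 2) w) \<longlonglongrightarrow> trace_dist n s \<alpha>' (X m 0) (X m 2) w"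
        unfolding trace_dist_def using n by (intro tendsto_intros X_lim \<alpha>_lim)
      show "\<forall>\<^sub>F j in sequentially. trace_dist n s (\<alpha> (r j)) (X (G (r j) 0) 0) (X (G (r j) 0) 2) w \<le> bound w"
        using ev
      proof eventually_elim
        case (elim j)
        have "trace_dist n s (\<alpha> (r j)) (h (r j)) (G (r j)) w \<le> bound w" by (rule td) (use w W2 elim in auto)
        then show ?case using eqX[OF elim wW2] unfolding trace_dist_def by simp
      qed
    qed simp
    ultimately show ?thesis using W2(1) X(5,6) by blast
  qed
  have "\<exists>a b h p G q. profile n s a b h p G q \<and> V j < b \<and> h 0 = 0 \<and> G 0 = m \<and>
     (\<forall>w. 0 < w \<longrightarrow> w \<le> V j \<longrightarrow> trace_dist n s \<alpha>' h G w \<le> bound w)" for j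
    by (rule local[OF V(1,2)])
  then obtain a b h p G q where P: "\<And>j. profile n s (a j) (b j) (h j) (p j) (G j) (q j)" "\<And>j. V j < b j"
    "\<And>j. h j 0 = 0" "\<And>j. G j 0 = m" "\<And>j w. 0 < w \<Longrightarrow> w \<le> V j \<Longrightarrow> trace_dist n s \<alpha>' (h j) (G j) w \<le> bound w"
    by metis
  have ex: "\<exists>j. w < V j" if "w < 1" for w using V_ev[OF that] eventually_happens'[OF sequentially_bot] by blast
  obtain a' h' p' G' q' where F: "profile n s a' 1 h' p' G' q'"
    "\<And>i w. 0 \<le> w \<Longrightarrow> w < V i \<Longrightarrow> h' w = h i w \<and> G' w = G i w"
    using profile_patch[OF n P(1) V(1) P(2) V(2) ex P(3,4)] by metis
  show ?thesis
  proof (rule that[OF F(1)])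
    fix w :: real assume w: "0 < w" "w < 1"
    obtain j where j: "w < V j" using ex[OF w(2)] by blast
    have "trace_dist n s \<alpha>' (h j) (G j) w \<le> bound w" using P(5)[of w j] w j by simp
    then show "trace_dist n s \<alpha>' h' G' w \<le> 2 * exp (8 * n\<^sup>2 * sqrt (1 - sqrt w))"
      using F(2)[of w j] w j unfolding trace_dist_def bound_def by simp
  qed
qed

subsection \<open>Smoothness\<close>

lemma td_cong:
  assumes "open S" "\<And>x. x \<in> S \<Longrightarrow> f x = g x" "times_differentiable_on n S f"
  shows "times_differentiable_on n S g"
  using assms(2,3)
proof (induction n arbitrary: f g)
  case 0
  then show ?case by (simp cong: continuous_on_cong)
next
  case (Suc n)
  have "g differentiable (at x)" if "x \<in> S" for x
  proof -
    have "f differentiable (at x)" using Suc.prems that by simp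
    then obtain f' where "(f has_derivative f') (at x)" unfolding differentiable_def by blast
    then have "(g has_derivative f') (at x)"
      by (rule has_derivative_transform_within_open[OF _ \<open>open S\<close> that]) (use Suc.prems in auto)
    then show ?thesis unfolding differentiable_def by blast
  qed
  moreover have "times_differentiable_on n S (\<lambda>x. frechet_derivative g (at x) w)" for w
  proof (rule Suc.IH)
    show "frechet_derivative f (at x) w = frechet_derivative g (at x) w" if "x \<in> S" for x
      using frechet_derivative_transform_within_open[of f x S g] Suc.prems that \<open>open S\<close> by simp
    show "times_differentiable_on n S (\<lambda>x. frechet_derivative f (at x) w)" using Suc.prems by simp
  qed
  ultimately show ?case by simp
qed

text \<open>Uniqueness of the derivative on an open set allows an explicit candidate
  \<open>D\<close> in place of \<open>frechet_derivative\<close>.\<close>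

lemma td_SucI:
  assumes "open S" "\<And>x. x \<in> S \<Longrightarrow> (f has_derivative D x) (at x)" "\<And>w. times_differentiable_on n S (\<lambda>x. D x w)"
  shows "times_differentiable_on (Suc n) S f"
proof -
  have "frechet_derivative f (at x) w = D x w" if "x \<in> S" for x w
    using frechet_derivative_at[OF assms(2)[OF that]] by simp
  then have "times_differentiable_on n S (\<lambda>x. frechet_derivative f (at x) w)" for w
    by (intro td_cong[OF assms(1) _ assms(3)]) auto
  then show ?thesis using assms(2) by (auto simp: differentiable_def)
qed

lemma td_SucD:
  assumes "times_differentiable_on (Suc n) S f"
  shows "x \<in> S \<Longrightarrow> (f has_derivative frechet_derivative f (at x)) (at x)"
    and "times_differentiable_on n S (\<lambda>x. frechet_derivative f (at x) w)"
  using assms by (auto simp: frechet_derivative_works)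

lemma td_lower: "times_differentiable_on (Suc n) S f \<Longrightarrow> times_differentiable_on n S f"
proof (induction n arbitrary: f)
  case 0
  then show ?case by (auto intro!: continuous_at_imp_continuous_on differentiable_imp_continuous_within)
next
  case (Suc n)
  then show ?case by (metis times_differentiable_on.simps(2))
qed

lemma td_continuous: "times_differentiable_on n S f \<Longrightarrow> continuous_on S f"
proof (induction n)
  case (Suc n)
  then show ?case using td_lower by blast
qed simp

lemma td_const: "times_differentiable_on n S (\<lambda>x. c)"
  by (induction n arbitrary: c) (auto simp: frechet_derivative_const)

lemma td_add:
  assumes S: "open S" and f: "times_differentiable_on n S f" and g: "times_differentiable_on n S g"
  shows "times_differentiable_on n S (\<lambda>x. f x + g x)"
  using f g
proof (induction n arbitrary: f g)
  case (Suc n)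
  show ?case
  proof (rule td_SucI[OF S])
    show "((\<lambda>x. f x + g x) has_derivative (\<lambda>w. frechet_derivative f (at x) w + frechet_derivative g (at x) w)) (at x)"
      if "x \<in> S" for x
      using td_SucD(1)[OF Suc.prems(1) that] td_SucD(1)[OF Suc.prems(2) that] by (rule has_derivative_add)
    show "times_differentiable_on n S (\<lambda>x. frechet_derivative f (at x) w + frechet_derivative g (at x) w)" for w
      by (rule Suc.IH; rule td_SucD(2); fact)
  qed
qed (simp add: continuous_on_add)

lemma td_linear:
  assumes S: "open S" and L: "bounded_linear L" and f: "times_differentiable_on n S f"
  shows "times_differentiable_on n S (\<lambda>x. L (f x))"
  using f
proof (induction n arbitrary: f)
  case 0
  then show ?case by (simp add: bounded_linear.continuous_on[OF L])
next
  case (Suc n)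
  show ?case
  proof (rule td_SucI[OF S])
    show "((\<lambda>x. L (f x)) has_derivative (\<lambda>w. L (frechet_derivative f (at x) w))) (at x)" if "x \<in> S" for x
      using td_SucD(1)[OF Suc.prems that] by (rule bounded_linear.has_derivative[OF L])
    show "times_differentiable_on n S (\<lambda>x. L (frechet_derivative f (at x) w))" for w
      by (rule Suc.IH; rule td_SucD(2); fact)
  qed
qed

lemma td_bilinear:
  assumes S: "open S" and b: "bounded_bilinear pr" and f: "times_differentiable_on n S f" and g: "times_differentiable_on n S g"
  shows "times_differentiable_on n S (\<lambda>x. pr (f x) (g x))"
  using f g
proof (induction n arbitrary: f g)
  case 0
  then show ?case by (simp add: bounded_bilinear.continuous_on[OF b])
next
  case (Suc n)
  show ?case
  proof (rule td_SucI[OF S])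
    show "((\<lambda>x. pr (f x) (g x)) has_derivative (\<lambda>w. pr (f x) (frechet_derivative g (at x) w) + pr (frechet_derivative f (at x) w) (g x))) (at x)"
      if "x \<in> S" for x
      using td_SucD(1)[OF Suc.prems(1) that] td_SucD(1)[OF Suc.prems(2) that] by (rule bounded_bilinear.FDERIV[OF b])
    show "times_differentiable_on n S (\<lambda>x. pr (f x) (frechet_derivative g (at x) w) + pr (frechet_derivative f (at x) w) (g x))" for w
      using td_SucD(2)[OF Suc.prems(1)] td_SucD(2)[OF Suc.prems(2)] td_lower[OF Suc.prems(1)] td_lower[OF Suc.prems(2)]
      by (intro td_add[OF S] Suc.IH)
  qed
qed

text \<open>The outer function has one real variable, so its derivative is multiplication of a
  vector by a scalar and the chain rule reduces to \<open>td_bilinear\<close>.\<close>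

lemma td_compose:
  fixes \<phi> :: "real \<Rightarrow> 'b::real_normed_vector"
  assumes S: "open S" and \<phi>: "times_differentiable_on n I \<phi>" and f: "times_differentiable_on n S f" and fI: "\<And>x. x \<in> S \<Longrightarrow> f x \<in> I"
  shows "times_differentiable_on n S (\<lambda>x. \<phi> (f x))"
  using \<phi> f
proof (induction n arbitrary: \<phi>)
  case 0
  then show ?case using fI by (auto intro: continuous_on_compose2)
next
  case (Suc n)
  show ?case
  proof (rule td_SucI[OF S])
    fix x assume x: "x \<in> S"
    have d: "(\<phi> has_derivative frechet_derivative \<phi> (at (f x))) (at (f x))"
      by (rule td_SucD(1)[OF Suc.prems(1) fI[OF x]])
    have lin: "frechet_derivative \<phi> (at (f x)) r = r *\<^sub>R frechet_derivative \<phi> (at (f x)) 1" for r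
      using linear_scale[OF has_derivative_linear[OF d], of r 1] by (simp only: real_scaleR_def mult_1_right)
    have "((\<lambda>x. \<phi> (f x)) has_derivative (\<lambda>w. frechet_derivative \<phi> (at (f x)) (frechet_derivative f (at x) w))) (at x)"
      using has_derivative_compose[OF td_SucD(1)[OF Suc.prems(2) x] d] .
    moreover have "(\<lambda>w. frechet_derivative \<phi> (at (f x)) (frechet_derivative f (at x) w)) =
        (\<lambda>w. frechet_derivative f (at x) w *\<^sub>R frechet_derivative \<phi> (at (f x)) 1)"
      by (rule ext) (rule lin)
    ultimately show "((\<lambda>x. \<phi> (f x)) has_derivative (\<lambda>w. frechet_derivative f (at x) w *\<^sub>R frechet_derivative \<phi> (at (f x)) 1)) (at x)"
      by (simp only:)
  next
    show "times_differentiable_on n S (\<lambda>x. frechet_derivative f (at x) w *\<^sub>R frechet_derivative \<phi> (at (f x)) 1)" for w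
      using td_SucD(2)[OF Suc.prems(2)] Suc.IH[OF td_SucD(2)[OF Suc.prems(1)] td_lower[OF Suc.prems(2)]]
      by (intro td_bilinear[OF S bounded_bilinear_scaleR])
  qed
qed

lemma td_realI:
  fixes f :: "real \<Rightarrow> real"
  assumes S: "open S" and f: "\<And>x. x \<in> S \<Longrightarrow> (f has_real_derivative f' x) (at x)" and f': "times_differentiable_on n S f'"
  shows "times_differentiable_on (Suc n) S f"
proof (rule td_SucI[OF S])
  show "(f has_derivative (\<lambda>w. f' x * w)) (at x)" if "x \<in> S" for x
    using f[OF that] unfolding has_field_derivative_def .
  show "times_differentiable_on n S (\<lambda>x. f' x * w)" for w
    by (rule td_bilinear[OF S bounded_bilinear_mult f' td_const])
qed

lemma td_realD:
  fixes f :: "real \<Rightarrow> real"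
  assumes f: "times_differentiable_on (Suc n) S f"
  obtains f' where "\<And>x. x \<in> S \<Longrightarrow> (f has_real_derivative f' x) (at x)" "times_differentiable_on n S f'"
proof (rule that[of "\<lambda>x. frechet_derivative f (at x) 1"])
  fix x assume x: "x \<in> S"
  have d: "(f has_derivative frechet_derivative f (at x)) (at x)" by (rule td_SucD(1)[OF f x])
  have "frechet_derivative f (at x) = (*) (frechet_derivative f (at x) 1)"
  proof
    fix r
    have "frechet_derivative f (at x) (r * 1) = r * frechet_derivative f (at x) 1"
      using linear_scale[OF has_derivative_linear[OF d], of r 1] unfolding real_scaleR_def .
    then show "frechet_derivative f (at x) r = frechet_derivative f (at x) 1 * r"
      by (simp only: mult_1_right mult.commute[of r "frechet_derivative f (at x) 1"])
  qed
  then show "(f has_real_derivative frechet_derivative f (at x) 1) (at x)"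
    using d unfolding has_field_derivative_def by simp
qed (rule td_SucD(2)[OF f])

lemma td_ident:
  assumes "open S"
  shows "times_differentiable_on n S (\<lambda>x. x)"
proof (cases n)
  case (Suc m)
  show ?thesis unfolding Suc
    by (rule td_SucI[OF assms has_derivative_ident]) (rule td_const)
qed simp

lemma td_mult: "open S \<Longrightarrow> times_differentiable_on n S f \<Longrightarrow> times_differentiable_on n S g \<Longrightarrow>
    times_differentiable_on n S (\<lambda>x. f x * g x :: 'a::real_normed_algebra)"
  by (rule td_bilinear[OF _ bounded_bilinear_mult])

lemma td_power: "open S \<Longrightarrow> times_differentiable_on n S f \<Longrightarrow> times_differentiable_on n S (\<lambda>x. f x ^ k :: 'a::real_normed_algebra_1)"
  by (induction k) (auto intro: td_const td_mult)

lemma td_minus: "open S \<Longrightarrow> times_differentiable_on n S f \<Longrightarrow> times_differentiable_on n S (\<lambda>x. - f x)"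
  by (rule td_linear[OF _ bounded_linear_minus[OF bounded_linear_ident]])

lemma td_diff: "open S \<Longrightarrow> times_differentiable_on n S f \<Longrightarrow> times_differentiable_on n S g \<Longrightarrow>
    times_differentiable_on n S (\<lambda>x. f x - g x)"
  using td_add[of S n f "\<lambda>x. - g x"] td_minus[of S n g] by simp

text \<open>The induction closes because the derivative is a polynomial in
  \<open>inverse\<close>.\<close>

lemma td_inverse_real: "times_differentiable_on n {x::real. x \<noteq> 0} inverse"
proof (induction n)
  case 0
  then show ?case by (auto intro!: continuous_intros)
next
  case (Suc n)
  have o: "open {x::real. x \<noteq> 0}" by (rule open_Collect_neq) (auto intro: continuous_intros)
  show ?case
  proof (rule td_realI[OF o])
    show "(inverse has_real_derivative - (inverse x * inverse x)) (at x)" if "x \<in> {x. x \<noteq> 0}" for x :: real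
      using that by (auto intro!: derivative_eq_intros simp: power2_eq_square)
    show "times_differentiable_on n {x::real. x \<noteq> 0} (\<lambda>x. - (inverse x * inverse x))"
      by (intro td_minus td_mult o Suc)
  qed
qed

lemma td_inverse:
  fixes f :: "'a::real_normed_vector \<Rightarrow> real"
  assumes "open S" "times_differentiable_on n S f" "\<And>x. x \<in> S \<Longrightarrow> f x \<noteq> 0"
  shows "times_differentiable_on n S (\<lambda>x. inverse (f x))"
  by (rule td_compose[OF assms(1) td_inverse_real assms(2)]) (use assms(3) in auto)

lemma td_exp: "times_differentiable_on n UNIV (exp :: real \<Rightarrow> real)"
proof (induction n)
  case 0
  then show ?case by (auto intro!: continuous_intros)
next
  case (Suc n)
  show ?case by (rule td_realI[OF open_UNIV DERIV_exp Suc])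
qed

lemma td_ln: "times_differentiable_on n {0<..} (ln :: real \<Rightarrow> real)"
proof (cases n)
  case 0
  then show ?thesis by (auto intro!: continuous_intros)
next
  case (Suc m)
  show ?thesis unfolding Suc
    by (rule td_realI[of _ _ inverse])
      (auto intro!: derivative_eq_intros td_inverse td_ident simp: inverse_eq_divide)
qed

lemma td_sqrt: "times_differentiable_on n {0<..} sqrt"
proof (induction n)
  case 0
  then show ?case by (auto intro!: continuous_intros)
next
  case (Suc n)
  show ?case
  proof (rule td_realI)
    show "(sqrt has_real_derivative inverse (sqrt x) * (1/2)) (at x)" if "x \<in> {0<..}" for x
      using that by (auto intro!: derivative_eq_intros)
    show "times_differentiable_on n {0<..} (\<lambda>x. inverse (sqrt x) * (1/2))"
      by (intro td_mult td_inverse td_const Suc) auto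
  qed simp
qed

text \<open>Each differentiation under the integral raises the power of \<open>l\<close> by one, so
  the induction has to run for all \<open>j\<close> at once.\<close>

lemma td_average:
  fixes F :: "real \<Rightarrow> real"
  assumes ab: "a < 0" "0 < b" and F: "times_differentiable_on n {a<..<b} F"
  shows "times_differentiable_on n {a<..<b} (\<lambda>w. integral {0..1} (\<lambda>l. l ^ j * F (l * w)))"
  using F
proof (induction n arbitrary: F j)
  have cont: "continuous_on ({a<..<b} \<times> {0..1}) (\<lambda>(w, l). l ^ j * F (l * w))" if "continuous_on {a<..<b} F" for F :: "real \<Rightarrow> real" and j
  proof -
    have "continuous_on ({a<..<b} \<times> {0..1}) (\<lambda>z. F (snd z * fst z))"
      by (rule continuous_on_compose2[OF that]) (use scale_mem ab in \<open>auto intro!: continuous_intros\<close>)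
    then show ?thesis unfolding case_prod_beta' by (intro continuous_intros)
  qed
  {
    case 0
    have "continuous_on {a<..<b} (\<lambda>w. integral (cbox 0 1) (\<lambda>l. l ^ j * F (l * w)))"
      by (rule integral_continuous_on_param) (use cont[of F j] 0 in auto)
    then show ?case by simp
  next
    case (Suc n)
    obtain F' where F': "\<And>x. x \<in> {a<..<b} \<Longrightarrow> (F has_real_derivative F' x) (at x)" "times_differentiable_on n {a<..<b} F'"
      using td_realD[OF Suc.prems] by metis
    have F'c: "continuous_on {a<..<b} F'"
      using F'(2) by (rule td_continuous)
    have Fc: "continuous_on {a<..<b} F" using F'(1) by (auto intro!: continuous_at_imp_continuous_on DERIV_isCont[OF F'(1)])
    show ?case
    proof (rule td_realI[of _ _ "\<lambda>w. integral {0..1} (\<lambda>l. l ^ Suc j * F' (l * w))"])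
      fix w assume w: "w \<in> {a<..<b}"
      have "((\<lambda>w. integral (cbox 0 1) (\<lambda>l. l ^ j * F (l * w))) has_field_derivative
          integral (cbox 0 1) (\<lambda>l. l ^ Suc j * F' (l * w))) (at w within {a<..<b})"
      proof (rule leibniz_rule_field_derivative)
        fix x l :: real assume x: "x \<in> {a<..<b}" and l: "l \<in> cbox 0 1"
        have "l * x \<in> {a<..<b}" using scale_mem[of l x a b] x l ab by auto
        then have "((\<lambda>x. F (l * x)) has_real_derivative F' (l * x) * l) (at x)"
          by (intro DERIV_chain2[where f = F and g = "\<lambda>x. l * x", OF F'(1)]) (auto intro!: derivative_eq_intros)
        then have "((\<lambda>x. l ^ j * F (l * x)) has_real_derivative l ^ j * (F' (l * x) * l)) (at x)"
          by (rule DERIV_cmult)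
        then show "((\<lambda>x. l ^ j * F (l * x)) has_real_derivative l ^ Suc j * F' (l * x)) (at x within {a<..<b})"
          by (simp add: mult_ac has_field_derivative_at_within)
      next
        fix x assume x: "x \<in> {a<..<b}"
        have "continuous_on {0..1} (\<lambda>l. (\<lambda>(w, l). l ^ j * F (l * w)) (x, l))"
          by (rule continuous_on_compose2[OF cont[OF Fc, of j]]) (use x in \<open>auto intro!: continuous_intros\<close>)
        then show "(\<lambda>l. l ^ j * F (l * x)) integrable_on cbox 0 1" by (auto intro: integrable_continuous_real)
      qed (use w cont[OF F'c, of "Suc j"] in auto)
      then show "((\<lambda>w. integral {0..1} (\<lambda>l. l ^ j * F (l * w))) has_real_derivative
          integral {0..1} (\<lambda>l. l ^ Suc j * F' (l * w))) (at w)"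
        by (simp only: at_within_open[OF w open_greaterThanLessThan] cbox_interval)
    qed (use Suc.IH[OF F'(2), of "Suc j"] in auto)
  }
qed

section \<open>Smoothness of profiles across the center\<close>

context knot_profile
begin

lemma src_q_0: "src_q n s p G q 0 = (n + 1) * q 0"
proof -
  have "q 0 = src_q n s p G q 0 * integral {0..1} (\<lambda>l::real. l ^ n)"
    using q_eq[of 0] ab by simp
  moreover have "integral {0..1} (\<lambda>l::real. l ^ n) = 1 / (n + 1)"
  proof (rule integral_unique)
    have "((\<lambda>l::real. l ^ n) has_integral (1 ^ Suc n / (n + 1) - 0 ^ Suc n / (n + 1))) {0..1}"
    proof (rule fundamental_theorem_of_calculus)
      fix l :: real
      have "((\<lambda>l::real. l ^ Suc n / (n + 1)) has_real_derivative real (Suc n) * l ^ (Suc n - Suc 0) / (n + 1)) (at l)"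
        by (rule DERIV_cdivide[OF DERIV_pow])
      then have "((\<lambda>l::real. l ^ Suc n / (n + 1)) has_real_derivative l ^ n) (at l)" by simp
      then show "((\<lambda>l::real. l ^ Suc n / (n + 1)) has_vector_derivative l ^ n) (at l within {0..1})"
        by (simp add: has_real_derivative_iff_has_vector_derivative has_vector_derivative_at_within)
    qed simp
    then show "((\<lambda>l::real. l ^ n) has_integral 1 / (n + 1)) {0..1}" by simp
  qed
  ultimately show ?thesis by simp
qed

text \<open>Away from \<open>0\<close> this is \<open>deriv_Q\<close> divided by
  \<open>w ^ n\<close>. At \<open>0\<close> the difference quotient of \<open>w q\<close> is
  \<open>q\<close> itself, so continuity of \<open>q\<close> gives the derivative
  \<open>q 0\<close>, and \<open>src_q_0\<close> identifies it with the right-hand side.\<close>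

lemma deriv_wq_all:
  assumes w: "w \<in> {a<..<b}"
  shows "((\<lambda>w. w * q w) has_real_derivative src_q n s p G q w - n * q w) (at w)"
proof (cases "w = 0")
  case True
  have "((\<lambda>h. ((0 + h) * q (0 + h) - 0 * q 0) / h) \<longlongrightarrow> q 0) (at 0)"
  proof (rule Lim_transform_eventually)
    show "(q \<longlongrightarrow> q 0) (at 0)" using cont_q[of 0] ab by (simp add: isCont_def)
    show "\<forall>\<^sub>F x in at 0. q x = ((0 + x) * q (0 + x) - 0 * q 0) / x"
      by (simp add: eventually_at_filter)
  qed
  then have "((\<lambda>w. w * q w) has_real_derivative q 0) (at 0)" unfolding DERIV_def .
  then show ?thesis unfolding True src_q_0 by (simp add: algebra_simps)
next
  case False
  obtain m where m: "n = Suc m" using n2 by (cases n) auto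
  have d: "((\<lambda>w. w ^ n) has_real_derivative n * w ^ m) (at w)"
    using DERIV_pow[of n w] m by simp
  have "((\<lambda>w. w ^ Suc n * q w / w ^ n) has_real_derivative
     (w ^ n * src_q n s p G q w * w ^ n - w ^ Suc n * q w * (n * w ^ m)) / (w ^ n * w ^ n)) (at w)"
    by (rule DERIV_divide[OF deriv_Q[OF w] d]) (use False in simp)
  moreover have "(w ^ n * src_q n s p G q w * w ^ n - w ^ Suc n * q w * (n * w ^ m)) / (w ^ n * w ^ n) = src_q n s p G q w - n * q w"
    using False unfolding m by (simp add: field_simps)
  ultimately have "((\<lambda>w. w ^ Suc n * q w / w ^ n) has_real_derivative src_q n s p G q w - n * q w) (at w)" by simp
  then show ?thesis
    by (rule has_field_derivative_transform_within_open[of _ _ _ "- {0}"]) (use False in auto)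
qed

text \<open>Bootstrapping, in an order that never divides by \<open>w\<close>: the derivative of
  \<open>w q\<close> contains no derivative of \<open>q\<close>, so \<open>w q\<close> gains one
  order; \<open>src_p\<close> sees \<open>q\<close> only through \<open>w q\<close>, so
  \<open>p\<close> gains one as an average of it; then \<open>src_q\<close> and with it
  \<open>q\<close> follow.\<close>

lemma td_profile:
  "times_differentiable_on m {a<..<b} h \<and> times_differentiable_on m {a<..<b} p \<and>
   times_differentiable_on m {a<..<b} G \<and> times_differentiable_on m {a<..<b} q"
proof (induction m)
  case 0
  then show ?case by (simp add: cont_on)
next
  case (Suc m)
  let ?I = "{a<..<b}"
  have o: "open ?I" by simp
  note [simp] = open_greaterThanLessThan
  have lin: "times_differentiable_on k ?I (\<lambda>v. inverse (1 + v))" for k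
    by (intro td_inverse td_add td_const td_ident o) (use ab in auto)
  have tt: "times_differentiable_on k ?I tt" for k
  proof -
    have "times_differentiable_on k ?I (\<lambda>v. (1 - v) * inverse (1 + v))"
      by (intro td_mult td_diff td_const td_ident o lin)
    then show ?thesis unfolding tt_def[abs_def] by (simp add: divide_inverse)
  qed
  have h1: "times_differentiable_on (Suc m) ?I h" by (rule td_realI[OF o deriv_h]) (use Suc in auto)
  have G1: "times_differentiable_on (Suc m) ?I G" by (rule td_realI[OF o deriv_G]) (use Suc in auto)
  have src_q_m: "times_differentiable_on k ?I (src_q n s p G q)"
    if "times_differentiable_on k ?I (\<lambda>v. v * q v)" "times_differentiable_on k ?I p" "times_differentiable_on k ?I G" for k
  proof -
    have "times_differentiable_on k ?I (\<lambda>v. 2 * (v * q v) * p v + s\<^sup>2 * n * G v * (2 * n * inverse (1 + v) + 2 * tt v * p v))"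
      by (intro that lin tt td_add td_mult td_const o)
    then show ?thesis unfolding src_q_def[abs_def] by (simp add: divide_inverse mult.assoc)
  qed
  have wq: "times_differentiable_on (Suc m) ?I (\<lambda>v. v * q v)"
  proof (rule td_realI[OF o deriv_wq_all])
    show "times_differentiable_on m ?I (\<lambda>w. src_q n s p G q w - n * q w)"
      using Suc by (intro td_diff td_mult td_const o src_q_m td_ident) auto
  qed simp
  have eh: "times_differentiable_on (Suc m) ?I (\<lambda>v. exp (- 2 * h v))"
    by (rule td_compose[OF o td_exp]) (intro td_mult td_const o h1, simp)
  have src_p1: "times_differentiable_on (Suc m) ?I (src_p n s h G q)"
    unfolding src_p_def[abs_def] by (intro eh wq G1 tt td_minus td_mult td_add td_power td_const td_ident o)
  have "times_differentiable_on (Suc m) ?I (\<lambda>w. integral {0..1} (\<lambda>l. l ^ 0 * src_p n s h G q (l * w)))"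
    by (rule td_average[OF ab(2,3) src_p1])
  then have p1: "times_differentiable_on (Suc m) ?I p"
    by (rule td_cong[OF o, rotated]) (simp add: p_eq)
  have "times_differentiable_on (Suc m) ?I (\<lambda>w. integral {0..1} (\<lambda>l. l ^ n * src_q n s p G q (l * w)))"
    by (rule td_average[OF ab(2,3) src_q_m[OF wq p1 G1]])
  then have q1: "times_differentiable_on (Suc m) ?I q"
    by (rule td_cong[OF o, rotated]) (simp add: q_eq)
  show ?case using h1 p1 G1 q1 by blast
qed

end

subsection \<open>Boundary asymptotics\<close>

text \<open>In \<open>src_p\<close> the pair \<open>(G, q)\<close> occurs quadratically against
  \<open>exp (- 2 h)\<close>, and \<open>src_q\<close> is linear in it.\<close>

lemma profile_scale:
  assumes "profile n s a b h p G q"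
  shows "profile n s a b (\<lambda>w. h w + \<alpha>) p (\<lambda>w. exp \<alpha> * G w) (\<lambda>w. exp \<alpha> * q w)"
proof -
  have "exp (- 2 * (h v + \<alpha>)) * (exp \<alpha>)\<^sup>2 = exp (- 2 * h v)" for v
    by (simp flip: exp_double exp_add)
  then have e: "exp (- 2 * (h v + \<alpha>)) * (exp \<alpha> * x) * (exp \<alpha> * y) = exp (- 2 * h v) * x * y" for v x y
    by (metis (no_types, opaque_lifting) mult.assoc mult.left_commute power2_eq_square)
  have p: "src_p n s (\<lambda>w. h w + \<alpha>) (\<lambda>w. exp \<alpha> * G w) (\<lambda>w. exp \<alpha> * q w) = src_p n s h G q"
  proof
    fix v
    have "src_p n s (\<lambda>w. h w + \<alpha>) (\<lambda>w. exp \<alpha> * G w) (\<lambda>w. exp \<alpha> * q w) v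
      = - (v ^ (n - 1) * (exp (- 2 * (h v + \<alpha>)) * (exp \<alpha> * (v * q v)) * (exp \<alpha> * (v * q v))
        + 2 * s\<^sup>2 * n * tt v * (exp (- 2 * (h v + \<alpha>)) * (exp \<alpha> * G v) * (exp \<alpha> * (v * q v)))
        + (exp (- 2 * (h v + \<alpha>)) * (exp \<alpha> * (n * s * G v)) * (exp \<alpha> * (n * s * G v)))))"
      unfolding src_p_def power2_eq_square by (simp only: distrib_left mult_ac)
    also have "\<dots> = src_p n s h G q v"
      unfolding e src_p_def power2_eq_square by (simp only: distrib_left mult_ac)
    finally show "src_p n s (\<lambda>w. h w + \<alpha>) (\<lambda>w. exp \<alpha> * G w) (\<lambda>w. exp \<alpha> * q w) v = src_p n s h G q v" .
  qed
  have q: "src_q n s p (\<lambda>w. exp \<alpha> * G w) (\<lambda>w. exp \<alpha> * q w) = (\<lambda>w. exp \<alpha> * src_q n s p G q w)"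
    by (rule ext) (simp add: src_q_def algebra_simps)
  have i: "integral {0..1} (\<lambda>l. l ^ n * (exp \<alpha> * src_q n s p G q (l * w))) = exp \<alpha> * integral {0..1} (\<lambda>l. l ^ n * src_q n s p G q (l * w))" for w
    using integral_mult_right[of "{0..1}" "exp \<alpha>" "\<lambda>l. l ^ n * src_q n s p G q (l * w)"] by (simp add: mult_ac)
  show ?thesis
    using assms unfolding profile_def p q i
    by (auto intro!: derivative_eq_intros continuous_intros)
qed

text \<open>Put \<open>\<sigma> = sinh t\<close>. Near the boundary \<open>t\<close> is asymptotic
  to \<open>\<sigma>\<close>, and the exponent is \<open>ln t\<close> up to a bounded term; far out
  \<open>t\<close> is asymptotic to \<open>ln \<sigma>\<close>, and \<open>h\<close> tends to
  \<open>h 0\<close>. The summand \<open>ln 2\<close> is the factor \<open>2\<close> in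
  \<open>Y\<close>.\<close>

lemma log_asymptotics:
  fixes n :: nat and h :: "real \<Rightarrow> real"
  assumes U0: "((\<lambda>t. real n * t + h (exp (- 2 * t)) - ln t) \<longlongrightarrow> L) (at_right 0)" and h: "isCont h 0"
  shows "((\<lambda>\<sigma>. (n * arsinh \<sigma> + h (exp (- 2 * arsinh \<sigma>)) + ln 2) / ln \<sigma>) \<longlongrightarrow> 1) (at_right 0)"
    and "((\<lambda>\<sigma>. (n * arsinh \<sigma> + h (exp (- 2 * arsinh \<sigma>)) + ln 2) / ln \<sigma>) \<longlongrightarrow> real n) at_top"
proof -
  have ar0: "filterlim arsinh (at_right 0) (at_right (0::real))"
    unfolding arsinh_real_def[abs_def] by real_asymp
  have arl0: "((\<lambda>\<sigma>. ln (arsinh \<sigma>) / ln \<sigma>) \<longlongrightarrow> 1) (at_right (0::real))"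
    unfolding arsinh_real_def[abs_def] by real_asymp
  have lnl: "((\<lambda>\<sigma>. 1 / ln \<sigma>) \<longlongrightarrow> 0) (at_right (0::real))" "((\<lambda>\<sigma>. 1 / ln \<sigma>) \<longlongrightarrow> 0) (at_top :: real filter)"
    by real_asymp+
  have arl1: "((\<lambda>\<sigma>. arsinh \<sigma> / ln \<sigma>) \<longlongrightarrow> 1) (at_top :: real filter)"
    unfolding arsinh_real_def[abs_def] by real_asymp
  have ex1: "((\<lambda>\<sigma>. exp (- 2 * arsinh \<sigma>)) \<longlongrightarrow> 0) (at_top :: real filter)"
    unfolding arsinh_real_def[abs_def] by real_asymp
  define U where "U t = real n * t + h (exp (- 2 * t)) - ln t" for t :: real
  have "((\<lambda>\<sigma>. U (arsinh \<sigma>) * (1 / ln \<sigma>) + ln (arsinh \<sigma>) / ln \<sigma> + ln 2 * (1 / ln \<sigma>)) \<longlongrightarrow> L * 0 + 1 + ln 2 * 0) (at_right 0)"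
    by (intro tendsto_add tendsto_mult lnl arl0 tendsto_const filterlim_compose[OF U0[folded U_def] ar0])
  moreover have "U (arsinh \<sigma>) * (1 / ln \<sigma>) + ln (arsinh \<sigma>) / ln \<sigma> + ln 2 * (1 / ln \<sigma>)
      = (n * arsinh \<sigma> + h (exp (- 2 * arsinh \<sigma>)) + ln 2) / ln \<sigma>" for \<sigma>
    unfolding U_def by (simp add: add_divide_distrib diff_divide_distrib)
  ultimately show "((\<lambda>\<sigma>. (n * arsinh \<sigma> + h (exp (- 2 * arsinh \<sigma>)) + ln 2) / ln \<sigma>) \<longlongrightarrow> 1) (at_right 0)"
    by simp
  have h0: "((\<lambda>\<sigma>. h (exp (- 2 * arsinh \<sigma>))) \<longlongrightarrow> h 0) at_top"
    by (rule isCont_tendsto_compose[OF h ex1])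
  have "((\<lambda>\<sigma>. n * (arsinh \<sigma> / ln \<sigma>) + h (exp (- 2 * arsinh \<sigma>)) * (1 / ln \<sigma>) + ln 2 * (1 / ln \<sigma>)) \<longlongrightarrow> real n * 1 + h 0 * 0 + ln 2 * 0) at_top"
    by (intro tendsto_add tendsto_mult lnl arl1 tendsto_const h0)
  moreover have "n * (arsinh \<sigma> / ln \<sigma>) + h (exp (- 2 * arsinh \<sigma>)) * (1 / ln \<sigma>) + ln 2 * (1 / ln \<sigma>)
      = (n * arsinh \<sigma> + h (exp (- 2 * arsinh \<sigma>)) + ln 2) / ln \<sigma>" for \<sigma>
    by (simp add: add_divide_distrib)
  ultimately show "((\<lambda>\<sigma>. (n * arsinh \<sigma> + h (exp (- 2 * arsinh \<sigma>)) + ln 2) / ln \<sigma>) \<longlongrightarrow> real n) at_top" by simp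
qed

lemma sinh_quotient_limit: "((\<lambda>t. sinh (real n * t) / t) \<longlongrightarrow> n) (at_right (0::real))"
proof -
  have "((\<lambda>t. sinh (real n * t)) has_real_derivative cosh (n * 0) * n) (at (0::real))"
    by (auto intro!: derivative_eq_intros)
  then have "((\<lambda>t. sinh (real n * t) / t) \<longlongrightarrow> n) (at (0::real))" by (simp add: DERIV_def)
  then show ?thesis by (simp add: filterlim_at_split)
qed

section \<open>Limits and expansion at the boundary\<close>

locale knot_profile_limit = knot_profile n s a 1 h p G q for n s a h p G q +
  assumes td: "\<And>w. 0 < w \<Longrightarrow> w < 1 \<Longrightarrow> trace_dist n s 0 h G w \<le> 2 * exp (8 * (real n)\<^sup>2 * sqrt (1 - sqrt w))"
begin

lemma bound_limit: "((\<lambda>w. 2 * exp (8 * (real n)\<^sup>2 * sqrt (1 - sqrt w))) \<longlongrightarrow> 2) (at_left (1::real))"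
proof -
  have "((\<lambda>w. 2 * exp (8 * (real n)\<^sup>2 * sqrt (1 - sqrt w))) \<longlongrightarrow> 2 * exp (8 * (real n)\<^sup>2 * sqrt (1 - sqrt 1))) (at_left (1::real))"
    by (intro tendsto_intros)
  then show ?thesis by simp
qed

text \<open>\<open>exp h\<close> divided by its value for the reference, that is, the first summand
  of the distance for \<open>\<alpha> = 0\<close>.\<close>

definition ratio :: "real \<Rightarrow> real" where "ratio w = exp (h w) * (2 * n / (1 - w ^ n))"

lemma wn_pos: "0 < (w::real) \<Longrightarrow> w < 1 \<Longrightarrow> 0 < 1 - w ^ n"
  using power_lt_one[of w n] n2 by simp

lemma n_pos: "0 < real n" using n2 by simp

lemma ratio_pos: "0 < w \<Longrightarrow> w < 1 \<Longrightarrow> 0 < ratio w"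
  unfolding ratio_def using wn_pos[of w] n_pos by simp

lemma trace_dist_ratio:
  fixes w :: real
  assumes "0 < w" "w < 1"
  shows "trace_dist n s 0 h G w = ratio w + 1 / ratio w + (G w - 1 / (2 * n * s))\<^sup>2 * (w ^ n * (2 * n / (1 - w ^ n))\<^sup>2 / ratio w)"
proof -
  define y e m where "y = 1 - w ^ n" and "e = exp (h w)" and "m = 2 * real n"
  have pos: "y > 0" "e > 0" "m > 0" unfolding y_def e_def m_def using wn_pos[OF assms] n_pos by auto
  have e: "exp (h w + 0) = e" "exp (- h w - 0) = 1 / e" unfolding e_def by (simp_all add: exp_minus inverse_eq_divide)
  have 1: "y / m * (1 / e) = 1 / (e * (m / y))" by simp
  have 2: "w ^ n * (m / y) * (1 / e) = w ^ n * (m / y)\<^sup>2 / (e * (m / y))"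
    using pos by (simp add: power2_eq_square)
  show ?thesis
    unfolding trace_dist_def ratio_def y_def[symmetric] m_def[symmetric] e e_def[symmetric] 1 2 by (simp add: m_def)
qed

lemma ev_left: "\<forall>\<^sub>F w in at_left (1::real). 0 < w \<and> w < 1"
  using eventually_at_left_real[of 0 1] by simp

text \<open>If \<open>x + 1/x \<le> B\<close>, then
  \<open>(x - 1)^2 = x * (x + 1/x - 2) \<le> B * (B - 2)\<close>, and the bound \<open>B\<close> on
  the distance tends to \<open>2\<close>.\<close>

lemma ratio_limit: "(ratio \<longlongrightarrow> 1) (at_left 1)"
proof -
  define B where "B w = 2 * exp (8 * (real n)\<^sup>2 * sqrt (1 - sqrt w))" for w :: real
  have Bl: "(B \<longlongrightarrow> 2) (at_left 1)" unfolding B_def by (rule bound_limit)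
  have le: "(ratio w - 1)\<^sup>2 \<le> B w * (B w - 2)" if w: "0 < w" "w < 1" for w
  proof -
    have r: "ratio w > 0" by (rule ratio_pos[OF w])
    have "0 \<le> (G w - 1 / (2 * n * s))\<^sup>2 * (w ^ n * (2 * n / (1 - w ^ n))\<^sup>2 / ratio w)"
      using w r by simp
    then have rB: "ratio w + 1 / ratio w \<le> B w" using td[OF w] trace_dist_ratio[OF w] unfolding B_def by simp
    moreover have "1 / ratio w > 0" using r by simp
    ultimately have "ratio w \<le> B w" by linarith
    have "(ratio w - 1)\<^sup>2 = ratio w * (ratio w + 1 / ratio w - 2)"
      using r by (simp add: field_simps power2_eq_square)
    also have "\<dots> \<le> ratio w * (B w - 2)" using rB r by (intro mult_left_mono) auto
    also have "\<dots> \<le> B w * (B w - 2)"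
    proof (rule mult_right_mono)
      have "0 \<le> (ratio w - 1)\<^sup>2 / ratio w" using r by simp
      then have "2 \<le> ratio w + 1 / ratio w" using r by (simp add: field_simps power2_eq_square)
      then show "0 \<le> B w - 2" using rB by simp
    qed fact
    finally show ?thesis .
  qed
  have "((\<lambda>w. (ratio w - 1)\<^sup>2) \<longlongrightarrow> 0) (at_left 1)"
  proof (rule tendsto_sandwich[OF _ _ tendsto_const])
    show "\<forall>\<^sub>F w in at_left 1. (ratio w - 1)\<^sup>2 \<le> B w * (B w - 2)"
      using ev_left by eventually_elim (use le in auto)
    have "((\<lambda>w. B w * (B w - 2)) \<longlongrightarrow> 2 * (2 - 2)) (at_left 1)" by (intro tendsto_intros Bl)
    then show "((\<lambda>w. B w * (B w - 2)) \<longlongrightarrow> 0) (at_left 1)" by simp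
  qed simp
  then have "((\<lambda>w. sqrt ((ratio w - 1)\<^sup>2)) \<longlongrightarrow> sqrt 0) (at_left 1)" by (rule tendsto_real_sqrt)
  then have "((\<lambda>w. \<bar>ratio w - 1\<bar>) \<longlongrightarrow> 0) (at_left 1)" by simp
  then show ?thesis by (rule LIM_zero_cancel[OF tendsto_rabs_zero_cancel])
qed

text \<open>The first two summands of the distance are together at least \<open>2\<close>, so the
  third is at most \<open>B - 2\<close>.\<close>

lemma G_limit: "(G \<longlongrightarrow> 1 / (2 * n * s)) (at_left 1)"
proof -
  define B where "B w = 2 * exp (8 * (real n)\<^sup>2 * sqrt (1 - sqrt w))" for w :: real
  define g where "g = 1 / (2 * n * s)"
  have Bl: "(B \<longlongrightarrow> 2) (at_left 1)" unfolding B_def by (rule bound_limit)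
  have le: "(G w - g)\<^sup>2 \<le> (B w - 2) * (ratio w * ((1 - w ^ n)\<^sup>2 / (2 * n)\<^sup>2) / w ^ n)" if w: "0 < w" "w < 1" for w
  proof -
    have r: "ratio w > 0" by (rule ratio_pos[OF w])
    have "0 \<le> (ratio w - 1)\<^sup>2 / ratio w" using r by simp
    then have "2 \<le> ratio w + 1 / ratio w" using r by (simp add: field_simps power2_eq_square)
    then have "(G w - g)\<^sup>2 * (w ^ n * (2 * n / (1 - w ^ n))\<^sup>2 / ratio w) \<le> B w - 2"
      using td[OF w] trace_dist_ratio[OF w] unfolding B_def g_def by simp
    then show ?thesis using w wn_pos[OF w] n_pos r by (simp add: field_simps power_divide power_mult_distrib)
  qed
  have "((\<lambda>w. (G w - g)\<^sup>2) \<longlongrightarrow> 0) (at_left 1)"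
  proof (rule tendsto_sandwich[OF _ _ tendsto_const])
    show "\<forall>\<^sub>F w in at_left 1. (G w - g)\<^sup>2 \<le> (B w - 2) * (ratio w * ((1 - w ^ n)\<^sup>2 / (2 * n)\<^sup>2) / w ^ n)"
      using ev_left by eventually_elim (use le in auto)
    have "((\<lambda>w. (B w - 2) * (ratio w * ((1 - w ^ n)\<^sup>2 / (2 * n)\<^sup>2) / w ^ n)) \<longlongrightarrow> (2 - 2) * (1 * ((1 - 1 ^ n)\<^sup>2 / (2 * n)\<^sup>2) / 1 ^ n)) (at_left 1)"
      using n_pos by (intro tendsto_intros Bl ratio_limit) auto
    then show "((\<lambda>w. (B w - 2) * (ratio w * ((1 - w ^ n)\<^sup>2 / (2 * n)\<^sup>2) / w ^ n)) \<longlongrightarrow> 0) (at_left 1)" by simp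
  qed simp
  then have "((\<lambda>w. sqrt ((G w - g)\<^sup>2)) \<longlongrightarrow> sqrt 0) (at_left 1)" by (rule tendsto_real_sqrt)
  then have "((\<lambda>w. \<bar>G w - g\<bar>) \<longlongrightarrow> 0) (at_left 1)" by simp
  then show ?thesis unfolding g_def by (rule LIM_zero_cancel[OF tendsto_rabs_zero_cancel])
qed

lemma exp_at_left: "filterlim (\<lambda>t::real. exp (- 2 * t)) (at_left 1) (at_right 0)"
  by real_asymp

text \<open>In the variable \<open>t\<close>, with \<open>U = n t + h\<close> the logarithm of
  \<open>Y / (2 r^n)\<close>: \<open>e2\<close> is \<open>exp (- 2 U)\<close>,
  \<open>\<Gamma>1\<close> is the derivative of \<open>\<Gamma>\<close>, and \<open>P\<close> is the
  corresponding momentum, which removes the term \<open>2 \<Gamma>1 U'\<close> from the equation of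
  second order.\<close>

definition e2 :: "real \<Rightarrow> real" where "e2 t = exp (- 2 * (real n * t + h (exp (- 2 * t))))"
definition \<Gamma> :: "real \<Rightarrow> real" where "\<Gamma> t = G (exp (- 2 * t))"
definition \<Gamma>1 :: "real \<Rightarrow> real" where "\<Gamma>1 t = - 2 * (exp (- 2 * t) * q (exp (- 2 * t)))"
definition P :: "real \<Rightarrow> real" where "P t = e2 t * \<Gamma>1 t"

lemma \<Gamma>_limit: "(\<Gamma> \<longlongrightarrow> 1 / (2 * n * s)) (at_right 0)"
  unfolding \<Gamma>_def by (rule filterlim_compose[OF G_limit exp_at_left])

text \<open>\<open>exp U\<close> is \<open>ratio * sinh (n t) / n\<close>, and
  \<open>sinh (n t) / t\<close> tends to \<open>n\<close>.\<close>

lemma e2_limit: "((\<lambda>t. t\<^sup>2 * e2 t) \<longlongrightarrow> 1) (at_right 0)"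
proof -
  have r: "((\<lambda>t. ratio (exp (- 2 * t))) \<longlongrightarrow> 1) (at_right 0)"
    by (rule filterlim_compose[OF ratio_limit exp_at_left])
  have "((\<lambda>t. (real n)\<^sup>2 / ((sinh (real n * t) / t)\<^sup>2 * (ratio (exp (- 2 * t)))\<^sup>2)) \<longlongrightarrow> (real n)\<^sup>2 / ((real n)\<^sup>2 * 1\<^sup>2)) (at_right 0)"
    using n_pos by (intro tendsto_intros r sinh_quotient_limit) auto
  then have lim: "((\<lambda>t. (real n)\<^sup>2 / ((sinh (real n * t) / t)\<^sup>2 * (ratio (exp (- 2 * t)))\<^sup>2)) \<longlongrightarrow> 1) (at_right 0)"
    using n_pos by simp
  have "\<forall>\<^sub>F t in at_right (0::real). (real n)\<^sup>2 / ((sinh (real n * t) / t)\<^sup>2 * (ratio (exp (- 2 * t)))\<^sup>2) = t\<^sup>2 * e2 t"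
    unfolding eventually_at_filter
  proof (intro always_eventually allI impI)
    fix t :: real assume "t \<noteq> 0" "t \<in> {0<..}"
    then have t: "t > 0" by simp
    define w where "w = exp (- 2 * t)"
    have w: "0 < w" "w < 1" unfolding w_def using t by auto
    have sh: "sinh (real n * t) = exp (real n * t) * ((1 - w ^ n) / 2)"
      using sinh_eq_power[of n t] n2 t n_pos unfolding w_def by (simp add: field_simps)
    have "sinh (real n * t) * ratio w = n * (exp (real n * t) * exp (h w))"
      unfolding sh ratio_def using wn_pos[OF w] by (simp add: field_simps)
    then have sr: "sinh (real n * t) * ratio w = n * exp (real n * t + h w)" by (simp add: exp_add)
    have "e2 t = inverse ((exp (real n * t + h w))\<^sup>2)"
    proof -
      have "exp (- 2 * x) = inverse ((exp x)\<^sup>2)" for x :: real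
        using exp_minus[of "2 * x"] exp_double[of x] by simp
      then show ?thesis unfolding e2_def w_def by blast
    qed
    moreover have "(sinh (real n * t) / t)\<^sup>2 * (ratio w)\<^sup>2 = (n * exp (real n * t + h w))\<^sup>2 / t\<^sup>2"
      using sr by (simp add: power_divide flip: power_mult_distrib)
    ultimately show "(real n)\<^sup>2 / ((sinh (real n * t) / t)\<^sup>2 * (ratio (exp (- 2 * t)))\<^sup>2) = t\<^sup>2 * e2 t"
      unfolding w_def[symmetric] using n_pos t by (simp add: power_mult_distrib field_simps)
  qed
  from Lim_transform_eventually[OF lim this] show ?thesis .
qed

lemma derivs:
  fixes t :: real
  assumes t: "t > 0"
  shows "(\<Gamma> has_real_derivative \<Gamma>1 t) (at t)"
    and "(e2 has_real_derivative e2 t * (- 2 * (n - 2 * (exp (- 2 * t) * p (exp (- 2 * t)))))) (at t)"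
    and "(P has_real_derivative 4 * s\<^sup>2 * n * e2 t * \<Gamma> t * (n - tanh t * (n - 2 * (exp (- 2 * t) * p (exp (- 2 * t)))))) (at t)"
proof -
  define v where "v = exp (- 2 * t)"
  have v: "0 < v" "v < 1" unfolding v_def using t by auto
  have v': "v \<in> {a<..<1}" using v ab by auto
  have dv: "((\<lambda>t. exp (- 2 * t)) has_real_derivative - 2 * v) (at t)"
    unfolding v_def by (auto intro!: derivative_eq_intros)
  have dG: "((\<lambda>t. G (exp (- 2 * t))) has_real_derivative q v * (- 2 * v)) (at t)"
    by (rule DERIV_chain2[where f = G and g = "\<lambda>t. exp (- 2 * t)", OF _ dv])
      (use deriv_G[OF v'] in \<open>simp add: v_def\<close>)
  then show "(\<Gamma> has_real_derivative \<Gamma>1 t) (at t)"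
    unfolding \<Gamma>_def[abs_def] \<Gamma>1_def v_def[symmetric] by (simp add: mult_ac)
  have dh: "((\<lambda>t. h (exp (- 2 * t))) has_real_derivative p v * (- 2 * v)) (at t)"
    by (rule DERIV_chain2[where f = h and g = "\<lambda>t. exp (- 2 * t)", OF _ dv])
      (use deriv_h[OF v'] in \<open>simp add: v_def\<close>)
  have dU: "((\<lambda>t. - 2 * (n * t + h (exp (- 2 * t)))) has_real_derivative - 2 * (n - 2 * (v * p v))) (at t)"
    by (rule DERIV_cong[OF DERIV_cmult[OF DERIV_add[OF DERIV_cmult[OF DERIV_ident] dh]]]) simp
  have de: "(e2 has_real_derivative e2 t * (- 2 * (n - 2 * (v * p v)))) (at t)"
    unfolding e2_def[abs_def] by (rule DERIV_fun_exp[OF dU])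
  then show "(e2 has_real_derivative e2 t * (- 2 * (n - 2 * (exp (- 2 * t) * p (exp (- 2 * t)))))) (at t)"
    unfolding v_def .
  have dq: "((\<lambda>t. exp (- 2 * t) * q (exp (- 2 * t))) has_real_derivative (src_q n s p G q v - n * q v) * (- 2 * v)) (at t)"
    by (rule DERIV_chain2[where f = "\<lambda>w. w * q w" and g = "\<lambda>t. exp (- 2 * t)", OF _ dv])
      (use deriv_wq[OF v] in \<open>simp add: v_def\<close>)
  have dG1: "(\<Gamma>1 has_real_derivative - 2 * ((src_q n s p G q v - n * q v) * (- 2 * v))) (at t)"
    unfolding \<Gamma>1_def[abs_def] by (rule DERIV_cmult[OF dq])
  have tanh: "tanh t = tt v" unfolding tanh_real_altdef tt_def v_def by simp
  have eq: "2 * n * v / (1 + v) = n - n * tt v" unfolding tt_def using v by (simp add: field_simps)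
  have vs: "v * src_q n s p G q v = 2 * (v * q v) * (v * p v) + s\<^sup>2 * n * G v * (2 * n * v / (1 + v) + 2 * tt v * (v * p v))"
    unfolding src_q_def by (simp add: algebra_simps)
  have "- 2 * ((src_q n s p G q v - n * q v) * (- 2 * v)) = 4 * (v * src_q n s p G q v) - 4 * n * (v * q v)"
    by (simp add: algebra_simps)
  then have dd: "- 2 * ((src_q n s p G q v - n * q v) * (- 2 * v)) =
      8 * (v * q v) * (v * p v) + 4 * s\<^sup>2 * n * G v * (n - n * tt v + 2 * tt v * (v * p v)) - 4 * n * (v * q v)"
    unfolding vs eq by (simp add: algebra_simps)
  have "(P has_real_derivative e2 t * (- 2 * (n - 2 * (v * p v))) * \<Gamma>1 t + - 2 * ((src_q n s p G q v - n * q v) * (- 2 * v)) * e2 t) (at t)"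
    unfolding P_def[abs_def] by (rule DERIV_mult[OF de dG1])
  then show "(P has_real_derivative 4 * s\<^sup>2 * n * e2 t * \<Gamma> t * (n - tanh t * (n - 2 * (exp (- 2 * t) * p (exp (- 2 * t)))))) (at t)"
    unfolding tanh \<Gamma>_def v_def[symmetric]
    by (rule DERIV_cong) (unfold dd \<Gamma>1_def v_def[symmetric], simp add: algebra_simps)
qed

text \<open>The combination \<open>Z = P - 2 s\<^sup>2 n \<Gamma> T e\<^sup>- \<^sup>2 \<^sup>U\<close> satisfies a linear equation in which the
  derivative of \<open>U\<close> no longer occurs.\<close>

definition Z :: "real \<Rightarrow> real" where "Z t = P t - 2 * s\<^sup>2 * n * \<Gamma> t * tanh t * e2 t"
definition "\<kappa> = 2 * s\<^sup>2 * n"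

text \<open>Replacing \<open>P\<close> by \<open>Z + \<kappa> \<Gamma> tanh t * e2\<close> gives an
  equation for \<open>Z\<close> with linear term \<open>- \<kappa> tanh t * Z\<close>; its
  integrating factor is \<open>cosh t\<close> to the power \<open>\<kappa>\<close>, written with
  \<open>exp\<close> and \<open>ln\<close>.\<close>

lemma deriv_Z:
  fixes t :: real
  assumes t: "t > 0"
  shows "((\<lambda>t. exp (\<kappa> * ln (cosh t)) * Z t) has_real_derivative
    exp (\<kappa> * ln (cosh t)) * (e2 t * \<Gamma> t * (4 * s\<^sup>2 * n\<^sup>2 - \<kappa> * (1 - (tanh t)\<^sup>2) - \<kappa>\<^sup>2 * (tanh t)\<^sup>2))) (at t)"
proof -
  define U1 where "U1 = n - 2 * (exp (- 2 * t) * p (exp (- 2 * t)))"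
  note d = derivs[OF t, folded U1_def]
  have dT: "(tanh has_real_derivative 1 - (tanh t)\<^sup>2) (at t)"
    by (auto intro!: derivative_eq_intros)
  have dZ: "(Z has_real_derivative 4 * s\<^sup>2 * n * e2 t * \<Gamma> t * (n - tanh t * U1)
      - ((2 * s\<^sup>2 * n * \<Gamma>1 t * tanh t + (1 - (tanh t)\<^sup>2) * (2 * s\<^sup>2 * n * \<Gamma> t)) * e2 t + e2 t * (- 2 * U1) * (2 * s\<^sup>2 * n * \<Gamma> t * tanh t))) (at t)"
    unfolding Z_def[abs_def] by (intro DERIV_diff DERIV_mult DERIV_cmult d dT)
  have dC: "((\<lambda>t. exp (\<kappa> * ln (cosh t))) has_real_derivative exp (\<kappa> * ln (cosh t)) * (\<kappa> * tanh t)) (at t)"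
    by (auto intro!: derivative_eq_intros simp: tanh_def)
  show ?thesis
    by (rule DERIV_cong[OF DERIV_mult[OF dC dZ]])
      (simp add: Z_def P_def \<kappa>_def power2_eq_square algebra_simps)
qed

text \<open>By l'Hopital against \<open>1/t\<close>: the denominator tends to infinity, so the
  growth of the derivative, of order \<open>1/t^2\<close>, determines the limit without any boundary
  value of \<open>Z\<close>.\<close>

lemma P_limit: "((\<lambda>t. t * P t) \<longlongrightarrow> - 2 * s * (real n - 1)) (at_right 0)"
proof -
  \<comment> \<open>The limit of \<open>t^2\<close> times the right-hand side of
    \<open>deriv_Z\<close>, where \<open>cosh\<close> tends to \<open>1\<close> and
    \<open>tanh\<close> to \<open>0\<close>; it equals \<open>s * (2 n - 1)\<close>.\<close>
  define c where "c = 1 / (2 * n * s) * (4 * s\<^sup>2 * n\<^sup>2 - \<kappa>)"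
  define R where "R t = e2 t * \<Gamma> t * (4 * s\<^sup>2 * n\<^sup>2 - \<kappa> * (1 - (tanh t)\<^sup>2) - \<kappa>\<^sup>2 * (tanh t)\<^sup>2)" for t
  define C where "C t = exp (\<kappa> * ln (cosh t))" for t :: real
  have cosh0: "((\<lambda>t. cosh t) \<longlongrightarrow> 1) (at_right (0::real))" by real_asymp
  have tanh0: "((\<lambda>t. tanh t) \<longlongrightarrow> 0) (at_right (0::real))" by real_asymp
  have tanh1: "((\<lambda>t. tanh t / t) \<longlongrightarrow> 1) (at_right (0::real))" by real_asymp
  have C0: "(C \<longlongrightarrow> exp (\<kappa> * ln 1)) (at_right 0)"
    unfolding C_def by (intro tendsto_intros cosh0) auto
  have R0: "((\<lambda>t. t\<^sup>2 * R t) \<longlongrightarrow> c) (at_right 0)"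
  proof -
    have "((\<lambda>t. (t\<^sup>2 * e2 t) * \<Gamma> t * (4 * s\<^sup>2 * n\<^sup>2 - \<kappa> * (1 - (tanh t)\<^sup>2) - \<kappa>\<^sup>2 * (tanh t)\<^sup>2)) \<longlongrightarrow>
        1 * (1 / (2 * n * s)) * (4 * s\<^sup>2 * n\<^sup>2 - \<kappa> * (1 - 0\<^sup>2) - \<kappa>\<^sup>2 * 0\<^sup>2)) (at_right 0)"
      by (intro tendsto_mult[OF tendsto_mult[OF e2_limit \<Gamma>_limit]] tendsto_intros tanh0)
    then show ?thesis unfolding R_def c_def by (simp add: mult.assoc)
  qed
  have "((\<lambda>t. C t * Z t / (1 / t)) \<longlongrightarrow> - c) (at_right 0)"
  proof (rule lhopital_right_0_at_top)
    show "filterlim (\<lambda>t::real. 1 / t) at_top (at_right 0)" by real_asymp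
    show "\<forall>\<^sub>F t in at_right (0::real). - (1 / t\<^sup>2) \<noteq> 0" unfolding eventually_at_filter by simp
    show "\<forall>\<^sub>F t in at_right 0. ((\<lambda>t. C t * Z t) has_real_derivative C t * R t) (at t)"
      unfolding eventually_at_filter C_def R_def using deriv_Z by (intro always_eventually) auto
    show "\<forall>\<^sub>F t in at_right (0::real). ((\<lambda>t. 1 / t) has_real_derivative - (1 / t\<^sup>2)) (at t)"
      unfolding eventually_at_filter by (intro always_eventually) (auto intro!: derivative_eq_intros simp: power2_eq_square)
    have "((\<lambda>t. - (C t * (t\<^sup>2 * R t))) \<longlongrightarrow> - (exp (\<kappa> * ln 1) * c)) (at_right 0)"
      by (rule tendsto_minus[OF tendsto_mult[OF C0 R0]])
    then show "((\<lambda>t. C t * R t / - (1 / t\<^sup>2)) \<longlongrightarrow> - c) (at_right 0)"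
      by (simp add: mult_ac)
  qed
  then have "((\<lambda>t. C t * Z t / (1 / t) / C t) \<longlongrightarrow> - c / exp (\<kappa> * ln 1)) (at_right 0)"
    by (intro tendsto_divide C0) auto
  then have Z0: "((\<lambda>t. t * Z t) \<longlongrightarrow> - c) (at_right 0)"
    unfolding C_def by (simp add: mult.commute)
  have lim: "((\<lambda>t. t * Z t + 2 * s\<^sup>2 * n * \<Gamma> t * (tanh t / t) * (t\<^sup>2 * e2 t)) \<longlongrightarrow> - c + 2 * s\<^sup>2 * n * (1 / (2 * n * s)) * 1 * 1) (at_right 0)"
    by (intro tendsto_add[OF Z0] tendsto_mult[OF _ e2_limit] tendsto_mult[OF _ tanh1] tendsto_mult[OF tendsto_const \<Gamma>_limit])
  have "\<forall>\<^sub>F t in at_right 0. t * Z t + 2 * s\<^sup>2 * n * \<Gamma> t * (tanh t / t) * (t\<^sup>2 * e2 t) = t * P t"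
    unfolding eventually_at_filter Z_def by (intro always_eventually) (auto simp: power2_eq_square algebra_simps)
  from Lim_transform_eventually[OF lim this]
  have "((\<lambda>t. t * P t) \<longlongrightarrow> - c + 2 * s\<^sup>2 * n * (1 / (2 * n * s)) * 1 * 1) (at_right 0)" .
  moreover have "- c + 2 * s\<^sup>2 * n * (1 / (2 * n * s)) * 1 * 1 = - 2 * s * (real n - 1)"
    unfolding c_def \<kappa>_def using s n2 by (simp add: field_simps power2_eq_square of_nat_diff)
  ultimately show ?thesis by simp
qed

text \<open>For \<open>\<sigma> = sinh t\<close> this is the prescribed limit of
  \<open>v / \<sigma>^2\<close>. Numerator and denominator both vanish at \<open>t = 0\<close>, the
  former by \<open>\<Gamma>_limit\<close>, and the quotient of their derivatives is given by
  \<open>P_limit\<close> and \<open>e2_limit\<close>.\<close>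

lemma \<Gamma>_expansion: "((\<lambda>t. (1 - 2 * n * s * \<Gamma> t) / (n * s\<^sup>2) / (sinh t)\<^sup>2) \<longlongrightarrow> 2 * (real n - 1)) (at_right 0)"
proof (rule lhopital_right_0)
  have "((\<lambda>t. (1 - 2 * n * s * \<Gamma> t) / (n * s\<^sup>2)) \<longlongrightarrow> (1 - 2 * n * s * (1 / (2 * n * s))) / (n * s\<^sup>2)) (at_right 0)"
    using s n_pos by (intro tendsto_intros \<Gamma>_limit) auto
  then show "((\<lambda>t. (1 - 2 * n * s * \<Gamma> t) / (n * s\<^sup>2)) \<longlongrightarrow> 0) (at_right 0)" using s n_pos by simp
  show "((\<lambda>t. (sinh t)\<^sup>2) \<longlongrightarrow> 0) (at_right (0::real))" by real_asymp
  show "\<forall>\<^sub>F t in at_right (0::real). (sinh t)\<^sup>2 \<noteq> 0" unfolding eventually_at_filter by simp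
  show "\<forall>\<^sub>F t in at_right (0::real). 2 * sinh t * cosh t \<noteq> 0" unfolding eventually_at_filter by simp
  show "\<forall>\<^sub>F t in at_right 0. ((\<lambda>t. (1 - 2 * n * s * \<Gamma> t) / (n * s\<^sup>2)) has_real_derivative (- 2 * \<Gamma>1 t / s)) (at t)"
    unfolding eventually_at_filter
  proof (intro always_eventually allI impI)
    fix t :: real assume "t \<noteq> 0" "t \<in> {0<..}"
    then have t: "t > 0" by simp
    have "((\<lambda>t. (1 - 2 * n * s * \<Gamma> t) / (n * s\<^sup>2)) has_real_derivative (0 - 2 * n * s * \<Gamma>1 t) / (n * s\<^sup>2)) (at t)"
      by (intro DERIV_cdivide DERIV_diff DERIV_const DERIV_cmult derivs(1)[OF t])
    moreover have "(0 - 2 * n * s * \<Gamma>1 t) / (n * s\<^sup>2) = - 2 * \<Gamma>1 t / s"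
      using s n_pos by (simp add: power2_eq_square)
    ultimately show "((\<lambda>t. (1 - 2 * n * s * \<Gamma> t) / (n * s\<^sup>2)) has_real_derivative (- 2 * \<Gamma>1 t / s)) (at t)" by simp
  qed
  show "\<forall>\<^sub>F t in at_right (0::real). ((\<lambda>t. (sinh t)\<^sup>2) has_real_derivative 2 * sinh t * cosh t) (at t)"
    by (intro always_eventually allI) (auto intro!: derivative_eq_intros)
  have sc: "((\<lambda>t. sinh t * cosh t / t) \<longlongrightarrow> 1) (at_right (0::real))" by real_asymp
  have lim: "((\<lambda>t. - (t * P t) / (s * (t\<^sup>2 * e2 t) * (sinh t * cosh t / t))) \<longlongrightarrow> - (- 2 * s * (real n - 1)) / (s * 1 * 1)) (at_right 0)"
    using s by (intro tendsto_divide[OF tendsto_minus[OF P_limit]] tendsto_mult[OF _ sc] tendsto_mult[OF tendsto_const e2_limit]) auto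
  have "\<forall>\<^sub>F t in at_right 0. - (t * P t) / (s * (t\<^sup>2 * e2 t) * (sinh t * cosh t / t)) = (- 2 * \<Gamma>1 t / s) / (2 * sinh t * cosh t)"
    unfolding eventually_at_filter
  proof (intro always_eventually allI impI)
    fix t :: real assume "t \<noteq> 0" "t \<in> {0<..}"
    then have t: "t > 0" by simp
    have "e2 t > 0" unfolding e2_def by simp
    moreover have "sinh t > 0" "cosh t > 0" using t by auto
    ultimately show "- (t * P t) / (s * (t\<^sup>2 * e2 t) * (sinh t * cosh t / t)) = (- 2 * \<Gamma>1 t / s) / (2 * sinh t * cosh t)"
      unfolding P_def using t s by (simp add: field_simps power2_eq_square)
  qed
  from Lim_transform_eventually[OF lim this] show "((\<lambda>t. (- 2 * \<Gamma>1 t / s) / (2 * sinh t * cosh t)) \<longlongrightarrow> 2 * (real n - 1)) (at_right 0)"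
    using s by simp
qed

lemma asymptotics:
  "profile_asymptotics (n - 1) (\<lambda>\<sigma>. n * arsinh \<sigma> + h (exp (- 2 * arsinh \<sigma>)) + ln 2)
     (\<lambda>\<sigma>. (1 - 2 * real n * s * G (exp (- 2 * arsinh \<sigma>))) / (n * s\<^sup>2))"
proof -
  have ar0: "filterlim arsinh (at_right 0) (at_right (0::real))"
    unfolding arsinh_real_def[abs_def] by real_asymp
  \<comment> \<open>This is \<open>e2_limit\<close> after taking logarithms.\<close>
  have U0: "((\<lambda>t. real n * t + h (exp (- 2 * t)) - ln t) \<longlongrightarrow> 0) (at_right 0)"
  proof -
    have "((\<lambda>t. - (1/2) * ln (t\<^sup>2 * e2 t)) \<longlongrightarrow> - (1/2) * ln 1) (at_right 0)"
      by (intro tendsto_mult[OF tendsto_const] tendsto_ln e2_limit) auto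
    then have lim: "((\<lambda>t. - (1/2) * ln (t\<^sup>2 * e2 t)) \<longlongrightarrow> 0) (at_right 0)" by simp
    have "\<forall>\<^sub>F t in at_right (0::real). - (1/2) * ln (t\<^sup>2 * e2 t) = real n * t + h (exp (- 2 * t)) - ln t"
      unfolding eventually_at_filter
    proof (intro always_eventually allI impI)
      fix t :: real assume "t \<noteq> 0" "t \<in> {0<..}"
      then have t: "t > 0" by simp
      have "ln (t\<^sup>2 * e2 t) = 2 * ln t + (- 2 * (real n * t + h (exp (- 2 * t))))"
        unfolding e2_def using t by (simp add: ln_mult ln_realpow)
      then show "- (1/2) * ln (t\<^sup>2 * e2 t) = real n * t + h (exp (- 2 * t)) - ln t" by (simp add: field_simps)
    qed
    from Lim_transform_eventually[OF lim this] show ?thesis .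
  qed
  have "isCont h 0" using deriv_h[of 0] ab by (auto intro: DERIV_isCont)
  note la = log_asymptotics[OF U0 this]
  have 2: "((\<lambda>\<sigma>. (n * arsinh \<sigma> + h (exp (- 2 * arsinh \<sigma>)) + ln 2) / ln \<sigma>) \<longlongrightarrow> real (n - 1) + 1) at_top"
    using la(2) n2 by (simp add: of_nat_diff)
  have 3: "((\<lambda>\<sigma>. (1 - 2 * real n * s * G (exp (- 2 * arsinh \<sigma>))) / (n * s\<^sup>2) / \<sigma>\<^sup>2) \<longlongrightarrow> 2 * real (n - 1)) (at_right 0)"
    using filterlim_compose[OF \<Gamma>_expansion ar0] n2 unfolding \<Gamma>_def by (simp add: of_nat_diff)
  define W where "W = exp (- 2 * arsinh (1::real))"
  have W: "0 < W" "W < 1" unfolding W_def by auto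
  have "continuous_on {0..W} (\<lambda>w. (1 - 2 * real n * s * G w) / (n * s\<^sup>2))"
    using s n_pos W ab by (intro continuous_intros continuous_at_imp_continuous_on ballI DERIV_isCont[OF deriv_G]) auto
  then have "bounded ((\<lambda>w. (1 - 2 * real n * s * G w) / (n * s\<^sup>2)) ` {0..W})"
    by (intro compact_imp_bounded compact_continuous_image) auto
  then obtain C where C: "C > 0" "\<forall>x\<in>(\<lambda>w. (1 - 2 * real n * s * G w) / (n * s\<^sup>2)) ` {0..W}. norm x \<le> C"
    unfolding bounded_pos by blast
  \<comment> \<open>\<open>\<epsilon> = 1/2\<close> will do: \<open>\<sigma> \<ge> 1\<close>
    corresponds to \<open>w\<close> in the compact interval \<open>[0, W]\<close>, on which
    \<open>v\<close> is bounded.\<close>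
  have bd: "\<bar>(1 - 2 * real n * s * G (exp (- 2 * arsinh \<sigma>))) / (n * s\<^sup>2)\<bar> \<le> C * \<sigma> powr ((real (n - 1) + 1) * (1 - 1/2))"
    if "\<sigma> \<ge> 1" for \<sigma>
  proof -
    have "exp (- 2 * arsinh \<sigma>) \<in> {0..W}" unfolding W_def using that arsinh_less_iff_real[of \<sigma> 1] by (simp del: arsinh_less_iff_real)
    then have "\<bar>(1 - 2 * real n * s * G (exp (- 2 * arsinh \<sigma>))) / (n * s\<^sup>2)\<bar> \<le> C"
      using C(2) unfolding real_norm_def[symmetric] by blast
    also have "C * 1 \<le> C * \<sigma> powr ((real (n - 1) + 1) * (1 - 1/2))"
      using that C(1) by (intro mult_left_mono ge_one_powr_ge_zero) auto
    finally show ?thesis by simp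
  qed
  show ?thesis unfolding profile_asymptotics_def
  proof (intro conjI la(1) 2 3)
    have "(0::real) < 1/2" "(1/2::real) < 1" by auto
    then show "\<exists>C>0. \<exists>\<epsilon>. 0 < \<epsilon> \<and> \<epsilon> < 1 \<and> (\<forall>\<sigma>\<ge>1. \<bar>(1 - 2 * real n * s * G (exp (- 2 * arsinh \<sigma>))) / (n * s\<^sup>2)\<bar>
        \<le> C * \<sigma> powr ((real (n - 1) + 1) * (1 - \<epsilon>)))"
      using C(1) bd by blast
  qed
qed

end

text \<open>The equations \<open>w p' + p = src_p\<close>, \<open>w q' + (n + 1) q = src_q\<close> for \<open>p = h'\<close>, \<open>q = G'\<close>
  are written with \<open>(w p)'\<close> and \<open>(w q)'\<close>, hence also hold at \<open>w = 0\<close>.\<close>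

definition radial_profile :: "nat \<Rightarrow> real \<Rightarrow> real \<Rightarrow> (real \<Rightarrow> real) \<Rightarrow> (real \<Rightarrow> real) \<Rightarrow> (real \<Rightarrow> real) \<Rightarrow> (real \<Rightarrow> real) \<Rightarrow> bool" where
  "radial_profile n s a h p G q \<longleftrightarrow> -1 \<le> a \<and> a < 0 \<and>
     (\<forall>m. times_differentiable_on m {a<..<1} h \<and> times_differentiable_on m {a<..<1} p \<and>
          times_differentiable_on m {a<..<1} G \<and> times_differentiable_on m {a<..<1} q) \<and>
     (\<forall>w\<in>{a<..<1}. (h has_real_derivative p w) (at w) \<and> (G has_real_derivative q w) (at w) \<and>
        ((\<lambda>w. w * p w) has_real_derivative src_p n s h G q w) (at w) \<and>
        ((\<lambda>w. w * q w) has_real_derivative src_q n s p G q w - n * q w) (at w))"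

lemma radial_profile_minus:
  assumes "radial_profile n s a h p G q"
  shows "radial_profile n (- s) a h p (\<lambda>w. - G w) (\<lambda>w. - q w)"
proof -
  have *: "src_p n (- s) h (\<lambda>w. - G w) (\<lambda>w. - q w) = src_p n s h G q"
    "src_q n (- s) p (\<lambda>w. - G w) (\<lambda>w. - q w) = (\<lambda>w. - src_q n s p G q w)"
    by (rule ext, simp add: src_p_def src_q_def algebra_simps)+
  have **: "((\<lambda>w. w * - q w) has_real_derivative - src_q n s p G q w - n * - q w) (at w)"
    if "((\<lambda>w. w * q w) has_real_derivative src_q n s p G q w - n * q w) (at w)" for w
    using DERIV_minus[OF that] by simp
  have o: "open {a<..<1::real}" by simp
  show ?thesis unfolding radial_profile_def *
  proof (intro conjI allI ballI)
    show "-1 \<le> a" "a < 0" using assms unfolding radial_profile_def by blast+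
    fix m
    show "times_differentiable_on m {a<..<1} h" "times_differentiable_on m {a<..<1} p"
      "times_differentiable_on m {a<..<1} (\<lambda>w. - G w)" "times_differentiable_on m {a<..<1} (\<lambda>w. - q w)"
      using assms td_minus[OF o] unfolding radial_profile_def by blast+
  next
    fix w :: real assume w: "w \<in> {a<..<1}"
    have d: "(h has_real_derivative p w) (at w)" "(G has_real_derivative q w) (at w)"
      "((\<lambda>w. w * p w) has_real_derivative src_p n s h G q w) (at w)"
      "((\<lambda>w. w * q w) has_real_derivative src_q n s p G q w - n * q w) (at w)"
      using assms w unfolding radial_profile_def by blast+
    show "(h has_real_derivative p w) (at w)" "((\<lambda>w. - G w) has_real_derivative - q w) (at w)"
      "((\<lambda>w. w * p w) has_real_derivative src_p n s h G q w) (at w)"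
      "((\<lambda>w. w * - q w) has_real_derivative - src_q n s p G q w - n * - q w) (at w)"
      using d DERIV_minus[OF d(2)] ** by blast+
  qed
qed

section \<open>Existence of radial profiles for all \<open>s \<noteq> 0\<close>\<close>

lemma knot_profile_radial:
  assumes "knot_profile n s a 1 h p G q"
  shows "radial_profile n s a h p G q"
proof -
  interpret knot_profile n s a 1 h p G q by fact
  show ?thesis unfolding radial_profile_def
    using ab td_profile deriv_h deriv_G deriv_wq_all deriv_P by blast
qed

lemma radial_profile_exists:
  fixes s :: real
  assumes "n \<ge> 1" "s \<noteq> 0" "\<bar>s\<bar> \<le> 1/2"
  shows "\<exists>a h p G q. radial_profile n s a h p G q \<and>
    profile_asymptotics (n - 1) (\<lambda>\<sigma>. n * arsinh \<sigma> + h (exp (- 2 * arsinh \<sigma>)) + ln 2)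
     (\<lambda>\<sigma>. (1 - 2 * real n * s * G (exp (- 2 * arsinh \<sigma>))) / (n * s\<^sup>2))"
proof -
  have pos: "\<exists>a h p G q. radial_profile n s a h p G q \<and>
    profile_asymptotics (n - 1) (\<lambda>\<sigma>. n * arsinh \<sigma> + h (exp (- 2 * arsinh \<sigma>)) + ln 2)
     (\<lambda>\<sigma>. (1 - 2 * real n * s * G (exp (- 2 * arsinh \<sigma>))) / (n * s\<^sup>2))" if s: "0 < s" "s \<le> 1/2" for s :: real
  proof (cases "n = 1")
    case False
    then have n: "n \<ge> 2" using assms(1) by simp
    obtain a h p G q \<alpha> where P: "profile n s a 1 h p G q"
      and td: "\<And>w. 0 < w \<Longrightarrow> w < 1 \<Longrightarrow> trace_dist n s \<alpha> h G w \<le> 2 * exp (real (8 * n\<^sup>2) * sqrt (1 - sqrt w))"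
      by (rule profile_exists[OF n s], rule that, assumption) simp
    have l: "knot_profile_limit n s a (\<lambda>w. h w + \<alpha>) p (\<lambda>w. exp \<alpha> * G w) (\<lambda>w. exp \<alpha> * q w)"
    proof -
      have 1: "profile n s a 1 (\<lambda>w. h w + \<alpha>) p (\<lambda>w. exp \<alpha> * G w) (\<lambda>w. exp \<alpha> * q w)" by (rule profile_scale[OF P])
      have 2: "trace_dist n s 0 (\<lambda>w. h w + \<alpha>) (\<lambda>w. exp \<alpha> * G w) w \<le> 2 * exp (8 * (real n)\<^sup>2 * sqrt (1 - sqrt w))" if "0 < w" "w < 1" for w
        using td[OF that] by (simp add: trace_dist_def)
      show ?thesis by unfold_locales (use 1 2 n s in auto)
    qed
    show ?thesis
      using knot_profile_limit.asymptotics[OF l] knot_profile_radial[OF knot_profile_limit.axioms(1)[OF l]] by blast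
  next
    case True
    \<comment> \<open>For \<open>n = 1\<close> the reference itself solves the equations, because
      its defect factor \<open>1 - tanh t * coth t\<close> vanishes; then
      \<open>exp u = 2 \<sigma>\<close> and \<open>v = 0\<close>.\<close>
    define h p G q :: "real \<Rightarrow> real" where "h w = ln ((1 - w) / 2)" and "p w = - inverse (1 - w)" and "G w = 1 / (2 * s)" and "q w = 0" for w :: real
    have o: "open {-1<..<1::real}" by simp
    have td1: "times_differentiable_on m {-1<..<1} (\<lambda>w::real. 1 - w)" for m
      by (intro td_diff td_const td_ident o)
    have r: "radial_profile n s (-1) h p G q"
      unfolding radial_profile_def
    proof (intro conjI allI ballI)
      fix m
      show "times_differentiable_on m {-1<..<1} h"
        unfolding h_def by (rule td_compose[OF o td_ln]) (use td_mult[OF o td1 td_const, of m "1/2"] in auto)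
      show "times_differentiable_on m {-1<..<1} p"
        unfolding p_def by (intro td_minus td_inverse o td1) auto
      show "times_differentiable_on m {-1<..<1} G" "times_differentiable_on m {-1<..<1} q"
        unfolding G_def q_def by (rule td_const)+
    next
      fix w :: real assume w: "w \<in> {-1<..<1}"
      then have w': "1 - w > 0" "1 + w > 0" by auto
      show "(h has_real_derivative p w) (at w)" "(G has_real_derivative q w) (at w)"
        unfolding h_def[abs_def] p_def G_def[abs_def] q_def using w'
        by (auto intro!: derivative_eq_intros simp: divide_simps)
      have e: "exp (- 2 * h w) = 4 / (1 - w)\<^sup>2"
        unfolding h_def using w' by (simp add: exp_minus exp_double power_divide)
      have "src_p n s h G q w = - 1 / (1 - w)\<^sup>2"
        unfolding src_p_def e q_def G_def True using s by (simp add: power2_eq_square)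
      then show "((\<lambda>w. w * p w) has_real_derivative src_p n s h G q w) (at w)"
        unfolding p_def[abs_def] using w' by (auto intro!: derivative_eq_intros simp: field_simps power2_eq_square)
      have "tt w * p w = - (1 / (1 + w))"
        unfolding tt_def p_def using w' by (simp add: divide_simps)
      then have "src_q n s p G q w = s\<^sup>2 * G w * (2 / (1 + w) + 2 * - (1 / (1 + w)))"
        unfolding src_q_def True q_def by (simp add: mult.assoc)
      then show "((\<lambda>w. w * q w) has_real_derivative src_q n s p G q w - n * q w) (at w)"
        unfolding q_def[abs_def] by simp
    qed auto
    have u: "n * arsinh \<sigma> + h (exp (- 2 * arsinh \<sigma>)) + ln 2 = ln (2 * \<sigma>)" if "\<sigma> > 0" for \<sigma> :: real
    proof -
      define t where "t = arsinh \<sigma>"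
      have t: "t > 0" "sinh t = \<sigma>" unfolding t_def using that by auto
      have "\<sigma> = exp t * ((1 - exp (- 2 * t)) / 2)"
        unfolding t(2)[symmetric] sinh_field_def by (simp add: field_simps exp_double power2_eq_square flip: exp_add)
      moreover have "(1 - exp (- 2 * t)) / 2 > 0" using t by simp
      ultimately have "ln \<sigma> = t + ln ((1 - exp (- 2 * t)) / 2)" by (metis exp_gt_zero exp_not_eq_zero ln_exp ln_mult_pos)
      then show ?thesis unfolding h_def True t_def[symmetric] using that by (simp add: ln_mult)
    qed
    have "profile_asymptotics (n - 1) (\<lambda>\<sigma>. n * arsinh \<sigma> + h (exp (- 2 * arsinh \<sigma>)) + ln 2)
     (\<lambda>\<sigma>. (1 - 2 * real n * s * G (exp (- 2 * arsinh \<sigma>))) / (n * s\<^sup>2))"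
      unfolding profile_asymptotics_def
    proof (intro conjI)
      have "((\<lambda>\<sigma>. ln (2 * \<sigma>) / ln \<sigma>) \<longlongrightarrow> 1) (at_right (0::real))" by real_asymp
      then show "((\<lambda>\<sigma>. (n * arsinh \<sigma> + h (exp (- 2 * arsinh \<sigma>)) + ln 2) / ln \<sigma>) \<longlongrightarrow> 1) (at_right 0)"
        by (rule Lim_transform_eventually) (simp only: eventually_at_filter, intro always_eventually allI impI, use u in simp)
      have "((\<lambda>\<sigma>. ln (2 * \<sigma>) / ln \<sigma>) \<longlongrightarrow> real (n - 1) + 1) (at_top :: real filter)" unfolding True by real_asymp
      then show "((\<lambda>\<sigma>. (n * arsinh \<sigma> + h (exp (- 2 * arsinh \<sigma>)) + ln 2) / ln \<sigma>) \<longlongrightarrow> real (n - 1) + 1) at_top"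
        by (rule Lim_transform_eventually) (use eventually_gt_at_top[of "0::real"] in eventually_elim, use u in simp)
      show "\<exists>C>0. \<exists>\<epsilon>. 0 < \<epsilon> \<and> \<epsilon> < 1 \<and> (\<forall>\<sigma>\<ge>1. \<bar>(1 - 2 * real n * s * G (exp (- 2 * arsinh \<sigma>))) / (n * s\<^sup>2)\<bar> \<le> C * \<sigma> powr ((real (n - 1) + 1) * (1 - \<epsilon>)))"
        by (rule exI[of _ 1], simp add: G_def True, rule exI[of _ "1/2"]) (use s in auto)
    qed (use s in \<open>simp add: G_def True\<close>)
    then show ?thesis using r by blast
  qed
  show ?thesis
  proof (cases "s > 0")
    case True
    then show ?thesis using pos[of s] assms by simp
  next
    case False
    \<comment> \<open>The equations contain \<open>s\<close> only through \<open>s^2\<close>.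
      Reversing the sign of \<open>G\<close> along with that of \<open>s\<close> preserves
      \<open>s G\<close>, and thus \<open>v\<close>.\<close>
    then have "0 < - s" "- s \<le> 1/2" using assms by auto
    from pos[OF this] obtain a h p G q where r: "radial_profile n (- s) a h p G q"
      and as: "profile_asymptotics (n - 1) (\<lambda>\<sigma>. n * arsinh \<sigma> + h (exp (- 2 * arsinh \<sigma>)) + ln 2)
     (\<lambda>\<sigma>. (1 - 2 * real n * (- s) * G (exp (- 2 * arsinh \<sigma>))) / (n * (- s)\<^sup>2))" by blast
    have "radial_profile n s a h p (\<lambda>w. - G w) (\<lambda>w. - q w)"
      using radial_profile_minus[OF r] by simp
    moreover have "(\<lambda>\<sigma>. (1 - 2 * real n * (- s) * G (exp (- 2 * arsinh \<sigma>))) / (n * (- s)\<^sup>2))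
      = (\<lambda>\<sigma>. (1 - 2 * real n * s * - G (exp (- 2 * arsinh \<sigma>))) / (n * s\<^sup>2))" by simp
    ultimately have c: "radial_profile n s a h p (\<lambda>w. - G w) (\<lambda>w. - q w) \<and> profile_asymptotics (n - 1) (\<lambda>\<sigma>. n * arsinh \<sigma> + h (exp (- 2 * arsinh \<sigma>)) + ln 2)
     (\<lambda>\<sigma>. (1 - 2 * real n * s * - G (exp (- 2 * arsinh \<sigma>))) / (n * s\<^sup>2))"
      using as by simp
    show ?thesis
      by (rule exI[of _ a], rule exI[of _ h], rule exI[of _ p], rule exI[of _ "\<lambda>w. - G w"], rule exI[of _ "\<lambda>w. - q w"], rule c)
  qed
qed

subsection \<open>Algebra of the Kapustin--Witten equations\<close>

lemma vector_4:
  "(vector [w, x, y, z] :: 'a::zero^4) $ 1 = w" "(vector [w, x, y, z] :: 'a^4) $ 2 = x"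
  "(vector [w, x, y, z] :: 'a^4) $ 3 = y" "(vector [w, x, y, z] :: 'a^4) $ 4 = z"
  unfolding vector_def by simp_all

text \<open>A swap of two rows changes the sign of the determinant; together with
  \<open>eps 1 2 3 4 = 1\<close> this evaluates the symbol on all indices without expanding
  determinants.\<close>

lemma eps_swap:
  "eps j i k l = - eps i j k l" "eps i k j l = - eps i j k l" "eps i j l k = - eps i j k l"
proof -
  have sw: "det (\<chi> r. A $ Transposition.transpose a b r) = - det A" if "a \<noteq> b" for A :: "real^4^4" and a b
    using det_permute_rows[of "Transposition.transpose a b" A] permutes_swap_id[of a UNIV b] that
    by (simp add: sign_swap_id)
  define A :: "real^4^4" where "A = vector [axis i 1, axis j 1, axis k 1, axis l 1]"
  have "vector [axis j 1, axis i 1, axis k 1, axis l 1] = (\<chi> r. A $ Transposition.transpose 1 2 r)"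
    unfolding A_def vec_eq_iff forall_4 vec_lambda_beta vector_4 Transposition.transpose_def by (simp add: vector_4)
  then show "eps j i k l = - eps i j k l" unfolding eps_def A_def[symmetric] using sw[of 1 2 A] by simp
  have "vector [axis i 1, axis k 1, axis j 1, axis l 1] = (\<chi> r. A $ Transposition.transpose 2 3 r)"
    unfolding A_def vec_eq_iff forall_4 vec_lambda_beta vector_4 Transposition.transpose_def by (simp add: vector_4)
  then show "eps i k j l = - eps i j k l" unfolding eps_def A_def[symmetric] using sw[of 2 3 A] by simp
  have "vector [axis i 1, axis j 1, axis l 1, axis k 1] = (\<chi> r. A $ Transposition.transpose 3 4 r)"
    unfolding A_def vec_eq_iff forall_4 vec_lambda_beta vector_4 Transposition.transpose_def by (simp add: vector_4)
  then show "eps i j l k = - eps i j k l" unfolding eps_def A_def[symmetric] using sw[of 3 4 A] by simp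
qed

lemma eps_repeat:
  "eps i i k l = 0" "eps i j j l = 0" "eps i j k k = 0" "eps i j i l = 0" "eps i j k j = 0" "eps i j k i = 0"
proof -
  show a: "eps i i k l = 0" for i k l using eps_swap(1)[of i i k l] by simp
  show b: "eps i j j l = 0" for i j l using eps_swap(2)[of i j j l] by simp
  show c: "eps i j k k = 0" for i j k using eps_swap(3)[of i j k k] by simp
  show d: "eps i j i l = 0" for i j l using eps_swap(2)[of i i j l] a by simp
  show "eps i j k j = 0" using eps_swap(3)[of i j j k] b by simp
  show "eps i j k i = 0" using eps_swap(3)[of i j i k] d by simp
qed

lemma eps_1234: "eps 1 2 3 4 = 1"
proof -
  have "vector [axis 1 1, axis 2 1, axis 3 1, axis 4 1] = (mat 1 :: real^4^4)"
    by (simp add: vec_eq_iff forall_4 mat_def axis_def vector_4)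
  then show ?thesis unfolding eps_def by simp
qed

lemma eps_values:
  "eps 2 1 3 4 = -1" "eps 1 3 2 4 = -1" "eps 1 2 4 3 = -1" "eps 2 3 1 4 = 1" "eps 2 1 4 3 = 1" "eps 3 1 2 4 = 1" "eps 1 3 4 2 = 1" "eps 1 4 2 3 = 1" "eps 3 2 1 4 = -1" "eps 2 3 4 1 = -1" "eps 2 4 1 3 = -1" "eps 3 1 4 2 = -1" "eps 1 4 3 2 = -1" "eps 4 1 2 3 = -1" "eps 3 2 4 1 = 1" "eps 2 4 3 1 = 1" "eps 4 2 1 3 = 1" "eps 3 4 1 2 = 1" "eps 4 1 3 2 = 1" "eps 3 4 2 1 = -1" "eps 4 2 3 1 = -1" "eps 4 3 1 2 = -1" "eps 4 3 2 1 = 1"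
  using eps_1234 eps_swap(1)[of 2 1 3 4] eps_swap(2)[of 1 3 2 4] eps_swap(3)[of 1 2 4 3] eps_swap(2)[of 2 3 1 4] eps_swap(3)[of 2 1 4 3] eps_swap(1)[of 3 1 2 4] eps_swap(3)[of 1 3 4 2] eps_swap(2)[of 1 4 2 3] eps_swap(1)[of 3 2 1 4] eps_swap(3)[of 2 3 4 1] eps_swap(2)[of 2 4 1 3] eps_swap(3)[of 3 1 4 2] eps_swap(2)[of 1 4 3 2] eps_swap(1)[of 4 1 2 3] eps_swap(3)[of 3 2 4 1] eps_swap(2)[of 2 4 3 1] eps_swap(1)[of 4 2 1 3] eps_swap(2)[of 3 4 1 2] eps_swap(1)[of 4 1 3 2] eps_swap(2)[of 3 4 2 1] eps_swap(1)[of 4 2 3 1] eps_swap(1)[of 4 3 1 2] eps_swap(1)[of 4 3 2 1]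
  by simp_all

lemmas eps_simps = eps_repeat eps_1234 eps_values

text \<open>The components in the basis of \<open>su(2)\<close> of the fields are linear in the logarithmic derivatives
  \<open>l\<^sub>j = Y\<^sup>-\<^sup>1 \<partial>\<^sub>jY\<close>, \<open>S\<^sub>j = Y\<^sup>-\<^sup>1 \<partial>\<^sub>j\<Sigma>\<close> and in \<open>Z = Y\<^sup>-\<^sup>1 z\<^sup>k\<close>.\<close>

definition su2_mat :: "real \<Rightarrow> complex \<Rightarrow> mat2" where
  "su2_mat a b = m22 (\<i> * a) b (- cnj b) (- \<i> * a)"

definition diag_A :: "real \<Rightarrow> real \<Rightarrow> (4 \<Rightarrow> real) \<Rightarrow> 4 \<Rightarrow> real" where
  "diag_A s c l k = (if k = 1 then s * l 4 / 2 else if k = 2 then (c\<^sup>2 - s\<^sup>2) * l 3 / 2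
     else if k = 3 then (s\<^sup>2 - c\<^sup>2) * l 2 / 2 else 0)"

definition diag_\<Phi> :: "real \<Rightarrow> real \<Rightarrow> (4 \<Rightarrow> real) \<Rightarrow> 4 \<Rightarrow> real" where
  "diag_\<Phi> s c l k = (if k = 1 then c * l 4 / 2 else if k = 2 then - (s * c * l 3)
     else if k = 3 then s * c * l 2 else 0)"

definition off_A :: "real \<Rightarrow> real \<Rightarrow> (4 \<Rightarrow> complex) \<Rightarrow> complex \<Rightarrow> 4 \<Rightarrow> complex" where
  "off_A s c S Z k = (if k = 1 then \<i> * s * S 4 / 2
     else if k = 2 then s * (s * (S 2 - \<i> * S 3) / 2 - Z) + c\<^sup>2 * ((S 2 + \<i> * S 3) / 2)
     else if k = 3 then \<i> * (s * (s * (S 2 - \<i> * S 3) / 2 - Z) - c\<^sup>2 * ((S 2 + \<i> * S 3) / 2))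
     else S 4 / 2)"

definition off_\<Phi> :: "real \<Rightarrow> real \<Rightarrow> (4 \<Rightarrow> complex) \<Rightarrow> complex \<Rightarrow> 4 \<Rightarrow> complex" where
  "off_\<Phi> s c S Z k = (if k = 1 then \<i> * c * S 4 / 2
     else if k = 2 then c * (s * (S 2 - \<i> * S 3) / 2 - Z) - s * c * ((S 2 + \<i> * S 3) / 2)
     else if k = 3 then \<i> * (c * (s * (S 2 - \<i> * S 3) / 2 - Z) + s * c * ((S 2 + \<i> * S 3) / 2))
     else 0)"

text \<open>Together with \<open>br_off\<close>: the components of the commutator in the coordinates
  of \<open>su2_mat\<close>.\<close>

definition br_diag :: "complex \<Rightarrow> complex \<Rightarrow> real" where
  "br_diag b b' = 2 * Im (b' * cnj b)"

definition br_off :: "real \<Rightarrow> complex \<Rightarrow> real \<Rightarrow> complex \<Rightarrow> complex" where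
  "br_off a b a' b' = 2 * \<i> * (a * b' - a' * b)"

lemma br_diag_complex: "complex_of_real (br_diag b b') = - \<i> * (b' * cnj b - cnj b' * b)"
  by (simp add: complex_eq_iff br_diag_def)

text \<open>The data at a single point: \<open>ll\<close> are the second derivatives of
  \<open>ln Y\<close>, \<open>SS\<close> those of \<open>\<Sigma>\<close> divided by
  \<open>Y\<close>, and \<open>\<zeta>\<close> is the derivative of \<open>z^k\<close> divided by
  \<open>Y\<close>. In these numbers and their conjugates the equations are polynomial, which
  reduces them to polynomial algebra. \<open>E1\<close> and \<open>E2\<close> are the diagonal and
  off-diagonal moment map equations.\<close>

locale kw_jet =
  fixes s c :: real and l :: "4 \<Rightarrow> real" and ll :: "4 \<Rightarrow> 4 \<Rightarrow> real"
    and S :: "4 \<Rightarrow> complex" and SS :: "4 \<Rightarrow> 4 \<Rightarrow> complex" and Z \<zeta> :: complex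
  assumes sc: "s\<^sup>2 + c\<^sup>2 = 1"
    and sym: "\<And>i j. ll i j = ll j i" "\<And>i j. SS i j = SS j i"
    and first: "l 1 = 0" "S 1 = 0" "\<And>j. ll 1 j = 0" "\<And>j. SS 1 j = 0"
    and E1: "ll 2 2 + ll 3 3 + ll 4 4 + (cmod (S 4))\<^sup>2 + 4 * (cmod (s * (S 2 - \<i> * S 3) / 2 - Z))\<^sup>2
      + 4 * c\<^sup>2 * (cmod ((S 2 + \<i> * S 3) / 2))\<^sup>2 = 0"
    and E2: "SS 2 2 + SS 3 3 + SS 4 4 = 2 * S 4 * l 4 + 4 * c\<^sup>2 * ((S 2 + \<i> * S 3) / 2) * (l 2 - \<i> * l 3)
      + 4 * s * (s * (S 2 - \<i> * S 3) / 2 - Z) * (l 2 + \<i> * l 3)"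
begin

text \<open>The derivatives in direction \<open>j\<close> of the quotients \<open>S k\<close> and,
  with \<open>dZ\<close>, of \<open>Z\<close>; the subtracted terms come from differentiating
  \<open>1 / Y\<close>.\<close>

definition dS :: "4 \<Rightarrow> 4 \<Rightarrow> complex" where "dS j k = SS j k - S k * l j"
definition dZ :: "4 \<Rightarrow> complex" where
  "dZ j = (if j = 2 then \<zeta> else if j = 3 then \<i> * \<zeta> else 0) - Z * l j"

abbreviation "aA \<equiv> diag_A s c l"
abbreviation "bA \<equiv> off_A s c S Z"
abbreviation "a\<Phi> \<equiv> diag_\<Phi> s c l"
abbreviation "b\<Phi> \<equiv> off_\<Phi> s c S Z"

text \<open>The complex curvature is \<open>P + i Q\<close> with both parts in \<open>su(2)\<close>:
  \<open>P\<close> is the curvature of \<open>A\<close> minus \<open>\<Phi> \<and> \<Phi>\<close>,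
  and \<open>Q\<close> is the covariant exterior derivative of \<open>\<Phi>\<close>.\<close>

definition P_diag :: "4 \<Rightarrow> 4 \<Rightarrow> real" where
  "P_diag i j = diag_A s c (ll i) j - diag_A s c (ll j) i + br_diag (bA i) (bA j) - br_diag (b\<Phi> i) (b\<Phi> j)"
definition P_off :: "4 \<Rightarrow> 4 \<Rightarrow> complex" where
  "P_off i j = off_A s c (dS i) (dZ i) j - off_A s c (dS j) (dZ j) i
     + br_off (aA i) (bA i) (aA j) (bA j) - br_off (a\<Phi> i) (b\<Phi> i) (a\<Phi> j) (b\<Phi> j)"
definition Q_diag :: "4 \<Rightarrow> 4 \<Rightarrow> real" where
  "Q_diag i j = diag_\<Phi> s c (ll i) j + br_diag (bA i) (b\<Phi> j) - (diag_\<Phi> s c (ll j) i + br_diag (bA j) (b\<Phi> i))"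
definition Q_off :: "4 \<Rightarrow> 4 \<Rightarrow> complex" where
  "Q_off i j = off_\<Phi> s c (dS i) (dZ i) j + br_off (aA i) (bA i) (a\<Phi> j) (b\<Phi> j)
     - (off_\<Phi> s c (dS j) (dZ j) i + br_off (aA j) (bA j) (a\<Phi> i) (b\<Phi> i))"

text \<open>\<open>C = cos (2 \<theta>)\<close> and \<open>T = sin (2 \<theta>)\<close>: since
  \<open>2 \<theta> = \<pi>/2 + 3 \<beta>\<close>, they are \<open>- sin (3 \<beta>)\<close> and
  \<open>cos (3 \<beta>)\<close>.\<close>

definition C :: real where "C = 4 * s ^ 3 - 3 * s"
definition T :: real where "T = 4 * c ^ 3 - 3 * c"

lemmas off_simps = P_off_def Q_off_def off_A_def off_\<Phi>_def dS_def dZ_def br_off_def diag_A_def diag_\<Phi>_def C_def T_def first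
lemmas diag_simps = P_diag_def Q_diag_def off_A_def off_\<Phi>_def diag_A_def diag_\<Phi>_def C_def T_def first br_diag_complex

lemma sc': "(complex_of_real s)\<^sup>2 + (complex_of_real c)\<^sup>2 = 1"
  using sc by (metis of_real_1 of_real_add of_real_power)

lemma sym': "ll 3 2 = ll 2 3" "ll 4 2 = ll 2 4" "ll 4 3 = ll 3 4" "SS 3 2 = SS 2 3" "SS 4 2 = SS 2 4" "SS 4 3 = SS 3 4"
  by (rule sym)+

text \<open>Solved for \<open>ll 4 4\<close>, with absolute values replaced by products with
  conjugates, the diagonal equation becomes a rewrite rule for the identities below.\<close>

lemma E1': "complex_of_real (ll 4 4) = - complex_of_real (ll 2 2) - complex_of_real (ll 3 3) - S 4 * cnj (S 4)
    - (s * (S 2 - \<i> * S 3) - 2 * Z) * (s * (cnj (S 2) + \<i> * cnj (S 3)) - 2 * cnj Z)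
    - (complex_of_real c)\<^sup>2 * ((S 2 + \<i> * S 3) * (cnj (S 2) - \<i> * cnj (S 3)))"
proof -
  define w1 w2 where "w1 = s * (S 2 - \<i> * S 3) / 2 - Z" and "w2 = (S 2 + \<i> * S 3) / 2"
  have "complex_of_real (ll 4 4) = - complex_of_real (ll 2 2) - complex_of_real (ll 3 3) - S 4 * cnj (S 4) - 4 * (w1 * cnj w1) - 4 * (complex_of_real c)\<^sup>2 * (w2 * cnj w2)"
  proof -
    have "complex_of_real (ll 2 2 + ll 3 3 + ll 4 4 + (cmod (S 4))\<^sup>2 + 4 * (cmod w1)\<^sup>2 + 4 * c\<^sup>2 * (cmod w2)\<^sup>2) = 0"
      unfolding E1[folded w1_def w2_def] by simp
    then have "complex_of_real (ll 2 2) + complex_of_real (ll 3 3) + complex_of_real (ll 4 4) + S 4 * cnj (S 4) + 4 * (w1 * cnj w1) + 4 * (complex_of_real c)\<^sup>2 * (w2 * cnj w2) = 0"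
      by (simp only: of_real_add of_real_mult of_real_power of_real_numeral complex_norm_square[symmetric])
    then show ?thesis by algebra
  qed
  moreover have "4 * (w1 * cnj w1) = (2 * w1) * cnj (2 * w1)" "4 * (complex_of_real c)\<^sup>2 * (w2 * cnj w2) = (complex_of_real c)\<^sup>2 * ((2 * w2) * cnj (2 * w2))"
    by simp_all
  moreover have "2 * w1 = s * (S 2 - \<i> * S 3) - 2 * Z" "2 * w2 = S 2 + \<i> * S 3" unfolding w1_def w2_def by simp_all
  ultimately show ?thesis by simp
qed

lemma E2': "SS 4 4 = - SS 2 2 - SS 3 3 + 2 * S 4 * l 4 + 2 * (complex_of_real c)\<^sup>2 * (S 2 + \<i> * S 3) * (l 2 - \<i> * l 3)
      + 2 * s * (s * (S 2 - \<i> * S 3) - 2 * Z) * (l 2 + \<i> * l 3)"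
proof -
  define w1 w2 where "w1 = s * (S 2 - \<i> * S 3) / 2 - Z" and "w2 = (S 2 + \<i> * S 3) / 2"
  have "2 * w1 = s * (S 2 - \<i> * S 3) - 2 * Z" "2 * w2 = S 2 + \<i> * S 3" unfolding w1_def w2_def by simp_all
  then show ?thesis using E2[folded w1_def w2_def] unfolding of_real_mult of_real_power of_real_numeral by algebra
qed

text \<open>Collecting the phases on one side, self-duality says that
  \<open>(C + i T) (P + i Q)\<close> on one coordinate plane equals \<open>P - i Q\<close> on the
  dual plane. Three pairs of planes, the \<open>P\<close> and \<open>Q\<close> parts, and diagonal
  and off-diagonal components make up this and the next eleven identities.\<close>

lemma P_off_12: "C * P_off 1 2 - T * Q_off 1 2 = P_off 3 4"
proof -
  \<comment> \<open>The imaginary unit becomes a variable with \<open>i^2 = - 1\<close>, and the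
    factor \<open>2\<close> clears denominators; what remains is a membership in a polynomial
    ideal.\<close>
  define i where "i = \<i>"
  have i: "i\<^sup>2 = - 1" unfolding i_def by simp
  have "2 * (C * P_off 1 2 - T * Q_off 1 2) = 2 * (P_off 3 4)"
    using sc' i by (simp add: off_simps E2' sym' i_def[symmetric] ring_distribs) algebra
  then show ?thesis by (simp only: mult_cancel_left) simp
qed

lemma Q_off_12: "T * P_off 1 2 + C * Q_off 1 2 = - Q_off 3 4"
proof -
  define i where "i = \<i>"
  have i: "i\<^sup>2 = - 1" unfolding i_def by simp
  have "2 * (T * P_off 1 2 + C * Q_off 1 2) = 2 * (- Q_off 3 4)"
    using sc' i by (simp add: off_simps E2' sym' i_def[symmetric] ring_distribs) algebra
  then show ?thesis by (simp only: mult_cancel_left) simp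
qed

lemma P_diag_12: "C * P_diag 1 2 - T * Q_diag 1 2 = P_diag 3 4"
proof -
  define i where "i = \<i>"
  have i: "i\<^sup>2 = - 1" unfolding i_def by simp
  \<comment> \<open>Diagonal components are real, but in complex form the brackets are polynomial in
    the fields and their conjugates.\<close>
  have "complex_of_real (4 * (C * P_diag 1 2 - T * Q_diag 1 2)) = complex_of_real (4 * (P_diag 3 4))"
    by (simp add: diag_simps E1' sym' ring_distribs add_divide_distrib diff_divide_distrib,
      unfold i_def[symmetric], insert sc' i, algebra)
  then show ?thesis by (simp only: of_real_eq_iff mult_cancel_left) simp
qed

lemma Q_diag_12: "T * P_diag 1 2 + C * Q_diag 1 2 = - Q_diag 3 4"
proof -
  define i where "i = \<i>"
  have i: "i\<^sup>2 = - 1" unfolding i_def by simp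
  have "complex_of_real (4 * (T * P_diag 1 2 + C * Q_diag 1 2)) = complex_of_real (4 * (- Q_diag 3 4))"
    by (simp add: diag_simps E1' sym' ring_distribs add_divide_distrib diff_divide_distrib,
      unfold i_def[symmetric], insert sc' i, algebra)
  then show ?thesis by (simp only: of_real_eq_iff mult_cancel_left) simp
qed

lemma P_off_13: "C * P_off 1 3 - T * Q_off 1 3 = P_off 4 2"
proof -
  define i where "i = \<i>"
  have i: "i\<^sup>2 = - 1" unfolding i_def by simp
  have "2 * (C * P_off 1 3 - T * Q_off 1 3) = 2 * (P_off 4 2)"
    using sc' i by (simp add: off_simps E2' sym' i_def[symmetric] ring_distribs) algebra
  then show ?thesis by (simp only: mult_cancel_left) simp
qed

lemma Q_off_13: "T * P_off 1 3 + C * Q_off 1 3 = - Q_off 4 2"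
proof -
  define i where "i = \<i>"
  have i: "i\<^sup>2 = - 1" unfolding i_def by simp
  have "2 * (T * P_off 1 3 + C * Q_off 1 3) = 2 * (- Q_off 4 2)"
    using sc' i by (simp add: off_simps E2' sym' i_def[symmetric] ring_distribs) algebra
  then show ?thesis by (simp only: mult_cancel_left) simp
qed

lemma P_diag_13: "C * P_diag 1 3 - T * Q_diag 1 3 = P_diag 4 2"
proof -
  define i where "i = \<i>"
  have i: "i\<^sup>2 = - 1" unfolding i_def by simp
  have "complex_of_real (4 * (C * P_diag 1 3 - T * Q_diag 1 3)) = complex_of_real (4 * (P_diag 4 2))"
    by (simp add: diag_simps E1' sym' ring_distribs add_divide_distrib diff_divide_distrib,
      unfold i_def[symmetric], insert sc' i, algebra)
  then show ?thesis by (simp only: of_real_eq_iff mult_cancel_left) simp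
qed

lemma Q_diag_13: "T * P_diag 1 3 + C * Q_diag 1 3 = - Q_diag 4 2"
proof -
  define i where "i = \<i>"
  have i: "i\<^sup>2 = - 1" unfolding i_def by simp
  have "complex_of_real (4 * (T * P_diag 1 3 + C * Q_diag 1 3)) = complex_of_real (4 * (- Q_diag 4 2))"
    by (simp add: diag_simps E1' sym' ring_distribs add_divide_distrib diff_divide_distrib,
      unfold i_def[symmetric], insert sc' i, algebra)
  then show ?thesis by (simp only: of_real_eq_iff mult_cancel_left) simp
qed

lemma P_off_14: "C * P_off 1 4 - T * Q_off 1 4 = P_off 2 3"
proof -
  define i where "i = \<i>"
  have i: "i\<^sup>2 = - 1" unfolding i_def by simp
  have "2 * (C * P_off 1 4 - T * Q_off 1 4) = 2 * (P_off 2 3)"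
    using sc' i by (simp add: off_simps E2' sym' i_def[symmetric] ring_distribs) algebra
  then show ?thesis by (simp only: mult_cancel_left) simp
qed

lemma Q_off_14: "T * P_off 1 4 + C * Q_off 1 4 = - Q_off 2 3"
proof -
  define i where "i = \<i>"
  have i: "i\<^sup>2 = - 1" unfolding i_def by simp
  have "2 * (T * P_off 1 4 + C * Q_off 1 4) = 2 * (- Q_off 2 3)"
    using sc' i by (simp add: off_simps E2' sym' i_def[symmetric] ring_distribs) algebra
  then show ?thesis by (simp only: mult_cancel_left) simp
qed

lemma P_diag_14: "C * P_diag 1 4 - T * Q_diag 1 4 = P_diag 2 3"
proof -
  define i where "i = \<i>"
  have i: "i\<^sup>2 = - 1" unfolding i_def by simp
  have "complex_of_real (4 * (C * P_diag 1 4 - T * Q_diag 1 4)) = complex_of_real (4 * (P_diag 2 3))"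
    by (simp add: diag_simps E1' sym' ring_distribs add_divide_distrib diff_divide_distrib,
      unfold i_def[symmetric], insert sc' i, algebra)
  then show ?thesis by (simp only: of_real_eq_iff mult_cancel_left) simp
qed

lemma Q_diag_14: "T * P_diag 1 4 + C * Q_diag 1 4 = - Q_diag 2 3"
proof -
  define i where "i = \<i>"
  have i: "i\<^sup>2 = - 1" unfolding i_def by simp
  have "complex_of_real (4 * (T * P_diag 1 4 + C * Q_diag 1 4)) = complex_of_real (4 * (- Q_diag 2 3))"
    by (simp add: diag_simps E1' sym' ring_distribs add_divide_distrib diff_divide_distrib,
      unfold i_def[symmetric], insert sc' i, algebra)
  then show ?thesis by (simp only: of_real_eq_iff mult_cancel_left) simp
qed


section \<open>The covariant divergence of \<open>\<Phi>\<close>\<close>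

definition D_diag :: "4 \<Rightarrow> 4 \<Rightarrow> real" where
  "D_diag i j = diag_\<Phi> s c (ll i) j + br_diag (bA i) (b\<Phi> j)"
definition D_off :: "4 \<Rightarrow> 4 \<Rightarrow> complex" where
  "D_off i j = off_\<Phi> s c (dS i) (dZ i) j + br_off (aA i) (bA i) (a\<Phi> j) (b\<Phi> j)"

lemma div_off: "D_off 1 1 + D_off 2 2 + D_off 3 3 + D_off 4 4 = 0"
proof -
  define i where "i = \<i>"
  have i: "i\<^sup>2 = - 1" unfolding i_def by simp
  have "2 * (D_off 1 1 + D_off 2 2 + D_off 3 3 + D_off 4 4) = 0"
    using sc' i by (simp add: D_off_def off_simps sym' i_def[symmetric] ring_distribs) algebra
  then show ?thesis by (simp only: mult_eq_0_iff) simp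
qed

lemma div_diag: "D_diag 1 1 + D_diag 2 2 + D_diag 3 3 + D_diag 4 4 = 0"
proof -
  have "D_diag 1 1 = 0" "D_diag 4 4 = 0"
    by (simp_all add: D_diag_def diag_\<Phi>_def off_\<Phi>_def off_A_def first br_diag_def)
  moreover have "D_diag 2 2 + D_diag 3 3 = 0"
  proof -
    \<comment> \<open>The brackets of the two transverse directions cancel for arbitrary
      \<open>B\<close> and \<open>E\<close>; the second derivatives cancel by symmetry of
      \<open>ll\<close>.\<close>
    have "br_diag (s * B + c\<^sup>2 * E) (c * B - s * c * E) + br_diag (\<i> * (s * B - c\<^sup>2 * E)) (\<i> * (c * B + s * c * E)) = 0" for B E :: complex
      unfolding br_diag_def by (simp add: algebra_simps flip: of_real_power)
    from this[of "s * (S 2 - \<i> * S 3) / 2 - Z" "(S 2 + \<i> * S 3) / 2"] show ?thesis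
      unfolding D_diag_def diag_\<Phi>_def off_A_def off_\<Phi>_def using sym'(1) by simp
  qed
  ultimately show ?thesis by simp
qed

end

subsection \<open>Partial derivatives and matrix-valued fields\<close>

lemma pd_eqI: "(f has_derivative D) (at x) \<Longrightarrow> pd j f x = D (axis j 1)"
  unfolding pd_def by (simp add: frechet_derivative_at[symmetric])

lemma pd_cong:
  assumes "open S" "x \<in> S" "\<And>y. y \<in> S \<Longrightarrow> f y = g y" "f differentiable (at x)"
  shows "pd j f x = pd j g x"
proof -
  have "(f has_derivative frechet_derivative f (at x)) (at x)"
    using assms(4) frechet_derivative_works by blast
  then have "(g has_derivative frechet_derivative f (at x)) (at x)"
    by (rule has_derivative_transform_within_open[OF _ assms(1,2)]) (use assms(3) in auto)
  then show ?thesis unfolding pd_def[of j f] by (rule pd_eqI[symmetric])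
qed

lemma pd_bounded_linear:
  assumes "bounded_linear L" "f differentiable (at x)"
  shows "pd j (\<lambda>x. L (f x)) x = L (pd j f x)"
proof -
  have "(f has_derivative frechet_derivative f (at x)) (at x)"
    using assms(2) frechet_derivative_works by blast
  from pd_eqI[OF bounded_linear.has_derivative[OF assms(1) this]] show ?thesis unfolding pd_def by simp
qed

lemma td_differentiable: "times_differentiable_on (Suc n) S f \<Longrightarrow> x \<in> S \<Longrightarrow> f differentiable (at x)"
  by simp

lemma td_pd: "times_differentiable_on (Suc n) S f \<Longrightarrow> times_differentiable_on n S (pd j f)"
  by (simp add: pd_def[abs_def])

lemma pd_line:
  fixes f :: "point \<Rightarrow> real"
  assumes "f differentiable (at (z + b *\<^sub>R axis j 1))"
  shows "((\<lambda>b. f (z + b *\<^sub>R axis j 1)) has_real_derivative pd j f (z + b *\<^sub>R axis j 1)) (at b)"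
proof -
  have f: "(f has_derivative frechet_derivative f (at (z + b *\<^sub>R axis j 1))) (at (z + b *\<^sub>R axis j 1))"
    using assms frechet_derivative_works by blast
  have g: "((\<lambda>b. z + b *\<^sub>R axis j 1) has_derivative (\<lambda>t. t *\<^sub>R axis j 1)) (at b)"
    by (auto intro!: derivative_eq_intros)
  have "((\<lambda>b. f (z + b *\<^sub>R axis j 1)) has_derivative (\<lambda>t. frechet_derivative f (at (z + b *\<^sub>R axis j 1)) (t *\<^sub>R axis j 1))) (at b)"
    by (rule has_derivative_compose[OF g f])
  moreover have "(\<lambda>t. frechet_derivative f (at (z + b *\<^sub>R axis j 1)) (t *\<^sub>R axis j 1)) = (*) (pd j f (z + b *\<^sub>R axis j 1))"
    unfolding pd_def using linear_frechet_derivative[OF assms] by (simp add: linear_scale fun_eq_iff)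
  ultimately show ?thesis by (simp add: has_field_derivative_def)
qed

text \<open>The mean value theorem is applied twice, along \<open>j\<close> and then along
  \<open>i\<close>.\<close>

lemma second_difference:
  fixes f :: "point \<Rightarrow> real"
  assumes td: "times_differentiable_on (Suc (Suc 0)) (ball x d) f" and h: "0 < h" "2 * h < d"
  shows "\<exists>p\<in>ball x d. f (x + h *\<^sub>R axis i 1 + h *\<^sub>R axis j 1) - f (x + h *\<^sub>R axis j 1) - f (x + h *\<^sub>R axis i 1) + f x
    = h * (h * pd i (pd j f) p)"
proof -
  have inb: "x + a *\<^sub>R axis i 1 + b *\<^sub>R axis j 1 \<in> ball x d" if "0 \<le> a" "a \<le> h" "0 \<le> b" "b \<le> h" for a b
  proof -
    have "norm (a *\<^sub>R axis i 1 + b *\<^sub>R axis j 1 :: point) \<le> norm (a *\<^sub>R axis i 1 :: point) + norm (b *\<^sub>R axis j 1 :: point)"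
      by (rule norm_triangle_ineq)
    also have "\<dots> = a + b" using that by simp
    finally have "norm (a *\<^sub>R axis i 1 + b *\<^sub>R axis j 1 :: point) < d" using that h by simp
    moreover have "dist x (x + u) = norm u" for u :: point by (simp add: dist_norm)
    ultimately show ?thesis by (simp only: mem_ball add.assoc)
  qed
  have f1: "f differentiable (at y)" and f2: "pd j f differentiable (at y)" if "y \<in> ball x d" for y
    using td that td_pd[OF td, of j] by auto
  have comm: "x + h *\<^sub>R axis i 1 + b *\<^sub>R axis j 1 = (x + h *\<^sub>R axis i 1) + b *\<^sub>R axis j 1"
    "x + b *\<^sub>R axis j 1 = x + 0 *\<^sub>R axis i 1 + b *\<^sub>R axis j 1" for b :: real by auto
  have "\<exists>z. 0 < z \<and> z < h \<and>
      (f (x + h *\<^sub>R axis i 1 + h *\<^sub>R axis j 1) - f (x + h *\<^sub>R axis j 1)) - (f (x + h *\<^sub>R axis i 1 + 0 *\<^sub>R axis j 1) - f (x + 0 *\<^sub>R axis j 1))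
      = (h - 0) * (pd j f (x + h *\<^sub>R axis i 1 + z *\<^sub>R axis j 1) - pd j f (x + z *\<^sub>R axis j 1))"
  proof (rule MVT2[OF h(1)])
    fix b assume b: "0 \<le> b" "b \<le> h"
    show "((\<lambda>b. f (x + h *\<^sub>R axis i 1 + b *\<^sub>R axis j 1) - f (x + b *\<^sub>R axis j 1)) has_real_derivative
       pd j f (x + h *\<^sub>R axis i 1 + b *\<^sub>R axis j 1) - pd j f (x + b *\<^sub>R axis j 1)) (at b)"
      using inb[of h b] inb[of 0 b] b h by (intro DERIV_diff pd_line f1) auto
  qed
  then obtain z where z: "0 < z" "z < h" and e1: "f (x + h *\<^sub>R axis i 1 + h *\<^sub>R axis j 1) - f (x + h *\<^sub>R axis j 1) - f (x + h *\<^sub>R axis i 1) + f x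
      = h * (pd j f (x + h *\<^sub>R axis i 1 + z *\<^sub>R axis j 1) - pd j f (x + z *\<^sub>R axis j 1))"
    by (auto simp: algebra_simps)
  have sw: "x + a *\<^sub>R axis i 1 + z *\<^sub>R axis j 1 = (x + z *\<^sub>R axis j 1) + a *\<^sub>R axis i 1" for a :: real by (simp add: add_ac)
  have "\<exists>a. 0 < a \<and> a < h \<and> pd j f ((x + z *\<^sub>R axis j 1) + h *\<^sub>R axis i 1) - pd j f ((x + z *\<^sub>R axis j 1) + 0 *\<^sub>R axis i 1)
      = (h - 0) * pd i (pd j f) ((x + z *\<^sub>R axis j 1) + a *\<^sub>R axis i 1)"
  proof (rule MVT2[OF h(1)])
    fix a assume a: "0 \<le> a" "a \<le> h"
    show "((\<lambda>a. pd j f ((x + z *\<^sub>R axis j 1) + a *\<^sub>R axis i 1)) has_real_derivative pd i (pd j f) ((x + z *\<^sub>R axis j 1) + a *\<^sub>R axis i 1)) (at a)"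
      using inb[of a z] a z by (intro pd_line f2) (auto simp: sw)
  qed
  then obtain a where a: "0 < a" "a < h" and e2: "pd j f ((x + z *\<^sub>R axis j 1) + h *\<^sub>R axis i 1) - pd j f (x + z *\<^sub>R axis j 1)
      = h * pd i (pd j f) ((x + z *\<^sub>R axis j 1) + a *\<^sub>R axis i 1)" by auto
  show ?thesis
    by (rule bexI[of _ "(x + z *\<^sub>R axis j 1) + a *\<^sub>R axis i 1"])
      (use e1 e2 inb[of a z] a z in \<open>auto simp: sw\<close>)
qed

lemma td_subset:
  "times_differentiable_on n S f \<Longrightarrow> T \<subseteq> S \<Longrightarrow> times_differentiable_on n T f"
  by (induction n arbitrary: f) (auto intro: continuous_on_subset)

text \<open>The second difference is symmetric in \<open>i\<close> and \<open>j\<close>, and both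
  mixed derivatives are continuous at \<open>x\<close>.\<close>

lemma pd_commute_real:
  fixes f :: "point \<Rightarrow> real"
  assumes S: "open S" "x \<in> S" and td: "times_differentiable_on (Suc (Suc 0)) S f"
  shows "pd i (pd j f) x = pd j (pd i f) x"
proof (rule ccontr)
  assume ne: "pd i (pd j f) x \<noteq> pd j (pd i f) x"
  define e where "e = \<bar>pd i (pd j f) x - pd j (pd i f) x\<bar> / 2"
  have e: "e > 0" unfolding e_def using ne by simp
  have c: "isCont (pd a (pd b f)) x" for a b
    using td_continuous[OF td_pd[OF td_pd[OF td]]] S continuous_on_eq_continuous_at by blast
  obtain d0 where d0: "d0 > 0" "ball x d0 \<subseteq> S" using S openE by blast
  obtain d1 where d1: "d1 > 0" "\<And>p. dist p x < d1 \<Longrightarrow> dist (pd i (pd j f) p) (pd i (pd j f) x) < e"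
    using c[of i j] e unfolding continuous_at_eps_delta by (auto simp: dist_norm)
  obtain d2 where d2: "d2 > 0" "\<And>p. dist p x < d2 \<Longrightarrow> dist (pd j (pd i f) p) (pd j (pd i f) x) < e"
    using c[of j i] e unfolding continuous_at_eps_delta by (auto simp: dist_norm)
  define d where "d = min d0 (min d1 d2)"
  define h where "h = d / 3"
  have h: "0 < h" "2 * h < d" unfolding h_def d_def using d0 d1 d2 by auto
  have tdb: "times_differentiable_on (Suc (Suc 0)) (ball x d) f"
    by (rule td_subset[OF td]) (use d0 in \<open>auto simp: d_def\<close>)
  obtain p where p: "p \<in> ball x d" "f (x + h *\<^sub>R axis i 1 + h *\<^sub>R axis j 1) - f (x + h *\<^sub>R axis j 1) - f (x + h *\<^sub>R axis i 1) + f x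
    = h * (h * pd i (pd j f) p)" using second_difference[OF tdb h, of i j] by blast
  obtain q where q: "q \<in> ball x d" "f (x + h *\<^sub>R axis j 1 + h *\<^sub>R axis i 1) - f (x + h *\<^sub>R axis i 1) - f (x + h *\<^sub>R axis j 1) + f x
    = h * (h * pd j (pd i f) q)" using second_difference[OF tdb h, of j i] by blast
  have "x + h *\<^sub>R axis j 1 + h *\<^sub>R axis i 1 = x + h *\<^sub>R axis i 1 + h *\<^sub>R axis j 1" by (simp add: add_ac)
  then have "f (x + h *\<^sub>R axis j 1 + h *\<^sub>R axis i 1) = f (x + h *\<^sub>R axis i 1 + h *\<^sub>R axis j 1)" by (rule arg_cong)
  then have "h * (h * pd i (pd j f) p) = h * (h * pd j (pd i f) q)" using p(2) q(2) by linarith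
  then have "pd i (pd j f) p = pd j (pd i f) q" using h by simp
  moreover have "dist (pd i (pd j f) p) (pd i (pd j f) x) < e" "dist (pd j (pd i f) q) (pd j (pd i f) x) < e"
    using p(1) q(1) by (auto intro!: d1(2) d2(2) simp: d_def dist_commute)
  moreover have "\<bar>B - A\<bar> \<le> \<bar>P - B\<bar> + \<bar>P - A\<bar>" for A B P :: real by linarith
  ultimately show False unfolding e_def dist_real_def by (smt (verit) field_sum_of_halves)
qed

lemma pd_commute_complex:
  fixes f :: "point \<Rightarrow> complex"
  assumes S: "open S" "x \<in> S" and td: "times_differentiable_on (Suc (Suc 0)) S f"
  shows "pd i (pd j f) x = pd j (pd i f) x"
proof -
  have L: "L (pd i (pd j f) x) = L (pd j (pd i f) x)" if L: "bounded_linear L" for L :: "complex \<Rightarrow> real"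
  proof -
    have tdL: "times_differentiable_on (Suc (Suc 0)) S (\<lambda>x. L (f x))" by (rule td_linear[OF S(1) L td])
    have d1: "pd b (\<lambda>x. L (f x)) y = L (pd b f y)" if "y \<in> S" for y b
      by (rule pd_bounded_linear[OF L td_differentiable[OF td that]])
    have d2: "pd a (pd b (\<lambda>x. L (f x))) x = L (pd a (pd b f) x)" for a b
    proof -
      have "pd a (pd b (\<lambda>x. L (f x))) x = pd a (\<lambda>y. L (pd b f y)) x"
        by (rule pd_cong[OF S]) (auto intro: d1 td_differentiable[OF td_pd[OF tdL] S(2)])
      also have "\<dots> = L (pd a (pd b f) x)"
        by (rule pd_bounded_linear[OF L td_differentiable[OF td_pd[OF td] S(2)]])
      finally show ?thesis .
    qed
    show ?thesis using pd_commute_real[OF S tdL, of i j] unfolding d2 .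
  qed
  show ?thesis using L[OF bounded_linear_Re] L[OF bounded_linear_Im] by (simp add: complex_eq_iff)
qed

section \<open>Matrices in \<open>su(2)\<close>, self-duality and divergence\<close>

lemma m22_nth: "m22 a b c d $ 1 $ 1 = a" "m22 a b c d $ 1 $ 2 = b" "m22 a b c d $ 2 $ 1 = c" "m22 a b c d $ 2 $ 2 = d"
  unfolding m22_def by simp_all

lemmas mat_simps = vec_eq_iff forall_2 m22_nth cscale_def dagger_def commutator_def matrix_matrix_mult_def sum_2
  su2_mat_def conj_sl2_def

lemma su2_mat_in: "su2_mat a b \<in> su2"
  unfolding su2_def by (simp add: mat_simps trace_def)

lemma su2_mat_add: "su2_mat a b + su2_mat a' b' = su2_mat (a + a') (b + b')"
  and su2_mat_diff: "su2_mat a b - su2_mat a' b' = su2_mat (a - a') (b - b')"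
  and su2_mat_scaleR: "r *\<^sub>R su2_mat a b = su2_mat (r * a) (r * b)"
  and su2_mat_0: "su2_mat 0 0 = 0"
  by (simp_all add: mat_simps complex_eq_iff algebra_simps)

lemma commutator_su2_mat: "commutator (su2_mat a b) (su2_mat a' b') = su2_mat (br_diag b b') (br_off a b a' b')"
  by (simp add: mat_simps br_diag_def br_off_def complex_eq_iff algebra_simps)

lemma bounded_linear_su2_mat: "bounded_linear (\<lambda>a. su2_mat a 0)" "bounded_linear (\<lambda>b. su2_mat 0 b)"
  by (auto simp flip: linear_conv_bounded_linear intro!: linearI simp: su2_mat_add su2_mat_scaleR[symmetric] scaleR_complex.ctr mat_simps complex_eq_iff)

lemma su2_mat_split: "su2_mat a b = su2_mat a 0 + su2_mat 0 b"
  by (simp add: su2_mat_add)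

lemma has_derivative_su2_mat:
  assumes "(a has_derivative a') F" "(b has_derivative b') F"
  shows "((\<lambda>x. su2_mat (a x) (b x)) has_derivative (\<lambda>w. su2_mat (a' w) (b' w))) F"
  by (subst (1 2) su2_mat_split)
    (intro has_derivative_add bounded_linear.has_derivative[OF bounded_linear_su2_mat(1)]
      bounded_linear.has_derivative[OF bounded_linear_su2_mat(2)] assms)

lemma td_su2_mat:
  assumes "open S" "times_differentiable_on n S a" "times_differentiable_on n S b"
  shows "times_differentiable_on n S (\<lambda>x. su2_mat (a x) (b x))"
  by (subst su2_mat_split)
    (intro td_add td_linear[OF _ bounded_linear_su2_mat(1)] td_linear[OF _ bounded_linear_su2_mat(2)] assms)

definition cmat :: "real \<Rightarrow> complex \<Rightarrow> real \<Rightarrow> complex \<Rightarrow> mat2" where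
  "cmat a b a' b' = su2_mat a b + \<i> *\<^sub>C su2_mat a' b'"

lemma cmat_minus: "cmat (- a) (- b) (- a') (- b') = - cmat a b a' b'"
  unfolding cmat_def by (simp add: mat_simps)

lemma conj_sl2_minus: "conj_sl2 (- M) = - conj_sl2 M" and conj_sl2_invol: "conj_sl2 (conj_sl2 M) = M"
  and cscale_minus: "z *\<^sub>C (- M) = - (z *\<^sub>C M)" and cscale_0: "z *\<^sub>C 0 = 0" and conj_sl2_0: "conj_sl2 0 = 0"
  by (simp_all add: mat_simps)

text \<open>The conjugation is antilinear, so the two phases combine to
  \<open>cis (2 * \<theta>)\<close> on one side, and it reverses the sign of the
  \<open>i su(2)\<close> part. It is also an involution, which gives the second equation from the
  first.\<close>

lemma self_dual_pair:
  fixes \<theta> a a' p p' :: real and b b' q q' :: complex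
  assumes "cos (2 * \<theta>) * a - sin (2 * \<theta>) * a' = p" "sin (2 * \<theta>) * a + cos (2 * \<theta>) * a' = - p'"
    and "complex_of_real (cos (2 * \<theta>)) * b - complex_of_real (sin (2 * \<theta>)) * b' = q"
      "complex_of_real (sin (2 * \<theta>)) * b + complex_of_real (cos (2 * \<theta>)) * b' = - q'"
  shows "cis \<theta> *\<^sub>C cmat a b a' b' = conj_sl2 (cis \<theta> *\<^sub>C cmat p q p' q')"
    and "cis \<theta> *\<^sub>C cmat p q p' q' = conj_sl2 (cis \<theta> *\<^sub>C cmat a b a' b')"
proof -
  have "cis (2 * \<theta>) *\<^sub>C cmat a b a' b' = cmat (cos (2 * \<theta>) * a - sin (2 * \<theta>) * a') (cos (2 * \<theta>) * b - sin (2 * \<theta>) * b')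
      (sin (2 * \<theta>) * a + cos (2 * \<theta>) * a') (sin (2 * \<theta>) * b + cos (2 * \<theta>) * b')"
    unfolding cmat_def by (simp add: mat_simps complex_eq_iff algebra_simps)
  then have d: "cis (2 * \<theta>) *\<^sub>C cmat a b a' b' = cmat p q (- p') (- q')" unfolding assms .
  have "cmat p q (- p') (- q') = su2_mat p q - \<i> *\<^sub>C su2_mat p' q'"
    unfolding cmat_def by (simp add: mat_simps)
  then have "conj_sl2 (cmat p q p' q') = cmat p q (- p') (- q')"
    unfolding cmat_def[of p q p' q'] by (simp add: conj_sl2_su2 su2_mat_in)
  then have "conj_sl2 (cis \<theta> *\<^sub>C cmat p q p' q') = cis (- \<theta>) *\<^sub>C (cis (2 * \<theta>) *\<^sub>C cmat a b a' b')"
    unfolding conj_sl2_cscale d by (simp add: cis_cnj)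
  also have "\<dots> = (cis (- \<theta>) * cis (2 * \<theta>)) *\<^sub>C cmat a b a' b'" by (simp add: cscale_def mult.assoc)
  also have "cis (- \<theta>) * cis (2 * \<theta>) = cis \<theta>" by (simp add: cis_mult)
  finally show 1: "cis \<theta> *\<^sub>C cmat a b a' b' = conj_sl2 (cis \<theta> *\<^sub>C cmat p q p' q')" by simp
  show "cis \<theta> *\<^sub>C cmat p q p' q' = conj_sl2 (cis \<theta> *\<^sub>C cmat a b a' b')" unfolding 1 conj_sl2_invol ..
qed

text \<open>The Hodge star pairs the plane \<open>12\<close> with \<open>34\<close>,
  \<open>13\<close> with \<open>42\<close> and \<open>14\<close> with \<open>23\<close>; by
  antisymmetry each plane occurs twice in the sum, which cancels the factor \<open>1/2\<close> of
  \<open>hodge2\<close>.\<close>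

lemma self_dual:
  assumes anti: "\<And>i j. F j i = - F i j" 
    and sd: "z *\<^sub>C F 1 2 = conj_sl2 (z *\<^sub>C F 3 4)" "z *\<^sub>C F 3 4 = conj_sl2 (z *\<^sub>C F 1 2)"
      "z *\<^sub>C F 1 3 = conj_sl2 (z *\<^sub>C F 4 2)" "z *\<^sub>C F 4 2 = conj_sl2 (z *\<^sub>C F 1 3)"
      "z *\<^sub>C F 1 4 = conj_sl2 (z *\<^sub>C F 2 3)" "z *\<^sub>C F 2 3 = conj_sl2 (z *\<^sub>C F 1 4)"
  shows "z *\<^sub>C F i j = conj_sl2 (hodge2 (\<lambda>i j x. z *\<^sub>C F i j) i j x)"
proof -
  have 0: "F m m = 0" for m using anti[of m m] by (simp add: mat_simps)
  have a: "F 2 1 = - F 1 2" "F 4 3 = - F 3 4" "F 3 1 = - F 1 3" "F 2 4 = - F 4 2" "F 4 1 = - F 1 4" "F 3 2 = - F 2 3"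
    by (rule anti)+
  have half: "M /\<^sub>R 2 + M /\<^sub>R 2 = M" for M :: mat2
    by (simp flip: scaleR_add_left)
  have "\<forall>i j. z *\<^sub>C F i j = conj_sl2 (hodge2 (\<lambda>i j x. z *\<^sub>C F i j) i j x)"
    unfolding forall_4 hodge2_def sum_4
    by (simp add: eps_simps 0 a cscale_minus cscale_0 conj_sl2_minus conj_sl2_0 half scaleR_right_distrib)
      (use sd in \<open>simp add: conj_sl2_minus\<close>)
  then show ?thesis by blast
qed

lemma commutator_linear: "commutator M (r *\<^sub>R N) = r *\<^sub>R commutator M N" "commutator M (N + N') = commutator M N + commutator M N'"
  by (simp_all add: mat_simps algebra_simps complex_eq_iff)

lemma covd_hodge1:
  assumes "\<And>m. \<Phi> m differentiable (at x)"
  shows "covd A i (hodge1 \<Phi> j k l) x = (\<Sum>m\<in>UNIV. eps m j k l *\<^sub>R covd A i (\<Phi> m) x)"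
proof -
  have d: "(\<Phi> m has_derivative frechet_derivative (\<Phi> m) (at x)) (at x)" for m
    using assms frechet_derivative_works by blast
  have "((\<lambda>x. eps 1 j k l *\<^sub>R \<Phi> 1 x + eps 2 j k l *\<^sub>R \<Phi> 2 x + eps 3 j k l *\<^sub>R \<Phi> 3 x + eps 4 j k l *\<^sub>R \<Phi> 4 x) has_derivative
    (\<lambda>w. eps 1 j k l *\<^sub>R frechet_derivative (\<Phi> 1) (at x) w + eps 2 j k l *\<^sub>R frechet_derivative (\<Phi> 2) (at x) w
      + eps 3 j k l *\<^sub>R frechet_derivative (\<Phi> 3) (at x) w + eps 4 j k l *\<^sub>R frechet_derivative (\<Phi> 4) (at x) w)) (at x)"
    by (intro has_derivative_add has_derivative_scaleR_right d)
  from pd_eqI[OF this, of i] show ?thesis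
    unfolding covd_def hodge1_def[abs_def] sum_4 by (simp add: commutator_linear pd_def algebra_simps)
qed

text \<open>A 4-form has one independent component, here up to sign the covariant divergence of
  \<open>\<Phi>\<close>.\<close>

lemma dA3_hodge1:
  assumes "\<And>m. \<Phi> m differentiable (at x)"
    and div: "covd A 1 (\<Phi> 1) x + covd A 2 (\<Phi> 2) x + covd A 3 (\<Phi> 3) x + covd A 4 (\<Phi> 4) x = 0"
  shows "dA3 A (hodge1 \<Phi>) i j k l x = 0"
proof -
  have 4: "covd A 4 (\<Phi> 4) x = - covd A 1 (\<Phi> 1) x - covd A 2 (\<Phi> 2) x - covd A 3 (\<Phi> 3) x"
    using div by (simp add: algebra_simps eq_neg_iff_add_eq_0)
  have "\<forall>i j k l. dA3 A (hodge1 \<Phi>) i j k l x = 0"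
    unfolding dA3_def covd_hodge1[OF assms(1)] sum_4 forall_4
    by (simp add: eps_simps 4)
  then show ?thesis by blast
qed

subsection \<open>The fields of the ansatz\<close>

lemma open_half_space: "open half_space"
  unfolding half_space_def by (intro open_Collect_less continuous_intros)

lemma bounded_linear_zcoord: "bounded_linear zcoord"
  unfolding linear_conv_bounded_linear[symmetric] zcoord_def by (intro linearI) (simp_all add: complex_eq_iff)

lemma td_zcoord: "times_differentiable_on m half_space zcoord"
  by (rule td_linear[OF open_half_space bounded_linear_zcoord td_ident[OF open_half_space]])

lemma zcoord_axis: "zcoord (axis j 1) = (if j = 2 then 1 else if j = 3 then \<i> else 0)"
  using exhaust_4[of j] by (auto simp: zcoord_def axis_def complex_eq_iff)

lemma has_derivative_divide_const:
  fixes f :: "'a::real_normed_vector \<Rightarrow> 'b::real_normed_field"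
  shows "(f has_derivative f') F \<Longrightarrow> ((\<lambda>x. f x / a) has_derivative (\<lambda>w. f' w / a)) F"
  by (rule bounded_linear.has_derivative[OF bounded_linear_divide])

lemma has_derivative_diag:
  assumes f: "\<And>j. ((\<lambda>x. f x j) has_derivative (\<lambda>w. f' w j)) F"
  shows "((\<lambda>x. diag_A s c (f x) i) has_derivative (\<lambda>w. diag_A s c (f' w) i)) F"
    and "((\<lambda>x. diag_\<Phi> s c (f x) i) has_derivative (\<lambda>w. diag_\<Phi> s c (f' w) i)) F"
  using exhaust_4[of i]
  by (auto simp: diag_A_def diag_\<Phi>_def intro!: has_derivative_divide_const has_derivative_mult_right has_derivative_minus has_derivative_const f)

lemma has_derivative_off:
  assumes f: "\<And>j. ((\<lambda>x. f x j) has_derivative (\<lambda>w. f' w j)) F" and g: "(g has_derivative g') F"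
  shows "((\<lambda>x. off_A s c (f x) (g x) i) has_derivative (\<lambda>w. off_A s c (f' w) (g' w) i)) F"
    and "((\<lambda>x. off_\<Phi> s c (f x) (g x) i) has_derivative (\<lambda>w. off_\<Phi> s c (f' w) (g' w) i)) F"
  using exhaust_4[of i]
  by (auto simp: off_A_def off_\<Phi>_def intro!: has_derivative_divide_const has_derivative_mult_right has_derivative_minus has_derivative_add has_derivative_diff has_derivative_const f g)

lemma td_divide_const:
  fixes f :: "'a::real_normed_vector \<Rightarrow> 'b::real_normed_field"
  shows "open S \<Longrightarrow> times_differentiable_on n S f \<Longrightarrow> times_differentiable_on n S (\<lambda>x. f x / a)"
  unfolding divide_inverse by (intro td_mult td_const)

lemma td_diag:
  assumes S: "open S" and f: "\<And>j. times_differentiable_on n S (\<lambda>x. f x j)"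
  shows "times_differentiable_on n S (\<lambda>x. diag_A s c (f x) i)"
    and "times_differentiable_on n S (\<lambda>x. diag_\<Phi> s c (f x) i)"
  using exhaust_4[of i]
  by (auto simp: diag_A_def diag_\<Phi>_def intro!: td_divide_const td_mult td_minus td_const S f)

lemma td_off:
  assumes S: "open S" and f: "\<And>j. times_differentiable_on n S (\<lambda>x. f x j)" and g: "times_differentiable_on n S g"
  shows "times_differentiable_on n S (\<lambda>x. off_A s c (f x) (g x) i)"
    and "times_differentiable_on n S (\<lambda>x. off_\<Phi> s c (f x) (g x) i)"
  using exhaust_4[of i]
  by (auto simp: off_A_def off_\<Phi>_def intro!: td_divide_const td_mult td_minus td_diff td_add td_const S f g)

lemma pd_const_direction:
  assumes "f differentiable (at x)" "\<And>t. f (x + axis j t) = f x"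
  shows "pd j f x = 0"
proof -
  have f: "(f has_derivative frechet_derivative f (at x)) (at (x + 0 *\<^sub>R axis j 1))"
    using assms(1) frechet_derivative_works by auto
  have g: "((\<lambda>b. x + b *\<^sub>R axis j 1) has_derivative (\<lambda>t. t *\<^sub>R axis j 1)) (at 0)"
    by (auto intro!: derivative_eq_intros)
  have ax: "b *\<^sub>R axis j 1 = (axis j b :: point)" for b by (simp add: vec_eq_iff axis_def)
  have "((\<lambda>b. f (x + b *\<^sub>R axis j 1)) has_derivative (\<lambda>t. frechet_derivative f (at x) (t *\<^sub>R axis j 1))) (at 0)"
    by (rule has_derivative_compose[OF g f])
  then have "((\<lambda>b::real. f x) has_derivative (\<lambda>t. frechet_derivative f (at x) (t *\<^sub>R axis j 1))) (at 0)"
    unfolding ax assms(2) .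
  from has_derivative_unique[OF this has_derivative_const] have "frechet_derivative f (at x) (1 *\<^sub>R axis j 1) = 0"
    by meson
  then show ?thesis unfolding pd_def by simp
qed

lemma pd_shift:
  assumes S: "open S" "x \<in> S" and f: "f differentiable (at x)" "f differentiable (at (x + a))"
    and inv: "\<And>y. y \<in> S \<Longrightarrow> f (y + a) = f y"
  shows "pd j f (x + a) = pd j f x"
proof -
  have d: "(f has_derivative frechet_derivative f (at (x + a))) (at (x + a))"
    using f(2) frechet_derivative_works by auto
  have "((\<lambda>y. y + a) has_derivative (\<lambda>w. w)) (at x)" by (auto intro!: derivative_eq_intros)
  from has_derivative_compose[OF this d] have e: "((\<lambda>y. f (y + a)) has_derivative frechet_derivative f (at (x + a))) (at x)" .
  have "pd j (\<lambda>y. f (y + a)) x = pd j f x"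
    by (rule pd_cong[OF S inv]) (use e in \<open>auto simp: differentiable_def\<close>)
  then show ?thesis using pd_eqI[OF e] by (simp add: pd_def)
qed

locale knot_fields =
  fixes k :: nat and s c :: real and Y :: "point \<Rightarrow> real" and \<Sigma> :: "point \<Rightarrow> complex"
  assumes sc: "s\<^sup>2 + c\<^sup>2 = 1"
    and smooth_Y: "smooth_on half_space Y" and smooth_\<Sigma>: "smooth_on half_space \<Sigma>"
    and Y_pos: "\<And>x. x \<in> half_space \<Longrightarrow> Y x > 0"
    and inv: "\<And>x t. x \<in> half_space \<Longrightarrow> Y (x + axis 1 t) = Y x" "\<And>x t. x \<in> half_space \<Longrightarrow> \<Sigma> (x + axis 1 t) = \<Sigma> x"
begin

definition l :: "point \<Rightarrow> 4 \<Rightarrow> real" where "l x j = pd j Y x / Y x"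
definition ll :: "point \<Rightarrow> 4 \<Rightarrow> 4 \<Rightarrow> real" where "ll x i j = pd i (pd j Y) x / Y x - l x i * l x j"
definition S :: "point \<Rightarrow> 4 \<Rightarrow> complex" where "S x j = pd j \<Sigma> x / complex_of_real (Y x)"
definition SS :: "point \<Rightarrow> 4 \<Rightarrow> 4 \<Rightarrow> complex" where "SS x i j = pd i (pd j \<Sigma>) x / complex_of_real (Y x)"
definition Z :: "point \<Rightarrow> complex" where "Z x = zcoord x ^ k / complex_of_real (Y x)"

definition A :: form1 where "A i x = su2_mat (diag_A s c (l x) i) (off_A s c (S x) (Z x) i)"
definition \<Phi> :: form1 where "\<Phi> i x = su2_mat (diag_\<Phi> s c (l x) i) (off_\<Phi> s c (S x) (Z x) i)"

lemma td_Y: "times_differentiable_on m half_space Y" and td_\<Sigma>: "times_differentiable_on m half_space \<Sigma>"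
  using smooth_Y smooth_\<Sigma> unfolding smooth_on_def by auto

lemma td_quotient:
  fixes f :: "point \<Rightarrow> complex"
  assumes "times_differentiable_on m half_space f"
  shows "times_differentiable_on m half_space (\<lambda>x. f x / complex_of_real (Y x))"
proof -
  have "times_differentiable_on m half_space (\<lambda>x. inverse (Y x))"
    by (rule td_inverse[OF open_half_space td_Y]) (use Y_pos in force)
  from td_linear[OF open_half_space bounded_linear_of_real this]
  have "times_differentiable_on m half_space (\<lambda>x. complex_of_real (inverse (Y x)))" .
  from td_mult[OF open_half_space assms this] show ?thesis by (simp add: divide_inverse)
qed

lemma td_l: "times_differentiable_on m half_space (\<lambda>x. l x j)"
proof -
  have "times_differentiable_on m half_space (\<lambda>x. inverse (Y x))"
    by (rule td_inverse[OF open_half_space td_Y]) (use Y_pos in force)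
  from td_mult[OF open_half_space td_pd[OF td_Y] this] show ?thesis unfolding l_def by (simp add: divide_inverse)
qed

lemma td_S: "times_differentiable_on m half_space (\<lambda>x. S x j)"
  unfolding S_def by (rule td_quotient[OF td_pd[OF td_\<Sigma>]])

lemma td_Z: "times_differentiable_on m half_space Z"
  unfolding Z_def[abs_def] by (rule td_quotient[OF td_power[OF open_half_space td_zcoord]])

lemma smooth_fields: "smooth_on half_space (A i)" "smooth_on half_space (\<Phi> i)"
  unfolding smooth_on_def A_def[abs_def] \<Phi>_def[abs_def]
  by (intro allI td_su2_mat td_diag td_off open_half_space td_l td_S td_Z)+

lemma half_space_shift: "x \<in> half_space \<Longrightarrow> x + axis 1 t \<in> half_space"
  unfolding half_space_def axis_def by simp

lemma fields_shift:
  assumes x: "x \<in> half_space"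
  shows "A i (x + axis 1 t) = A i x" "\<Phi> i (x + axis 1 t) = \<Phi> i x"
proof -
  have z: "zcoord (x + axis 1 t) = zcoord x" unfolding zcoord_def axis_def by simp
  have p: "pd j Y (x + axis 1 t) = pd j Y x" "pd j \<Sigma> (x + axis 1 t) = pd j \<Sigma> x" for j
    using td_differentiable[OF td_Y x] td_differentiable[OF td_Y half_space_shift[OF x]]
      td_differentiable[OF td_\<Sigma> x] td_differentiable[OF td_\<Sigma> half_space_shift[OF x]]
    by (auto intro!: pd_shift[OF open_half_space x] inv)
  have "l (x + axis 1 t) = l x" "S (x + axis 1 t) = S x" "Z (x + axis 1 t) = Z x"
    unfolding l_def S_def Z_def fun_eq_iff p z inv[OF x] by auto
  then show "A i (x + axis 1 t) = A i x" "\<Phi> i (x + axis 1 t) = \<Phi> i x"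
    unfolding A_def \<Phi>_def by simp_all
qed

lemma pd_1:
  assumes x: "x \<in> half_space"
  shows "pd 1 Y x = 0" "pd 1 \<Sigma> x = 0" "pd 1 (pd j Y) x = 0" "pd 1 (pd j \<Sigma>) x = 0"
proof -
  have 0: "pd 1 Y y = 0 \<and> pd 1 \<Sigma> y = 0" if "y \<in> half_space" for y
    using td_differentiable[OF td_Y that] td_differentiable[OF td_\<Sigma> that] inv[OF that]
    by (intro conjI pd_const_direction) auto
  then show "pd 1 Y x = 0" "pd 1 \<Sigma> x = 0" using x by auto
  have c: "pd j (\<lambda>x. 0) x = 0" for j and x :: point by (rule pd_const_direction) auto
  have "pd j (pd 1 Y) x = pd j (\<lambda>x. 0) x" "pd j (pd 1 \<Sigma>) x = pd j (\<lambda>x. 0) x" for j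
    by (rule pd_cong[OF open_half_space x]; use 0 td_differentiable[OF td_pd[OF td_Y] x] td_differentiable[OF td_pd[OF td_\<Sigma>] x] in auto)+
  then show "pd 1 (pd j Y) x = 0" "pd 1 (pd j \<Sigma>) x = 0"
    unfolding pd_commute_real[OF open_half_space x td_Y, of 1 j] pd_commute_complex[OF open_half_space x td_\<Sigma>, of 1 j] c by auto
qed

text \<open>For \<open>k = 0\<close> truncated subtraction gives the power \<open>z ^ 0\<close>, but
  the factor \<open>k\<close> vanishes.\<close>

definition \<zeta> :: "point \<Rightarrow> complex" where "\<zeta> x = of_nat k * zcoord x ^ (k - 1) / complex_of_real (Y x)"

lemma pd_fields:
  assumes x: "x \<in> half_space"
  shows "pd i (A j) x = su2_mat (diag_A s c (ll x i) j)
      (off_A s c (\<lambda>j. SS x i j - S x j * l x i) ((if i = 2 then \<zeta> x else if i = 3 then \<i> * \<zeta> x else 0) - Z x * l x i) j)"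
    and "pd i (\<Phi> j) x = su2_mat (diag_\<Phi> s c (ll x i) j)
      (off_\<Phi> s c (\<lambda>j. SS x i j - S x j * l x i) ((if i = 2 then \<zeta> x else if i = 3 then \<i> * \<zeta> x else 0) - Z x * l x i) j)"
    and "\<Phi> j differentiable (at x)"
proof -
  have Y0: "Y x \<noteq> 0" using Y_pos[OF x] by simp
  define DY where "DY = frechet_derivative Y (at x)"
  have dY: "(Y has_derivative DY) (at x)"
    using td_differentiable[OF td_Y x] frechet_derivative_works unfolding DY_def by blast
  have dYc: "((\<lambda>x. complex_of_real (Y x)) has_derivative (\<lambda>w. complex_of_real (DY w))) (at x)"
    by (rule bounded_linear.has_derivative[OF bounded_linear_of_real dY])
  have q: "((\<lambda>x. f x / complex_of_real (Y x)) has_derivative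
      (\<lambda>w. D w / complex_of_real (Y x) - f x / complex_of_real (Y x) * (DY w / Y x))) (at x)" if "(f has_derivative D) (at x)" for f D
    by (rule has_derivative_eq_rhs[OF has_derivative_divide'[OF that dYc]])
      (use Y0 in \<open>auto simp: field_simps\<close>)
  define DL where "DL w j = frechet_derivative (pd j Y) (at x) w / Y x - l x j * (DY w / Y x)" for w j
  have dl: "((\<lambda>x. l x j) has_derivative (\<lambda>w. DL w j)) (at x)" for j
  proof -
    have "(pd j Y has_derivative frechet_derivative (pd j Y) (at x)) (at x)"
      using td_differentiable[OF td_pd[OF td_Y] x] frechet_derivative_works by blast
    from has_derivative_divide'[OF this dY Y0] show ?thesis unfolding DL_def l_def
      by (rule has_derivative_eq_rhs) (use Y0 in \<open>auto simp: field_simps\<close>)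
  qed
  define DS where "DS w j = frechet_derivative (pd j \<Sigma>) (at x) w / complex_of_real (Y x) - S x j * (DY w / Y x)" for w j
  have dS: "((\<lambda>x. S x j) has_derivative (\<lambda>w. DS w j)) (at x)" for j
  proof -
    have "(pd j \<Sigma> has_derivative frechet_derivative (pd j \<Sigma>) (at x)) (at x)"
      using td_differentiable[OF td_pd[OF td_\<Sigma>] x] frechet_derivative_works by blast
    from q[OF this] show ?thesis unfolding DS_def S_def .
  qed
  define DZ where "DZ w = of_nat k * zcoord w * zcoord x ^ (k - 1) / complex_of_real (Y x) - Z x * (DY w / Y x)" for w
  have dZ: "(Z has_derivative DZ) (at x)"
  proof -
    have "((\<lambda>x. zcoord x ^ k) has_derivative (\<lambda>w. of_nat k * zcoord w * zcoord x ^ (k - 1))) (at x)"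
      by (rule has_derivative_power[OF bounded_linear_imp_has_derivative[OF bounded_linear_zcoord]])
    from q[OF this] show ?thesis unfolding DZ_def[abs_def] Z_def[abs_def] .
  qed
  have ax: "DL (axis i 1) = ll x i" "DS (axis i 1) = (\<lambda>j. SS x i j - S x j * l x i)"
      "DZ (axis i 1) = (if i = 2 then \<zeta> x else if i = 3 then \<i> * \<zeta> x else 0) - Z x * l x i"
    by (auto simp: DL_def DS_def DZ_def ll_def SS_def l_def DY_def pd_def fun_eq_iff zcoord_axis \<zeta>_def)
  have dA: "(A j has_derivative (\<lambda>w. su2_mat (diag_A s c (DL w) j) (off_A s c (DS w) (DZ w) j))) (at x)"
    unfolding A_def[abs_def] by (intro has_derivative_su2_mat has_derivative_diag has_derivative_off dl dS dZ)
  have dP: "(\<Phi> j has_derivative (\<lambda>w. su2_mat (diag_\<Phi> s c (DL w) j) (off_\<Phi> s c (DS w) (DZ w) j))) (at x)"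
    unfolding \<Phi>_def[abs_def] by (intro has_derivative_su2_mat has_derivative_diag has_derivative_off dl dS dZ)
  show "pd i (A j) x = su2_mat (diag_A s c (ll x i) j)
      (off_A s c (\<lambda>j. SS x i j - S x j * l x i) ((if i = 2 then \<zeta> x else if i = 3 then \<i> * \<zeta> x else 0) - Z x * l x i) j)"
    using pd_eqI[OF dA, of i] unfolding ax .
  show "pd i (\<Phi> j) x = su2_mat (diag_\<Phi> s c (ll x i) j)
      (off_\<Phi> s c (\<lambda>j. SS x i j - S x j * l x i) ((if i = 2 then \<zeta> x else if i = 3 then \<i> * \<zeta> x else 0) - Z x * l x i) j)"
    using pd_eqI[OF dP, of i] unfolding ax .
  show "\<Phi> j differentiable (at x)" using dP by (auto simp: differentiable_def)
qed

text \<open>The moment map equation \<open>D\<^sub>2\<Psi>\<^sub>2 + D\<^sub>3\<Psi>\<^sub>3 + D\<^sub>4\<Psi>\<^sub>4 + 2 i (s\<^sup>2 - c\<^sup>2) [\<Psi>\<^sub>2, \<Psi>\<^sub>3] = 0\<close>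
  of the flat connection underlying the ansatz, split into its diagonal and off-diagonal part.\<close>

definition moment_eq :: "point \<Rightarrow> bool" where
  "moment_eq x \<longleftrightarrow>
     ll x 2 2 + ll x 3 3 + ll x 4 4 + (cmod (S x 4))\<^sup>2 + 4 * (cmod (s * (S x 2 - \<i> * S x 3) / 2 - Z x))\<^sup>2
      + 4 * c\<^sup>2 * (cmod ((S x 2 + \<i> * S x 3) / 2))\<^sup>2 = 0 \<and>
     SS x 2 2 + SS x 3 3 + SS x 4 4 = 2 * S x 4 * l x 4 + 4 * c\<^sup>2 * ((S x 2 + \<i> * S x 3) / 2) * (l x 2 - \<i> * l x 3)
      + 4 * s * (s * (S x 2 - \<i> * S x 3) / 2 - Z x) * (l x 2 + \<i> * l x 3)"

lemma KW_at:
  assumes x: "x \<in> half_space" and m: "moment_eq x"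
    and trig: "cos (2 * \<theta>) = 4 * s ^ 3 - 3 * s" "sin (2 * \<theta>) = 4 * c ^ 3 - 3 * c"
  shows "cis \<theta> *\<^sub>C complex_curvature A \<Phi> i j x = conj_sl2 (hodge2 (\<lambda>i j x. cis \<theta> *\<^sub>C complex_curvature A \<Phi> i j x) i j x)"
    and "dA3 A (hodge1 \<Phi>) i j k' l' x = 0"
proof -
  interpret kw_jet s c "l x" "ll x" "S x" "SS x" "Z x" "\<zeta> x"
  proof
    show "ll x i j = ll x j i" "SS x i j = SS x j i" for i j
      unfolding ll_def SS_def pd_commute_real[OF open_half_space x td_Y, of i j] pd_commute_complex[OF open_half_space x td_\<Sigma>, of i j]
      by simp_all
    show "l x 1 = 0" "S x 1 = 0" "ll x 1 j = 0" "SS x 1 j = 0" for j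
      unfolding l_def S_def ll_def SS_def pd_1[OF x] by simp_all
  qed (use m sc in \<open>auto simp: moment_eq_def\<close>)
  note pdf = pd_fields[OF x, folded dS_def dZ_def]
  have cc: "complex_curvature A \<Phi> i j x = cmat (P_diag i j) (P_off i j) (Q_diag i j) (Q_off i j)" for i j
  proof -
    have w: "wedge_self B i j x = commutator (B i x) (B j x)" for B :: form1
      unfolding wedge_self_def commutator_def ..
    show ?thesis
      unfolding complex_curvature_def curvature_def dA1_def covd_def w pdf A_def \<Phi>_def commutator_su2_mat
        su2_mat_add su2_mat_diff cmat_def P_diag_def P_off_def Q_diag_def Q_off_def by simp
  qed
  have hx: "hodge2 (\<lambda>i j x. cis \<theta> *\<^sub>C complex_curvature A \<Phi> i j x) i j x = hodge2 (\<lambda>i j _. cis \<theta> *\<^sub>C complex_curvature A \<Phi> i j x) i j x"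
    unfolding hodge2_def ..
  have tr: "cos (2 * \<theta>) = C" "sin (2 * \<theta>) = T" unfolding C_def T_def trig by auto
  have anti: "complex_curvature A \<Phi> j i x = - complex_curvature A \<Phi> i j x" for i j
    unfolding cc cmat_minus[symmetric] P_diag_def P_off_def Q_diag_def Q_off_def br_diag_def br_off_def
    by (rule arg_cong4[where f = cmat]) (simp_all add: algebra_simps)
  note sd = self_dual_pair[of \<theta>, unfolded tr]
  show "cis \<theta> *\<^sub>C complex_curvature A \<Phi> i j x = conj_sl2 (hodge2 (\<lambda>i j x. cis \<theta> *\<^sub>C complex_curvature A \<Phi> i j x) i j x)"
    unfolding hx
  proof (rule self_dual[OF anti])
    note e12 = P_diag_12 Q_diag_12 P_off_12 Q_off_12
    note e13 = P_diag_13 Q_diag_13 P_off_13 Q_off_13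
    note e14 = P_diag_14 Q_diag_14 P_off_14 Q_off_14
    show "cis \<theta> *\<^sub>C complex_curvature A \<Phi> 1 2 x = conj_sl2 (cis \<theta> *\<^sub>C complex_curvature A \<Phi> 3 4 x)"
      "cis \<theta> *\<^sub>C complex_curvature A \<Phi> 3 4 x = conj_sl2 (cis \<theta> *\<^sub>C complex_curvature A \<Phi> 1 2 x)"
      unfolding cc by (rule sd[OF e12])+
    show "cis \<theta> *\<^sub>C complex_curvature A \<Phi> 1 3 x = conj_sl2 (cis \<theta> *\<^sub>C complex_curvature A \<Phi> 4 2 x)"
      "cis \<theta> *\<^sub>C complex_curvature A \<Phi> 4 2 x = conj_sl2 (cis \<theta> *\<^sub>C complex_curvature A \<Phi> 1 3 x)"
      unfolding cc by (rule sd[OF e13])+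
    show "cis \<theta> *\<^sub>C complex_curvature A \<Phi> 1 4 x = conj_sl2 (cis \<theta> *\<^sub>C complex_curvature A \<Phi> 2 3 x)"
      "cis \<theta> *\<^sub>C complex_curvature A \<Phi> 2 3 x = conj_sl2 (cis \<theta> *\<^sub>C complex_curvature A \<Phi> 1 4 x)"
      unfolding cc by (rule sd[OF e14])+
  qed
  have D: "covd A i (\<Phi> j) x = su2_mat (D_diag i j) (D_off i j)" for i j
    unfolding covd_def pdf A_def \<Phi>_def commutator_su2_mat su2_mat_add D_diag_def D_off_def ..
  show "dA3 A (hodge1 \<Phi>) i j k' l' x = 0"
    by (rule dA3_hodge1[OF pd_fields(3)[OF x]]) (simp add: D su2_mat_add div_diag div_off su2_mat_0)
qed

lemma ansatz:
  assumes \<beta>: "s = sin \<beta>" "c = cos \<beta>" and c0: "cos \<beta> \<noteq> 0"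
  shows "has_ansatz_form \<beta> k Y \<Sigma> A \<Phi>"
  unfolding has_ansatz_form_def Let_def
proof (intro ballI conjI)
  fix x assume x: "x \<in> half_space"
  have Y0: "Y x \<noteq> 0" using Y_pos[OF x] by simp
  have pY: "pd j (\<lambda>p. complex_of_real (Y p)) x = complex_of_real (pd j Y x)" for j
    by (rule pd_bounded_linear[OF bounded_linear_of_real td_differentiable[OF td_Y x]])
  have pc: "pd j (\<lambda>p. cnj (\<Sigma> p)) x = cnj (pd j \<Sigma> x)" for j
    by (rule pd_bounded_linear[OF bounded_linear_cnj td_differentiable[OF td_\<Sigma> x]])
  define Yi where "Yi = inverse (complex_of_real (Y x))"
  have e: "Yi * ((complex_of_real (pd 2 Y x) - \<i> * complex_of_real (pd 3 Y x)) / 2) = (l x 2 - \<i> * l x 3) / 2"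
    "Yi * ((pd 2 \<Sigma> x - \<i> * pd 3 \<Sigma> x) / 2) = (S x 2 - \<i> * S x 3) / 2"
    "2 * Yi * ((pd 2 \<Sigma> x - \<i> * pd 3 \<Sigma> x) / 2) = S x 2 - \<i> * S x 3"
    "Yi * ((cnj (pd 2 \<Sigma> x) - \<i> * cnj (pd 3 \<Sigma> x)) / 2) = (cnj (S x 2) - \<i> * cnj (S x 3)) / 2"
    "2 * Yi * ((cnj (pd 2 \<Sigma> x) - \<i> * cnj (pd 3 \<Sigma> x)) / 2) = cnj (S x 2) - \<i> * cnj (S x 3)"
    "Yi * zcoord x ^ k = Z x" "Yi * complex_of_real (pd 4 Y x) = l x 4" "Yi * pd 4 \<Sigma> x = S x 4" "Yi * cnj (pd 4 \<Sigma> x) = cnj (S x 4)"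
    unfolding Yi_def l_def S_def Z_def using Y0 by (simp_all add: field_simps)
  have Az: "ansatz_Az \<beta> k Y \<Sigma> x = (s\<^sup>2 / 2) *\<^sub>R m22 ((l x 2 - \<i> * l x 3) / 2) (S x 2 - \<i> * S x 3) 0 (- ((l x 2 - \<i> * l x 3) / 2))
      - s *\<^sub>R m22 0 (Z x) 0 0 - (c\<^sup>2 / 2) *\<^sub>R m22 ((l x 2 - \<i> * l x 3) / 2) 0 (cnj (S x 2) - \<i> * cnj (S x 3)) (- ((l x 2 - \<i> * l x 3) / 2))"
    unfolding ansatz_Az_def Let_def dz_def pY pc Yi_def[symmetric] e \<beta> ..
  have Pz: "ansatz_\<phi>z \<beta> k Y \<Sigma> x = (s * c) *\<^sub>R m22 ((l x 2 - \<i> * l x 3) / 2) ((S x 2 - \<i> * S x 3) / 2) ((cnj (S x 2) - \<i> * cnj (S x 3)) / 2) (- ((l x 2 - \<i> * l x 3) / 2))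
      - c *\<^sub>R m22 0 (Z x) 0 0"
    unfolding ansatz_\<phi>z_def Let_def dz_def pY pc Yi_def[symmetric] e \<beta> ..
  have Ay: "ansatz_Ay Y \<Sigma> x = (1/2) *\<^sub>R m22 0 (S x 4) (- cnj (S x 4)) 0"
    unfolding ansatz_Ay_def Let_def pc Yi_def[symmetric] e ..
  have P1: "ansatz_\<phi>1 \<beta> Y \<Sigma> x = (\<i> * complex_of_real c / 2) *\<^sub>C m22 (l x 4) (S x 4) (cnj (S x 4)) (- l x 4)"
    unfolding ansatz_\<phi>1_def Let_def pY pc Yi_def[symmetric] e \<beta> by simp
  have "tan \<beta> * c = s" unfolding \<beta> tan_def using c0 by simp
  then have tc: "tan \<beta> * (c * r) = s * r" for r by (simp flip: mult.assoc)
  note ms = vec_eq_iff forall_2 m22_nth cscale_def dagger_def su2_mat_def diag_A_def diag_\<Phi>_def off_A_def off_\<Phi>_def complex_eq_iff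
  show "A 1 x = tan \<beta> *\<^sub>R ansatz_\<phi>1 \<beta> Y \<Sigma> x" unfolding P1 A_def by (simp add: ms tc mult.assoc)
  show "A 2 x = ansatz_Az \<beta> k Y \<Sigma> x + - dagger (ansatz_Az \<beta> k Y \<Sigma> x)"
    unfolding Az A_def by (simp add: ms power2_eq_square) (simp add: field_simps)
  show "A 3 x = \<i> *\<^sub>C (ansatz_Az \<beta> k Y \<Sigma> x - - dagger (ansatz_Az \<beta> k Y \<Sigma> x))"
    unfolding Az A_def by (simp add: ms power2_eq_square) (simp add: field_simps)
  show "A 4 x = ansatz_Ay Y \<Sigma> x" unfolding Ay A_def by (simp add: ms)
  show "\<Phi> 1 x = ansatz_\<phi>1 \<beta> Y \<Sigma> x" unfolding P1 \<Phi>_def by (simp add: ms)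
  show "\<Phi> 2 x = ansatz_\<phi>z \<beta> k Y \<Sigma> x + - dagger (ansatz_\<phi>z \<beta> k Y \<Sigma> x)"
    unfolding Pz \<Phi>_def by (simp add: ms) (simp add: field_simps)
  show "\<Phi> 3 x = \<i> *\<^sub>C (ansatz_\<phi>z \<beta> k Y \<Sigma> x - - dagger (ansatz_\<phi>z \<beta> k Y \<Sigma> x))"
    unfolding Pz \<Phi>_def by (simp add: ms) (simp add: field_simps)
  show "\<Phi> 4 x = 0" unfolding \<Phi>_def by (simp add: ms)
qed

end

lemma sin_times_3: "sin (3 * x) = 3 * sin x - 4 * sin x ^ 3" for x :: real
proof -
  have "sin (3 * x) = sin (2 * x + x)" by simp
  also have "\<dots> = 2 * sin x * (cos x)\<^sup>2 + (1 - 2 * (sin x)\<^sup>2) * sin x"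
    unfolding sin_add sin_double cos_double_sin by (simp add: power2_eq_square)
  also have "\<dots> = 3 * sin x - 4 * sin x ^ 3"
    unfolding cos_squared_eq by (simp add: power2_eq_square power3_eq_cube algebra_simps)
  finally show ?thesis .
qed

theorem model_knot_solution_of_profile:
  fixes \<theta> :: real
  assumes "knot_fields (sin (beta_of \<theta>)) (cos (beta_of \<theta>)) Y \<Sigma>" and c0: "cos (beta_of \<theta>) \<noteq> 0"
    and m: "\<And>x. x \<in> half_space \<Longrightarrow> knot_fields.moment_eq k (sin (beta_of \<theta>)) (cos (beta_of \<theta>)) Y \<Sigma> x"
    and u: "profile_asymptotics k u v"
    and r: "\<And>x. x \<in> half_space \<Longrightarrow> zcoord x \<noteq> 0 \<Longrightarrow> Y x = cmod (zcoord x) ^ (k + 1) * exp (u (ycoord x / cmod (zcoord x)))"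
      "\<And>x. x \<in> half_space \<Longrightarrow> zcoord x \<noteq> 0 \<Longrightarrow> \<Sigma> x = complex_of_real (sin (beta_of \<theta>)) * zcoord x ^ (k + 1) * complex_of_real (v (ycoord x / cmod (zcoord x)))"
  shows "\<exists>A \<Phi>. model_knot_solution k \<theta> A \<Phi>"
proof -
  interpret knot_fields k "sin (beta_of \<theta>)" "cos (beta_of \<theta>)" Y \<Sigma> by fact
  have "2 * \<theta> = 3 * beta_of \<theta> + pi / 2" unfolding beta_of_def by (simp add: field_simps)
  then have tr: "cos (2 * \<theta>) = 4 * sin (beta_of \<theta>) ^ 3 - 3 * sin (beta_of \<theta>)" "sin (2 * \<theta>) = 4 * cos (beta_of \<theta>) ^ 3 - 3 * cos (beta_of \<theta>)"
    using sin_times_3[of "beta_of \<theta>"] cos_treble_cos[of "beta_of \<theta>"] by (simp_all add: cos_add sin_add)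
  have "KW_equations \<theta> A \<Phi>"
    unfolding KW_equations_def Let_def using KW_at[OF _ m tr] by blast
  moreover have "A i x \<in> su2" "\<Phi> i x \<in> su2" for i x unfolding A_def \<Phi>_def by (rule su2_mat_in)+
  ultimately have "model_knot_solution k \<theta> A \<Phi>"
    unfolding model_knot_solution_def Let_def
    using smooth_fields fields_shift ansatz[OF refl refl c0] u r smooth_Y smooth_\<Sigma> Y_pos by blast
  then show ?thesis by blast
qed

subsection \<open>Coordinates adapted to the knot\<close>

lemma td_coord: "times_differentiable_on m half_space (\<lambda>x. x $ j)"
  by (rule td_linear[OF open_half_space bounded_linear_vec_nth td_ident[OF open_half_space]])

definition rho :: "point \<Rightarrow> real" where "rho x = sqrt ((x$2)\<^sup>2 + (x$3)\<^sup>2 + (x$4)\<^sup>2)"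
text \<open>Reciprocals get names of their own: the identities below then follow by polynomial
  algebra from \<open>rho * irho = 1\<close>, \<open>(y + rho) * idst = 1\<close> and the formula
  for \<open>rho^2\<close>.\<close>

definition irho :: "point \<Rightarrow> real" where "irho x = inverse (rho x)"
definition idst :: "point \<Rightarrow> real" where "idst x = inverse (x$4 + rho x)"

text \<open>\<open>w = (\<rho> - y) / (\<rho> + y) = e\<^sup>- \<^sup>2 \<^sup>t\<close> with \<open>sinh t = y / r\<close> is smooth across \<open>z = 0\<close>.\<close>

definition wvar :: "point \<Rightarrow> real" where "wvar x = (rho x - x$4) * idst x"

text \<open>The partial derivatives of \<open>wvar\<close>; likewise \<open>VJ\<close> are those of
  \<open>ln (y + rho)\<close>. \<open>DWJ\<close> and \<open>DVJ\<close> below are the pure second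
  derivatives.\<close>

definition WJ :: "4 \<Rightarrow> point \<Rightarrow> real" where
  "WJ j x = (if j = 2 \<or> j = 3 then 2 * x$4 * (x$j * (irho x * (idst x)\<^sup>2)) else if j = 4 then - 2 * (wvar x * irho x) else 0)"
definition VJ :: "4 \<Rightarrow> point \<Rightarrow> real" where
  "VJ j x = (if j = 2 \<or> j = 3 then x$j * (irho x * idst x) else if j = 4 then irho x else 0)"

lemma rho_facts:
  assumes "x \<in> half_space"
  shows "rho x > 0" "x$4 > 0" "(rho x)\<^sup>2 = (x$2)\<^sup>2 + (x$3)\<^sup>2 + (x$4)\<^sup>2" "x$4 \<le> rho x"
    "rho x * irho x = 1" "(x$4 + rho x) * idst x = 1" "0 < irho x" "0 < idst x"
proof -
  show y: "x$4 > 0" using assms unfolding half_space_def by simp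
  then have pos: "(x$2)\<^sup>2 + (x$3)\<^sup>2 + (x$4)\<^sup>2 > 0" by (simp add: add_nonneg_pos)
  then show r: "rho x > 0" unfolding rho_def by simp
  show "(rho x)\<^sup>2 = (x$2)\<^sup>2 + (x$3)\<^sup>2 + (x$4)\<^sup>2" unfolding rho_def using pos by simp
  show "x$4 \<le> rho x" unfolding rho_def by (rule real_le_rsqrt) simp
  show "rho x * irho x = 1" "(x$4 + rho x) * idst x = 1" "0 < irho x" "0 < idst x"
    unfolding irho_def idst_def using r y by auto
qed

lemma wvar_bounds:
  assumes "x \<in> half_space"
  shows "0 \<le> wvar x" "wvar x < 1" "wvar x * (x$4 + rho x)\<^sup>2 = (x$2)\<^sup>2 + (x$3)\<^sup>2"
    and "tt (wvar x) = x$4 * irho x" "1 / (1 + wvar x) = (1 + x$4 * irho x) / 2"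
proof -
  note f = rho_facts[OF assms]
  have w: "wvar x = (rho x - x$4) / (x$4 + rho x)" unfolding wvar_def idst_def by (simp add: divide_inverse)
  show "0 \<le> wvar x" "wvar x < 1" unfolding w using f by auto
  have "wvar x * (x$4 + rho x)\<^sup>2 = (rho x - x$4) * (x$4 + rho x) * ((x$4 + rho x) * idst x)"
    unfolding wvar_def by (simp add: power2_eq_square)
  also have "\<dots> = (rho x)\<^sup>2 - (x$4)\<^sup>2" unfolding f(6) by (simp add: power2_eq_square algebra_simps)
  finally show "wvar x * (x$4 + rho x)\<^sup>2 = (x$2)\<^sup>2 + (x$3)\<^sup>2" using f(3) by simp
  have 1: "1 + wvar x = 2 * rho x / (x$4 + rho x)" "1 - wvar x = 2 * x$4 / (x$4 + rho x)"
    unfolding w using f(1,2) by (simp_all add: field_simps)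
  show "tt (wvar x) = x$4 * irho x" "1 / (1 + wvar x) = (1 + x$4 * irho x) / 2"
  proof -
    define D where "D = x$4 + rho x"
    have D: "D > 0" unfolding D_def using f(1,2) by simp
    have g: "(2 * u / D) / (2 * v / D) = u * inverse v" if "v > 0" for u v using D that by (simp add: field_simps)
    show "tt (wvar x) = x$4 * irho x" unfolding tt_def 1 irho_def D_def[symmetric] by (rule g[OF f(1)])
    have "1 / (1 + wvar x) = D / (2 * rho x)" unfolding 1 D_def[symmetric] by simp
    then show "1 / (1 + wvar x) = (1 + x$4 * irho x) / 2" unfolding irho_def D_def using f(1) by (simp add: field_simps)
  qed
qed

lemma has_derivative_rho:
  assumes x: "x \<in> half_space"
  shows "(rho has_derivative (\<lambda>v. (x$2 * v$2 + x$3 * v$3 + x$4 * v$4) * irho x)) (at x)"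
    and "(irho has_derivative (\<lambda>v. - (x$2 * v$2 + x$3 * v$3 + x$4 * v$4) * irho x ^ 3)) (at x)"
    and "(idst has_derivative (\<lambda>v. - (v$4 + (x$2 * v$2 + x$3 * v$3 + x$4 * v$4) * irho x) * (idst x)\<^sup>2)) (at x)"
    and "(wvar has_derivative (\<lambda>v. WJ 2 x * v$2 + WJ 3 x * v$3 + WJ 4 x * v$4)) (at x)"
proof -
  note f = rho_facts[OF x]
  have co: "((\<lambda>x::point. x $ j) has_derivative (\<lambda>v. v $ j)) (at x)" for j
    by (rule bounded_linear_imp_has_derivative[OF bounded_linear_vec_nth])
  have pos: "(x$2)\<^sup>2 + (x$3)\<^sup>2 + (x$4)\<^sup>2 > 0" using f(1,3) by (metis zero_less_power)
  have sq: "((\<lambda>x::point. (x$2)\<^sup>2 + (x$3)\<^sup>2 + (x$4)\<^sup>2) has_derivative (\<lambda>v. 2 * (x$2 * v$2 + x$3 * v$3 + x$4 * v$4))) (at x)"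
    by (rule has_derivative_eq_rhs[OF has_derivative_add[OF has_derivative_add[OF has_derivative_power[OF co] has_derivative_power[OF co]] has_derivative_power[OF co]]])
      (simp add: fun_eq_iff algebra_simps)
  have "(rho has_derivative (\<lambda>v. 2 * (x$2 * v$2 + x$3 * v$3 + x$4 * v$4) * (inverse (sqrt ((x$2)\<^sup>2 + (x$3)\<^sup>2 + (x$4)\<^sup>2)) / 2))) (at x)"
    unfolding rho_def[abs_def] by (rule has_derivative_real_sqrt[OF pos sq])
  then show r: "(rho has_derivative (\<lambda>v. (x$2 * v$2 + x$3 * v$3 + x$4 * v$4) * irho x)) (at x)"
    unfolding irho_def rho_def by (rule has_derivative_eq_rhs) (simp add: fun_eq_iff)
  have r0: "rho x \<noteq> 0" "x$4 + rho x \<noteq> 0" using f by auto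
  show "(irho has_derivative (\<lambda>v. - (x$2 * v$2 + x$3 * v$3 + x$4 * v$4) * irho x ^ 3)) (at x)"
    unfolding irho_def[abs_def]
    by (rule has_derivative_eq_rhs[OF Deriv.has_derivative_inverse[OF r0(1) r]])
      (simp add: fun_eq_iff irho_def power3_eq_cube algebra_simps)
  show d: "(idst has_derivative (\<lambda>v. - (v$4 + (x$2 * v$2 + x$3 * v$3 + x$4 * v$4) * irho x) * (idst x)\<^sup>2)) (at x)"
    unfolding idst_def[abs_def]
    by (rule has_derivative_eq_rhs[OF Deriv.has_derivative_inverse[OF r0(2) has_derivative_add[OF co r]]])
      (simp add: fun_eq_iff idst_def power2_eq_square algebra_simps)
  show "(wvar has_derivative (\<lambda>v. WJ 2 x * v$2 + WJ 3 x * v$3 + WJ 4 x * v$4)) (at x)"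
    unfolding wvar_def[abs_def]
  proof (rule has_derivative_eq_rhs[OF has_derivative_mult[OF has_derivative_diff[OF r co] d]], rule ext)
    fix v :: point
    show "(rho x - x $ 4) * (- (v$4 + (x$2 * v$2 + x$3 * v$3 + x$4 * v$4) * irho x) * (idst x)\<^sup>2)
      + ((x$2 * v$2 + x$3 * v$3 + x$4 * v$4) * irho x - v$4) * idst x = WJ 2 x * v$2 + WJ 3 x * v$3 + WJ 4 x * v$4"
      unfolding WJ_def wvar_def using f(3,5,6) by simp algebra
  qed
qed

definition DWJ :: "4 \<Rightarrow> point \<Rightarrow> real" where
  "DWJ j x = (if j = 4 then 4 * wvar x * (irho x)\<^sup>2 + 2 * wvar x * x$4 * irho x ^ 3
     else 2 * x$4 * (irho x * (idst x)\<^sup>2 - (x$j)\<^sup>2 * irho x ^ 3 * (idst x)\<^sup>2 - 2 * (x$j)\<^sup>2 * (irho x)\<^sup>2 * idst x ^ 3))"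
definition DVJ :: "4 \<Rightarrow> point \<Rightarrow> real" where
  "DVJ j x = (if j = 4 then - x$4 * irho x ^ 3
     else irho x * idst x - (x$j)\<^sup>2 * irho x ^ 3 * idst x - (x$j)\<^sup>2 * (irho x)\<^sup>2 * (idst x)\<^sup>2)"

lemma has_derivative_WJ:
  assumes x: "x \<in> half_space" and j: "j \<in> {2, 3, 4}"
  shows "\<exists>D. (WJ j has_derivative D) (at x) \<and> D (axis j 1) = DWJ j x"
    and "\<exists>D. (VJ j has_derivative D) (at x) \<and> D (axis j 1) = DVJ j x"
proof -
  note d = has_derivative_rho[OF x]
  have co: "((\<lambda>x::point. x $ j) has_derivative (\<lambda>v. v $ j)) (at x)" for j
    by (rule bounded_linear_imp_has_derivative[OF bounded_linear_vec_nth])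
  show "\<exists>D. (WJ j has_derivative D) (at x) \<and> D (axis j 1) = DWJ j x"
  proof (cases "j = 4")
    case True
    have e: "WJ j = (\<lambda>x. - 2 * (wvar x * irho x))" unfolding True by (simp add: WJ_def fun_eq_iff)
    have h: "(WJ j has_derivative (\<lambda>v. - 2 * (wvar x * (- (x$2 * v$2 + x$3 * v$3 + x$4 * v$4) * irho x ^ 3) + (WJ 2 x * v$2 + WJ 3 x * v$3 + WJ 4 x * v$4) * irho x))) (at x)"
      unfolding e by (intro has_derivative_minus has_derivative_mult_right has_derivative_mult d)
    show ?thesis
      by (rule exI, rule conjI, rule h) (use True in \<open>simp add: axis_def WJ_def DWJ_def power2_eq_square power3_eq_cube algebra_simps\<close>)
  next
    case False
    have e: "WJ j = (\<lambda>x. 2 * x$4 * (x$j * (irho x * (idst x)\<^sup>2)))" using False j by (auto simp: WJ_def fun_eq_iff)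
    have h: "(WJ j has_derivative (\<lambda>v. 2 * x$4 * (x$j * (irho x * (of_nat 2 * (- (v$4 + (x$2 * v$2 + x$3 * v$3 + x$4 * v$4) * irho x) * (idst x)\<^sup>2) * idst x ^ (2 - 1))
        + (- (x$2 * v$2 + x$3 * v$3 + x$4 * v$4) * irho x ^ 3) * (idst x)\<^sup>2) + v$j * (irho x * (idst x)\<^sup>2)) + (2 * v$4) * (x$j * (irho x * (idst x)\<^sup>2)))) (at x)"
      unfolding e by (intro has_derivative_mult has_derivative_mult_right has_derivative_power co d)
    show ?thesis
      by (rule exI, rule conjI, rule h) (use False j in \<open>auto simp: axis_def DWJ_def power2_eq_square power3_eq_cube algebra_simps\<close>)
  qed
  show "\<exists>D. (VJ j has_derivative D) (at x) \<and> D (axis j 1) = DVJ j x"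
  proof (cases "j = 4")
    case True
    have h: "(VJ j has_derivative (\<lambda>v. - (x$2 * v$2 + x$3 * v$3 + x$4 * v$4) * irho x ^ 3)) (at x)"
      unfolding VJ_def[of j, abs_def] using True d(2) by simp
    show ?thesis
      by (rule exI, rule conjI, rule h) (use True in \<open>simp add: axis_def DVJ_def\<close>)
  next
    case False
    have e: "VJ j = (\<lambda>x. x$j * (irho x * idst x))" using False j by (auto simp: VJ_def fun_eq_iff)
    have h: "(VJ j has_derivative (\<lambda>v. x$j * (irho x * (- (v$4 + (x$2 * v$2 + x$3 * v$3 + x$4 * v$4) * irho x) * (idst x)\<^sup>2)
        + (- (x$2 * v$2 + x$3 * v$3 + x$4 * v$4) * irho x ^ 3) * idst x) + v$j * (irho x * idst x))) (at x)"
      unfolding e by (intro has_derivative_mult co d)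
    show ?thesis
      by (rule exI, rule conjI, rule h) (use False j in \<open>auto simp: axis_def DVJ_def power2_eq_square power3_eq_cube algebra_simps\<close>)
  qed
qed

text \<open>Consequently \<open>ln (y + rho)\<close> drops out of the Laplacian of
  \<open>ln Y\<close>, and a function \<open>f\<close> of \<open>w\<close> has Laplacian
  \<open>4 (w f')' / (y + rho)^2\<close>. This is why the radial equations are equations for the
  derivatives of \<open>w p\<close> and \<open>w g1\<close>.\<close>

lemma harmonicity:
  assumes x: "x \<in> half_space"
  shows "DVJ 2 x + DVJ 3 x + DVJ 4 x = 0"
    and "DWJ 2 x + DWJ 3 x + DWJ 4 x = 4 * (idst x)\<^sup>2"
    and "(WJ 2 x)\<^sup>2 + (WJ 3 x)\<^sup>2 + (WJ 4 x)\<^sup>2 = 4 * wvar x * (idst x)\<^sup>2"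
  using rho_facts(3,5,6)[OF x] unfolding DVJ_def DWJ_def WJ_def wvar_def by (simp_all, algebra+)

lemma td_rho:
  "times_differentiable_on m half_space rho" "times_differentiable_on m half_space irho"
  "times_differentiable_on m half_space idst" "times_differentiable_on m half_space wvar"
proof -
  show r: "times_differentiable_on m half_space rho"
    unfolding rho_def[abs_def]
  proof (rule td_compose[OF open_half_space td_sqrt])
    show "times_differentiable_on m half_space (\<lambda>x. (x$2)\<^sup>2 + (x$3)\<^sup>2 + (x$4)\<^sup>2)"
      by (intro td_add td_power open_half_space td_coord)
    show "(x$2)\<^sup>2 + (x$3)\<^sup>2 + (x$4)\<^sup>2 \<in> {0<..}" if "x \<in> half_space" for x
      using rho_facts(1,3)[OF that] by (metis greaterThan_iff zero_less_power)
  qed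
  show "times_differentiable_on m half_space irho"
    unfolding irho_def[abs_def] by (rule td_inverse[OF open_half_space r]) (use rho_facts(1) in force)
  show d: "times_differentiable_on m half_space idst"
    unfolding idst_def[abs_def]
    by (rule td_inverse[OF open_half_space td_add[OF open_half_space td_coord r]]) (use rho_facts(1,2) in force)
  show "times_differentiable_on m half_space wvar"
    unfolding wvar_def[abs_def] by (intro td_mult td_diff r d td_coord open_half_space)
qed

text \<open>\<open>g = 1 / (n s) - 2 G\<close>, with \<open>n = k + 1\<close>, is the radial factor
  of \<open>\<Sigma>\<close>. In terms of it the equations contain \<open>s n g - 1\<close> in place
  of \<open>- 2 n s G\<close>, and so they also make sense for \<open>s = 0\<close>.\<close>

locale radial_fields =
  fixes k :: nat and s c a :: real and h p g g1 :: "real \<Rightarrow> real"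
  assumes sc: "s\<^sup>2 + c\<^sup>2 = 1" and a: "a < 0"
    and td: "\<And>m. times_differentiable_on m {a<..<1} h" "\<And>m. times_differentiable_on m {a<..<1} p"
      "\<And>m. times_differentiable_on m {a<..<1} g" "\<And>m. times_differentiable_on m {a<..<1} g1"
    and dh: "\<And>w. w \<in> {a<..<1} \<Longrightarrow> (h has_real_derivative p w) (at w)"
    and dg: "\<And>w. w \<in> {a<..<1} \<Longrightarrow> (g has_real_derivative g1 w) (at w)"
    and dP: "\<And>w. w \<in> {a<..<1} \<Longrightarrow> ((\<lambda>w. w * p w) has_real_derivative - (w ^ k * exp (- 2 * h w) / 4 * ((w * g1 w)\<^sup>2
      + 2 * s * (s * (real k + 1) * g w - 1) * tt w * (w * g1 w) + (s * (real k + 1) * g w - 1)\<^sup>2))) (at w)"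
    and dQ: "\<And>w. w \<in> {a<..<1} \<Longrightarrow> ((\<lambda>w. w * g1 w) has_real_derivative 2 * w * p w * g1 w - (real k + 1) * g1 w
      + s * (s * (real k + 1) * g w - 1) * (2 * (real k + 1) * (1 / (1 + w)) + 2 * tt w * p w)) (at w)"
begin

definition Yr :: "point \<Rightarrow> real" where "Yr x = 2 * (x$4 + rho x) ^ (k + 1) * exp (h (wvar x))"
definition \<Sigma>r :: "point \<Rightarrow> complex" where "\<Sigma>r x = zcoord x ^ (k + 1) * complex_of_real (g (wvar x))"

lemma w_in: "x \<in> half_space \<Longrightarrow> wvar x \<in> {a<..<1}"
  using wvar_bounds(1,2)[of x] a by auto

lemma td_w: "times_differentiable_on m {a<..<1} f \<Longrightarrow> times_differentiable_on m half_space (\<lambda>x. f (wvar x))" for f :: "real \<Rightarrow> real"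
  by (rule td_compose[OF open_half_space _ td_rho(4)]) (use w_in in auto)

lemma has_derivative_w:
  fixes f :: "real \<Rightarrow> real"
  assumes "x \<in> half_space" "(f has_real_derivative f') (at (wvar x))"
  shows "((\<lambda>x. f (wvar x)) has_derivative (\<lambda>v. f' * (WJ 2 x * v$2 + WJ 3 x * v$3 + WJ 4 x * v$4))) (at x)"
  using has_derivative_compose[OF has_derivative_rho(4)[OF assms(1)] assms(2)[unfolded has_field_derivative_def]] .

lemma knot: "knot_fields s c Yr \<Sigma>r"
proof
  show "s\<^sup>2 + c\<^sup>2 = 1" by (rule sc)
  show "smooth_on half_space Yr"
    unfolding smooth_on_def Yr_def[abs_def]
    by (intro allI td_mult td_const td_power td_add td_rho td_coord open_half_space td_compose[OF open_half_space td_exp td_w[OF td(1)]] UNIV_I)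
  show "smooth_on half_space \<Sigma>r"
    unfolding smooth_on_def \<Sigma>r_def[abs_def]
    by (intro allI td_mult td_power td_zcoord open_half_space td_linear[OF open_half_space bounded_linear_of_real td_w[OF td(3)]])
  fix x assume x: "x \<in> half_space"
  show "Yr x > 0" unfolding Yr_def using rho_facts(1,2)[OF x] by simp
  fix t
  have e: "(x + axis 1 t) $ 2 = x $ 2" "(x + axis 1 t) $ 3 = x $ 3" "(x + axis 1 t) $ 4 = x $ 4" by (simp_all add: axis_def)
  show "Yr (x + axis 1 t) = Yr x" "\<Sigma>r (x + axis 1 t) = \<Sigma>r x"
    unfolding Yr_def \<Sigma>r_def wvar_def idst_def rho_def zcoord_def e by simp_all
qed

sublocale knot_fields k s c Yr \<Sigma>r by (rule knot)

definition lj :: "4 \<Rightarrow> point \<Rightarrow> real" where "lj j x = (real k + 1) * VJ j x + p (wvar x) * WJ j x"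

lemma deriv_Y:
  assumes x: "x \<in> half_space"
  shows "(Yr has_derivative (\<lambda>v. Yr x * (lj 2 x * v$2 + lj 3 x * v$3 + lj 4 x * v$4))) (at x)"
proof -
  note f = rho_facts[OF x]
  have co: "((\<lambda>x::point. x $ j) has_derivative (\<lambda>v. v $ j)) (at x)" for j
    by (rule bounded_linear_imp_has_derivative[OF bounded_linear_vec_nth])
  have dD: "((\<lambda>x. x$4 + rho x) has_derivative (\<lambda>v. (x$4 + rho x) * (VJ 2 x * v$2 + VJ 3 x * v$3 + VJ 4 x * v$4))) (at x)"
  proof (rule has_derivative_eq_rhs[OF has_derivative_add[OF co has_derivative_rho(1)[OF x]]], rule ext)
    fix v :: point
    show "v $ 4 + (x$2 * v$2 + x$3 * v$3 + x$4 * v$4) * irho x = (x$4 + rho x) * (VJ 2 x * v$2 + VJ 3 x * v$3 + VJ 4 x * v$4)"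
      unfolding VJ_def using f(5,6) by simp algebra
  qed
  have de: "((\<lambda>x. exp (h (wvar x))) has_derivative (\<lambda>v. exp (h (wvar x)) * (p (wvar x) * (WJ 2 x * v$2 + WJ 3 x * v$3 + WJ 4 x * v$4)))) (at x)"
    using has_derivative_compose[OF has_derivative_w[OF x dh[OF w_in[OF x]]] DERIV_exp[unfolded has_field_derivative_def]] .
  show ?thesis
    unfolding Yr_def[abs_def]
    by (rule has_derivative_eq_rhs[OF has_derivative_mult[OF has_derivative_mult_right[OF has_derivative_power[OF dD]] de]])
      (simp add: fun_eq_iff lj_def algebra_simps)
qed

lemma pd_Y: "x \<in> half_space \<Longrightarrow> j \<in> {2, 3, 4} \<Longrightarrow> pd j Yr x = Yr x * lj j x"
  using pd_eqI[OF deriv_Y[of x], of j] by (auto simp: axis_def)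

lemma l_eq: "x \<in> half_space \<Longrightarrow> j \<in> {2, 3, 4} \<Longrightarrow> l x j = lj j x"
  unfolding l_def using pd_Y[of x j] Y_pos[of x] by simp

lemma deriv_deriv:
  assumes "w \<in> {a<..<1}"
  shows "(p has_real_derivative deriv p w) (at w)" "(g1 has_real_derivative deriv g1 w) (at w)"
  using td_differentiable[OF td(2) assms] td_differentiable[OF td(4) assms]
  by (simp_all add: DERIV_deriv_iff_real_differentiable)

lemma ode:
  assumes w: "w \<in> {a<..<1}"
  shows "p w + w * deriv p w = - (w ^ k * exp (- 2 * h w) / 4 * ((w * g1 w)\<^sup>2
      + 2 * s * (s * (real k + 1) * g w - 1) * tt w * (w * g1 w) + (s * (real k + 1) * g w - 1)\<^sup>2))"
    and "g1 w + w * deriv g1 w = 2 * w * p w * g1 w - (real k + 1) * g1 w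
      + s * (s * (real k + 1) * g w - 1) * (2 * (real k + 1) * (1 / (1 + w)) + 2 * tt w * p w)"
  using DERIV_unique[OF dP[OF w] DERIV_mult[OF DERIV_ident deriv_deriv(1)[OF w]]]
    DERIV_unique[OF dQ[OF w] DERIV_mult[OF DERIV_ident deriv_deriv(2)[OF w]]]
  by (simp_all add: mult_ac)

lemma ll_eq:
  assumes x: "x \<in> half_space" and j: "j \<in> {2, 3, 4}"
  shows "ll x j j = (real k + 1) * DVJ j x + deriv p (wvar x) * (WJ j x)\<^sup>2 + p (wvar x) * DWJ j x"
proof -
  obtain DW where DW: "(WJ j has_derivative DW) (at x)" "DW (axis j 1) = DWJ j x" using has_derivative_WJ(1)[OF x j] by blast
  obtain DV where DV: "(VJ j has_derivative DV) (at x)" "DV (axis j 1) = DVJ j x" using has_derivative_WJ(2)[OF x j] by blast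
  have d: "((\<lambda>x. Yr x * lj j x) has_derivative (\<lambda>v. Yr x * ((real k + 1) * DV v + (p (wvar x) * DW v
      + deriv p (wvar x) * (WJ 2 x * v$2 + WJ 3 x * v$3 + WJ 4 x * v$4) * WJ j x))
      + Yr x * (lj 2 x * v$2 + lj 3 x * v$3 + lj 4 x * v$4) * lj j x)) (at x)"
    unfolding lj_def[of j, abs_def]
    by (rule has_derivative_eq_rhs[OF has_derivative_mult[OF deriv_Y[OF x] has_derivative_add[OF has_derivative_mult_right[OF DV(1)]
      has_derivative_mult[OF has_derivative_w[OF x deriv_deriv(1)[OF w_in[OF x]]] DW(1)]]]])
      (simp add: lj_def)
  have "pd j (pd j Yr) x = pd j (\<lambda>x. Yr x * lj j x) x"
    by (rule pd_cong[OF open_half_space x]) (use pd_Y j td_differentiable[OF td_pd[OF td_Y] x] in auto)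
  also have "\<dots> = Yr x * ((real k + 1) * DVJ j x + (p (wvar x) * DWJ j x + deriv p (wvar x) * WJ j x * WJ j x)) + Yr x * lj j x * lj j x"
    unfolding pd_eqI[OF d] DW(2) DV(2) using j by (auto simp: axis_def)
  finally show ?thesis
    unfolding ll_def l_eq[OF x j] using Y_pos[OF x] by (simp add: field_simps power2_eq_square)
qed

definition dj :: "4 \<Rightarrow> complex" where "dj j = zcoord (axis j 1)"

lemma deriv_pw:
  fixes f :: "real \<Rightarrow> real"
  assumes x: "x \<in> half_space" and f: "(f has_real_derivative f') (at (wvar x))"
  shows "((\<lambda>x. zcoord x ^ m * complex_of_real (f (wvar x))) has_derivative
    (\<lambda>v. zcoord x ^ m * complex_of_real (f' * (WJ 2 x * v$2 + WJ 3 x * v$3 + WJ 4 x * v$4))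
       + of_nat m * zcoord v * zcoord x ^ (m - 1) * complex_of_real (f (wvar x)))) (at x)"
  by (intro has_derivative_mult has_derivative_power bounded_linear_imp_has_derivative[OF bounded_linear_zcoord]
    bounded_linear.has_derivative[OF bounded_linear_of_real] has_derivative_w x f)

lemma axis_W: "j \<in> {2, 3, 4} \<Longrightarrow> WJ 2 x * (axis j 1 :: point)$2 + WJ 3 x * (axis j 1 :: point)$3 + WJ 4 x * (axis j 1 :: point)$4 = WJ j x"
  by (auto simp: axis_def)

lemma pd_\<Sigma>:
  assumes "x \<in> half_space" "j \<in> {2, 3, 4}"
  shows "pd j \<Sigma>r x = (of_nat k + 1) * dj j * (zcoord x ^ k * complex_of_real (g (wvar x)))
    + zcoord x ^ (k + 1) * complex_of_real (g1 (wvar x)) * complex_of_real (WJ j x)"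
  using pd_eqI[OF deriv_pw[OF assms(1) dg[OF w_in[OF assms(1)]], of "k + 1"], of j]
  unfolding axis_W[OF assms(2)] \<Sigma>r_def[abs_def] by (simp add: dj_def algebra_simps)

lemma pd2_\<Sigma>:
  assumes x: "x \<in> half_space" and j: "j \<in> {2, 3, 4}"
  shows "pd j (pd j \<Sigma>r) x = (dj j)\<^sup>2 * ((of_nat k + 1) * of_nat k * zcoord x ^ (k - 1) * complex_of_real (g (wvar x)))
    + 2 * (of_nat k + 1) * dj j * zcoord x ^ k * complex_of_real (g1 (wvar x)) * complex_of_real (WJ j x)
    + zcoord x ^ (k + 1) * (complex_of_real (deriv g1 (wvar x)) * (complex_of_real (WJ j x))\<^sup>2 + complex_of_real (g1 (wvar x)) * complex_of_real (DWJ j x))"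
proof -
  obtain DW where DW: "(WJ j has_derivative DW) (at x)" "DW (axis j 1) = DWJ j x" using has_derivative_WJ(1)[OF x j] by blast
  define R where "R x = (of_nat k + 1) * dj j * (zcoord x ^ k * complex_of_real (g (wvar x)))
    + zcoord x ^ (k + 1) * complex_of_real (g1 (wvar x)) * complex_of_real (WJ j x)" for x
  have dR: "(R has_derivative (\<lambda>v. (of_nat k + 1) * dj j * (zcoord x ^ k * complex_of_real (g1 (wvar x) * (WJ 2 x * v$2 + WJ 3 x * v$3 + WJ 4 x * v$4))
       + of_nat k * zcoord v * zcoord x ^ (k - 1) * complex_of_real (g (wvar x)))
     + (zcoord x ^ (k + 1) * complex_of_real (g1 (wvar x)) * complex_of_real (DW v)
      + (zcoord x ^ (k + 1) * complex_of_real (deriv g1 (wvar x) * (WJ 2 x * v$2 + WJ 3 x * v$3 + WJ 4 x * v$4))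
       + of_nat (k + 1) * zcoord v * zcoord x ^ (k + 1 - 1) * complex_of_real (g1 (wvar x))) * complex_of_real (WJ j x)))) (at x)"
    unfolding R_def[abs_def]
    by (rule has_derivative_add[OF has_derivative_mult_right[OF deriv_pw[OF x dg[OF w_in[OF x]]]]
      has_derivative_mult[OF deriv_pw[OF x deriv_deriv(2)[OF w_in[OF x]]] bounded_linear.has_derivative[OF bounded_linear_of_real DW(1)]]])
  have "pd j (pd j \<Sigma>r) x = pd j R x"
    by (rule pd_cong[OF open_half_space x]) (use pd_\<Sigma> j td_differentiable[OF td_pd[OF td_\<Sigma>] x] in \<open>auto simp: R_def\<close>)
  then show ?thesis
    unfolding pd_eqI[OF dR] DW(2) axis_W[OF j] dj_def[symmetric]
    by (simp add: algebra_simps power2_eq_square)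
qed

text \<open>All off-diagonal entries are multiples of \<open>q = z^k / Y\<close>. Once the common
  factors are removed, both equations are polynomial identities modulo the radial equations and the
  relations \<open>rel\<close>.\<close>

lemma moment:
  assumes x: "x \<in> half_space"
  shows "moment_eq x"
proof -
  define z w Yx y i d where "z = zcoord x" and "w = wvar x" and "Yx = Yr x" and "y = x$4" and "i = irho x" and "d = idst x"
  define r where "r = rho x"
  define pw gw g1w p2 g2 where "pw = p w" and "gw = g w" and "g1w = g1 w" and "p2 = deriv p w" and "g2 = deriv g1 w"
  define K n where "K = s * (real k + 1) * gw - 1" and "n = real k + 1"
  have rel: "r * i = 1" "(y + r) * d = 1" "w = (r - y) * d"
    unfolding r_def i_def y_def d_def w_def wvar_def using rho_facts(5,6)[OF x] by auto
  have z2: "z * cnj z = complex_of_real (w * (y + r)\<^sup>2)" "(cmod z)\<^sup>2 = w * (y + r)\<^sup>2"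
    unfolding z_def w_def y_def r_def wvar_bounds(3)[OF x]
    by (simp add: zcoord_def complex_eq_iff power2_eq_square, simp add: zcoord_def cmod_power2)
  have W: "WJ 2 x = 2 * y * (x$2 * (i * d\<^sup>2))" "WJ 3 x = 2 * y * (x$3 * (i * d\<^sup>2))" "WJ 4 x = - 2 * (w * i)"
    "VJ 2 x = x$2 * (i * d)" "VJ 3 x = x$3 * (i * d)" "VJ 4 x = i"
    unfolding WJ_def VJ_def y_def i_def d_def w_def by simp_all
  have zc: "z = complex_of_real (x$2) + \<i> * complex_of_real (x$3)" "cnj z = complex_of_real (x$2) - \<i> * complex_of_real (x$3)"
    unfolding z_def zcoord_def by (simp_all add: complex_eq_iff)
  have dj: "dj 2 = 1" "dj 3 = \<i>" "dj 4 = 0" unfolding dj_def zcoord_axis by simp_all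
  \<comment> \<open>By rotational symmetry the gradient of \<open>ln Y\<close> in the
    \<open>z\<close> plane is radial: it is \<open>m\<close> times \<open>z\<close>.\<close>
  define m where "m = n * (i * d) + 2 * pw * y * i * d\<^sup>2"
  have l4: "l x 4 = n * i - 2 * pw * w * i"
    using l_eq[OF x, of 4] by (simp add: lj_def W pw_def w_def n_def algebra_simps)
  have l23: "complex_of_real (l x 2) - \<i> * complex_of_real (l x 3) = cnj z * m" "complex_of_real (l x 2) + \<i> * complex_of_real (l x 3) = z * m"
    using l_eq[OF x, of 2] l_eq[OF x, of 3] unfolding zc m_def
    by (simp_all add: lj_def W pw_def w_def n_def algebra_simps)
  define q where "q = z ^ k / complex_of_real Yx"
  \<comment> \<open>\<open>q b\<close> is the transverse entry in which \<open>\<Sigma>\<close> and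
    \<open>z^k\<close> combine, through \<open>K\<close>; the other transverse entry, computed in
    \<open>Eq\<close>, contains only \<open>g1\<close>.\<close>
  define b where "b = K + s * w * g1w * (y * i)"
  have S2: "S x 2 = q * (of_real n * gw + z * g1w * (2 * y * (x$2 * (i * d\<^sup>2))))"
    and S3: "S x 3 = q * (\<i> * of_real n * gw + z * g1w * (2 * y * (x$3 * (i * d\<^sup>2))))"
    and S4: "S x 4 = q * (z * complex_of_real (g1w * (- 2 * w * i)))"
    unfolding S_def q_def
    by (simp_all add: pd_\<Sigma>[OF x] W dj Yx_def[symmetric] z_def[symmetric] w_def[symmetric] gw_def[symmetric] g1w_def[symmetric] n_def
      add_divide_distrib algebra_simps)
  have zz: "z * cnj z * complex_of_real (d\<^sup>2) = of_real w"
  proof -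
    have "w * (y + r)\<^sup>2 * d\<^sup>2 = w" using rel(2) by algebra
    then show ?thesis by (simp only: z2(1) of_real_mult[symmetric])
  qed
  have Bq: "s * (S x 2 - \<i> * S x 3) / 2 - Z x = q * complex_of_real b"
  proof -
    have "S x 2 - \<i> * S x 3 = q * (2 * of_real n * gw + 2 * (z * cnj z * complex_of_real (d\<^sup>2)) * complex_of_real (g1w * y * i))"
      unfolding S2 S3 zc(2) by (simp add: algebra_simps)
    then have e: "S x 2 - \<i> * S x 3 = q * (2 * of_real n * gw + 2 * of_real w * complex_of_real (g1w * y * i))" unfolding zz .
    have "Z x = q" unfolding Z_def q_def z_def Yx_def ..
    then show ?thesis unfolding e b_def K_def n_def by (simp add: algebra_simps)
  qed
  have Eq: "(S x 2 + \<i> * S x 3) / 2 = q * (z * (z * complex_of_real (g1w * y * i * d\<^sup>2)))"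
  proof -
    have "S x 2 + \<i> * S x 3 = q * (2 * (z * (z * complex_of_real (g1w * y * i * d\<^sup>2))))"
      unfolding S2 S3 by (subst (3) zc(1)) (simp add: zc(1) algebra_simps)
    then show ?thesis by simp
  qed
  have T: "tt w = y * i" "1 / (1 + w) = (1 + y * i) / 2"
    unfolding w_def y_def i_def using wvar_bounds(4,5)[OF x] by auto
  note od = ode[OF w_in[OF x], folded w_def, unfolded T, folded pw_def gw_def g1w_def p2_def g2_def, folded K_def]
  define q1 where "q1 = w ^ k * exp (- 2 * h w)"
  \<comment> \<open>Since \<open>|z|^2 = w (y + r)^2\<close>, the powers of \<open>y + r\<close> in
    \<open>z^k\<close> and in \<open>Y\<close> cancel up to one factor.\<close>
  have q0: "(cmod q)\<^sup>2 = q1 * d\<^sup>2 / 4"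
  proof -
    have "(cmod q)\<^sup>2 = ((cmod z)\<^sup>2) ^ k / Yx\<^sup>2"
      unfolding q_def by (simp add: norm_divide norm_power power_divide flip: power_mult) (simp add: mult.commute)
    also have "\<dots> = w ^ k * ((y + r) ^ k)\<^sup>2 / (4 * ((y + r) ^ k)\<^sup>2 * (y + r)\<^sup>2 * (exp (h w))\<^sup>2)"
      unfolding z2 Yx_def Yr_def y_def[symmetric] r_def[symmetric] w_def[symmetric]
      by (simp add: power_mult_distrib flip: power_mult) (simp add: mult.commute power2_eq_square mult_ac)
    also have "\<dots> = w ^ k * inverse ((exp (h w))\<^sup>2) * (inverse (y + r))\<^sup>2 / 4"
      using rel(2) by (simp add: field_simps)
    also have "inverse (y + r) = d" using rel(2) by (rule inverse_unique)
    also have "inverse ((exp (h w))\<^sup>2) = exp (- 2 * h w)" by (simp add: exp_minus flip: exp_double)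
    finally show ?thesis unfolding q1_def .
  qed
  have c2: "c\<^sup>2 = 1 - s\<^sup>2" using sc by simp
  show ?thesis unfolding moment_eq_def
  proof
    have "ll x 2 2 + ll x 3 3 + ll x 4 4 = n * (DVJ 2 x + DVJ 3 x + DVJ 4 x) + p2 * ((WJ 2 x)\<^sup>2 + (WJ 3 x)\<^sup>2 + (WJ 4 x)\<^sup>2) + pw * (DWJ 2 x + DWJ 3 x + DWJ 4 x)"
      by (simp add: ll_eq[OF x] n_def p2_def pw_def w_def algebra_simps)
    also have "\<dots> = 4 * d\<^sup>2 * (pw + w * p2)" unfolding harmonicity[OF x] d_def w_def by (simp add: algebra_simps)
    finally have L: "ll x 2 2 + ll x 3 3 + ll x 4 4 = - (d\<^sup>2 * q1 * ((w * g1w)\<^sup>2 + 2 * s * K * (y * i) * (w * g1w) + K\<^sup>2))"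
      unfolding od(1) q1_def by simp
    have n4: "(cmod (S x 4))\<^sup>2 = q1 * d\<^sup>2 / 4 * (w * (y + r)\<^sup>2 * (g1w * (- 2 * w * i))\<^sup>2)"
      unfolding S4 norm_mult power_mult_distrib q0 z2 norm_of_real power2_abs by simp
    have nB: "(cmod (q * complex_of_real b))\<^sup>2 = q1 * d\<^sup>2 / 4 * b\<^sup>2"
      unfolding norm_mult power_mult_distrib q0 norm_of_real power2_abs by simp
    have nE: "(cmod (q * (z * (z * complex_of_real (g1w * y * i * d\<^sup>2)))))\<^sup>2 = q1 * d\<^sup>2 / 4 * (w * (y + r)\<^sup>2 * (w * (y + r)\<^sup>2 * (g1w * y * i * d\<^sup>2)\<^sup>2))"
      unfolding norm_mult[of q] norm_mult[of z] power_mult_distrib[of "cmod _"] q0 z2 norm_of_real power2_abs by simp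
    \<comment> \<open>The diagonal equation without its common factor
      \<open>q1 d^2 / 4\<close>.\<close>
    have "4 * (- ((w * g1w)\<^sup>2 + 2 * s * K * (y * i) * (w * g1w) + K\<^sup>2)) + (w * (y + r)\<^sup>2 * (g1w * (- 2 * w * i))\<^sup>2)
      + 4 * b\<^sup>2 + 4 * c\<^sup>2 * (w * (y + r)\<^sup>2 * (w * (y + r)\<^sup>2 * (g1w * y * i * d\<^sup>2)\<^sup>2)) = 0"
      unfolding b_def c2 using rel by algebra
    then have "q1 * d\<^sup>2 / 4 * (4 * (- ((w * g1w)\<^sup>2 + 2 * s * K * (y * i) * (w * g1w) + K\<^sup>2)) + (w * (y + r)\<^sup>2 * (g1w * (- 2 * w * i))\<^sup>2)
      + 4 * b\<^sup>2 + 4 * c\<^sup>2 * (w * (y + r)\<^sup>2 * (w * (y + r)\<^sup>2 * (g1w * y * i * d\<^sup>2)\<^sup>2))) = 0" by simp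
    then show "ll x 2 2 + ll x 3 3 + ll x 4 4 + (cmod (S x 4))\<^sup>2 + 4 * (cmod (s * (S x 2 - \<i> * S x 3) / 2 - Z x))\<^sup>2
      + 4 * c\<^sup>2 * (cmod ((S x 2 + \<i> * S x 3) / 2))\<^sup>2 = 0"
      unfolding L n4 Bq Eq nB nE by (simp only: ring_distribs mult_ac) (simp add: field_simps)
    \<comment> \<open>The off-diagonal equation without its common factor
      \<open>q z\<close>.\<close>
    have R: "4 * n * g1w * y * i * d\<^sup>2 + 4 * d\<^sup>2 * (g1w + w * g2)
      = 2 * (g1w * (- 2 * w * i)) * (n * i - 2 * pw * w * i) + 4 * c\<^sup>2 * (g1w * y * i * d\<^sup>2 * (w * (y + r)\<^sup>2)) * m + 4 * s * b * m"
      unfolding b_def c2 od(2) m_def n_def[symmetric] using rel by algebra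
    have "SS x 2 2 + SS x 3 3 + SS x 4 4 = (pd 2 (pd 2 \<Sigma>r) x + pd 3 (pd 3 \<Sigma>r) x + pd 4 (pd 4 \<Sigma>r) x) / complex_of_real Yx"
      unfolding SS_def Yx_def by (simp add: add_divide_distrib)
    also have "pd 2 (pd 2 \<Sigma>r) x + pd 3 (pd 3 \<Sigma>r) x + pd 4 (pd 4 \<Sigma>r) x
      = z ^ k * (2 * of_real n * g1w * (complex_of_real (WJ 2 x) + \<i> * complex_of_real (WJ 3 x))
        + z * complex_of_real (g2 * ((WJ 2 x)\<^sup>2 + (WJ 3 x)\<^sup>2 + (WJ 4 x)\<^sup>2) + g1w * (DWJ 2 x + DWJ 3 x + DWJ 4 x)))"
      by (simp add: pd2_\<Sigma>[OF x] dj n_def z_def g1w_def g2_def w_def algebra_simps)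
    also have "complex_of_real (WJ 2 x) + \<i> * complex_of_real (WJ 3 x) = z * complex_of_real (2 * y * i * d\<^sup>2)"
      unfolding W zc by (simp add: algebra_simps)
    finally have "SS x 2 2 + SS x 3 3 + SS x 4 4 = q * (z * complex_of_real (4 * n * g1w * y * i * d\<^sup>2 + 4 * d\<^sup>2 * (g1w + w * g2)))"
      unfolding harmonicity[OF x] q_def d_def w_def by (simp add: algebra_simps add_divide_distrib)
    also have "\<dots> = 2 * S x 4 * l x 4 + 4 * c\<^sup>2 * (q * (z * complex_of_real (g1w * y * i * d\<^sup>2))) * (z * cnj z) * m + 4 * s * (q * complex_of_real b) * (z * m)"
      unfolding R S4 l4 z2 by (simp add: algebra_simps)
    also have "\<dots> = 2 * S x 4 * l x 4 + 4 * c\<^sup>2 * ((S x 2 + \<i> * S x 3) / 2) * (l x 2 - \<i> * l x 3)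
      + 4 * s * (s * (S x 2 - \<i> * S x 3) / 2 - Z x) * (l x 2 + \<i> * l x 3)"
      unfolding Bq Eq l23 by (simp add: mult_ac)
    finally show "SS x 2 2 + SS x 3 3 + SS x 4 4 = 2 * S x 4 * l x 4 + 4 * c\<^sup>2 * ((S x 2 + \<i> * S x 3) / 2) * (l x 2 - \<i> * l x 3)
      + 4 * s * (s * (S x 2 - \<i> * S x 3) / 2 - Z x) * (l x 2 + \<i> * l x 3)" .
  qed
qed

text \<open>\<open>exp (arsinh \<sigma>) = \<sigma> + sqrt (\<sigma>^2 + 1)\<close>, which is
  \<open>(y + rho) / r\<close>.\<close>

lemma radial_form:
  assumes x: "x \<in> half_space" and z: "zcoord x \<noteq> 0"
  defines "r \<equiv> cmod (zcoord x)" and "\<sigma> \<equiv> ycoord x / cmod (zcoord x)"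
  shows "wvar x = exp (- 2 * arsinh \<sigma>)"
    and "Yr x = r ^ (k + 1) * exp ((k + 1) * arsinh \<sigma> + h (exp (- 2 * arsinh \<sigma>)) + ln 2)"
proof -
  note f = rho_facts[OF x]
  have r: "r > 0" "r\<^sup>2 = (x$2)\<^sup>2 + (x$3)\<^sup>2" unfolding r_def using z by (simp_all add: zcoord_def cmod_power2)
  have \<sigma>: "\<sigma> = x$4 / r" unfolding \<sigma>_def r_def ycoord_def ..
  have "r\<^sup>2 * (\<sigma>\<^sup>2 + 1) = (x$4)\<^sup>2 + r\<^sup>2" using r(1) unfolding \<sigma> by (simp add: power_divide field_simps)
  then have "rho x = sqrt (r\<^sup>2 * (\<sigma>\<^sup>2 + 1))" unfolding rho_def r(2) by (simp add: add_ac)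
  then have "rho x = r * sqrt (\<sigma>\<^sup>2 + 1)" using r(1) by (simp add: real_sqrt_mult)
  then have D: "x$4 + rho x = r * exp (arsinh \<sigma>)"
  proof -
    have "\<sigma> + sqrt (\<sigma>\<^sup>2 + 1) > 0" using f(2) r(1) unfolding \<sigma> by (intro add_pos_nonneg) auto
    then have "exp (arsinh \<sigma>) = \<sigma> + sqrt (\<sigma>\<^sup>2 + 1)" unfolding arsinh_real_def by simp
    then show ?thesis using \<open>rho x = r * sqrt (\<sigma>\<^sup>2 + 1)\<close> r(1) unfolding \<sigma> by (simp add: algebra_simps)
  qed
  have "wvar x * (r * exp (arsinh \<sigma>))\<^sup>2 = r\<^sup>2" using wvar_bounds(3)[OF x] unfolding D r(2) .
  then have "wvar x * (exp (arsinh \<sigma>))\<^sup>2 = 1" using r(1) by (simp add: power_mult_distrib)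
  then show w: "wvar x = exp (- 2 * arsinh \<sigma>)" by (simp add: exp_minus inverse_eq_divide field_simps flip: exp_double)
  show "Yr x = r ^ (k + 1) * exp ((k + 1) * arsinh \<sigma> + h (exp (- 2 * arsinh \<sigma>)) + ln 2)"
    unfolding Yr_def D w exp_add power_mult_distrib exp_of_nat_mult by (simp add: mult_ac)
qed

end

subsection \<open>Model knot solutions\<close>

lemma radial_fields_of_profile:
  assumes r: "radial_profile (k + 1) s a h p G q" and s: "s \<noteq> 0" and sc: "s\<^sup>2 + c\<^sup>2 = 1"
  shows "radial_fields k s c a h p (\<lambda>w. 1 / (real (k + 1) * s) - 2 * G w) (\<lambda>w. - 2 * q w)"
proof
  have o: "open {a<..<1::real}" by simp
  have td: "times_differentiable_on m {a<..<1} h" "times_differentiable_on m {a<..<1} p"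
    "times_differentiable_on m {a<..<1} G" "times_differentiable_on m {a<..<1} q" for m
    using r unfolding radial_profile_def by auto
  show "s\<^sup>2 + c\<^sup>2 = 1" by (rule sc)
  show "a < 0" using r unfolding radial_profile_def by auto
  show "times_differentiable_on m {a<..<1} h" "times_differentiable_on m {a<..<1} p"
    "times_differentiable_on m {a<..<1} (\<lambda>w. 1 / (real (k + 1) * s) - 2 * G w)" "times_differentiable_on m {a<..<1} (\<lambda>w. - 2 * q w)" for m
    by (intro td td_diff td_mult td_const o)+
  fix w assume w: "w \<in> {a<..<1}"
  have d: "(h has_real_derivative p w) (at w)" "(G has_real_derivative q w) (at w)"
    "((\<lambda>w. w * p w) has_real_derivative src_p (k + 1) s h G q w) (at w)"
    "((\<lambda>w. w * q w) has_real_derivative src_q (k + 1) s p G q w - real (k + 1) * q w) (at w)"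
    using r w unfolding radial_profile_def by auto
  show "(h has_real_derivative p w) (at w)" by (rule d)
  show "((\<lambda>w. 1 / (real (k + 1) * s) - 2 * G w) has_real_derivative - 2 * q w) (at w)"
    by (rule DERIV_cong[OF DERIV_diff[OF DERIV_const DERIV_cmult[OF d(2)]]]) simp
  have K: "s * (real k + 1) * (1 / (real (k + 1) * s) - 2 * G w) - 1 = - 2 * (real k + 1) * s * G w"
  proof -
    have "s * N * (1 / (N * s) - 2 * x) - 1 = - 2 * N * s * x" if "N \<noteq> 0" for N x
      using s that by (simp add: field_simps)
    from this[of "real k + 1" "G w"] show ?thesis by (simp add: add.commute)
  qed
  show "((\<lambda>w. w * p w) has_real_derivative - (w ^ k * exp (- 2 * h w) / 4 * ((w * (- 2 * q w))\<^sup>2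
      + 2 * s * (s * (real k + 1) * (1 / (real (k + 1) * s) - 2 * G w) - 1) * tt w * (w * (- 2 * q w))
      + (s * (real k + 1) * (1 / (real (k + 1) * s) - 2 * G w) - 1)\<^sup>2))) (at w)"
    unfolding K by (rule DERIV_cong[OF d(3)]) (simp add: src_p_def power2_eq_square algebra_simps)
  have e: "(\<lambda>w. w * (- 2 * q w)) = (\<lambda>w. - 2 * (w * q w))" by auto
  show "((\<lambda>w. w * (- 2 * q w)) has_real_derivative 2 * w * p w * (- 2 * q w) - (real k + 1) * (- 2 * q w)
      + s * (s * (real k + 1) * (1 / (real (k + 1) * s) - 2 * G w) - 1) * (2 * (real k + 1) * (1 / (1 + w)) + 2 * tt w * p w)) (at w)"
  proof -
    have j: "2 * real (k + 1) / (1 + w) = 2 * (real k + 1) * (1 / (1 + w))" by simp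
    show ?thesis
      unfolding K e by (rule DERIV_cong[OF DERIV_cmult[OF d(4)]], unfold src_q_def j) (simp add: power2_eq_square algebra_simps del: times_divide_eq_right times_divide_eq_left mult_1_right)
  qed
qed

section \<open>The diagonal solution for \<open>s = 0\<close>\<close>

definition diag_profile :: "nat \<Rightarrow> real \<Rightarrow> real" where "diag_profile n w = ln ((1 - w ^ n) / (2 * real n))"

text \<open>For \<open>s = 0\<close> and \<open>g = 0\<close> what remains is the Liouville equation
  \<open>U'' = - exp (- 2 U)\<close>, solved by \<open>exp U = sinh (n t) / n\<close> with
  \<open>n = k + 1\<close>; in the variable \<open>w\<close> this is
  \<open>diag_profile\<close>.\<close>

lemma radial_fields_0:
  assumes "c\<^sup>2 = 1"
  shows "radial_fields k 0 c (-1) (diag_profile (k + 1)) (\<lambda>w. - (real (k + 1) * (w ^ k * inverse (1 - w ^ (k + 1))))) (\<lambda>w. 0) (\<lambda>w. 0)"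
proof
  have o: "open {-1<..<1::real}" by simp
  have pos: "1 - w ^ (k + 1) > 0" if "w \<in> {-1<..<1}" for w :: real
  proof -
    have "\<bar>w\<bar> ^ (k + 1) < 1" using that by (intro power_less_one_iff[THEN iffD2]) auto
    then have "\<bar>w ^ (k + 1)\<bar> < 1" by (simp only: power_abs)
    then show ?thesis using abs_ge_self[of "w ^ (k + 1)"] by linarith
  qed
  have td1: "times_differentiable_on m {-1<..<1} (\<lambda>w::real. 1 - w ^ (k + 1))" for m
    by (intro td_diff td_const td_power td_ident o)
  show "times_differentiable_on m {-1<..<1} (diag_profile (k + 1))" for m
    unfolding diag_profile_def[abs_def]
  proof (rule td_compose[OF o td_ln])
    show "times_differentiable_on m {-1<..<1} (\<lambda>w. (1 - w ^ (k + 1)) / (2 * real (k + 1)))"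
      by (rule td_divide_const[OF o td1])
    show "(1 - w ^ (k + 1)) / (2 * real (k + 1)) \<in> {0<..}" if "w \<in> {-1<..<1}" for w
      using pos[OF that] by simp
  qed
  show "times_differentiable_on m {-1<..<1} (\<lambda>w::real. - (real (k + 1) * (w ^ k * inverse (1 - w ^ (k + 1)))))" for m
    by (intro td_minus td_mult td_const td_power td_ident td_inverse td1 o) (use pos in force)
  show "times_differentiable_on m {-1<..<1} (\<lambda>w::real. 0::real)" for m by (rule td_const)
  fix w :: real assume w: "w \<in> {-1<..<1}"
  define y where "y = 1 - w ^ (k + 1)"
  have y: "y > 0" unfolding y_def by (rule pos[OF w])
  have dy: "((\<lambda>w. 1 - w ^ (k + 1)) has_real_derivative - (real (k + 1) * w ^ k)) (at w)"
    by (rule DERIV_cong[OF DERIV_diff[OF DERIV_const DERIV_pow]]) simp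
  have "((\<lambda>w. ln ((1 - w ^ (k + 1)) / (2 * real (k + 1)))) has_real_derivative
      1 / (y / (2 * real (k + 1))) * (- (real (k + 1) * w ^ k) / (2 * real (k + 1)))) (at w)"
    unfolding y_def by (rule DERIV_chain2[OF DERIV_ln_divide DERIV_cdivide[OF dy]]) (use pos[OF w] in simp)
  then show "(diag_profile (k + 1) has_real_derivative - (real (k + 1) * (w ^ k * inverse (1 - w ^ (k + 1))))) (at w)"
    unfolding diag_profile_def[abs_def] y_def[symmetric] by (rule DERIV_cong) (use y in \<open>simp add: divide_inverse\<close>)
  show "((\<lambda>w. 0) has_real_derivative 0) (at w)" by simp
  \<comment> \<open>By \<open>w ^ (k + 1) = 1 - y\<close> the product of \<open>w\<close> with the
    derivative of \<open>diag_profile\<close> is \<open>n - n / y\<close>, which is easier to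
    differentiate.\<close>
  have d: "((\<lambda>w. real (k + 1) - real (k + 1) * inverse (1 - w ^ (k + 1))) has_real_derivative
      0 - real (k + 1) * (- (inverse y * (- (real (k + 1) * w ^ k)) * inverse y))) (at w)"
    unfolding y_def by (intro DERIV_diff DERIV_const DERIV_cmult DERIV_inverse' dy) (use pos[OF w] in simp)
  have "((\<lambda>w. w * - (real (k + 1) * (w ^ k * inverse (1 - w ^ (k + 1))))) has_real_derivative
      0 - real (k + 1) * (- (inverse y * (- (real (k + 1) * w ^ k)) * inverse y))) (at w)"
  proof (rule has_field_derivative_transform_within_open[OF d o w])
    fix v :: real assume "v \<in> {-1<..<1}"
    from pos[OF this] show "real (k + 1) - real (k + 1) * inverse (1 - v ^ (k + 1)) = v * - (real (k + 1) * (v ^ k * inverse (1 - v ^ (k + 1))))"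
      by (simp add: field_simps)
  qed
  moreover have "exp (- 2 * diag_profile (k + 1) w) = (2 * real (k + 1) * inverse y)\<^sup>2"
  proof -
    have "exp (diag_profile (k + 1) w) = y / (2 * real (k + 1))" unfolding diag_profile_def y_def using pos[OF w] by simp
    moreover have "exp (- 2 * diag_profile (k + 1) w) = inverse ((exp (diag_profile (k + 1) w))\<^sup>2)"
      using exp_minus[of "2 * diag_profile (k + 1) w"] exp_double[of "diag_profile (k + 1) w"] by simp
    ultimately show ?thesis by (simp add: power_inverse[symmetric] divide_inverse mult.commute)
  qed
  ultimately show "((\<lambda>w. w * - (real (k + 1) * (w ^ k * inverse (1 - w ^ (k + 1))))) has_real_derivative
      - (w ^ k * exp (- 2 * diag_profile (k + 1) w) / 4 * ((w * 0)\<^sup>2 + 2 * 0 * (0 * (real k + 1) * 0 - 1) * tt w * (w * 0) + (0 * (real k + 1) * 0 - 1)\<^sup>2))) (at w)"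
    by (auto elim!: DERIV_cong simp: power2_eq_square algebra_simps)
qed (use assms in auto)

text \<open>For \<open>s = 0\<close> the field \<open>\<Sigma>\<close> vanishes whatever
  \<open>v\<close> is, so \<open>v\<close> may be any function with the prescribed behavior; this
  one is bounded and has the right limit at \<open>0\<close>.\<close>

lemma profile_asymptotics_0:
  "profile_asymptotics k (\<lambda>\<sigma>. real (k + 1) * arsinh \<sigma> + diag_profile (k + 1) (exp (- 2 * arsinh \<sigma>)) + ln 2)
     (\<lambda>\<sigma>. 2 * real k * \<sigma>\<^sup>2 / (1 + \<sigma>\<^sup>2))"
proof -
  define n where "n = k + 1"
  have n: "real n > 0" unfolding n_def by simp
  have "((\<lambda>t. ln (sinh (real n * t) / t / real n)) \<longlongrightarrow> ln (real n / real n)) (at_right 0)"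
    using n by (intro tendsto_ln tendsto_divide sinh_quotient_limit tendsto_const) auto
  moreover have "\<forall>\<^sub>F t in at_right 0. ln (sinh (real n * t) / t / real n) = real n * t + diag_profile n (exp (- 2 * t)) - ln t"
    unfolding eventually_at_filter
  proof (intro always_eventually allI impI)
    fix t :: real assume "t \<noteq> 0" "t \<in> {0<..}"
    then have t: "t > 0" by simp
    have x: "exp (- 2 * t) ^ n = exp (- 2 * (real n * t))" by (simp add: exp_of_nat_mult[symmetric] mult_ac)
    have "1 - exp (- 2 * (real n * t)) > 0" using t n by simp
    then have p: "(1 - exp (- 2 * t) ^ n) / (2 * real n) > 0" unfolding x using n by simp
    have "exp (real n * t) * exp (- 2 * (real n * t)) = exp (- (real n * t))" by (simp flip: exp_add)
    then have "sinh (real n * t) = exp (real n * t) * (1 - exp (- 2 * (real n * t))) / 2"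
      unfolding sinh_field_def by (simp add: algebra_simps)
    then have "sinh (real n * t) / t / real n = exp (real n * t) * ((1 - exp (- 2 * t) ^ n) / (2 * real n)) / t"
      unfolding x by (simp only: times_divide_eq_right times_divide_eq_left divide_divide_eq_left mult_ac)
    then show "ln (sinh (real n * t) / t / real n) = real n * t + diag_profile n (exp (- 2 * t)) - ln t"
      unfolding diag_profile_def using p t by (simp only: ln_divide_pos ln_mult_pos exp_gt_zero mult_pos_pos ln_exp)
  qed
  ultimately have U0: "((\<lambda>t. real n * t + diag_profile n (exp (- 2 * t)) - ln t) \<longlongrightarrow> ln (real n / real n)) (at_right 0)"
    by (rule Lim_transform_eventually)
  have "isCont (diag_profile n) 0"
    using radial_fields.dh[OF radial_fields_0[of 1 k], of 0] unfolding n_def by (auto intro: DERIV_isCont)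
  note la = log_asymptotics[OF U0 this, unfolded n_def]
  have v: "((\<lambda>\<sigma>. 2 * real k * \<sigma>\<^sup>2 / (1 + \<sigma>\<^sup>2) / \<sigma>\<^sup>2) \<longlongrightarrow> 2 * real k) (at_right (0::real))"
  proof -
    have "((\<lambda>\<sigma>. 2 * real k / (1 + \<sigma>\<^sup>2)) \<longlongrightarrow> 2 * real k / (1 + 0\<^sup>2)) (at_right (0::real))"
      by (intro tendsto_intros) auto
    then have l: "((\<lambda>\<sigma>. 2 * real k / (1 + \<sigma>\<^sup>2)) \<longlongrightarrow> 2 * real k) (at_right (0::real))" by simp
    show ?thesis by (rule Lim_transform_eventually[OF l]) (simp add: eventually_at_filter)
  qed
  have b: "\<bar>2 * real k * \<sigma>\<^sup>2 / (1 + \<sigma>\<^sup>2)\<bar> \<le> (2 * real k + 1) * \<sigma> powr ((real k + 1) * (1 - 1/2))" if "\<sigma> \<ge> 1" for \<sigma> :: real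
  proof -
    have "\<sigma>\<^sup>2 / (1 + \<sigma>\<^sup>2) \<le> 1" by (simp add: divide_le_eq add_pos_nonneg)
    then have "2 * real k * (\<sigma>\<^sup>2 / (1 + \<sigma>\<^sup>2)) \<le> 2 * real k * 1" by (intro mult_left_mono) auto
    then have "\<bar>2 * real k * \<sigma>\<^sup>2 / (1 + \<sigma>\<^sup>2)\<bar> \<le> (2 * real k + 1) * 1" by simp
    also have "\<dots> \<le> (2 * real k + 1) * \<sigma> powr ((real k + 1) * (1 - 1/2))"
      using that by (intro mult_left_mono ge_one_powr_ge_zero) auto
    finally show ?thesis .
  qed
  show ?thesis unfolding profile_asymptotics_def
  proof (intro conjI la(1) v)
    show "((\<lambda>\<sigma>. (real (k + 1) * arsinh \<sigma> + diag_profile (k + 1) (exp (- 2 * arsinh \<sigma>)) + ln 2) / ln \<sigma>) \<longlongrightarrow> real k + 1) at_top"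
      using la(2) by (simp add: add.commute)
    have "0 < 2 * real k + 1" "0 < (1/2::real)" "(1/2::real) < 1" by auto
    then show "\<exists>C>0. \<exists>\<epsilon>. 0 < \<epsilon> \<and> \<epsilon> < 1 \<and> (\<forall>\<sigma>\<ge>1. \<bar>2 * real k * \<sigma>\<^sup>2 / (1 + \<sigma>\<^sup>2)\<bar> \<le> C * \<sigma> powr ((real k + 1) * (1 - \<epsilon>)))"
      using b by blast
  qed
qed

text \<open>Here the range of \<open>\<theta>\<close> enters: \<open>sin (\<pi>/6) = 1/2\<close> is
  the bound on \<open>|s|\<close> in the a priori and comparison estimates.\<close>

lemma beta_of_bounds:
  assumes "0 < \<theta>" "\<theta> < pi / 2"
  shows "\<bar>sin (beta_of \<theta>)\<bar> \<le> 1/2" "cos (beta_of \<theta>) > 0"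
proof -
  have b: "- (pi / 6) < beta_of \<theta>" "beta_of \<theta> < pi / 6" unfolding beta_of_def using assms by (simp_all add: field_simps)
  have "sin (beta_of \<theta>) \<le> sin (pi / 6)" by (rule sin_monotone_2pi_le) (use b pi_gt_zero in linarith)+
  moreover have "sin (- (pi / 6)) \<le> sin (beta_of \<theta>)" by (rule sin_monotone_2pi_le) (use b pi_gt_zero in linarith)+
  ultimately show "\<bar>sin (beta_of \<theta>)\<bar> \<le> 1/2" by (simp add: sin_30)
  show "cos (beta_of \<theta>) > 0" by (rule cos_gt_zero_pi) (use b pi_gt_zero in linarith)+
qed

theorem theorem1p1:
  fixes k :: nat and \<theta> :: real
  assumes "0 < \<theta>" and "\<theta> < pi / 2"
  shows "\<exists>A \<Phi>. model_knot_solution k \<theta> A \<Phi>"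
proof -
  define s c where "s = sin (beta_of \<theta>)" and "c = cos (beta_of \<theta>)"
  have sc: "s\<^sup>2 + c\<^sup>2 = 1" and s: "\<bar>s\<bar> \<le> 1/2" and c: "c \<noteq> 0"
    unfolding s_def c_def using beta_of_bounds[OF assms] by auto
  have main: ?thesis if "radial_fields k s c a h p g g1"
    and u: "profile_asymptotics k (\<lambda>\<sigma>. real (k + 1) * arsinh \<sigma> + h (exp (- 2 * arsinh \<sigma>)) + ln 2) v"
    and v: "\<And>\<sigma>. g (exp (- 2 * arsinh \<sigma>)) = s * v \<sigma>" for a h p g g1 v
  proof -
    interpret radial_fields k s c a h p g g1 by fact
    show ?thesis
    proof (rule model_knot_solution_of_profile[OF knot[unfolded s_def c_def] c[unfolded c_def] _ u])
      fix x assume x: "x \<in> half_space"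
      show "knot_fields.moment_eq k (sin (beta_of \<theta>)) (cos (beta_of \<theta>)) Yr \<Sigma>r x"
        using moment[OF x] unfolding s_def c_def .
      assume z: "zcoord x \<noteq> 0"
      show "Yr x = cmod (zcoord x) ^ (k + 1) * exp (real (k + 1) * arsinh (ycoord x / cmod (zcoord x))
          + h (exp (- 2 * arsinh (ycoord x / cmod (zcoord x)))) + ln 2)"
        by (rule radial_form(2)[OF x z])
      show "\<Sigma>r x = complex_of_real (sin (beta_of \<theta>)) * zcoord x ^ (k + 1) * complex_of_real (v (ycoord x / cmod (zcoord x)))"
        unfolding \<Sigma>r_def radial_form(1)[OF x z] v s_def by (simp add: mult_ac)
    qed
  qed
  show ?thesis
  proof (cases "s = 0")
    case True
    have "radial_fields k s c (-1) (diag_profile (k + 1)) (\<lambda>w. - (real (k + 1) * (w ^ k * inverse (1 - w ^ (k + 1))))) (\<lambda>w. 0) (\<lambda>w. 0)"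
      using radial_fields_0[of c k] sc True by simp
    then show ?thesis by (rule main[OF _ profile_asymptotics_0]) (simp add: True)
  next
    case False
    obtain a h p G q where r: "radial_profile (k + 1) s a h p G q"
      and u: "profile_asymptotics (k + 1 - 1) (\<lambda>\<sigma>. real (k + 1) * arsinh \<sigma> + h (exp (- 2 * arsinh \<sigma>)) + ln 2)
       (\<lambda>\<sigma>. (1 - 2 * real (k + 1) * s * G (exp (- 2 * arsinh \<sigma>))) / (real (k + 1) * s\<^sup>2))"
      using radial_profile_exists[of "k + 1" s] False s by auto
    show ?thesis
    proof (rule main[OF radial_fields_of_profile[OF r False sc]])
      show "profile_asymptotics k (\<lambda>\<sigma>. real (k + 1) * arsinh \<sigma> + h (exp (- 2 * arsinh \<sigma>)) + ln 2)
       (\<lambda>\<sigma>. (1 - 2 * real (k + 1) * s * G (exp (- 2 * arsinh \<sigma>))) / (real (k + 1) * s\<^sup>2))"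
        using u by simp
      show "1 / (real (k + 1) * s) - 2 * G (exp (- 2 * arsinh \<sigma>))
        = s * ((1 - 2 * real (k + 1) * s * G (exp (- 2 * arsinh \<sigma>))) / (real (k + 1) * s\<^sup>2))" for \<sigma>
      proof -
        have "1 / (N * s) - 2 * x = s * ((1 - 2 * N * s * x) / (N * s\<^sup>2))" if "N \<noteq> 0" for N x
          using False that by (simp add: field_simps power2_eq_square)
        then show ?thesis by simp
      qed
    qed
  qed
qed

end
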